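(* Let $n\ge2$ and for $k=1,\dots,n$ let $$\bar\ell_k(u)=\operatorname{tr}_{1,\dots,k}\,A_kL_1^{-}(u_1)\cdots L_k^{-}(u_k),\qquad u_i=u+(i-1)h.$$ All coefficients of the series $\bar\ell_k(u)\mathbf{1}$, $k=1,\dots,n$, belong to the subspace of invariants $$\mathfrak{Z}_h(\mathfrak{gl}_n)=\{v\in V_h(\mathfrak{gl}_n)\mid L^{+}(z)v=Iv\}$$ of the vacuum module $V_h(\mathfrak{gl}_n)$ at the critical level. Moreover, the coefficients of all the series $\bar\ell_k(u)$, $k=1,\dots,n$, commute with each other.
   Context: Let $P$ be the permutation operator on $\mathbb{C}^n\otimes\mathbb{C}^n$, $\bar R(u)=I+\frac{h}{u}P$, and $R(u)=f(u)\bar R(u)$, where $f(u)=1+\sum_{k\ge1}f_ku^{-k}$ is the power series in $u^{-1}$ uniquely determined by $f(u-nh)=\frac{u^2-h^2}{u^2}f(u)$. The Yangian double $\mathrm{DY}_h(\mathfrak{gl}_n)$ is the ($h$-adically completed) associative algebra over $\mathbb{C}[[h]]$ generated by $l_{ij}^{(k)}$ ($1\le i,j\le n$, $k\in\mathbb{Z}$) and $c$. Put $l_{ij}^{+}(u)=\delta_{ij}-h\sum_{k\ge0}l_{ij}^{(k)}u^{-k-1}$, $l_{ij}^{-}(u)=\delta_{ij}+h\sum_{k<0}l_{ij}^{(k)}u^{-k-1}$, $L^{\pm}(u)=(l^{\pm}_{ij}(u))_{i,j}$. The defining relations are $[L^{\pm}(u),c]=0$ and $$R(u-v)L_1^{\pm}(u)L_2^{\pm}(v)=L_2^{\pm}(v)L_1^{\pm}(u)R(u-v),$$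 $$R(u-v-\tfrac12hc)L_1^{+}(u)L_2^{-}(v)=L_2^{-}(v)L_1^{+}(u)R(u-v+\tfrac12hc),$$ where $R$ is viewed as a power series in $u^{-1}$ (in the $h$-adic topology). A subscript $a$ on $L_a^\pm$ indicates the tensor copy of $\mathrm{End}\,\mathbb{C}^n$ in which the matrix is placed; $\operatorname{tr}_{1,\dots,k}$ is the trace over all $k$ copies. $\overline{\mathrm{DY}}_h(\mathfrak{gl}_n)_{cr}$ is the quotient by the ideal generated by $c+n$ (critical level $c=-n$), and $\mathrm{DY}_h(\mathfrak{gl}_n)_{cr}=\varprojlim_{p>0}\overline{\mathrm{DY}}_h(\mathfrak{gl}_n)_{cr}/J_p$, where $J_p$ is the left ideal generated by all $l_{ij}^{(r)}$ with $r\ge p$. The vacuum module $V_h(\mathfrak{gl}_n)$ at the critical level is the quotient of $\mathrm{DY}_h(\mathfrak{gl}_n)_{cr}$ by the left ideal generated by all $l_{ij}^{(r)}$ with $r\ge0$; $\mathbf{1}$ is the image of $1$, so $L^{+}(z)\mathbf{1}=I\mathbf{1}$ ($I$ the identity matrix, i.e. $l_{ij}^+(z)\mathbf 1=\delta_{ij}\mathbf 1$). $A_k=\frac1{k!}\sum_{\sigma\in\mathfrak{S}_k}\mathrm{sgn}(\sigma)\,\sigma$ acts on $(\mathbb{C}^n)^{\otimes k}$ by permuting tensor factors. The coefficients of $\bar\ell_k(u)$ are elements of $\mathrm{DY}_h(\mathfrak{gl}_n)_{cr}$ (expressed through the $l_{ij}^{(r)}$ with $r<0$).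
   Formalization: The Yangian double is taken topologically free: its ideal of relations is closed h-adically and under division by h; the projective limit uses the h-adic completions of the quotients by J_p. Otherwise the product on the limit is undefined. *)

theory Defs
  imports
    "HOL-Library.Poly_Mapping"
    "HOL-Library.Set_Algebras"
    "HOL-Library.FuncSet"
    "HOL-Library.Cardinality"
    "HOL-Combinatorics.Permutations"
    "HOL-Computational_Algebra.Formal_Power_Series"
begin

text \<open>
  The index set \<open>{1,\<dots>,n}\<close> is a finite type \<open>'n\<close>, with \<open>n = CARD('n)\<close>.
\<close>

section \<open>The \<open>h\<close>-adically completed free algebra\<close>

datatype 'n gen = L_gen 'n 'n int | C_gen

datatype 'n gen_word = Word "'n gen list"

instantiation gen_word :: (type) monoid_add
begin

definition zero_gen_word :: "'a gen_word" where
  "zero_gen_word = Word []"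

fun plus_gen_word :: "'a gen_word \<Rightarrow> 'a gen_word \<Rightarrow> 'a gen_word" where
  "plus_gen_word (Word xs) (Word ys) = Word (xs @ ys)"

instance
proof
  fix a b c :: "'a gen_word"
  show "a + b + c = a + (b + c)" by (cases a; cases b; cases c) simp
  show "0 + a = a" by (cases a) (simp add: zero_gen_word_def)
  show "a + 0 = a" by (cases a) (simp add: zero_gen_word_def)
qed

end

text \<open>
  Finitely supported functions on words form the noncommutative polynomial ring
  \<open>\<complex>\<langle>X\<rangle>\<close>, and \<open>\<complex>\<langle>X\<rangle>[[h]]\<close> is the \<open>h\<close>-adic completion of the free algebra
  \<open>\<complex>[[h]]\<langle>X\<rangle>\<close>; the series variable of the outer \<open>fps\<close> is \<open>h\<close>.
\<close>

type_synonym 'n free_alg = "('n gen_word \<Rightarrow>\<^sub>0 complex) fps"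

abbreviation hbar :: "'a::ring_1 fps" where
  "hbar \<equiv> fps_X"

definition gen :: "'n gen \<Rightarrow> 'n free_alg" where
  "gen g = fps_const (Poly_Mapping.single (Word [g]) 1)"

abbreviation l_free :: "'n \<Rightarrow> 'n \<Rightarrow> int \<Rightarrow> 'n free_alg" where
  "l_free i j r \<equiv> gen (L_gen i j r)"

abbreviation c_free :: "'n free_alg" where
  "c_free \<equiv> gen C_gen"

definition scal :: "complex fps \<Rightarrow> 'n free_alg" where
  "scal s = Abs_fps (\<lambda>m. Poly_Mapping.single 0 (fps_nth s m))"

text \<open>
  Sum of an \<open>h\<close>-adically summable family, i.e. one in which every power of \<open>h\<close> occurs in only
  finitely many members.
\<close>

definition hsum :: "('s \<Rightarrow> 'a::comm_monoid_add fps) \<Rightarrow> 'a fps" where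
  "hsum x = Abs_fps (\<lambda>m. Sum_any (\<lambda>s. fps_nth (x s) m))"

text \<open>
  The coefficient matrices of \<open>L\<^sup>+(u)\<close> and \<open>L\<^sup>-(u)\<close> at \<open>u\<^sup>e\<close>, for an arbitrary integer \<open>e\<close>.
\<close>

definition L_plus :: "int \<Rightarrow> 'n \<Rightarrow> 'n \<Rightarrow> 'n free_alg" where
  "L_plus e i j = (if e = 0 \<and> i = j then 1 else 0)
     - (if e < 0 then hbar * l_free i j (- e - 1) else 0)"

definition L_minus :: "int \<Rightarrow> 'n \<Rightarrow> 'n \<Rightarrow> 'n free_alg" where
  "L_minus e i j = (if e = 0 \<and> i = j then 1 else 0)
     + (if e \<ge> 0 then hbar * l_free i j (- e - 1) else 0)"


section \<open>Operators on tensor powers of \<open>\<complex>\<^sup>n\<close>\<close>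

text \<open>
  The basis vectors of the \<open>k\<close>-th tensor power are indexed by the extensional functions on
  \<open>{1..k}\<close>; an operator with coefficients in a ring is given by its matrix.
\<close>

definition midx :: "nat \<Rightarrow> (nat \<Rightarrow> 'n) set" where
  "midx k = {1..k} \<rightarrow>\<^sub>E UNIV"

type_synonym ('n, 'a) tmat = "(nat \<Rightarrow> 'n) \<Rightarrow> (nat \<Rightarrow> 'n) \<Rightarrow> 'a"

definition tid :: "('n, 'a::zero_neq_one) tmat" where
  "tid I J = (if I = J then 1 else 0)"

definition tmul :: "nat \<Rightarrow> ('n, 'a::semiring_0) tmat \<Rightarrow> ('n, 'a) tmat \<Rightarrow> ('n, 'a) tmat" where
  "tmul k A B I J = (\<Sum>K\<in>midx k. A I K * B K J)"

definition ttrace :: "nat \<Rightarrow> ('n, 'a::comm_monoid_add) tmat \<Rightarrow> 'a" where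
  "ttrace k A = (\<Sum>I\<in>midx k. A I I)"

definition place :: "nat \<Rightarrow> nat \<Rightarrow> ('n \<Rightarrow> 'n \<Rightarrow> 'a::zero) \<Rightarrow> ('n, 'a) tmat" where
  "place k a M I J = (if \<forall>b\<in>{1..k} - {a}. I b = J b then M (I a) (J a) else 0)"

text \<open>
  The permutation \<open>\<sigma>\<close> moves the tensor factor in position \<open>a\<close> to position \<open>\<sigma> a\<close>.
\<close>

definition perm_op :: "(nat \<Rightarrow> nat) \<Rightarrow> ('n, 'a::zero_neq_one) tmat" where
  "perm_op \<sigma> I J = (if I = J \<circ> inv \<sigma> then 1 else 0)"

definition antisymmetrizer :: "nat \<Rightarrow> ('n, complex) tmat" where
  "antisymmetrizer k I J = (\<Sum>\<sigma> | \<sigma> permutes {1..k}. of_int (sign \<sigma>) * perm_op \<sigma> I J) / fact k"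


section \<open>The \<open>R\<close>-matrix\<close>

text \<open>
  \<open>inv_lin y\<close> is \<open>(u - y)\<^sup>-\<^sup>1 = \<Sum>\<^sub>j y\<^sup>j u\<^sup>-\<^sup>j\<^sup>-\<^sup>1\<close> as a series in the variable \<open>u\<^sup>-\<^sup>1\<close>. Hence a series
  \<open>s\<close> in \<open>u\<^sup>-\<^sup>1\<close> turns into \<open>s(u - y)\<close>, again expanded in \<open>u\<^sup>-\<^sup>1\<close>, by composition with \<open>inv_lin y\<close>.
\<close>

definition inv_lin :: "'a::semiring_1 \<Rightarrow> 'a fps" where
  "inv_lin y = Abs_fps (\<lambda>k. if k = 0 then 0 else y ^ (k - 1))"

text \<open>
  In \<open>complex fps fps\<close> the inner variable is \<open>h\<close>, the outer one is \<open>u\<^sup>-\<^sup>1\<close>.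
\<close>

definition f_series :: "nat \<Rightarrow> complex fps fps" where
  "f_series n = (THE f. fps_nth f 0 = 1 \<and>
     f oo inv_lin (of_nat n * hbar) = (1 - fps_const (hbar ^ 2) * fps_X ^ 2) * f)"

definition R_bar :: "('n, complex fps fps) tmat" where
  "R_bar I J = tid I J + fps_const hbar * fps_X * perm_op (Transposition.transpose 1 2) I J"

definition R_mat :: "('n::finite, complex fps fps) tmat" where
  "R_mat I J = f_series CARD('n) * R_bar I J"

text \<open>
  \<open>R_coeff a p q\<close> is the coefficient of \<open>u\<^sup>p v\<^sup>q\<close> in \<open>R(u - v - a)\<close>, expanded in \<open>u\<^sup>-\<^sup>1\<close>.
  In the intermediate type \<open>'n free_alg fps fps\<close> the inner series variable is \<open>v\<close>.
\<close>

definition R_coeff :: "'n::finite free_alg \<Rightarrow> int \<Rightarrow> int \<Rightarrow> ('n, 'n free_alg) tmat" where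
  "R_coeff a p q I J =
     (if p \<le> 0 \<and> q \<ge> 0
      then fps_nth (fps_nth
             (Abs_fps (\<lambda>k. fps_const (scal (fps_nth (R_mat I J) k))) oo inv_lin (fps_X + fps_const a))
             (nat (- p))) (nat q)
      else 0)"

text \<open>
  Matrix entries of the coefficients of \<open>u\<^sup>a v\<^sup>b\<close> in \<open>R(u - v - y) X\<^sub>1(u) Y\<^sub>2(v)\<close> and in
  \<open>Y\<^sub>2(v) X\<^sub>1(u) R(u - v - y)\<close>.
\<close>

definition RXY :: "'n::finite free_alg \<Rightarrow> (int \<Rightarrow> 'n \<Rightarrow> 'n \<Rightarrow> 'n free_alg) \<Rightarrow>
    (int \<Rightarrow> 'n \<Rightarrow> 'n \<Rightarrow> 'n free_alg) \<Rightarrow> int \<Rightarrow> int \<Rightarrow> ('n, 'n free_alg) tmat" where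
  "RXY y X Y a b I J = hsum (\<lambda>(p, q).
     tmul 2 (R_coeff y p q) (tmul 2 (place 2 1 (X (a - p))) (place 2 2 (Y (b - q)))) I J)"

definition YXR :: "'n::finite free_alg \<Rightarrow> (int \<Rightarrow> 'n \<Rightarrow> 'n \<Rightarrow> 'n free_alg) \<Rightarrow>
    (int \<Rightarrow> 'n \<Rightarrow> 'n \<Rightarrow> 'n free_alg) \<Rightarrow> int \<Rightarrow> int \<Rightarrow> ('n, 'n free_alg) tmat" where
  "YXR y X Y a b I J = hsum (\<lambda>(p, q).
     tmul 2 (tmul 2 (place 2 2 (Y (b - q))) (place 2 1 (X (a - p)))) (R_coeff y p q) I J)"

definition half_hc :: "'n free_alg" where
  "half_hc = scal (fps_const (1 / 2)) * hbar * c_free"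


section \<open>The Yangian double\<close>

definition two_sided_ideal :: "'a::ring set \<Rightarrow> bool" where
  "two_sided_ideal I \<longleftrightarrow> 0 \<in> I \<and> (\<forall>x\<in>I. \<forall>y\<in>I. x - y \<in> I) \<and> (\<forall>x\<in>I. \<forall>r. r * x \<in> I \<and> x * r \<in> I)"

definition left_ideal :: "'a::{ab_group_add, times} set \<Rightarrow> bool" where
  "left_ideal I \<longleftrightarrow> 0 \<in> I \<and> (\<forall>x\<in>I. \<forall>y\<in>I. x - y \<in> I) \<and> (\<forall>x\<in>I. \<forall>r. r * x \<in> I)"

definition two_sided_ideal_gen :: "'a::ring set \<Rightarrow> 'a set" where
  "two_sided_ideal_gen S = \<Inter>{I. two_sided_ideal I \<and> S \<subseteq> I}"

definition left_ideal_gen :: "'a::{ab_group_add, times} set \<Rightarrow> 'a set" where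
  "left_ideal_gen S = \<Inter>{I. left_ideal I \<and> S \<subseteq> I}"

inductive_set yd_relators :: "'n::finite free_alg set" where
  c_plus: "L_plus e i j * c_free - c_free * L_plus e i j \<in> yd_relators"
| c_minus: "L_minus e i j * c_free - c_free * L_minus e i j \<in> yd_relators"
| plus_plus: "I \<in> midx 2 \<Longrightarrow> J \<in> midx 2 \<Longrightarrow>
    RXY 0 L_plus L_plus a b I J - YXR 0 L_plus L_plus a b I J \<in> yd_relators"
| minus_minus: "I \<in> midx 2 \<Longrightarrow> J \<in> midx 2 \<Longrightarrow>
    RXY 0 L_minus L_minus a b I J - YXR 0 L_minus L_minus a b I J \<in> yd_relators"
| plus_minus: "I \<in> midx 2 \<Longrightarrow> J \<in> midx 2 \<Longrightarrow>
    RXY half_hc L_plus L_minus a b I J - YXR (- half_hc) L_plus L_minus a b I J \<in> yd_relators"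

text \<open>
  The Yangian double is understood as a topologically free \<open>\<complex>[[h]]\<close>-algebra: the ideal of relations
  is closed under \<open>h\<close>-adic limits (the quotient is \<open>h\<close>-adically separated and complete) and under
  division by \<open>h\<close> (the quotient has no \<open>h\<close>-torsion). The second condition is needed because every
  generator enters \<open>L\<^sup>\<plusminus>(u)\<close> with a factor \<open>h\<close>: all coefficients of the \<open>RLL\<close>-relations are divisible
  by \<open>h\<^sup>2\<close>, and they give commutation relations for the generators only after division by \<open>h\<^sup>2\<close>.
\<close>

definition h_closed :: "'a::ring_1 fps set \<Rightarrow> bool" where
  "h_closed I \<longleftrightarrow> (\<forall>x. (\<forall>m. \<exists>y\<in>I. \<exists>z. x = y + hbar ^ m * z) \<longrightarrow> x \<in> I)"

definition h_saturated :: "'a::ring_1 fps set \<Rightarrow> bool" where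
  "h_saturated I \<longleftrightarrow> (\<forall>x. hbar * x \<in> I \<longrightarrow> x \<in> I)"

definition yd_ideal :: "'n::finite free_alg set" where
  "yd_ideal = \<Inter>{I. two_sided_ideal I \<and> h_closed I \<and> h_saturated I \<and> yd_relators \<subseteq> I}"

lemma two_sided_ideal_Inter:
  "(\<And>I. I \<in> \<I> \<Longrightarrow> two_sided_ideal I) \<Longrightarrow> two_sided_ideal (\<Inter>\<I>)"
  unfolding two_sided_ideal_def by blast

lemma left_ideal_Inter:
  "(\<And>I. I \<in> \<I> \<Longrightarrow> left_ideal I) \<Longrightarrow> left_ideal (\<Inter>\<I>)"
  unfolding left_ideal_def by blast

lemma two_sided_ideal_gen: "two_sided_ideal (two_sided_ideal_gen S)"
  unfolding two_sided_ideal_gen_def by (rule two_sided_ideal_Inter) simp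

lemma left_ideal_gen: "left_ideal (left_ideal_gen S)"
  unfolding left_ideal_gen_def by (rule left_ideal_Inter) simp

lemma two_sided_ideal_yd_ideal: "two_sided_ideal yd_ideal"
  unfolding yd_ideal_def by (rule two_sided_ideal_Inter) simp

lemma equivp_subgroup:
  fixes I :: "'a::ab_group_add set"
  assumes "0 \<in> I" and diff: "\<And>x y. x \<in> I \<Longrightarrow> y \<in> I \<Longrightarrow> x - y \<in> I"
  shows "equivp (\<lambda>x y. x - y \<in> I)"
proof (rule equivpI)
  show "reflp (\<lambda>x y. x - y \<in> I)" using assms(1) by (simp add: reflp_def)
  show "symp (\<lambda>x y. x - y \<in> I)"
    using diff[OF assms(1)] by (fastforce simp: symp_def)
  have "x - z \<in> I" if "x - y \<in> I" "y - z \<in> I" for x y z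
  proof -
    have "z - y \<in> I" using diff[OF assms(1) that(2)] by simp
    from diff[OF that(1) this] show ?thesis by simp
  qed
  then show "transp (\<lambda>x y. x - y \<in> I)" by (auto simp: transp_def)
qed

lemma ideal_cong:
  assumes I: "two_sided_ideal I"
  shows two_sided_ideal_equivp: "equivp (\<lambda>x y. x - y \<in> I)"
    and two_sided_ideal_add: "a - a' \<in> I \<Longrightarrow> b - b' \<in> I \<Longrightarrow> (a + b) - (a' + b') \<in> I"
    and two_sided_ideal_diff: "a - a' \<in> I \<Longrightarrow> b - b' \<in> I \<Longrightarrow> (a - b) - (a' - b') \<in> I"
    and two_sided_ideal_minus: "a - a' \<in> I \<Longrightarrow> - a - (- a') \<in> I"
    and two_sided_ideal_times: "a - a' \<in> I \<Longrightarrow> b - b' \<in> I \<Longrightarrow> a * b - a' * b' \<in> I"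
proof -
  have zero: "0 \<in> I" and diff: "\<And>x y. x \<in> I \<Longrightarrow> y \<in> I \<Longrightarrow> x - y \<in> I"
    and mult: "\<And>x r. x \<in> I \<Longrightarrow> r * x \<in> I" "\<And>x r. x \<in> I \<Longrightarrow> x * r \<in> I"
    using I by (auto simp: two_sided_ideal_def)
  have minus: "- x \<in> I" if "x \<in> I" for x using diff[OF zero that] by simp
  have add: "x + y \<in> I" if "x \<in> I" "y \<in> I" for x y using diff[OF that(1) minus[OF that(2)]] by simp
  show "equivp (\<lambda>x y. x - y \<in> I)" by (rule equivp_subgroup[OF zero diff])
  show "(a + b) - (a' + b') \<in> I" if "a - a' \<in> I" "b - b' \<in> I"
    using add[OF that] by (simp add: algebra_simps)
  show "(a - b) - (a' - b') \<in> I" if "a - a' \<in> I" "b - b' \<in> I"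
    using diff[OF that] by (simp add: algebra_simps)
  show "- a - (- a') \<in> I" if "a - a' \<in> I"
    using minus[OF that] by (simp add: algebra_simps)
  show "a * b - a' * b' \<in> I" if "a - a' \<in> I" "b - b' \<in> I"
    using add[OF mult(2)[OF that(1), of b] mult(1)[OF that(2), of a']] by (simp add: algebra_simps)
qed

quotient_type (overloaded) 'n yangian_double = "'n::finite free_alg" / "\<lambda>x y. x - y \<in> yd_ideal"
  by (rule two_sided_ideal_equivp[OF two_sided_ideal_yd_ideal])

instantiation yangian_double :: (finite) "{ring, monoid_mult}"
begin

lift_definition zero_yangian_double :: "'a yangian_double" is 0 .
lift_definition one_yangian_double :: "'a yangian_double" is 1 .
lift_definition plus_yangian_double :: "'a yangian_double \<Rightarrow> 'a yangian_double \<Rightarrow> 'a yangian_double" is "(+)"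
  by (rule two_sided_ideal_add[OF two_sided_ideal_yd_ideal])
lift_definition minus_yangian_double :: "'a yangian_double \<Rightarrow> 'a yangian_double \<Rightarrow> 'a yangian_double" is "(-)"
  by (rule two_sided_ideal_diff[OF two_sided_ideal_yd_ideal])
lift_definition uminus_yangian_double :: "'a yangian_double \<Rightarrow> 'a yangian_double" is uminus
  by (rule two_sided_ideal_minus[OF two_sided_ideal_yd_ideal])
lift_definition times_yangian_double :: "'a yangian_double \<Rightarrow> 'a yangian_double \<Rightarrow> 'a yangian_double" is "(*)"
  by (rule two_sided_ideal_times[OF two_sided_ideal_yd_ideal])

instance
proof -
  have eq: "x = y \<Longrightarrow> x - y \<in> yd_ideal" for x y :: "'a free_alg"
  proof -
    assume "x = y"
    moreover have "two_sided_ideal (yd_ideal :: 'a free_alg set)" by (rule two_sided_ideal_yd_ideal)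
    ultimately show "x - y \<in> yd_ideal" unfolding two_sided_ideal_def by simp
  qed
  show "OFCLASS('a yangian_double, ring_class)"
    by standard (transfer, rule eq, simp add: algebra_simps)+
  show "OFCLASS('a yangian_double, monoid_mult_class)"
    by standard (transfer, rule eq, simp add: algebra_simps)+
qed

end


section \<open>The critical level\<close>

abbreviation yd :: "'n::finite free_alg \<Rightarrow> 'n yangian_double" where
  "yd \<equiv> abs_yangian_double"

quotient_type (overloaded) 'n yd_crit =
  "'n::finite yangian_double" / "\<lambda>x y. x - y \<in> two_sided_ideal_gen {yd (c_free + of_nat CARD('n))}"
  by (rule two_sided_ideal_equivp[OF two_sided_ideal_gen])

instantiation yd_crit :: (finite) "{ring, monoid_mult}"
begin

lift_definition zero_yd_crit :: "'a yd_crit" is 0 .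
lift_definition one_yd_crit :: "'a yd_crit" is 1 .
lift_definition plus_yd_crit :: "'a yd_crit \<Rightarrow> 'a yd_crit \<Rightarrow> 'a yd_crit" is "(+)"
  by (rule two_sided_ideal_add[OF two_sided_ideal_gen])
lift_definition minus_yd_crit :: "'a yd_crit \<Rightarrow> 'a yd_crit \<Rightarrow> 'a yd_crit" is "(-)"
  by (rule two_sided_ideal_diff[OF two_sided_ideal_gen])
lift_definition uminus_yd_crit :: "'a yd_crit \<Rightarrow> 'a yd_crit" is uminus
  by (rule two_sided_ideal_minus[OF two_sided_ideal_gen])
lift_definition times_yd_crit :: "'a yd_crit \<Rightarrow> 'a yd_crit \<Rightarrow> 'a yd_crit" is "(*)"
  by (rule two_sided_ideal_times[OF two_sided_ideal_gen])

instance
proof -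
  have eq: "x = y \<Longrightarrow> x - y \<in> two_sided_ideal_gen {yd (c_free + of_nat CARD('a))}"
    for x y :: "'a yangian_double"
    using two_sided_ideal_gen[of "{yd (c_free + of_nat CARD('a) :: 'a free_alg)}"]
    unfolding two_sided_ideal_def by simp
  show "OFCLASS('a yd_crit, ring_class)"
    by standard (transfer, rule eq, simp add: algebra_simps)+
  show "OFCLASS('a yd_crit, monoid_mult_class)"
    by standard (transfer, rule eq, simp add: algebra_simps)+
qed

end

definition crit :: "'n::finite free_alg \<Rightarrow> 'n yd_crit" where
  "crit x = abs_yd_crit (yd x)"

definition J_ideal :: "nat \<Rightarrow> 'n::finite yd_crit set" where
  "J_ideal p = left_ideal_gen {crit (l_free i j r) | i j r. r \<ge> int p}"

text \<open>
  The projective limit of the quotients by \<open>J\<^sub>p\<close> is formed in \<open>h\<close>-adically complete modules: each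
  quotient \<open>A / J\<^sub>p\<close> stands for its completion \<open>lim\<^sub>m A / (J\<^sub>p + h\<^sup>m A)\<close>. This is what makes the
  multiplication extend to the limit: for fixed \<open>x\<close> and \<open>r \<rightarrow> \<infinity>\<close> the products \<open>l\<^sub>i\<^sub>j\<^sup>(\<^sup>r\<^sup>) x\<close> tend to \<open>0\<close>
  modulo \<open>J\<^sub>p\<close> only in the \<open>h\<close>-adic sense. The index \<open>p = 0\<close> is redundant and does not change the limit.
\<close>

definition J_h :: "nat \<Rightarrow> nat \<Rightarrow> 'n::finite yd_crit set" where
  "J_h p m = J_ideal p + range (\<lambda>x. crit hbar ^ m * x)"

lemma J_h_zero: "0 \<in> J_h p m"
  and J_h_diff: "x \<in> J_h p m \<Longrightarrow> y \<in> J_h p m \<Longrightarrow> x - y \<in> J_h p m"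
proof -
  have J: "0 \<in> J_ideal p" "\<And>x y. x \<in> J_ideal p \<Longrightarrow> y \<in> J_ideal p \<Longrightarrow> x - y \<in> J_ideal p"
    using left_ideal_gen by (auto simp: J_ideal_def left_ideal_def)
  have "0 + crit hbar ^ m * 0 \<in> J_h p m"
    unfolding J_h_def by (intro set_plus_intro J rangeI)
  then show "0 \<in> J_h p m" by simp
  assume "x \<in> J_h p m" "y \<in> J_h p m"
  then obtain a b c d where "a \<in> J_ideal p" "c \<in> J_ideal p"
    "x = a + crit hbar ^ m * b" "y = c + crit hbar ^ m * d"
    unfolding J_h_def by (auto elim!: set_plus_elim)
  moreover from this have "x - y = (a - c) + crit hbar ^ m * (b - d)"
    by (simp add: algebra_simps)
  ultimately show "x - y \<in> J_h p m"
    unfolding J_h_def by (metis J(2) rangeI set_plus_intro)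
qed

lemma J_h_minus: "x \<in> J_h p m \<Longrightarrow> - x \<in> J_h p m"
  using J_h_diff[OF J_h_zero] by fastforce

lemma J_h_add: "x \<in> J_h p m \<Longrightarrow> y \<in> J_h p m \<Longrightarrow> x + y \<in> J_h p m"
  using J_h_diff[OF _ J_h_minus] by fastforce

lemma J_ideal_antimono: "p \<le> p' \<Longrightarrow> J_ideal p' \<subseteq> J_ideal p"
  unfolding J_ideal_def left_ideal_gen_def by (rule Inter_anti_mono) fastforce

lemma J_h_antimono:
  assumes "p \<le> p'" "m \<le> m'"
  shows "J_h p' m' \<subseteq> J_h p m"
proof -
  have "crit hbar ^ m' * x = crit hbar ^ m * (crit hbar ^ (m' - m) * x)" for x :: "'a yd_crit"
    using assms(2) by (simp add: mult.assoc[symmetric] power_add[symmetric])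
  then have "range (\<lambda>x. crit hbar ^ m' * x) \<subseteq> range (\<lambda>x :: 'a yd_crit. crit hbar ^ m * x)"
    by (metis image_subsetI rangeI)
  then show ?thesis
    unfolding J_h_def by (intro set_plus_mono2 J_ideal_antimono[OF assms(1)])
qed

definition coset_family :: "(nat \<Rightarrow> nat \<Rightarrow> 'n::finite yd_crit set) \<Rightarrow> bool" where
  "coset_family x \<longleftrightarrow> (\<forall>p m. \<exists>a. x p m = a +o J_h p m) \<and>
     (\<forall>p p' m m'. p \<le> p' \<longrightarrow> m \<le> m' \<longrightarrow> x p' m' \<subseteq> x p m)"

lemma coset_familyD:
  assumes "coset_family x"
  shows "\<exists>a. x p m = a +o J_h p m"
    and "p \<le> p' \<Longrightarrow> m \<le> m' \<Longrightarrow> x p' m' \<subseteq> x p m"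
  using assms by (simp_all only: coset_family_def)

lemma coset_family_const: "coset_family (\<lambda>p m. a +o J_h p m)"
  unfolding coset_family_def by (blast intro: set_plus_mono dest: subsetD[OF J_h_antimono])

text \<open>
  An element of the limit is a family of cosets, compatible with the projections.
\<close>

typedef (overloaded) 'n yd_cr = "{x :: nat \<Rightarrow> nat \<Rightarrow> 'n::finite yd_crit set. coset_family x}"
  morphisms component Abs_yd_cr
  using coset_family_const by blast

definition yd_cr_of_crit :: "'n::finite yd_crit \<Rightarrow> 'n yd_cr" where
  "yd_cr_of_crit a = Abs_yd_cr (\<lambda>p m. a +o J_h p m)"

definition yd_cr :: "'n::finite free_alg \<Rightarrow> 'n yd_cr" where
  "yd_cr x = yd_cr_of_crit (crit x)"

lemma coset_add: "(a +o J_h p m) + (b +o J_h p m) = (a + b) +o J_h p m"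
proof -
  have "J_h p m + J_h p m \<subseteq> (J_h p m :: 'a yd_crit set)"
    by (auto elim!: set_plus_elim intro: J_h_add)
  moreover have "0 + x \<in> J_h p m + J_h p m" if "x \<in> J_h p m" for x :: "'a yd_crit"
    by (rule set_plus_intro[OF J_h_zero that])
  ultimately have "J_h p m + J_h p m = (J_h p m :: 'a yd_crit set)" by auto
  then show ?thesis by (simp only: set_plus_rearrange)
qed

lemma coset_minus: "uminus ` (a +o J_h p m) = (- a) +o J_h p m"
proof (intro equalityI subsetI)
  fix x assume "x \<in> uminus ` (a +o J_h p m)"
  then obtain b where "b \<in> J_h p m" "x = - (a + b)" by (auto simp: elt_set_plus_def)
  then have "x = - a + (- b)" "- b \<in> J_h p m" by (simp_all add: J_h_minus)
  then show "x \<in> (- a) +o J_h p m" unfolding elt_set_plus_def by blast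
next
  fix x assume "x \<in> (- a) +o J_h p m"
  then obtain b where "b \<in> J_h p m" "x = - a + b" by (auto simp: elt_set_plus_def)
  then have "x = - (a + (- b))" "- b \<in> J_h p m" by (simp_all add: J_h_minus)
  then show "x \<in> uminus ` (a +o J_h p m)" unfolding elt_set_plus_def by blast
qed

lemma coset_family_component: "coset_family (component x)"
  using component by blast

lemma component_coset: obtains a where "component x p m = a +o J_h p m"
  using coset_familyD(1)[OF coset_family_component] by blast

lemma coset_family_zero: "coset_family J_h"
proof -
  have "(\<lambda>p m. (0 :: 'a yd_crit) +o J_h p m) = J_h"
    by (intro ext set_zero_plus)
  with coset_family_const[of "0 :: 'a yd_crit"] show ?thesis by metis
qed

lemma coset_family_add:
  assumes x: "coset_family x" and y: "coset_family y"
  shows "coset_family (\<lambda>p m. x p m + y p m)"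
proof -
  have "\<exists>c. x p m + y p m = c +o J_h p m" for p m
  proof -
    obtain a b where "x p m = a +o J_h p m" "y p m = b +o J_h p m"
      using coset_familyD(1)[OF x] coset_familyD(1)[OF y] by metis
    then have "x p m + y p m = (a + b) +o J_h p m" by (simp only: coset_add)
    then show ?thesis by blast
  qed
  moreover have "x p' m' + y p' m' \<subseteq> x p m + y p m" if "p \<le> p'" "m \<le> m'" for p p' m m'
    by (intro set_plus_mono2 coset_familyD(2)[OF x that] coset_familyD(2)[OF y that])
  ultimately show ?thesis unfolding coset_family_def by simp
qed

lemma coset_family_minus:
  assumes x: "coset_family x"
  shows "coset_family (\<lambda>p m. uminus ` x p m)"
proof -
  have "\<exists>c. uminus ` x p m = c +o J_h p m" for p m
  proof -
    obtain a where "x p m = a +o J_h p m" using coset_familyD(1)[OF x] by metis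
    then have "uminus ` x p m = (- a) +o J_h p m" by (simp only: coset_minus)
    then show ?thesis by blast
  qed
  moreover have "uminus ` x p' m' \<subseteq> uminus ` x p m" if "p \<le> p'" "m \<le> m'" for p p' m m'
    by (intro image_mono coset_familyD(2)[OF x that])
  ultimately show ?thesis unfolding coset_family_def by simp
qed

instantiation yd_cr :: (finite) ab_group_add
begin

definition zero_yd_cr :: "'a yd_cr" where
  "0 = Abs_yd_cr J_h"

definition plus_yd_cr :: "'a yd_cr \<Rightarrow> 'a yd_cr \<Rightarrow> 'a yd_cr" where
  "x + y = Abs_yd_cr (\<lambda>p m. component x p m + component y p m)" for x y :: "'a yd_cr"

definition uminus_yd_cr :: "'a yd_cr \<Rightarrow> 'a yd_cr" where
  "- x = Abs_yd_cr (\<lambda>p m. uminus ` component x p m)" for x :: "'a yd_cr"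

definition minus_yd_cr :: "'a yd_cr \<Rightarrow> 'a yd_cr \<Rightarrow> 'a yd_cr" where
  "x - y = x + (- y)" for x y :: "'a yd_cr"

lemma component_zero: "component (0 :: 'a yd_cr) p m = J_h p m"
  unfolding zero_yd_cr_def by (simp add: Abs_yd_cr_inverse coset_family_zero)

lemma component_add: "component (x + y) p m = component x p m + component y p m"
  for x y :: "'a yd_cr"
  unfolding plus_yd_cr_def
  by (simp add: Abs_yd_cr_inverse coset_family_add coset_family_component)

lemma component_minus: "component (- x) p m = uminus ` component x p m"
  for x :: "'a yd_cr"
  unfolding uminus_yd_cr_def
  by (simp add: Abs_yd_cr_inverse coset_family_minus coset_family_component)

instance
proof
  fix x y z :: "'a yd_cr"
  have eqI: "x = y" if "\<And>p m. component x p m = component y p m" for x y :: "'a yd_cr"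
    using that by (meson component_inject ext)
  show "x + y + z = x + (y + z)" by (rule eqI) (simp only: component_add add.assoc)
  show "x + y = y + x" by (rule eqI) (simp only: component_add add.commute)
  show "0 + x = x"
  proof (rule eqI)
    fix p m
    obtain a where a: "component x p m = a +o J_h p m" by (rule component_coset)
    have "J_h p m + a +o J_h p m = a +o J_h p m"
      using coset_add[of 0 p m a] by (simp only: set_zero_plus add_0_left)
    then show "component (0 + x) p m = component x p m"
      by (simp only: component_add component_zero a)
  qed
  show "- x + x = 0"
  proof (rule eqI)
    fix p m
    obtain a where a: "component x p m = a +o J_h p m" by (rule component_coset)
    show "component (- x + x) p m = component 0 p m"
      by (simp only: component_add component_minus component_zero a coset_minus coset_add
        add.left_inverse set_zero_plus)
  qed
  show "x - y = x + (- y)" by (rule minus_yd_cr_def)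
qed

end

text \<open>
  The multiplication of the limit is the continuous extension of that of its dense image
  of \<open>'n yd_crit\<close>: a component of the product \<open>x y\<close> is the common class of all products of
  representatives of sufficiently deep components of \<open>x\<close> and \<open>y\<close>. As the \<open>J_h p m\<close> are only left
  ideals, the product of the components of \<open>x\<close> and \<open>y\<close> at the same index would not be well defined.
\<close>

instantiation yd_cr :: (finite) "{times, one}"
begin

definition one_yd_cr :: "'a yd_cr" where
  "one_yd_cr = yd_cr 1"

definition times_yd_cr :: "'a yd_cr \<Rightarrow> 'a yd_cr \<Rightarrow> 'a yd_cr" where
  "x * y = (THE z. \<forall>p m. \<exists>q. \<forall>r\<ge>q. \<forall>a\<in>component x r r. \<forall>b\<in>component y r r.
     a * b \<in> component z p m)" for x y :: "'a yd_cr"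

instance ..

end


section \<open>The vacuum module\<close>

definition vacuum_ideal :: "'n::finite yd_cr set" where
  "vacuum_ideal = left_ideal_gen {yd_cr (l_free i j r) | i j r. r \<ge> 0}"

quotient_type (overloaded) 'n vacuum_module =
  "'n::finite yd_cr" / "\<lambda>x y. x - y \<in> vacuum_ideal"
proof (rule equivp_subgroup)
  have "left_ideal (vacuum_ideal :: 'n yd_cr set)"
    unfolding vacuum_ideal_def by (rule left_ideal_gen)
  then show "0 \<in> (vacuum_ideal :: 'n yd_cr set)"
    and "\<And>x y :: 'n yd_cr. x \<in> vacuum_ideal \<Longrightarrow> y \<in> vacuum_ideal \<Longrightarrow> x - y \<in> vacuum_ideal"
    unfolding left_ideal_def by auto
qed

instantiation vacuum_module :: (finite) zero
begin
lift_definition zero_vacuum_module :: "'a vacuum_module" is 0 .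
instance ..
end

definition vacuum :: "'n::finite vacuum_module" where
  "vacuum = abs_vacuum_module 1"

text \<open>
  The left action on the quotient by a left ideal; the choice of representative is immaterial.
\<close>

definition vac_act :: "'n::finite yd_cr \<Rightarrow> 'n vacuum_module \<Rightarrow> 'n vacuum_module"  (infixr \<open>\<bullet>\<close> 75) where
  "x \<bullet> v = abs_vacuum_module (x * rep_vacuum_module v)"

text \<open>
  The equation \<open>L\<^sup>+(z) v = I v\<close>, read off at the matrix entry \<open>(i, j)\<close> and the power \<open>z\<^sup>e\<close>.
\<close>

definition invariants :: "'n::finite vacuum_module set" where
  "invariants = {v. \<forall>i j e. yd_cr (L_plus e i j) \<bullet> v = (if e = 0 \<and> i = j then v else 0)}"


section \<open>The series \<open>tr A\<^sub>k L\<^sub>1\<^sup>-(u\<^sub>1) \<dots> L\<^sub>k\<^sup>-(u\<^sub>k)\<close>\<close>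

text \<open>
  Matrix entries of \<open>L\<^sup>-(u + a h)\<close>, as power series in \<open>u\<close>; the coefficients are \<open>h\<close>-adically
  convergent sums. The products below are formed in the completed free algebra and then mapped to
  the algebra at the critical level.
\<close>

definition L_minus_shift :: "nat \<Rightarrow> 'n \<Rightarrow> 'n \<Rightarrow> 'n free_alg fps" where
  "L_minus_shift a i j = Abs_fps (\<lambda>b. hsum (\<lambda>e::nat.
     of_nat (e choose b) * (of_nat a * hbar) ^ (e - b) * L_minus (int e) i j))"

definition L_minus_prod :: "nat \<Rightarrow> ('n, 'n free_alg fps) tmat" where
  "L_minus_prod k = foldr (tmul k) (map (\<lambda>a. place k a (L_minus_shift (a - 1))) [1..<Suc k]) tid"

definition ell_bar :: "nat \<Rightarrow> 'n free_alg fps" where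
  "ell_bar k = ttrace k (tmul k (\<lambda>I J. fps_const (scal (fps_const (antisymmetrizer k I J)))) (L_minus_prod k))"

definition ell_coeff :: "nat \<Rightarrow> nat \<Rightarrow> 'n::finite yd_cr" where
  "ell_coeff k r = yd_cr (fps_nth (ell_bar k) r)"

end

theory Submission
  imports Defs "HOL-Library.Function_Algebras"
begin

text \<open>
  Everything is computed in the completed free algebra, modulo ideals. The normalizing series \<open>f\<close>
  cancels from the relations, because its coefficients are scalars and its constant term is \<open>1\<close>;
  at the critical level the factors \<open>f\<close> on the two sides of the mixed relation have the arguments
  \<open>u - v \<plusminus> nh/2\<close>, and their quotient is rational by the defining equation of \<open>f\<close>.

  Because of the fusion procedure the antisymmetrizer turns \<open>L\<^sub>1\<^sup>-(u\<^sub>1) \<dots> L\<^sub>k\<^sup>-(u\<^sub>k)\<close> into an operator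
  which it absorbs on either side, and it can be moved through the products of \<open>R\<close>-matrices that
  arise when two such products, or such a product and \<open>L\<^sub>0\<^sup>+(u)\<close>, are interchanged. Under the trace the
  \<open>R\<close>-matrices acting from the left and from the right meet. For two fused products they are inverse
  to each other, which gives commutativity. For \<open>L\<^sub>0\<^sup>+(u)\<close>, which may be replaced by the identity
  next to the vacuum, the tensor position \<open>0\<close> is not traced over, and the \<open>R\<close>-matrices cancel in the partial
  trace over each position \<open>i \<ge> 1\<close> exactly because their arguments differ by \<open>nh\<close>.
\<close>


section \<open>Expansions of shifted series\<close>

text \<open>Working modulo ideals, whatever is divided out must be shown cancellable there. Series
  with constant term \<open>1\<close> cancel by recursion on coefficients, integers because complex
  scalars are available, powers of \<open>h\<close> by saturation, and the factors
  \<open>u - v + r h\<close> left over by two fused products by an induction on degrees. The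
  invariants live in a module over a completion with respect to left ideals \<open>J_p\<close>,
  whose product exists only because \<open>l_ij^(r) x\<close> tends to \<open>0\<close> for fixed
  \<open>x\<close> as \<open>r\<close> grows. This is extracted from the defining relations by
  induction on the power of \<open>h\<close>. It also makes the elements that vanish in the
  completion a two-sided ideal; as this ideal is closed under \<open>h\<close>-adic limits, the
  mixed relation can be shifted by multiples of \<open>h\<close> modulo it. Antisymmetrizers are
  sums without the factor \<open>1/k!\<close>; each absorbed copy costs a factor \<open>k!\<close>,
  which is removed at the end together with the scalar products in front of the relations.\<close>

lemma of_nat_left_commute: "x * (of_nat c * y) = of_nat c * (x * (y :: 'a::semiring_1))"
  by (metis mult.assoc mult_of_nat_commute)

text \<open>The negative binomial series: \<open>(u - y)^(-i)\<close> is the sum over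
  \<open>P\<close> of \<open>invc i P * y ^ (P - i)\<close> times \<open>u^(-P)\<close>.\<close>

definition invc :: "nat \<Rightarrow> nat \<Rightarrow> nat" where
  "invc i P = (if i = 0 then (if P = 0 then 1 else 0)
     else if P = 0 then 0 else (P - 1) choose (i - 1))"

lemma invc_0 [simp]: "invc 0 P = (if P = 0 then 1 else 0)"
  and invc_Suc_0 [simp]: "invc (Suc i) 0 = 0"
  and invc_Suc_Suc [simp]: "invc (Suc i) (Suc P) = P choose i"
  by (simp_all add: invc_def)

lemma invc_self [simp]: "invc i i = 1"
  by (cases i) simp_all

lemma invc_eq_0: "P < i \<Longrightarrow> invc i P = 0"
  by (cases i; cases P) auto

lemma invc_rec: "invc (Suc i) (Suc P) = invc (Suc i) P + invc i P"
  by (cases P; cases i) auto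

lemma inv_lin_nth [simp]: "fps_nth (inv_lin y) k = (if k = 0 then 0 else y ^ (k - 1))"
  by (simp add: inv_lin_def)

text \<open>With \<open>X\<close> for \<open>u^(-1)\<close>, this is the equation
  \<open>inv_lin y = X + y X inv_lin y\<close> read off at one coefficient. It yields the powers of
  \<open>inv_lin y\<close> by Pascal's rule.\<close>

lemma inv_lin_Suc_mult:
  fixes g :: "'a::ring_1 fps"
  shows "fps_nth (inv_lin y * g) (Suc P) = y * fps_nth (inv_lin y * g) P + fps_nth g P"
proof -
  have "fps_nth (inv_lin y * g) (Suc P) = (\<Sum>i\<in>{1..Suc P}. y ^ (i - 1) * fps_nth g (Suc P - i))"
    unfolding fps_mult_nth by (rule sum.mono_neutral_cong_right) auto
  also have "\<dots> = (\<Sum>i\<in>{0..P}. y ^ i * fps_nth g (P - i))"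
    by (rule sum.reindex_bij_witness[of _ Suc "\<lambda>i. i - 1"]) auto
  also have "\<dots> = fps_nth g P + (\<Sum>i\<in>{1..P}. y ^ i * fps_nth g (P - i))"
    by (simp add: sum.atLeast_Suc_atMost)
  also have "(\<Sum>i\<in>{1..P}. y ^ i * fps_nth g (P - i)) = y * (\<Sum>i\<in>{1..P}. y ^ (i - 1) * fps_nth g (P - i))"
    unfolding sum_distrib_left
  proof (rule sum.cong[OF refl])
    fix i assume "i \<in> {1..P}"
    then have "y ^ i = y * y ^ (i - 1)" by (cases i) auto
    then show "y ^ i * fps_nth g (P - i) = y * (y ^ (i - 1) * fps_nth g (P - i))"
      by (simp add: mult.assoc)
  qed
  also have "(\<Sum>i\<in>{1..P}. y ^ (i - 1) * fps_nth g (P - i)) = fps_nth (inv_lin y * g) P"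
    unfolding fps_mult_nth by (rule sum.mono_neutral_cong_left) auto
  finally show ?thesis by simp
qed

lemma inv_lin_power_nth:
  fixes y :: "'a::ring_1"
  shows "fps_nth (inv_lin y ^ i) P = of_nat (invc i P) * y ^ (P - i)"
proof (induction P arbitrary: i)
  case 0
  then show ?case by (cases i) (simp_all add: invc_def)
next
  case (Suc P)
  show ?case
  proof (cases i)
    case 0
    then show ?thesis by simp
  next
    case (Suc i')
    have eq: "y * (of_nat (invc (Suc i') P) * y ^ (P - Suc i')) = of_nat (invc (Suc i') P) * y ^ (P - i')"
    proof (cases "P < Suc i'")
      case True
      then show ?thesis by (simp add: invc_eq_0)
    next
      case False
      then have "P - i' = Suc (P - Suc i')" by simp
      then show ?thesis by (simp add: of_nat_left_commute)
    qed
    have "fps_nth (inv_lin y ^ Suc i') (Suc P)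
        = y * fps_nth (inv_lin y ^ Suc i') P + fps_nth (inv_lin y ^ i') P"
      by (simp add: inv_lin_Suc_mult)
    also have "\<dots> = of_nat (invc (Suc i') (Suc P)) * y ^ (P - i')"
      by (simp only: Suc.IH eq) (simp only: invc_rec of_nat_add distrib_right)
    finally show ?thesis by (simp add: Suc)
  qed
qed

lemma fps_X_plus_const_power_nth:
  fixes a :: "'a::ring_1"
  shows "fps_nth ((fps_X + fps_const a) ^ M) Q = of_nat (M choose Q) * a ^ (M - Q)"
proof (induction M arbitrary: Q)
  case 0
  then show ?case by (cases Q) auto
next
  case (Suc M)
  have eq: "a * (of_nat (M choose Q) * a ^ (M - Q)) = of_nat (M choose Q) * a ^ (Suc M - Q)"
  proof (cases "M < Q")
    case False
    then have "Suc M - Q = Suc (M - Q)" by simp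
    then show ?thesis by (simp add: of_nat_left_commute)
  qed (simp add: binomial_eq_0)
  show ?case
  proof (cases Q)
    case 0
    then show ?thesis by (simp add: distrib_right Suc.IH)
  next
    case (Suc Q')
    have "fps_nth ((fps_X + fps_const a) ^ Suc M) (Suc Q')
      = of_nat (M choose Q') * a ^ (M - Q') + of_nat (M choose Suc Q') * a ^ (Suc M - Suc Q')"
      by (simp only: power_Suc distrib_right fps_add_nth fps_X_mult_nth fps_mult_left_const_nth Suc.IH
          eq[unfolded Suc]) simp
    then show ?thesis by (simp add: Suc distrib_right)
  qed
qed

lemma compose_inv_lin_nth:
  fixes g :: "'a::ring_1 fps"
  shows "fps_nth (g oo inv_lin y) P = (\<Sum>i\<le>P. fps_nth g i * (of_nat (invc i P) * y ^ (P - i)))"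
  by (simp add: fps_compose_nth inv_lin_power_nth atMost_atLeast0)

text \<open>The inner variable \<open>v\<close> is central, so \<open>(v + a) ^ (P - i)\<close>
  expands binomially although \<open>a\<close> lies in a noncommutative ring. The formula replaces
  the composition in \<open>R_coeff\<close> from here on.\<close>

lemma lift_compose_inv_lin_nth:
  fixes g :: "nat \<Rightarrow> 'a::ring_1"
  shows "fps_nth (fps_nth (Abs_fps (\<lambda>k. fps_const (g k)) oo inv_lin (fps_X + fps_const a)) P) Q
    = (\<Sum>i\<le>P. g i * (of_nat (invc i P * ((P - i) choose Q)) * a ^ (P - i - Q)))"
proof -
  have "fps_nth (of_nat c * (fps_X + fps_const a) ^ M) Q = of_nat (c * (M choose Q)) * a ^ (M - Q)" for c M
    by (simp add: fps_of_nat[symmetric] fps_X_plus_const_power_nth mult.assoc)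
  then show ?thesis
    by (simp add: compose_inv_lin_nth fps_sum_nth)
qed


section \<open>The normalizing series\<close>

text \<open>The functional equation is invariant under scaling \<open>h\<close> and \<open>u\<close>
  together, so its solution has the form \<open>f_m = phi_m h^m\<close>. At \<open>u^(-m-1)\<close>
  the unknown \<open>f_(m+1)\<close> cancels and \<open>f_m\<close> remains with the factor
  \<open>m n h\<close>; solving for \<open>phi_m\<close> gives the recursion.\<close>

function phi_coeff :: "nat \<Rightarrow> nat \<Rightarrow> complex" where
  "phi_coeff n m = (if m = 0 then 1 else
     - ((\<Sum>j\<in>{1..<m}. phi_coeff n j * of_nat (m choose (j - 1)) * of_nat n ^ (Suc m - j))
        + phi_coeff n (m - 1)) / (of_nat m * of_nat n))"
  by pat_completeness auto
termination by (relation "measure snd") auto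

declare phi_coeff.simps [simp del]

definition normalizing :: "nat \<Rightarrow> complex fps fps \<Rightarrow> bool" where
  "normalizing n f \<longleftrightarrow> fps_nth f 0 = 1 \<and>
     f oo inv_lin (of_nat n * hbar) = (1 - fps_const (hbar ^ 2) * fps_X ^ 2) * f"

lemma invc_Suc_Suc': "1 \<le> j \<Longrightarrow> invc j (Suc m) = m choose (j - 1)"
  by (cases j) auto

text \<open>At \<open>u^(-m-1)\<close> the summand \<open>i = m + 1\<close> of the composition
  cancels against the right-hand side, and \<open>i = m\<close> brings in the factor
  \<open>m\<close> through \<open>invc m (Suc m)\<close>. At the powers \<open>0\<close> and
  \<open>1\<close> both sides agree automatically.\<close>

lemma normalizing_iff:
  "normalizing n f \<longleftrightarrow> fps_nth f 0 = 1 \<and>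
     (\<forall>m\<ge>1. of_nat m * (of_nat n * hbar) * fps_nth f m
        + (\<Sum>j\<in>{1..<m}. fps_nth f j * of_nat (m choose (j - 1)) * (of_nat n * hbar) ^ (Suc m - j))
        + hbar ^ 2 * fps_nth f (m - 1) = 0)"
proof -
  let ?y = "of_nat n * hbar :: complex fps"
  let ?S = "\<lambda>m. \<Sum>j\<in>{1..<m}. fps_nth f j * of_nat (m choose (j - 1)) * ?y ^ (Suc m - j)"
  have rhs: "fps_nth ((1 - fps_const (hbar ^ 2) * fps_X ^ 2) * f) P
      = fps_nth f P - (if P < 2 then 0 else hbar ^ 2 * fps_nth f (P - 2))" for P
    by (simp add: left_diff_distrib mult.assoc fps_X_power_mult_nth)
  have lhs: "fps_nth (f oo inv_lin ?y) (Suc m) = fps_nth f (Suc m) + (of_nat m * ?y * fps_nth f m + ?S m)"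
    if "m \<ge> 1" for m
  proof -
    have "fps_nth (f oo inv_lin ?y) (Suc m)
      = (\<Sum>i\<le>Suc m. fps_nth f i * (of_nat (invc i (Suc m)) * ?y ^ (Suc m - i)))"
      by (rule compose_inv_lin_nth)
    also have "\<dots> = (\<Sum>i\<in>{1..Suc m}. fps_nth f i * (of_nat (invc i (Suc m)) * ?y ^ (Suc m - i)))"
      by (rule sum.mono_neutral_right) (auto simp: not_less_eq_eq)
    also have "{1..Suc m} = insert (Suc m) (insert m {1..<m})" using that by auto
    also have "(\<Sum>i\<in>insert (Suc m) (insert m {1..<m}). fps_nth f i * (of_nat (invc i (Suc m)) * ?y ^ (Suc m - i)))
      = fps_nth f (Suc m) + (of_nat m * ?y * fps_nth f m + (\<Sum>i\<in>{1..<m}. fps_nth f i * (of_nat (invc i (Suc m)) * ?y ^ (Suc m - i))))"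
    proof -
      have "invc m (Suc m) = m" using that
        by (cases m) (simp_all add: invc_def)
      then show ?thesis by (simp add: mult_ac)
    qed
    also have "(\<Sum>i\<in>{1..<m}. fps_nth f i * (of_nat (invc i (Suc m)) * ?y ^ (Suc m - i))) = ?S m"
      by (rule sum.cong) (auto simp: invc_Suc_Suc' mult.assoc)
    finally show ?thesis .
  qed
  have "f oo inv_lin ?y = (1 - fps_const (hbar ^ 2) * fps_X ^ 2) * f \<longleftrightarrow>
     (\<forall>P. fps_nth (f oo inv_lin ?y) P = fps_nth ((1 - fps_const (hbar ^ 2) * fps_X ^ 2) * f) P)"
    by (simp only: fps_eq_iff)
  also have "\<dots> \<longleftrightarrow> (\<forall>m\<ge>1. fps_nth (f oo inv_lin ?y) (Suc m) = fps_nth ((1 - fps_const (hbar ^ 2) * fps_X ^ 2) * f) (Suc m))"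
    (is "(\<forall>P. ?A P) \<longleftrightarrow> _")
  proof -
    have "?A 0" by simp
    moreover have "?A (Suc 0)" by (simp add: rhs compose_inv_lin_nth del: fps_mult_nth_1')
    ultimately show ?thesis
      by (metis One_nat_def Suc_le_eq not0_implies_Suc gr0_conv_Suc)
  qed
  also have "\<dots> \<longleftrightarrow> (\<forall>m\<ge>1. of_nat m * ?y * fps_nth f m + ?S m + hbar ^ 2 * fps_nth f (m - 1) = 0)"
  proof -
    have "fps_nth (f oo inv_lin ?y) (Suc m) = fps_nth ((1 - fps_const (hbar ^ 2) * fps_X ^ 2) * f) (Suc m)
       \<longleftrightarrow> of_nat m * ?y * fps_nth f m + ?S m + hbar ^ 2 * fps_nth f (m - 1) = 0" if "m \<ge> 1" for m
    proof -
      have r: "fps_nth ((1 - fps_const (hbar ^ 2) * fps_X ^ 2) * f) (Suc m)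
          = fps_nth f (Suc m) - hbar ^ 2 * fps_nth f (m - 1)"
        using that by (simp add: rhs)
      have "X + (A + B) = X - C \<longleftrightarrow> A + B + C = 0" for X A B C :: "complex fps"
        by (metis (no_types) add.commute add_diff_cancel_right' diff_add_cancel diff_eq_eq eq_neg_iff_add_eq_0 diff_conv_add_uminus add_left_cancel)
      then show ?thesis unfolding lhs[OF that] r by blast
    qed
    then show ?thesis by auto
  qed
  finally show ?thesis unfolding normalizing_def by simp
qed

text \<open>All terms of the equation at \<open>m\<close> carry the same power
  \<open>hbar ^ Suc m\<close>, and what multiplies it vanishes by the recursion.\<close>

lemma normalizing_phi:
  assumes "n > 0"
  shows "normalizing n (Abs_fps (\<lambda>k. fps_const (phi_coeff n k) * hbar ^ k))"
  unfolding normalizing_iff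
proof (intro conjI allI impI)
  show "fps_nth (Abs_fps (\<lambda>k. fps_const (phi_coeff n k) * hbar ^ k)) 0 = (1 :: complex fps)"
    by (simp add: phi_coeff.simps)
  fix m :: nat assume m: "m \<ge> 1"
  let ?p = "phi_coeff n"
  let ?S = "\<Sum>j\<in>{1..<m}. ?p j * of_nat (m choose (j - 1)) * of_nat n ^ (Suc m - j)"
  have S: "(\<Sum>j\<in>{1..<m}. fps_nth (Abs_fps (\<lambda>k. fps_const (?p k) * hbar ^ k)) j * of_nat (m choose (j - 1)) * (of_nat n * hbar) ^ (Suc m - j))
     = fps_const ?S * hbar ^ Suc m"
  proof -
    have "fps_const ?S = (\<Sum>j\<in>{1..<m}. fps_const (?p j * of_nat (m choose (j - 1)) * of_nat n ^ (Suc m - j)))"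
      by (simp add: fps_eq_iff fps_sum_nth)
    then have "fps_const ?S * hbar ^ Suc m = (\<Sum>j\<in>{1..<m}. fps_const (?p j * of_nat (m choose (j - 1)) * of_nat n ^ (Suc m - j)) * hbar ^ Suc m)"
      by (simp only: sum_distrib_right)
    also have "\<dots> = (\<Sum>j\<in>{1..<m}. fps_nth (Abs_fps (\<lambda>k. fps_const (?p k) * hbar ^ k)) j * of_nat (m choose (j - 1)) * (of_nat n * hbar) ^ (Suc m - j))"
  proof (rule sum.cong[OF refl])
    fix j assume "j \<in> {1..<m}"
    then have "hbar ^ Suc m = (hbar ^ j * hbar ^ (Suc m - j) :: complex fps)"
      by (simp add: power_add[symmetric] del: power_Suc)
    then show "fps_const (?p j * of_nat (m choose (j - 1)) * of_nat n ^ (Suc m - j)) * hbar ^ Suc m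
       = fps_nth (Abs_fps (\<lambda>k. fps_const (?p k) * hbar ^ k)) j * of_nat (m choose (j - 1)) * (of_nat n * hbar) ^ (Suc m - j)"
      by (simp only: fps_nth_Abs_fps fps_of_nat[symmetric] power_mult_distrib fps_const_power fps_const_mult[symmetric])
        (simp only: mult_ac)
  qed
  finally show ?thesis by simp
  qed
  have "of_nat m * of_nat n * ?p m + ?S + ?p (m - 1) = 0"
    using m assms by (subst phi_coeff.simps) (simp add: field_simps)
  then have "fps_const (of_nat m * of_nat n * ?p m + ?S + ?p (m - 1)) * hbar ^ Suc m = 0" by simp
  then have *: "(fps_const (of_nat m) * fps_const (of_nat n) * fps_const (?p m) + fps_const ?S + fps_const (?p (m - 1))) * hbar ^ Suc m = 0"
    by (simp only: fps_const_mult fps_const_add)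
  have m_Suc: "hbar ^ 2 * hbar ^ (m - 1) = (hbar ^ Suc m :: complex fps)"
    using m by (simp add: power_add[symmetric] del: power_Suc)
  have t1: "of_nat m * (of_nat n * hbar) * (fps_const (?p m) * hbar ^ m) = fps_const (of_nat m) * fps_const (of_nat n) * fps_const (?p m) * hbar ^ Suc m"
    by (simp only: fps_of_nat power_Suc mult_ac)
  have t2: "hbar ^ 2 * (fps_const (?p (m - 1)) * hbar ^ (m - 1)) = fps_const (?p (m - 1)) * hbar ^ Suc m"
    unfolding m_Suc[symmetric] by (simp only: mult_ac)
  show "of_nat m * (of_nat n * hbar) * fps_nth (Abs_fps (\<lambda>k. fps_const (?p k) * hbar ^ k)) m
        + (\<Sum>j\<in>{1..<m}. fps_nth (Abs_fps (\<lambda>k. fps_const (?p k) * hbar ^ k)) j * of_nat (m choose (j - 1)) * (of_nat n * hbar) ^ (Suc m - j))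
        + hbar ^ 2 * fps_nth (Abs_fps (\<lambda>k. fps_const (?p k) * hbar ^ k)) (m - 1) = (0 :: complex fps)"
    unfolding fps_nth_Abs_fps S[unfolded fps_nth_Abs_fps] t1 t2 using * by (simp only: distrib_right)
qed

text \<open>\<open>of_nat m * (of_nat n * hbar)\<close> is a nonzero element of a domain, so the
  equation at \<open>m\<close> determines coefficient \<open>m\<close> from the lower ones. This
  justifies the definite description in \<open>f_series\<close>.\<close>

lemma normalizing_unique:
  assumes n: "n > 0" and f: "normalizing n f" and g: "normalizing n g"
  shows "f = g"
proof -
  have "fps_nth f m = fps_nth g m" for m
  proof (induction m rule: less_induct)
    case (less m)
    show ?case
    proof (cases "m = 0")
      case True
      with f g show ?thesis by (simp add: normalizing_def)
    next
      case False
      let ?y = "of_nat n * hbar :: complex fps"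
      let ?S = "\<lambda>f. \<Sum>j\<in>{1..<m}. fps_nth f j * of_nat (m choose (j - 1)) * ?y ^ (Suc m - j)"
      have "?S f = ?S g" by (rule sum.cong) (auto simp: less.IH)
      moreover have "fps_nth f (m - 1) = fps_nth g (m - 1)" using False by (simp add: less.IH)
      moreover have "of_nat m * ?y * fps_nth f m + ?S f + hbar ^ 2 * fps_nth f (m - 1) = 0"
        by (rule f[unfolded normalizing_iff, THEN conjunct2, rule_format, of m], use False in simp)
      moreover have "of_nat m * ?y * fps_nth g m + ?S g + hbar ^ 2 * fps_nth g (m - 1) = 0"
        by (rule g[unfolded normalizing_iff, THEN conjunct2, rule_format, of m], use False in simp)
      ultimately have "of_nat m * ?y * fps_nth f m + (?S g + hbar ^ 2 * fps_nth g (m - 1))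
          = of_nat m * ?y * fps_nth g m + (?S g + hbar ^ 2 * fps_nth g (m - 1))"
        by (simp only: add.assoc)
      then have "of_nat m * ?y * fps_nth f m = of_nat m * ?y * fps_nth g m"
        by (rule add_right_imp_eq)
      with False n show ?thesis by simp
    qed
  qed
  then show ?thesis by (simp add: fps_eq_iff)
qed

lemma f_series_eq:
  assumes "n > 0"
  shows "f_series n = Abs_fps (\<lambda>k. fps_const (phi_coeff n k) * hbar ^ k)"
proof -
  have "f_series n = (THE f. normalizing n f)"
    by (simp add: f_series_def normalizing_def)
  also have "\<dots> = Abs_fps (\<lambda>k. fps_const (phi_coeff n k) * hbar ^ k)"
    using normalizing_phi[OF assms] normalizing_unique[OF assms] by (blast intro: the_equality)
  finally show ?thesis .
qed

section \<open>Ideals and \<open>h\<close>-adic sums\<close>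

definition central :: "'a::times \<Rightarrow> bool" where
  "central c \<longleftrightarrow> (\<forall>x. c * x = x * c)"

lemma centralD: "central c \<Longrightarrow> x * c = c * x"
  by (simp add: central_def)

lemma central_left_commute: "central c \<Longrightarrow> x * (c * y) = c * (x * y :: 'a::semigroup_mult)"
  by (metis centralD mult.assoc)

lemma central_0 [simp]: "central (0 :: 'a::ring_1)"
  and central_1 [simp]: "central (1 :: 'a::ring_1)"
  and central_of_nat [simp]: "central (of_nat k :: 'a::ring_1)"
  and central_of_int [simp]: "central (of_int i :: 'a::ring_1)"
  by (auto simp: central_def mult_of_nat_commute mult_of_int_commute)

lemma central_add [intro, simp]: "central a \<Longrightarrow> central b \<Longrightarrow> central (a + b :: 'a::ring_1)"
  by (simp add: central_def distrib_left distrib_right)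

lemma central_diff [intro, simp]: "central a \<Longrightarrow> central b \<Longrightarrow> central (a - b :: 'a::ring_1)"
  by (simp add: central_def left_diff_distrib right_diff_distrib)

lemma central_minus [intro, simp]: "central a \<Longrightarrow> central (- a :: 'a::ring_1)"
  by (simp add: central_def)

lemma central_mult [intro, simp]: "central a \<Longrightarrow> central b \<Longrightarrow> central (a * b :: 'a::ring_1)"
  unfolding central_def by (metis mult.assoc)

lemma central_power [intro, simp]: "central a \<Longrightarrow> central (a ^ k :: 'a::ring_1)"
  by (induction k) auto

lemma central_prod_list: "(\<And>x. x \<in> set xs \<Longrightarrow> central (f x)) \<Longrightarrow> central (prod_list (map f xs) :: 'a::ring_1)"
  by (induction xs) auto

lemma central_fps_X [simp]: "central (fps_X :: 'a::ring_1 fps)"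
  by (simp add: central_def fps_mult_fps_X_commute)

lemma central_fps_const [intro, simp]: "central a \<Longrightarrow> central (fps_const a :: 'a::ring_1 fps)"
  by (simp add: central_def fps_eq_iff)

lemma central_fpsI: "(\<And>k. central (fps_nth a k)) \<Longrightarrow> central (a :: 'a::ring_1 fps)"
proof -
  assume c: "\<And>k. central (fps_nth a k)"
  have "fps_nth (a * x) n = fps_nth (x * a) n" for x n
  proof -
    have "fps_nth (a * x) n = (\<Sum>i=0..n. fps_nth x (n - i) * fps_nth a i)"
      by (simp add: fps_mult_nth centralD[OF c])
    also have "\<dots> = (\<Sum>i=0..n. fps_nth x i * fps_nth a (n - i))"
      by (rule sum.reindex_bij_witness[of _ "\<lambda>i. n - i" "\<lambda>i. n - i"]) auto
    finally show ?thesis by (simp add: fps_mult_nth)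
  qed
  then show ?thesis by (simp add: central_def fps_eq_iff)
qed

lemma left_ideal_0: "left_ideal I \<Longrightarrow> 0 \<in> I"
  and left_ideal_diff: "left_ideal I \<Longrightarrow> x \<in> I \<Longrightarrow> y \<in> I \<Longrightarrow> x - y \<in> I"
  and left_ideal_mult: "left_ideal I \<Longrightarrow> x \<in> I \<Longrightarrow> r * x \<in> I"
  for I :: "'a::ring set"
  by (auto simp: left_ideal_def)

lemma left_ideal_minus: "left_ideal I \<Longrightarrow> x \<in> I \<Longrightarrow> - x \<in> I" for I :: "'a::ring set"
  using left_ideal_diff[of I 0 x] by (simp add: left_ideal_0)

lemma left_ideal_add: "left_ideal I \<Longrightarrow> x \<in> I \<Longrightarrow> y \<in> I \<Longrightarrow> x + y \<in> I" for I :: "'a::ring set"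
  using left_ideal_diff[of I x "- y"] by (simp add: left_ideal_minus)

lemma left_ideal_sum: "left_ideal I \<Longrightarrow> (\<And>s. s \<in> A \<Longrightarrow> f s \<in> I) \<Longrightarrow> sum f A \<in> I"
  for I :: "'a::ring set"
  by (induction A rule: infinite_finite_induct) (auto simp: left_ideal_0 left_ideal_add)

lemma two_sided_left: "two_sided_ideal I \<Longrightarrow> left_ideal I"
  by (simp add: two_sided_ideal_def left_ideal_def)

lemma two_sided_mult_right: "two_sided_ideal I \<Longrightarrow> x \<in> I \<Longrightarrow> x * r \<in> I"
  by (simp add: two_sided_ideal_def)

lemma two_sidedI: "left_ideal I \<Longrightarrow> (\<And>x r. x \<in> I \<Longrightarrow> x * r \<in> I) \<Longrightarrow> two_sided_ideal I"
  for I :: "'a::ring set"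
  by (simp add: two_sided_ideal_def left_ideal_def)

definition coeff_ideal :: "'a::zero set \<Rightarrow> 'a fps set" where
  "coeff_ideal I = {x. \<forall>k. fps_nth x k \<in> I}"

lemma coeff_idealI: "(\<And>k. fps_nth x k \<in> I) \<Longrightarrow> x \<in> coeff_ideal I"
  and coeff_idealD: "x \<in> coeff_ideal I \<Longrightarrow> fps_nth x k \<in> I"
  by (auto simp: coeff_ideal_def)

lemma left_ideal_coeff: "left_ideal I \<Longrightarrow> left_ideal (coeff_ideal I)" for I :: "'a::ring_1 set"
proof -
  assume I: "left_ideal I"
  show ?thesis
    unfolding left_ideal_def[of "coeff_ideal I"]
    by (auto simp: coeff_ideal_def fps_mult_nth
        intro: left_ideal_0[OF I] left_ideal_diff[OF I] left_ideal_sum[OF I] left_ideal_mult[OF I])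
qed

lemma two_sided_coeff: "two_sided_ideal I \<Longrightarrow> two_sided_ideal (coeff_ideal I)" for I :: "'a::ring_1 set"
proof (rule two_sidedI)
  assume I: "two_sided_ideal I"
  then show "left_ideal (coeff_ideal I)" by (intro left_ideal_coeff two_sided_left)
  show "x * r \<in> coeff_ideal I" if "x \<in> coeff_ideal I" for x r
    using that I unfolding coeff_ideal_def
    by (auto simp: fps_mult_nth intro!: left_ideal_sum two_sided_left two_sided_mult_right)
qed

text \<open>Since \<open>s\<close> starts with \<open>1\<close>, coefficient \<open>k\<close> of
  \<open>s * x\<close> is that of \<open>x\<close> plus a left combination of earlier ones. The
  factor \<open>f\<close>, and later the scalar products in front of the relations, are divided out
  this way.\<close>

lemma coeff_ideal_cancel_unit:
  fixes I :: "'a::ring_1 set"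
  assumes I: "left_ideal I" and s: "fps_nth s 0 = 1" and x: "s * x \<in> coeff_ideal I"
  shows "x \<in> coeff_ideal I"
proof (rule coeff_idealI)
  fix k show "fps_nth x k \<in> I"
  proof (induction k rule: less_induct)
    case (less k)
    have "fps_nth (s * x) k = fps_nth x k + (\<Sum>i\<in>{1..k}. fps_nth s i * fps_nth x (k - i))"
      by (simp add: fps_mult_nth sum.atLeast_Suc_atMost s)
    moreover have "(\<Sum>i\<in>{1..k}. fps_nth s i * fps_nth x (k - i)) \<in> I"
      by (intro left_ideal_sum left_ideal_mult I less.IH) auto
    ultimately have "fps_nth x k = fps_nth (s * x) k - (\<Sum>i\<in>{1..k}. fps_nth s i * fps_nth x (k - i))"
      by simp
    then show ?case
      using coeff_idealD[OF x, of k] left_ideal_diff[OF I] \<open>(\<Sum>i\<in>{1..k}. _ i) \<in> I\<close> by metis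
  qed
qed

section \<open>Summable families and ideals closed under h-adic limits\<close>

definition hsummable :: "('s \<Rightarrow> 'a::comm_monoid_add fps) \<Rightarrow> bool" where
  "hsummable x \<longleftrightarrow> (\<forall>m. finite {s. fps_nth (x s) m \<noteq> 0})"

lemma hsummableE:
  assumes "hsummable x"
  obtains A where "finite A" "\<And>s j. s \<notin> A \<Longrightarrow> j \<le> m \<Longrightarrow> fps_nth (x s) j = 0"
proof
  show "finite (\<Union>j\<le>m. {s. fps_nth (x s) j \<noteq> 0})"
    using assms by (auto simp: hsummable_def)
qed auto

lemma hsum_nth_finite:
  assumes "finite A" "\<And>s. s \<notin> A \<Longrightarrow> fps_nth (x s) j = 0"
  shows "fps_nth (hsum x) j = (\<Sum>s\<in>A. fps_nth (x s) j)"
  unfolding hsum_def fps_nth_Abs_fps using assms by (intro Sum_any.expand_superset) auto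

lemma hsum_finite:
  assumes "finite A" "\<And>s. s \<notin> A \<Longrightarrow> x s = 0"
  shows "hsum x = sum x A"
proof (rule fps_ext)
  fix j show "fps_nth (hsum x) j = fps_nth (sum x A) j"
    unfolding fps_sum_nth using assms by (intro hsum_nth_finite) auto
qed

lemma hsummable_finite: "finite A \<Longrightarrow> (\<And>s. s \<notin> A \<Longrightarrow> x s = 0) \<Longrightarrow> hsummable x"
  unfolding hsummable_def by (metis (mono_tags, lifting) finite_subset fps_zero_nth mem_Collect_eq subsetI)

lemma hsummable_add:
  assumes x: "hsummable x" and y: "hsummable y"
  shows "hsummable (\<lambda>s. x s + y s)"
    and "hsum (\<lambda>s. x s + y s) = hsum x + hsum y"
proof -
  have *: "\<exists>A. finite A \<and> (\<forall>s j. s \<notin> A \<longrightarrow> j \<le> m \<longrightarrow> fps_nth (x s) j = 0 \<and> fps_nth (y s) j = 0)" for m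
  proof -
    obtain A where "finite A" "\<And>s j. s \<notin> A \<Longrightarrow> j \<le> m \<Longrightarrow> fps_nth (x s) j = 0"
      using hsummableE[OF x] by metis
    moreover obtain B where "finite B" "\<And>s j. s \<notin> B \<Longrightarrow> j \<le> m \<Longrightarrow> fps_nth (y s) j = 0"
      using hsummableE[OF y] by metis
    ultimately show ?thesis by (intro exI[of _ "A \<union> B"]) auto
  qed
  show "hsummable (\<lambda>s. x s + y s)"
    unfolding hsummable_def
  proof
    fix m
    obtain A where "finite A" "\<And>s j. s \<notin> A \<Longrightarrow> j \<le> m \<Longrightarrow> fps_nth (x s) j = 0 \<and> fps_nth (y s) j = 0"
      using *[of m] by metis
    then show "finite {s. fps_nth (x s + y s) m \<noteq> 0}"
      by (elim finite_subset[rotated]) force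
  qed
  show "hsum (\<lambda>s. x s + y s) = hsum x + hsum y"
  proof (rule fps_ext)
    fix m
    obtain A where A: "finite A" "\<And>s j. s \<notin> A \<Longrightarrow> j \<le> m \<Longrightarrow> fps_nth (x s) j = 0 \<and> fps_nth (y s) j = 0"
      using *[of m] by metis
    then show "fps_nth (hsum (\<lambda>s. x s + y s)) m = fps_nth (hsum x + hsum y) m"
      by (simp add: hsum_nth_finite[OF A(1)] sum.distrib)
  qed
qed

text \<open>Coefficient \<open>m\<close> of a product involves only coefficients up to
  \<open>m\<close>, so one finite index set from \<open>hsummableE\<close> serves for the family and
  for its multiples.\<close>

lemma hsum_mult:
  fixes x :: "'s \<Rightarrow> 'a::ring_1 fps"
  assumes x: "hsummable x"
  shows hsummable_mult_left: "hsummable (\<lambda>s. c * x s)"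
    and hsum_mult_left: "hsum (\<lambda>s. c * x s) = c * hsum x"
    and hsummable_mult_right: "hsummable (\<lambda>s. x s * c)"
    and hsum_mult_right: "hsum (\<lambda>s. x s * c) = hsum x * c"
proof -
  have *: "finite {s. fps_nth (c * x s) m \<noteq> 0} \<and> finite {s. fps_nth (x s * c) m \<noteq> 0} \<and>
    fps_nth (hsum (\<lambda>s. c * x s)) m = fps_nth (c * hsum x) m \<and>
    fps_nth (hsum (\<lambda>s. x s * c)) m = fps_nth (hsum x * c) m" for m
  proof -
    obtain A where A: "finite A" "\<And>s j. s \<notin> A \<Longrightarrow> j \<le> m \<Longrightarrow> fps_nth (x s) j = 0"
      using hsummableE[OF x] by metis
    have hx: "fps_nth (hsum x) j = (\<Sum>s\<in>A. fps_nth (x s) j)" if "j \<le> m" for j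
      using A that by (intro hsum_nth_finite) auto
    have 0: "fps_nth (c * x s) m = 0" "fps_nth (x s * c) m = 0" if "s \<notin> A" for s
      using A(2)[OF that] by (simp_all add: fps_mult_nth)
    have "finite {s. fps_nth (c * x s) m \<noteq> 0}" "finite {s. fps_nth (x s * c) m \<noteq> 0}"
      by (rule finite_subset[OF _ A(1)]; use 0 in auto)+
    moreover have "fps_nth (hsum (\<lambda>s. c * x s)) m = (\<Sum>s\<in>A. \<Sum>i=0..m. fps_nth c i * fps_nth (x s) (m - i))"
      by (subst hsum_nth_finite[OF A(1) 0(1)]) (simp_all add: fps_mult_nth)
    moreover have "fps_nth (hsum (\<lambda>s. x s * c)) m = (\<Sum>s\<in>A. \<Sum>i=0..m. fps_nth (x s) i * fps_nth c (m - i))"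
      by (subst hsum_nth_finite[OF A(1) 0(2)]) (simp_all add: fps_mult_nth)
    moreover have "fps_nth (c * hsum x) m = (\<Sum>s\<in>A. \<Sum>i=0..m. fps_nth c i * fps_nth (x s) (m - i))"
      by (subst sum.swap) (simp add: fps_mult_nth hx sum_distrib_left)
    moreover have "fps_nth (hsum x * c) m = (\<Sum>s\<in>A. \<Sum>i=0..m. fps_nth (x s) i * fps_nth c (m - i))"
      by (subst sum.swap) (simp add: fps_mult_nth hx sum_distrib_right)
    ultimately show ?thesis by simp
  qed
  then show "hsummable (\<lambda>s. c * x s)" "hsummable (\<lambda>s. x s * c)"
    by (simp_all add: hsummable_def)
  from * show "hsum (\<lambda>s. c * x s) = c * hsum x" "hsum (\<lambda>s. x s * c) = hsum x * c"
    by (simp_all add: fps_eq_iff)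
qed

lemma hsum_minus:
  fixes x :: "'s \<Rightarrow> 'a::ring_1 fps"
  assumes x: "hsummable x"
  shows "hsummable (\<lambda>s. - x s)" "hsum (\<lambda>s. - x s) = - hsum x"
  using hsummable_mult_left[OF x, of "- 1"] hsum_mult_left[OF x, of "- 1"] by simp_all

lemma hsum_diff:
  fixes x :: "'s \<Rightarrow> 'a::ring_1 fps"
  assumes x: "hsummable x" and y: "hsummable y"
  shows "hsummable (\<lambda>s. x s - y s)" "hsum (\<lambda>s. x s - y s) = hsum x - hsum y"
  using hsummable_add[OF x hsum_minus(1)[OF y]] by (simp_all add: hsum_minus(2)[OF y])

lemma hsum_reindex_inj:
  assumes g: "inj g" and x: "\<And>s. s \<notin> range g \<Longrightarrow> x s = 0"
  shows "hsum (\<lambda>s. x (g s)) = hsum x" and "hsummable (\<lambda>s. x (g s)) \<longleftrightarrow> hsummable x"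
proof -
  have *: "{s. fps_nth (x s) m \<noteq> 0} = g ` {s. fps_nth (x (g s)) m \<noteq> 0}" for m
    using x by (force simp: image_iff)
  have inj: "inj_on g B" for B
    using g by (metis inj_on_subset subset_UNIV)
  show "hsummable (\<lambda>s. x (g s)) \<longleftrightarrow> hsummable x"
    unfolding hsummable_def * by (simp add: finite_image_iff[OF inj])
  have "fps_nth (hsum (\<lambda>s. x (g s))) m = fps_nth (hsum x) m" for m
    by (simp add: hsum_def Sum_any.expand_set * sum.reindex[OF inj])
  then show "hsum (\<lambda>s. x (g s)) = hsum x" by (simp add: fps_eq_iff)
qed

lemma hsum_reindex:
  assumes "bij g"
  shows "hsum (\<lambda>s. x (g s)) = hsum x" and "hsummable (\<lambda>s. x (g s)) \<longleftrightarrow> hsummable x"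
  using hsum_reindex_inj[of g x] assms by (auto simp: bij_def)

text \<open>Congruence modulo \<open>I\<close> to the precision \<open>h^m\<close>. Membership in an
  \<open>h\<close>-closed ideal is proved by establishing it in \<open>mod_h I m\<close> for every
  \<open>m\<close>.\<close>

definition mod_h :: "'a::ring_1 fps set \<Rightarrow> nat \<Rightarrow> 'a fps set" where
  "mod_h I m = {y + hbar ^ m * z | y z. y \<in> I}"

lemma left_ideal_mod_h:
  assumes "left_ideal I"
  shows "left_ideal (mod_h I m)"
  unfolding left_ideal_def[of "mod_h I m"]
proof (intro conjI ballI allI)
  have "0 = 0 + hbar ^ m * (0 :: 'a fps)" by simp
  then show "0 \<in> mod_h I m" using left_ideal_0[OF assms] unfolding mod_h_def by blast
next
  fix x y assume "x \<in> mod_h I m" "y \<in> mod_h I m"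
  then obtain a b c d where "a \<in> I" "c \<in> I" "x = a + hbar ^ m * b" "y = c + hbar ^ m * d"
    by (auto simp: mod_h_def)
  then have "x - y = (a - c) + hbar ^ m * (b - d)" "a - c \<in> I"
    by (simp_all add: algebra_simps left_ideal_diff[OF assms])
  then show "x - y \<in> mod_h I m" by (auto simp: mod_h_def)
next
  fix x r assume "x \<in> mod_h I m"
  then obtain a b where "a \<in> I" "x = a + hbar ^ m * b" by (auto simp: mod_h_def)
  then have "r * x = r * a + hbar ^ m * (r * b)" "r * a \<in> I"
    by (simp_all add: distrib_left left_ideal_mult[OF assms] central_left_commute[OF central_power[OF central_fps_X]])
  then show "r * x \<in> mod_h I m" by (auto simp: mod_h_def)
qed

lemma mod_h_0: "left_ideal I \<Longrightarrow> x \<in> mod_h I 0"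
  using left_ideal_0[of I] by (auto simp: mod_h_def intro: exI[of _ 0])

lemma mod_h_subset: "I \<subseteq> mod_h I m"
proof
  fix x assume "x \<in> I"
  then have "x = x + hbar ^ m * 0" "x \<in> I" by auto
  then show "x \<in> mod_h I m" unfolding mod_h_def by blast
qed

lemma mod_h_power: "left_ideal I \<Longrightarrow> m \<le> m' \<Longrightarrow> hbar ^ m' * x \<in> mod_h I m"
proof -
  assume "left_ideal I" "m \<le> m'"
  then have "hbar ^ m' * x = 0 + hbar ^ m * (hbar ^ (m' - m) * x)" "0 \<in> I"
    by (simp_all add: mult.assoc[symmetric] power_add[symmetric] left_ideal_0)
  then show ?thesis unfolding mod_h_def by blast
qed

lemma mod_h_Suc: "left_ideal I \<Longrightarrow> x \<in> mod_h I m \<Longrightarrow> hbar * x \<in> mod_h I (Suc m)"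
proof -
  assume I: "left_ideal I" and "x \<in> mod_h I m"
  then obtain a b where "a \<in> I" "x = a + hbar ^ m * b" by (auto simp: mod_h_def)
  then have "hbar * x = hbar * a + hbar ^ Suc m * b" "hbar * a \<in> I"
    by (simp_all add: distrib_left left_ideal_mult[OF I] mult.assoc del: fps_X_mult_nth)
  then show ?thesis unfolding mod_h_def by blast
qed

lemma h_closedD: "h_closed I \<Longrightarrow> (\<And>m. x \<in> mod_h I m) \<Longrightarrow> x \<in> I"
  unfolding h_closed_def mod_h_def by blast

lemma fps_low_coeffs_zero: "(\<And>j. j < m \<Longrightarrow> fps_nth x j = 0) \<Longrightarrow> \<exists>z. x = hbar ^ m * (z :: 'a::ring_1 fps)"
  by (rule exI[of _ "Abs_fps (\<lambda>j. fps_nth x (j + m))"]) (auto simp: fps_eq_iff fps_X_power_mult_nth)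

text \<open>Outside a finite index set the members vanish below order \<open>m\<close>, so the tail
  of the sum is a multiple of \<open>hbar ^ m\<close>.\<close>

lemma hsum_mod_h:
  assumes I: "left_ideal I" and x: "hsummable x" and xI: "\<And>s. x s \<in> mod_h I m"
  shows "hsum x \<in> mod_h I m"
proof -
  obtain A where A: "finite A" "\<And>s j. s \<notin> A \<Longrightarrow> j \<le> m \<Longrightarrow> fps_nth (x s) j = 0"
    using hsummableE[OF x] by metis
  have "fps_nth (hsum x - sum x A) j = 0" if "j < m" for j
    using A that by (simp add: fps_sum_nth hsum_nth_finite[OF A(1)])
  then obtain z where "hsum x - sum x A = hbar ^ m * z"
    using fps_low_coeffs_zero by blast
  then have "hsum x = sum x A + hbar ^ m * z" by (simp add: algebra_simps)
  moreover have "sum x A \<in> mod_h I m"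
    by (intro left_ideal_sum left_ideal_mod_h I xI)
  ultimately show ?thesis
    using left_ideal_add[OF left_ideal_mod_h[OF I]] mod_h_power[OF I order_refl] by metis
qed

lemma hsum_in_closed:
  assumes "left_ideal I" "h_closed I" "hsummable x" "\<And>s. x s \<in> I"
  shows "hsum x \<in> I"
  using assms by (metis h_closedD hsum_mod_h mod_h_subset subsetD)

lemma h_closed_Inter: "(\<And>I. I \<in> \<I> \<Longrightarrow> h_closed I) \<Longrightarrow> h_closed (\<Inter>\<I>)"
  unfolding h_closed_def by (meson Inter_iff)

lemma h_closed_yd_ideal: "h_closed yd_ideal"
  unfolding yd_ideal_def by (rule h_closed_Inter) simp

lemma h_saturated_yd_ideal: "h_saturated yd_ideal"
  unfolding yd_ideal_def h_saturated_def by blast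

lemma yd_relators_subset: "yd_relators \<subseteq> yd_ideal"
  unfolding yd_ideal_def by blast

lemma left_ideal_yd_ideal: "left_ideal yd_ideal"
  by (rule two_sided_left[OF two_sided_ideal_yd_ideal])

lemma yd_ideal_divide_h_power: "hbar ^ m * x \<in> yd_ideal \<Longrightarrow> x \<in> yd_ideal"
proof (induction m)
  case (Suc m)
  then have "hbar * (hbar ^ m * x) \<in> yd_ideal" by (simp only: power_Suc mult.assoc)
  then show ?case using h_saturated_yd_ideal Suc.IH unfolding h_saturated_def by blast
qed simp


section \<open>Scalars\<close>

lemma scal_nth [simp]: "fps_nth (scal s) m = Poly_Mapping.single 0 (fps_nth s m)"
  by (simp add: scal_def)

lemma scal_0 [simp]: "scal 0 = 0" and scal_1 [simp]: "scal 1 = 1"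
  by (auto simp: fps_eq_iff)

lemma scal_hbar: "scal hbar = hbar"
  by (auto simp: fps_eq_iff fps_X_def)

lemma scal_add: "scal (a + b) = scal a + scal b"
  by (simp add: fps_eq_iff single_add)

lemma scal_minus: "scal (- a) = - scal a"
  by (simp add: fps_eq_iff single_uminus)

lemma scal_diff: "scal (a - b) = scal a - scal b"
  by (simp add: fps_eq_iff single_diff)

lemma scal_sum: "scal (sum f A) = (\<Sum>x\<in>A. scal (f x))"
  by (induction A rule: infinite_finite_induct) (simp_all add: scal_add)

lemma single_sum: "Poly_Mapping.single k (sum f A) = (\<Sum>x\<in>A. Poly_Mapping.single k (f x))"
  by (induction A rule: infinite_finite_induct) (simp_all add: single_add)

lemma scal_mult: "scal (a * b) = scal a * scal b"
  by (simp add: fps_eq_iff fps_mult_nth mult_single single_sum)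

lemma scal_power: "scal (a ^ k) = scal a ^ k"
  by (induction k) (simp_all add: scal_mult)

lemma scal_of_nat: "scal (of_nat k) = of_nat k"
  by (induction k) (simp_all add: scal_add)

lemma scal_of_int: "scal (of_int k) = of_int k"
  by (cases k) (simp_all add: scal_of_nat scal_diff scal_minus)

lemma central_single_0: "central (Poly_Mapping.single (0 :: 'n gen_word) (c :: complex))"
proof -
  have "Poly_Mapping.single 0 c * x = x * Poly_Mapping.single 0 c" for x :: "'n gen_word \<Rightarrow>\<^sub>0 complex"
  proof -
    have x: "x = (\<Sum>k\<in>Poly_Mapping.keys x. Poly_Mapping.single k (Poly_Mapping.lookup x k))"
      by (rule poly_mapping_eqI) (simp add: lookup_sum lookup_single when_def in_keys_iff)
    show ?thesis
      by (subst (1 2) x) (simp add: sum_distrib_left sum_distrib_right mult_single mult.commute)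
  qed
  then show ?thesis by (simp add: central_def)
qed

lemma central_scal [simp]: "central (scal s)"
  by (rule central_fpsI) (simp add: central_single_0)

lemma scal_half: "scal (fps_const (1 / 2)) + scal (fps_const (1 / 2)) = 1"
  by (simp add: scal_add[symmetric])

lemma scal_inverse:
  "c \<noteq> 0 \<Longrightarrow> scal (fps_const (inverse c)) * (scal (fps_const c) * x) = x"
  by (simp add: mult.assoc[symmetric] scal_mult[symmetric])

lemma scal_fps_const_of_nat: "scal (fps_const (of_nat k)) = of_nat k"
  by (simp add: scal_of_nat fps_of_nat)

text \<open>The inverse of \<open>k\<close> is a complex scalar. Numbers of permutations are
  cancelled with this.\<close>

lemma left_ideal_of_nat_cancel:
  fixes I :: "'n free_alg set"
  assumes I: "left_ideal I" and x: "of_nat k * x \<in> I" and k: "k > 0"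
  shows "x \<in> I"
proof -
  have "scal (fps_const (inverse (of_nat k))) * (of_nat k * x) \<in> I"
    by (rule left_ideal_mult[OF I x])
  then show ?thesis
    using k scal_inverse[of "of_nat k" x] by (simp add: scal_fps_const_of_nat)
qed

section \<open>Coefficients of the \<open>R\<close>-matrix\<close>

text \<open>\<open>R_coeff\<close> with a scalar series \<open>g\<close> in place of a matrix entry:
  the coefficient of \<open>u^p v^q\<close> in \<open>g(u - v - a)\<close>. Since \<open>R\<close>
  is a combination of the identity and \<open>P\<close>, only two such series occur.\<close>

definition rcoeff :: "'n free_alg \<Rightarrow> int \<Rightarrow> int \<Rightarrow> complex fps fps \<Rightarrow> 'n free_alg" where
  "rcoeff a p q g =
     (if p \<le> 0 \<and> q \<ge> 0
      then fps_nth (fps_nth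
             (Abs_fps (\<lambda>k. fps_const (scal (fps_nth g k))) oo inv_lin (fps_X + fps_const a))
             (nat (- p))) (nat q)
      else 0)"

lemma R_coeff_eq_rcoeff: "R_coeff a p q I J = rcoeff a p q (R_mat I J)"
  by (simp add: R_coeff_def rcoeff_def)

lemma rcoeff_eq_0: "\<not> (p \<le> 0 \<and> q \<ge> 0) \<Longrightarrow> rcoeff a p q g = 0"
  by (auto simp: rcoeff_def)

lemma rcoeff_nat:
  "rcoeff a (- int P) (int Q) g
    = (\<Sum>i\<le>P. scal (fps_nth g i) * (of_nat (invc i P * ((P - i) choose Q)) * a ^ (P - i - Q)))"
  by (simp add: rcoeff_def lift_compose_inv_lin_nth)

lemma exponent_cases:
  fixes p q :: int
  obtains "\<not> (p \<le> 0 \<and> q \<ge> 0)" | P Q where "p = - int P" "q = int Q"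
proof (cases "p \<le> 0 \<and> q \<ge> 0")
  case True
  then show ?thesis using that(2)[of "nat (- p)" "nat q"] by simp
qed (use that(1) in blast)

lemma rcoeff_0 [simp]: "rcoeff a p q 0 = 0"
  by (cases rule: exponent_cases[of p q]) (auto simp: rcoeff_nat rcoeff_eq_0)

lemma rcoeff_add: "rcoeff a p q (g + g') = rcoeff a p q g + rcoeff a p q g'"
  by (cases rule: exponent_cases[of p q])
    (auto simp: rcoeff_nat rcoeff_eq_0 scal_add distrib_right sum.distrib)

lemma rcoeff_central: "central a \<Longrightarrow> central (rcoeff a p q g)"
proof (cases rule: exponent_cases[of p q])
  case (2 P Q)
  assume a: "central a"
  have "central (\<Sum>i\<in>A. scal (fps_nth g i) * (of_nat (invc i P * ((P - i) choose Q)) * a ^ (P - i - Q)))" for A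
    by (induction A rule: infinite_finite_induct) (use a in \<open>auto simp del: of_nat_mult\<close>)
  then show ?thesis using 2 by (simp add: rcoeff_nat del: of_nat_mult)
qed (simp add: rcoeff_eq_0)

text \<open>The series in front of \<open>P\<close> in \<open>R(u)\<close>.\<close>

abbreviation f_hP :: "nat \<Rightarrow> complex fps fps" where
  "f_hP n \<equiv> fps_const hbar * fps_X * f_series n"

lemma R_coeff_split:
  "R_coeff a p q (I :: nat \<Rightarrow> 'n::finite) J = rcoeff a p q (f_series CARD('n)) * tid I J
     + rcoeff a p q (f_hP CARD('n)) * perm_op (Transposition.transpose 1 2) I J"
proof -
  have "R_mat I J = (if I = J then f_series CARD('n) else 0)
    + (if I = J \<circ> inv (Transposition.transpose 1 2) then f_hP CARD('n) else 0)"
    by (simp add: R_mat_def R_bar_def tid_def perm_op_def distrib_left mult_ac)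
  then show ?thesis
    by (simp add: R_coeff_eq_rcoeff rcoeff_add tid_def perm_op_def)
qed

text \<open>A series in \<open>h u^(-1)\<close> with complex coefficients. High negative powers of
  \<open>u\<close> are thus tied to high powers of \<open>h\<close>, on which the convergence
  arguments below rely.\<close>

definition homogeneous :: "(nat \<Rightarrow> complex) \<Rightarrow> complex fps fps \<Rightarrow> bool" where
  "homogeneous \<gamma> g \<longleftrightarrow> (\<forall>i. fps_nth g i = fps_const (\<gamma> i) * hbar ^ i)"

lemma homogeneous_f_series: "n > 0 \<Longrightarrow> homogeneous (phi_coeff n) (f_series n)"
  by (simp add: homogeneous_def f_series_eq)

lemma homogeneous_f_hP:
  "n > 0 \<Longrightarrow> homogeneous (\<lambda>i. if i = 0 then 0 else phi_coeff n (i - 1)) (f_hP n)"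
  unfolding homogeneous_def
proof
  fix i assume "n > 0"
  then show "fps_nth (f_hP n) i = fps_const (if i = 0 then 0 else phi_coeff n (i - 1)) * hbar ^ i"
    by (cases i) (simp_all add: f_series_eq mult_ac)
qed

text \<open>What remains of the coefficient of \<open>u^(-P) v^Q\<close> in
  \<open>g(u - v - h b)\<close> when the factor \<open>h^(P - Q)\<close> is taken out.\<close>

definition tcoeff :: "(nat \<Rightarrow> complex) \<Rightarrow> 'n free_alg \<Rightarrow> nat \<Rightarrow> nat \<Rightarrow> 'n free_alg" where
  "tcoeff \<gamma> b P Q = (\<Sum>i\<le>P. scal (fps_const (\<gamma> i)) * (of_nat (invc i P * ((P - i) choose Q)) * b ^ (P - i - Q)))"

lemma central_hbar_power [simp]: "central (hbar ^ k :: 'a::ring_1 fps)"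
  by simp

lemma hbar_mult_power: "(hbar * b) ^ k = hbar ^ k * (b ^ k :: 'a::ring_1 fps)"
  by (induction k) (simp_all add: mult.assoc central_left_commute[OF central_hbar_power] del: fps_X_mult_nth)

text \<open>Summand \<open>i\<close> receives \<open>h^i\<close> from \<open>g\<close> and
  \<open>h^(P - i - Q)\<close> from the power of \<open>h b\<close>. Where the subtraction
  truncates, the binomial coefficient vanishes on both sides.\<close>

lemma rcoeff_homogeneous:
  assumes g: "homogeneous \<gamma> g"
  shows "rcoeff (hbar * b) (- int P) (int Q) g = hbar ^ (P - Q) * tcoeff \<gamma> b P Q"
  unfolding rcoeff_nat tcoeff_def sum_distrib_left
proof (rule sum.cong[OF refl])
  fix i assume "i \<in> {..P}"
  show "scal (fps_nth g i) * (of_nat (invc i P * ((P - i) choose Q)) * (hbar * b) ^ (P - i - Q)) =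
    hbar ^ (P - Q) * (scal (fps_const (\<gamma> i)) * (of_nat (invc i P * ((P - i) choose Q)) * b ^ (P - i - Q)))"
  proof (cases "P - i < Q")
    case False
    with \<open>i \<in> {..P}\<close> have 1: "P - Q = i + (P - i - Q)" by simp
    have 2: "scal (fps_nth g i) = hbar ^ i * scal (fps_const (\<gamma> i))"
      using g by (simp add: homogeneous_def scal_mult scal_power scal_hbar centralD)
    show ?thesis
      unfolding 1 2
      by (simp only: hbar_mult_power mult.assoc power_add
          central_left_commute[OF central_hbar_power, of "of_nat _"]
          central_left_commute[OF central_hbar_power, of "scal _"])
  qed (simp add: binomial_eq_0)
qed

text \<open>For \<open>i >= 1\<close> the degree in \<open>v\<close> is at most
  \<open>P - i < Q\<close>, and the constant term of \<open>g\<close> contributes only to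
  \<open>u^0 v^0\<close>. So apart from \<open>(0, 0)\<close> only exponents with
  \<open>Q < P\<close> occur.\<close>

lemma rcoeff_homogeneous_0:
  assumes g: "homogeneous \<gamma> g" and "P \<le> Q" "(P, Q) \<noteq> (0, 0)"
  shows "rcoeff a (- int P) (int Q) g = 0"
  unfolding rcoeff_nat
proof (rule sum.neutral, rule ballI)
  fix i assume "i \<in> {..P}"
  then show "scal (fps_nth g i) * (of_nat (invc i P * ((P - i) choose Q)) * a ^ (P - i - Q)) = 0"
    using assms(2,3) by (cases "i = 0"; cases "P = 0") (auto simp: binomial_eq_0)
qed

lemma rcoeff_0_0: "rcoeff a 0 0 g = scal (fps_nth g 0)"
  using rcoeff_nat[of a 0 0 g] by simp

lemma f_series_nth_0: "n > 0 \<Longrightarrow> fps_nth (f_series n) 0 = 1"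
  using normalizing_phi[of n] f_series_eq[of n] by (simp add: normalizing_def)


section \<open>The defining relations in components\<close>

lemma midx_finite [simp]: "finite (midx k :: (nat \<Rightarrow> 'n::finite) set)"
  by (simp add: midx_def finite_PiE)

lemma midx_fun_upd: "I \<in> midx k \<Longrightarrow> a \<in> {1..k} \<Longrightarrow> I(a := x) \<in> midx k"
  unfolding midx_def by (auto simp: PiE_def extensional_def)

lemma midx_comp: "I \<in> midx k \<Longrightarrow> \<sigma> permutes {1..k} \<Longrightarrow> I \<circ> \<sigma> \<in> midx k"
  unfolding midx_def by (auto simp: PiE_def extensional_def permutes_not_in)

lemma midx_eqI: "I \<in> midx k \<Longrightarrow> J \<in> midx k \<Longrightarrow> (\<And>a. a \<in> {1..k} \<Longrightarrow> I a = J a) \<Longrightarrow> I = J"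
  unfolding midx_def by (blast intro: PiE_ext)

lemma tmul_place:
  fixes B :: "('n::finite, 'a::semiring_0) tmat"
  assumes I: "I \<in> midx k" and a: "a \<in> {1..k}"
  shows "tmul k (place k a M) B I J = (\<Sum>x\<in>UNIV. M (I a) x * B (I(a := x)) J)"
proof -
  have "tmul k (place k a M) B I J = (\<Sum>K\<in>(\<lambda>x. I(a := x)) ` UNIV. place k a M I K * B K J)"
    unfolding tmul_def
  proof (rule sum.mono_neutral_right)
    show "(\<lambda>x. I(a := x)) ` UNIV \<subseteq> midx k" using midx_fun_upd[OF I a] by auto
    show "\<forall>K\<in>midx k - (\<lambda>x. I(a := x)) ` UNIV. place k a M I K * B K J = 0"
    proof
      fix K assume K: "K \<in> midx k - (\<lambda>x. I(a := x)) ` UNIV"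
      have "\<not> (\<forall>b\<in>{1..k} - {a}. I b = K b)"
      proof
        assume "\<forall>b\<in>{1..k} - {a}. I b = K b"
        then have "K = I(a := K a)"
          by (intro midx_eqI[where k = k]) (use K midx_fun_upd[OF I a] in auto)
        with K show False by blast
      qed
      then have "place k a M I K = 0" unfolding place_def by (rule if_not_P)
      then show "place k a M I K * B K J = 0" by simp
    qed
  qed simp
  also have "\<dots> = (\<Sum>x\<in>UNIV. M (I a) x * B (I(a := x)) J)"
    by (subst sum.reindex) (auto simp: inj_on_def place_def dest: fun_upd_eqD)
  finally show ?thesis .
qed

lemma perm_op_iff: "\<sigma> permutes S \<Longrightarrow> I = K \<circ> inv \<sigma> \<longleftrightarrow> K = I \<circ> \<sigma>"
  by (auto simp: comp_assoc permutes_inv_o)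

lemma tmul_delta_left:
  assumes "K \<in> midx k" "\<And>I'. I' \<in> midx k \<Longrightarrow> I' \<noteq> K \<Longrightarrow> A I I' = 0"
  shows "tmul k A B I J = A I K * B K (J :: nat \<Rightarrow> 'n::finite)"
  unfolding tmul_def by (subst sum.remove[OF _ assms(1)]) (auto simp: assms(2) intro!: sum.neutral)

lemma tmul_delta_right:
  assumes "K \<in> midx k" "\<And>I'. I' \<in> midx k \<Longrightarrow> I' \<noteq> K \<Longrightarrow> A I' J = 0"
  shows "tmul k B A I (J :: nat \<Rightarrow> 'n::finite) = B I K * A K J"
  unfolding tmul_def by (subst sum.remove[OF _ assms(1)]) (auto simp: assms(2) intro!: sum.neutral)

lemma tmul_id_perm_left:
  fixes B :: "('n::finite, 'a::ring_1) tmat"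
  assumes I: "I \<in> midx k" and \<sigma>: "\<sigma> permutes {1..k}"
  shows "tmul k (\<lambda>I K. c * tid I K + d * perm_op \<sigma> I K) B I J = c * B I J + d * B (I \<circ> \<sigma>) J"
proof -
  have "tmul k (\<lambda>I K. c * tid I K + d * perm_op \<sigma> I K) B I J
    = tmul k (\<lambda>I K. c * tid I K) B I J + tmul k (\<lambda>I K. d * perm_op \<sigma> I K) B I J"
    by (simp add: tmul_def distrib_right sum.distrib)
  also have "tmul k (\<lambda>I K. c * tid I K) B I J = c * B I J"
    using tmul_delta_left[OF I, of "\<lambda>I K. c * tid I K" I B J] by (simp add: tid_def)
  also have "tmul k (\<lambda>I K. d * perm_op \<sigma> I K) B I J = d * B (I \<circ> \<sigma>) J"
    using tmul_delta_left[OF midx_comp[OF I \<sigma>], of "\<lambda>I K. d * perm_op \<sigma> I K" I B J]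
    by (simp add: perm_op_def perm_op_iff[OF \<sigma>])
  finally show ?thesis .
qed

lemma tmul_id_perm_right:
  fixes B :: "('n::finite, 'a::ring_1) tmat"
  assumes J: "J \<in> midx k" and \<sigma>: "\<sigma> permutes {1..k}"
  shows "tmul k B (\<lambda>K J. c * tid K J + d * perm_op \<sigma> K J) I J = B I J * c + B I (J \<circ> inv \<sigma>) * d"
proof -
  have "tmul k B (\<lambda>I K. c * tid I K + d * perm_op \<sigma> I K) I J
    = tmul k B (\<lambda>I K. c * tid I K) I J + tmul k B (\<lambda>I K. d * perm_op \<sigma> I K) I J"
    by (simp add: tmul_def distrib_left sum.distrib)
  also have "tmul k B (\<lambda>I K. c * tid I K) I J = B I J * c"
    using tmul_delta_right[OF J, of "\<lambda>I K. c * tid I K" J B I] by (simp add: tid_def)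
  also have "tmul k B (\<lambda>I K. d * perm_op \<sigma> I K) I J = B I (J \<circ> inv \<sigma>) * d"
    using tmul_delta_right[OF midx_comp[OF J permutes_inv[OF \<sigma>]], of "\<lambda>I K. d * perm_op \<sigma> I K" J B I]
    by (simp add: perm_op_def)
  finally show ?thesis .
qed

lemma tmul_2_place:
  fixes X Y :: "'n::finite \<Rightarrow> 'n \<Rightarrow> 'a::ring_1"
  assumes I: "I \<in> midx 2"
  shows "tmul 2 (place 2 1 X) (place 2 2 Y) I J = X (I 1) (J 1) * Y (I 2) (J 2)"
    and "tmul 2 (place 2 2 Y) (place 2 1 X) I J = Y (I 2) (J 2) * X (I 1) (J 1)"
proof -
  have s: "{1..2} - {1} = {2 :: nat}" "{1..2} - {2} = {1 :: nat}"
    "{Suc 0..2} - {Suc 0} = {2 :: nat}" "{Suc 0..2} - {2} = {Suc 0}" by auto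
  have *: "(\<Sum>x\<in>UNIV. g x * (if x = b then t x else 0)) = g b * t b" for g t :: "'n \<Rightarrow> 'a" and b
    by (simp add: if_distrib[of "(*) _"] cong: if_cong)
  show "tmul 2 (place 2 1 X) (place 2 2 Y) I J = X (I 1) (J 1) * Y (I 2) (J 2)"
    using *[of "X (I 1)" "J 1" "\<lambda>_. Y (I 2) (J 2)"] by (simp add: tmul_place[OF I] place_def[of _ 2] s cong: if_cong)
  show "tmul 2 (place 2 2 Y) (place 2 1 X) I J = Y (I 2) (J 2) * X (I 1) (J 1)"
    using *[of "Y (I 2)" "J 2" "\<lambda>_. X (I 1) (J 1)"] by (simp add: tmul_place[OF I] place_def[of _ "Suc 0"] s cong: if_cong)
qed

text \<open>The summand \<open>(p, q)\<close> of the entry of \<open>R X_1 Y_2\<close> with row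
  indices \<open>i, k\<close> and column indices \<open>j, l\<close>, after splitting
  \<open>R\<close> into its identity part and its \<open>P\<close> part. Here \<open>P\<close>
  exchanges the row indices; in \<open>rel_right\<close> it stands on the right and exchanges the
  column indices.\<close>

definition rel_left :: "'n::finite free_alg \<Rightarrow> (int \<Rightarrow> 'n \<Rightarrow> 'n \<Rightarrow> 'n free_alg) \<Rightarrow>
    (int \<Rightarrow> 'n \<Rightarrow> 'n \<Rightarrow> 'n free_alg) \<Rightarrow> int \<Rightarrow> int \<Rightarrow> 'n \<Rightarrow> 'n \<Rightarrow> 'n \<Rightarrow> 'n \<Rightarrow> int \<times> int \<Rightarrow> 'n free_alg" where
  "rel_left y X Y a b i j k l = (\<lambda>(p, q).
     rcoeff y p q (f_series CARD('n)) * (X (a - p) i j * Y (b - q) k l)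
     + rcoeff y p q (f_hP CARD('n)) * (X (a - p) k j * Y (b - q) i l))"

definition rel_right :: "'n::finite free_alg \<Rightarrow> (int \<Rightarrow> 'n \<Rightarrow> 'n \<Rightarrow> 'n free_alg) \<Rightarrow>
    (int \<Rightarrow> 'n \<Rightarrow> 'n \<Rightarrow> 'n free_alg) \<Rightarrow> int \<Rightarrow> int \<Rightarrow> 'n \<Rightarrow> 'n \<Rightarrow> 'n \<Rightarrow> 'n \<Rightarrow> int \<times> int \<Rightarrow> 'n free_alg" where
  "rel_right y X Y a b i j k l = (\<lambda>(p, q).
     Y (b - q) k l * X (a - p) i j * rcoeff y p q (f_series CARD('n))
     + Y (b - q) k j * X (a - p) i l * rcoeff y p q (f_hP CARD('n)))"

lemma transpose_1_2_permutes: "Transposition.transpose 1 2 permutes {1..2::nat}"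
  by (rule permutes_swap_id) auto

lemma RXY_YXR_components:
  fixes i j k l :: "'n::finite"
  obtains I J where "I \<in> midx 2" "J \<in> midx 2"
    "\<And>y X Y a b. RXY y X Y a b I J = hsum (rel_left y X Y a b i j k l)"
    "\<And>y X Y a b. YXR y X Y a b I J = hsum (rel_right y X Y a b i j k l)"
proof
  define I where "I = (\<lambda>a::nat. if a = 1 then i else if a = 2 then k else undefined)"
  define J where "J = (\<lambda>a::nat. if a = 1 then j else if a = 2 then l else undefined)"
  let ?\<tau> = "Transposition.transpose 1 (2::nat)"
  show I: "I \<in> midx 2" and J: "J \<in> midx 2"
    by (auto simp: midx_def I_def J_def PiE_def extensional_def)
  have R: "R_coeff y p q = (\<lambda>(I :: nat \<Rightarrow> 'n) K. rcoeff y p q (f_series CARD('n)) * tid I K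
     + rcoeff y p q (f_hP CARD('n)) * perm_op ?\<tau> I K)" for y p q
    by (intro ext) (rule R_coeff_split)
  have val: "I 1 = i" "I 2 = k" "J 1 = j" "J 2 = l" "(I \<circ> ?\<tau>) 1 = k" "(I \<circ> ?\<tau>) 2 = i"
    "(J \<circ> inv ?\<tau>) 1 = l" "(J \<circ> inv ?\<tau>) 2 = j"
    by (simp_all add: I_def J_def)
  show "RXY y X Y a b I J = hsum (rel_left y X Y a b i j k l)" for y X Y a b
    unfolding RXY_def rel_left_def R
    by (simp only: tmul_id_perm_left[OF I transpose_1_2_permutes] tmul_2_place[OF I]
        tmul_2_place[OF midx_comp[OF I transpose_1_2_permutes]] val)
  show "YXR y X Y a b I J = hsum (rel_right y X Y a b i j k l)" for y X Y a b
    unfolding YXR_def rel_right_def R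
    by (simp only: tmul_id_perm_right[OF J transpose_1_2_permutes] tmul_2_place[OF I] val)
qed

lemma plus_plus_ideal: "hsum (rel_left 0 L_plus L_plus a b i j k l) - hsum (rel_right 0 L_plus L_plus a b i j k l) \<in> yd_ideal"
  and minus_minus_ideal: "hsum (rel_left 0 L_minus L_minus a b i j k l) - hsum (rel_right 0 L_minus L_minus a b i j k l) \<in> yd_ideal"
  and plus_minus_ideal: "hsum (rel_left half_hc L_plus L_minus a b i j k l)
    - hsum (rel_right (- half_hc) L_plus L_minus a b i j k l) \<in> yd_ideal"
proof -
  obtain I J where *: "I \<in> midx 2" "J \<in> midx 2"
    "\<And>y X Y a b. RXY y X Y a b I J = hsum (rel_left y X Y a b i j k l)"
    "\<And>y X Y a b. YXR y X Y a b I J = hsum (rel_right y X Y a b i j k l)"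
    by (rule RXY_YXR_components[where i = i and j = j and k = k and l = l]) (rule that)
  show "hsum (rel_left 0 L_plus L_plus a b i j k l) - hsum (rel_right 0 L_plus L_plus a b i j k l) \<in> yd_ideal"
    "hsum (rel_left 0 L_minus L_minus a b i j k l) - hsum (rel_right 0 L_minus L_minus a b i j k l) \<in> yd_ideal"
    "hsum (rel_left half_hc L_plus L_minus a b i j k l)
      - hsum (rel_right (- half_hc) L_plus L_minus a b i j k l) \<in> yd_ideal"
    by (rule subsetD[OF yd_relators_subset yd_relators.plus_plus[OF *(1,2)], unfolded *(3,4)]
        subsetD[OF yd_relators_subset yd_relators.minus_minus[OF *(1,2)], unfolded *(3,4)]
        subsetD[OF yd_relators_subset yd_relators.plus_minus[OF *(1,2)], unfolded *(3,4)])+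
qed

text \<open>Generators enter \<open>L\<close> with a factor \<open>h\<close>, so the relators give
  \<open>h\<close> times this commutator up to sign; saturation removes the factor.\<close>

lemma c_free_comm: "l_free i j r * c_free - c_free * l_free i j r \<in> yd_ideal"
proof -
  have "hbar * (l_free i j r * c_free - c_free * l_free i j r) \<in> yd_ideal"
  proof (cases "r \<ge> 0")
    case True
    have "L_plus (- r - 1) i j * c_free - c_free * L_plus (- r - 1) i j
      = - (hbar * (l_free i j r * c_free - c_free * l_free i j r))"
      using True by (simp add: L_plus_def mult.assoc right_diff_distrib
          central_left_commute[OF central_fps_X, of c_free])
    then show ?thesis
      using subsetD[OF yd_relators_subset yd_relators.c_plus[of "- r - 1" i j]]
        left_ideal_minus[OF left_ideal_yd_ideal] by fastforce
  next
    case False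
    have "L_minus (- r - 1) i j * c_free - c_free * L_minus (- r - 1) i j
      = hbar * (l_free i j r * c_free - c_free * l_free i j r)"
      using False by (simp add: L_minus_def mult.assoc right_diff_distrib distrib_left distrib_right
          central_left_commute[OF central_fps_X, of c_free])
    then show ?thesis
      using subsetD[OF yd_relators_subset yd_relators.c_minus[of "- r - 1" i j]] by simp
  qed
  then show ?thesis using yd_ideal_divide_h_power[of 1] by simp
qed

section \<open>The relations for \<open>L\<^sup>-\<close> without the normalizing series\<close>

lemma rcoeff_0_nat:
  "rcoeff 0 (- int P) (int Q) g = (if Q \<le> P then scal (fps_nth g (P - Q)) * of_nat (invc (P - Q) P) else 0)"
proof -
  let ?t = "\<lambda>i. scal (fps_nth g i) * (of_nat (invc i P * ((P - i) choose Q)) * 0 ^ (P - i - Q))"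
  have 0: "?t i = 0" if "i \<le> P" "Q \<le> P \<Longrightarrow> i \<noteq> P - Q" for i
  proof (cases "P - i < Q")
    case False
    with that have "P - i - Q > 0" by (cases "Q \<le> P") auto
    then show ?thesis by (simp add: power_0_left)
  qed (simp add: binomial_eq_0)
  show ?thesis
  proof (cases "Q \<le> P")
    case True
    have "(\<Sum>i\<le>P. ?t i) = ?t (P - Q)"
      by (subst sum.remove[of _ "P - Q"]) (use 0 in \<open>auto intro!: sum.neutral simp del: of_nat_mult\<close>)
    with True show ?thesis by (simp add: rcoeff_nat)
  next
    case False
    then show ?thesis unfolding rcoeff_nat using 0 by (auto intro!: sum.neutral simp del: of_nat_mult)
  qed
qed

text \<open>The coefficients of \<open>(u - v) g(u - v) = h f(u - v)\<close> for
  \<open>g(u) = h u^(-1) f(u)\<close>.\<close>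

lemma rcoeff_rec:
  "rcoeff 0 (p - 1) q (f_hP n) - rcoeff 0 p (q - 1) (f_hP n) = hbar * (rcoeff 0 p q (f_series n) :: 'a free_alg)"
proof (cases "q < 0 \<or> p > 0")
  case True
  \<comment> \<open>The only case inside the range of the expansion is \<open>p = 1\<close>; there
    the coefficient vanishes because \<open>f_hP\<close> has no constant term.\<close>
  have "rcoeff 0 (p - 1) q (f_hP n) = (0 :: 'a free_alg)"
  proof (cases "p = 1 \<and> q \<ge> 0")
    case True
    moreover have "rcoeff 0 (- int 0) (int (nat q)) (f_hP n) = (0 :: 'a free_alg)"
      unfolding rcoeff_0_nat by simp
    ultimately show ?thesis by simp
  qed (use True in \<open>auto simp: rcoeff_eq_0\<close>)
  moreover have "rcoeff 0 p (q - 1) (f_hP n) = (0 :: 'a free_alg)" "rcoeff 0 p q (f_series n) = (0 :: 'a free_alg)"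
    using True by (auto simp: rcoeff_eq_0)
  ultimately show ?thesis by (simp only: diff_self mult_zero_right)
next
  case False
  then obtain P Q where [simp]: "p = - int P" "q = int Q" using exponent_cases[of p q] by (metis not_less)
  have nth: "fps_nth (f_hP n) (Suc m) = hbar * fps_nth (f_series n) m" for m
    by (simp add: mult.assoc)
  have p1: "- int P - 1 = - int (Suc P)" by simp
  show ?thesis
  proof (cases Q)
    case 0
    then show ?thesis
      unfolding \<open>p = _\<close> \<open>q = _\<close> p1 rcoeff_0_nat
      by (simp add: rcoeff_eq_0 nth scal_mult scal_hbar mult.assoc)
  next
    case (Suc Q')
    then have q1: "int Q - 1 = int Q'" by simp
    show ?thesis
    proof (cases "Suc Q' \<le> P")
      case True
      then obtain d where P: "P = Suc Q' + d" by (metis le_iff_add)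
      have "P choose d = ((P - 1) choose d) + invc d P"
        unfolding P by (cases d) auto
      then have "(of_nat (P choose d) :: 'a free_alg) = of_nat ((P - 1) choose d) + of_nat (invc d P)"
        by simp
      then show ?thesis
        unfolding \<open>p = _\<close> \<open>q = _\<close> p1 q1 rcoeff_0_nat
        by (simp add: Suc P nth scal_mult scal_hbar mult.assoc distrib_left)
    next
      case False
      then show ?thesis
        unfolding \<open>p = _\<close> \<open>q = _\<close> p1 q1 rcoeff_0_nat
        by (auto simp: Suc nth not_le mult.assoc)
    qed
  qed
qed

lemma rcoeff_0_homogeneous:
  "homogeneous \<gamma> g \<Longrightarrow> rcoeff 0 (- int P) (int Q) g = hbar ^ (P - Q) * tcoeff \<gamma> 0 P Q"
  using rcoeff_homogeneous[where b = 0] by simp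

text \<open>The vanishing of \<open>Z\<close> bounds \<open>Q\<close> by \<open>B\<close>, and the
  factor \<open>h^(P - Q)\<close> then leaves only \<open>P <= m + B\<close> for the coefficient of
  \<open>h^m\<close>.\<close>

lemma hsummable_rcoeff:
  assumes g: "homogeneous \<gamma> g" and Z: "\<And>p q. q > B \<Longrightarrow> Z p q = 0"
  shows "hsummable (\<lambda>(p, q). rcoeff 0 p q g * Z p q)"
  unfolding hsummable_def
proof
  fix m
  have "{s. fps_nth (case s of (p, q) \<Rightarrow> rcoeff 0 p q g * Z p q) m \<noteq> 0}
    \<subseteq> (\<lambda>(P, Q). (- int P, int Q)) ` ({..m + nat B} \<times> {..nat B})"
  proof clarify
    fix p q assume nz: "fps_nth (rcoeff 0 p q g * Z p q) m \<noteq> 0"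
    show "(p, q) \<in> (\<lambda>(P, Q). (- int P, int Q)) ` ({..m + nat B} \<times> {..nat B})"
    proof (cases rule: exponent_cases[of p q])
      case 1
      with nz show ?thesis by (simp add: rcoeff_eq_0)
    next
      case (2 P Q)
      have "Z p q \<noteq> 0" using nz by auto
      with Z[of q p] 2 have Q: "Q \<le> nat B" by force
      have "rcoeff 0 p q g * Z p q = hbar ^ (P - Q) * (tcoeff \<gamma> 0 P Q * Z p q)"
        using 2 by (simp add: rcoeff_0_homogeneous[OF g] mult.assoc)
      with nz have "P - Q \<le> m" by (auto simp: fps_X_power_mult_nth not_less split: if_splits)
      with Q 2 show ?thesis by force
    qed
  qed
  then show "finite {s. fps_nth (case s of (p, q) \<Rightarrow> rcoeff 0 p q g * Z p q) m \<noteq> 0}"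
    by (rule finite_subset) auto
qed

definition mm_comm :: "'n \<Rightarrow> 'n \<Rightarrow> 'n \<Rightarrow> 'n \<Rightarrow> int \<Rightarrow> int \<Rightarrow> 'n free_alg" where
  "mm_comm i j k l a b = L_minus a i j * L_minus b k l - L_minus b k l * L_minus a i j"

definition mm_exch :: "'n \<Rightarrow> 'n \<Rightarrow> 'n \<Rightarrow> 'n \<Rightarrow> int \<Rightarrow> int \<Rightarrow> 'n free_alg" where
  "mm_exch i j k l a b = L_minus a k j * L_minus b i l - L_minus b k j * L_minus a i l"

text \<open>The coefficient of \<open>u^a v^b\<close> in \<open>u - v\<close> times the relation
  \<open>R_bar(u - v) L_1 L_2 = L_2 L_1 R_bar(u - v)\<close>; the factor \<open>u - v\<close> clears
  the denominator of \<open>R_bar\<close>.\<close>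

definition mm_rel :: "'n \<Rightarrow> 'n \<Rightarrow> 'n \<Rightarrow> 'n \<Rightarrow> int \<Rightarrow> int \<Rightarrow> 'n free_alg" where
  "mm_rel i j k l a b = mm_comm i j k l (a - 1) b - mm_comm i j k l a (b - 1) + hbar * mm_exch i j k l a b"

lemma L_minus_neg: "e < 0 \<Longrightarrow> L_minus e i j = 0"
  by (simp add: L_minus_def)

lemma mm_comm_neg: "b < 0 \<Longrightarrow> mm_comm i j k l a b = 0"
  and mm_exch_neg: "b < 0 \<Longrightarrow> mm_exch i j k l a b = 0"
  and mm_rel_neg: "b < 0 \<Longrightarrow> mm_rel i j k l a b = 0"
  by (simp_all add: mm_rel_def mm_comm_def mm_exch_def L_minus_neg)

context
  fixes i j k l :: "'n::finite"
begin

private abbreviation "F p q \<equiv> rcoeff (0 :: 'n free_alg) p q (f_series CARD('n))"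
private abbreviation "G p q \<equiv> rcoeff (0 :: 'n free_alg) p q (f_hP CARD('n))"
private abbreviation "C \<equiv> mm_comm i j k l"
private abbreviation "D \<equiv> mm_exch i j k l"
private abbreviation "E \<equiv> mm_rel i j k l"

private lemma homF: "homogeneous (phi_coeff CARD('n)) (f_series CARD('n))"
  and homG: "homogeneous (\<lambda>i. if i = 0 then 0 else phi_coeff CARD('n) (i - 1)) (f_hP CARD('n))"
  by (rule homogeneous_f_series homogeneous_f_hP, simp)+

private definition "HF a b = hsum (\<lambda>(p, q). F p q * C (a - p) (b - q))"
private definition "HG a b = hsum (\<lambda>(p, q). G p q * D (a - p) (b - q))"

private lemma summF: "hsummable (\<lambda>(p, q). F p q * C (a - p) (b - q))"
  by (rule hsummable_rcoeff[OF homF, of b]) (simp add: mm_comm_neg)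

private lemma summG: "hsummable (\<lambda>(p, q). G p q * D (a - p) (b - q))"
  by (rule hsummable_rcoeff[OF homG, of b]) (simp add: mm_exch_neg)

text \<open>The coefficients of \<open>R(u - v)\<close> are central, so those on the right can be
  moved to the left; the relation becomes
  \<open>f(u - v) C(u, v) + h (u - v)^(-1) f(u - v) D(u, v) = 0\<close>.\<close>

private lemma HF_HG: "HF a b + HG a b \<in> yd_ideal"
proof -
  have L0: "\<And>e i j. e < 0 \<Longrightarrow> L_minus e i j = 0" by (rule L_minus_neg)
  have l: "hsummable (rel_left 0 L_minus L_minus a b i j k l)"
  proof -
    have "hsummable (\<lambda>s. (case s of (p, q) \<Rightarrow> F p q * (L_minus (a - p) i j * L_minus (b - q) k l))
      + (case s of (p, q) \<Rightarrow> G p q * (L_minus (a - p) k j * L_minus (b - q) i l)))"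
      by (intro hsummable_add hsummable_rcoeff[OF homF, of b] hsummable_rcoeff[OF homG, of b]) (simp_all add: L0)
    then show ?thesis by (simp add: rel_left_def case_prod_unfold)
  qed
  have rr: "rel_right 0 L_minus L_minus a b i j k l = (\<lambda>s. (case s of (p, q) \<Rightarrow> F p q * (L_minus (b - q) k l * L_minus (a - p) i j))
      + (case s of (p, q) \<Rightarrow> G p q * (L_minus (b - q) k j * L_minus (a - p) i l)))"
    by (simp add: rel_right_def case_prod_unfold centralD[OF rcoeff_central])
  have r: "hsummable (rel_right 0 L_minus L_minus a b i j k l)"
    unfolding rr
    by (intro hsummable_add hsummable_rcoeff[OF homF, of b] hsummable_rcoeff[OF homG, of b]) (simp_all add: L0)
  have "hsum (rel_left 0 L_minus L_minus a b i j k l) - hsum (rel_right 0 L_minus L_minus a b i j k l)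
    = hsum (\<lambda>s. rel_left 0 L_minus L_minus a b i j k l s - rel_right 0 L_minus L_minus a b i j k l s)"
    by (rule hsum_diff(2)[OF l r, symmetric])
  also have "\<dots> = hsum (\<lambda>s. (case s of (p, q) \<Rightarrow> F p q * C (a - p) (b - q)) + (case s of (p, q) \<Rightarrow> G p q * D (a - p) (b - q)))"
    by (simp add: rr rel_left_def mm_comm_def mm_exch_def case_prod_unfold right_diff_distrib add_diff_add)
  also have "\<dots> = HF a b + HG a b"
    by (simp only: hsummable_add(2)[OF summF summG] HF_def HG_def)
  finally show ?thesis using minus_minus_ideal by metis
qed

text \<open>Multiplying this relation by \<open>u - v\<close> turns the second series into
  \<open>h f(u - v)\<close> by \<open>rcoeff_rec\<close>, so that \<open>f(u - v)\<close> becomes a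
  common factor and \<open>E\<close> remains.\<close>

private lemma hsum_F_E: "hsum (\<lambda>(p, q). F p q * E (a - p) (b - q)) \<in> yd_ideal"
proof -
  have bij1: "bij (\<lambda>(p, q). (p - 1, q) :: int \<times> int)"
    by (rule o_bij[of "\<lambda>(p, q). (p + 1, q)"]) (auto simp: fun_eq_iff)
  have bij2: "bij (\<lambda>(p, q). (p, q - 1) :: int \<times> int)"
    by (rule o_bij[of "\<lambda>(p, q). (p, q + 1)"]) (auto simp: fun_eq_iff)
  have g1: "hsum (\<lambda>s. case s of (p, q) \<Rightarrow> G (p - 1) q * D (a - p) (b - q)) = HG (a - 1) b"
    and s1: "hsummable (\<lambda>s. case s of (p, q) \<Rightarrow> G (p - 1) q * D (a - p) (b - q))"
    using hsum_reindex[OF bij1, of "\<lambda>(p, q). G p q * D (a - 1 - p) (b - q)"] summG[of "a - 1" b]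
    by (simp_all add: case_prod_unfold HG_def)
  have g2: "hsum (\<lambda>s. case s of (p, q) \<Rightarrow> G p (q - 1) * D (a - p) (b - q)) = HG a (b - 1)"
    and s2: "hsummable (\<lambda>s. case s of (p, q) \<Rightarrow> G p (q - 1) * D (a - p) (b - q))"
    using hsum_reindex[OF bij2, of "\<lambda>(p, q). G p q * D (a - p) (b - 1 - q)"] summG[of a "b - 1"]
    by (simp_all add: case_prod_unfold HG_def)
  have pt: "F p q * E (a - p) (b - q) =
    (F p q * C (a - 1 - p) (b - q) - F p q * C (a - p) (b - 1 - q))
      + (G (p - 1) q * D (a - p) (b - q) - G p (q - 1) * D (a - p) (b - q))" for p q
  proof -
    have "G (p - 1) q * D (a - p) (b - q) - G p (q - 1) * D (a - p) (b - q) = hbar * F p q * D (a - p) (b - q)"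
      by (simp only: left_diff_distrib[symmetric] rcoeff_rec)
    also have "\<dots> = F p q * (hbar * D (a - p) (b - q))"
      by (simp only: mult.assoc central_left_commute[OF central_fps_X, of "F p q"])
    finally have "G (p - 1) q * D (a - p) (b - q) - G p (q - 1) * D (a - p) (b - q) = F p q * (hbar * D (a - p) (b - q))" .
    moreover have "a - p - 1 = a - 1 - p" "b - q - 1 = b - 1 - q" by simp_all
    ultimately show ?thesis
      by (simp only: mm_rel_def distrib_left right_diff_distrib)
  qed
  have "hsum (\<lambda>(p, q). F p q * E (a - p) (b - q)) =
    hsum (\<lambda>s. ((case s of (p, q) \<Rightarrow> F p q * C (a - 1 - p) (b - q)) - (case s of (p, q) \<Rightarrow> F p q * C (a - p) (b - 1 - q)))
      + ((case s of (p, q) \<Rightarrow> G (p - 1) q * D (a - p) (b - q)) - (case s of (p, q) \<Rightarrow> G p (q - 1) * D (a - p) (b - q))))"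
    by (simp add: case_prod_unfold pt)
  also have "\<dots> = (HF (a - 1) b - HF a (b - 1)) + (HG (a - 1) b - HG a (b - 1))"
    by (simp only: hsummable_add(2)[OF hsum_diff(1)[OF summF summF] hsum_diff(1)[OF s1 s2]]
        hsum_diff(2)[OF summF summF] hsum_diff(2)[OF s1 s2] g1 g2 HF_def)
  also have "\<dots> = (HF (a - 1) b + HG (a - 1) b) - (HF a (b - 1) + HG a (b - 1))"
    by (simp add: algebra_simps)
  also have "\<dots> \<in> yd_ideal"
    by (intro left_ideal_diff[OF left_ideal_yd_ideal] HF_HG)
  finally show ?thesis .
qed

text \<open>The coefficient of \<open>f(u - v)\<close> at \<open>(0, 0)\<close> is \<open>1\<close>
  and all others are divisible by \<open>h\<close>. Hence \<open>E\<close> agrees with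
  \<open>f(u - v) E\<close>, which lies in the ideal, up to \<open>h\<close> times values of
  \<open>E\<close>, and each round gains one power of \<open>h\<close>.\<close>

private lemma E_mod_h: "E a b \<in> mod_h yd_ideal m"
proof (induction m arbitrary: a b)
  case 0
  show ?case by (rule mod_h_0[OF left_ideal_yd_ideal])
next
  case (Suc m)
  let ?N = "mod_h yd_ideal (Suc m) :: 'n free_alg set"
  let ?x = "\<lambda>s. case s of (p, q) \<Rightarrow> F p q * E (a - p) (b - q)"
  let ?d = "\<lambda>s. if s = (0, 0) then E a b else 0"
  have sx: "hsummable ?x"
    by (rule hsummable_rcoeff[OF homF, of b]) (simp add: mm_rel_neg)
  have sd: "hsummable ?d" by (rule hsummable_finite[of "{(0, 0)}"]) auto
  have hd: "hsum ?d = E a b" by (subst hsum_finite[of "{(0, 0)}"]) auto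
  have "?x s - ?d s \<in> ?N" for s
  proof -
    obtain p q where s: "s = (p, q)" by (cases s)
    show ?thesis
    proof (cases rule: exponent_cases[of p q])
      case 1
      then have "F p q = 0" by (rule rcoeff_eq_0)
      with 1 show ?thesis using s left_ideal_0[OF left_ideal_mod_h[OF left_ideal_yd_ideal]] by auto
    next
      case (2 P Q)
      show ?thesis
      proof (cases "(P, Q) = (0, 0)")
        case True
        then have "?x s = E a b" using 2 s by (simp add: rcoeff_0_0 f_series_nth_0)
        then show ?thesis using True 2 s left_ideal_0[OF left_ideal_mod_h[OF left_ideal_yd_ideal]] by simp
      next
        case nz: False
        show ?thesis
        proof (cases "P \<le> Q")
          case True
          then show ?thesis
            using nz 2 s left_ideal_0[OF left_ideal_mod_h[OF left_ideal_yd_ideal]]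
            by (auto simp: rcoeff_homogeneous_0[OF homF True nz])
        next
          case False
          then obtain d where "P - Q = Suc d" by (metis Suc_diff_Suc not_le)
          then have "?x s = hbar * (hbar ^ d * tcoeff (phi_coeff CARD('n)) 0 P Q * E (a - p) (b - q))"
            using 2 s by (simp add: rcoeff_0_homogeneous[OF homF] mult.assoc)
          moreover have "\<dots> \<in> ?N"
            by (intro mod_h_Suc left_ideal_mult[OF left_ideal_mod_h] left_ideal_yd_ideal Suc.IH)
          ultimately show ?thesis using nz 2 s by auto
        qed
      qed
    qed
  qed
  then have "hsum (\<lambda>s. ?x s - ?d s) \<in> ?N"
    by (rule hsum_mod_h[OF left_ideal_yd_ideal hsum_diff(1)[OF sx sd]])
  then have 1: "hsum ?x - E a b \<in> ?N"
    by (simp only: hsum_diff(2)[OF sx sd] hd)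
  have 2: "hsum ?x \<in> ?N"
    by (rule subsetD[OF mod_h_subset hsum_F_E])
  have "hsum ?x - (hsum ?x - E a b) \<in> ?N"
    by (rule left_ideal_diff[OF left_ideal_mod_h[OF left_ideal_yd_ideal] 2 1])
  then show ?case by (simp only: diff_diff_eq2 add_diff_cancel_left')
qed

lemma mm_rel_ideal: "mm_rel i j k l a b \<in> yd_ideal"
  by (rule h_closedD[OF h_closed_yd_ideal E_mod_h])

end

section \<open>Shifting the spectral parameter\<close>

text \<open>The substitution \<open>u -> u + \<alpha> h\<close> in a power series in
  \<open>u\<close>. The sum converges \<open>h\<close>-adically because the term \<open>e\<close> is
  divisible by \<open>h^(e - b)\<close>.\<close>

definition shift :: "nat \<Rightarrow> 'a::ring_1 fps fps \<Rightarrow> 'a fps fps" where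
  "shift \<alpha> X = Abs_fps (\<lambda>b. hsum (\<lambda>e::nat.
     of_nat (e choose b) * (of_nat \<alpha> * hbar) ^ (e - b) * fps_nth X e))"

lemma hsummable_shift:
  "hsummable (\<lambda>e::nat. of_nat (e choose b) * (of_nat \<alpha> * hbar) ^ (e - b) * (x e :: 'a::ring_1 fps))"
  unfolding hsummable_def
proof
  fix m
  have "fps_nth (of_nat (e choose b) * (of_nat \<alpha> * hbar) ^ (e - b) * x e) m = 0" if "e > m + b" for e
  proof -
    have "of_nat (e choose b) * (of_nat \<alpha> * hbar) ^ (e - b) * x e
      = hbar ^ (e - b) * (of_nat (e choose b) * (of_nat \<alpha> ^ (e - b) * x e))"
      by (simp only: centralD[OF central_fps_X, of "of_nat \<alpha>"] hbar_mult_power mult.assoc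
          central_left_commute[OF central_hbar_power, of "of_nat _"])
    moreover have "m < e - b" using that by simp
    ultimately show ?thesis by (simp only: fps_X_power_mult_nth if_True)
  qed
  then have "{e. fps_nth (of_nat (e choose b) * (of_nat \<alpha> * hbar) ^ (e - b) * x e) m \<noteq> 0} \<subseteq> {..m + b}"
    by (metis (mono_tags, lifting) atMost_iff mem_Collect_eq not_le subsetI)
  then show "finite {e. fps_nth (of_nat (e choose b) * (of_nat \<alpha> * hbar) ^ (e - b) * x e) m \<noteq> 0}"
    by (rule finite_subset) simp
qed

lemma shift_nth: "fps_nth (shift \<alpha> X) b
    = hsum (\<lambda>e::nat. of_nat (e choose b) * (of_nat \<alpha> * hbar) ^ (e - b) * fps_nth X e)"
  by (simp add: shift_def)

lemma shift_add: "shift \<alpha> (X + Y) = shift \<alpha> X + shift \<alpha> Y"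
  and shift_diff: "shift \<alpha> (X - Y) = shift \<alpha> X - shift \<alpha> Y"
  by (rule fps_ext, simp add: shift_nth distrib_left right_diff_distrib
      hsummable_add(2)[OF hsummable_shift hsummable_shift] hsum_diff(2)[OF hsummable_shift hsummable_shift])+

lemma central_shift_coeff: "central (of_nat c * (of_nat \<alpha> * hbar) ^ k :: 'a::ring_1 fps)"
  by (intro central_mult central_power central_of_nat central_fps_X)

lemma shift_const_left: "shift \<alpha> (fps_const c * X) = fps_const c * shift \<alpha> X"
  by (rule fps_ext) (simp add: shift_nth hsum_mult_left[OF hsummable_shift, symmetric]
      central_left_commute[OF central_shift_coeff])

lemma shift_const_right: "shift \<alpha> (X * fps_const c) = shift \<alpha> X * fps_const c"
  by (rule fps_ext) (simp only: shift_nth fps_mult_right_const_nth mult.assoc[symmetric]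
      hsum_mult_right[OF hsummable_shift])

text \<open>Pascal's rule. Together with linearity over constants on both sides this governs all
  uses of the substitution: a relation is shifted in one variable while the other series enters
  through a single coefficient.\<close>

lemma shift_X: "shift \<alpha> (fps_X * X) = (fps_X + fps_const (of_nat \<alpha> * hbar)) * shift \<alpha> X"
proof (rule fps_ext)
  fix b
  let ?y = "of_nat \<alpha> * hbar :: 'a fps"
  let ?t = "\<lambda>b e. of_nat (e choose b) * ?y ^ (e - b) * fps_nth X e"
  have "fps_nth (shift \<alpha> (fps_X * X)) b
    = hsum (\<lambda>e. of_nat (e choose b) * ?y ^ (e - b) * fps_nth (fps_X * X) e)"
    by (rule shift_nth)
  also have "\<dots> = hsum (\<lambda>e. of_nat (Suc e choose b) * ?y ^ (Suc e - b) * fps_nth (fps_X * X) (Suc e))"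
  proof (rule hsum_reindex_inj(1)[OF inj_Suc, symmetric])
    show "of_nat (s choose b) * ?y ^ (s - b) * fps_nth (fps_X * X) s = 0" if "s \<notin> range Suc" for s
      using that by (cases s) auto
  qed
  also have "\<dots> = hsum (\<lambda>e. (if b = 0 then 0 else ?t (b - 1) e) + ?y * ?t b e)"
  proof (rule arg_cong[where f = hsum], rule ext)
    fix e
    have y: "w * (of_nat c * w ^ k * z) = of_nat c * w ^ Suc k * z" for c k and w z :: "'a fps"
      by (simp only: power_Suc mult.assoc of_nat_left_commute[of w])
    show "of_nat (Suc e choose b) * ?y ^ (Suc e - b) * fps_nth (fps_X * X) (Suc e)
      = (if b = 0 then 0 else ?t (b - 1) e) + ?y * ?t b e"
    proof (cases b)
      case 0
      then show ?thesis by (simp add: y mult.assoc del: of_nat_mult)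
    next
      case (Suc b')
      show ?thesis
      proof (cases "e < b")
        case True
        then show ?thesis using Suc by (simp add: binomial_eq_0 distrib_right)
      next
        case False
        then have "Suc (e - b) = e - b'" using Suc by simp
        then have "?y * ?t b e = of_nat (e choose b) * ?y ^ (e - b') * fps_nth X e"
          by (simp only: y)
        moreover have "fps_nth (fps_X * X) (Suc e) = fps_nth X e" by simp
        ultimately show ?thesis
          using Suc by (simp only: diff_Suc_Suc binomial_Suc_Suc of_nat_add distrib_right) simp
      qed
    qed
  qed
  also have "\<dots> = hsum (\<lambda>e. if b = 0 then 0 else ?t (b - 1) e) + hsum (\<lambda>e. ?y * ?t b e)"
  proof (rule hsummable_add(2))
    show "hsummable (\<lambda>e. if b = 0 then 0 else ?t (b - 1) e)"
      using hsummable_shift[of "b - 1" \<alpha> "fps_nth X"] by (cases "b = 0") (simp_all add: hsummable_def)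
    show "hsummable (\<lambda>e. ?y * ?t b e)" by (rule hsummable_mult_left[OF hsummable_shift])
  qed
  also have "hsum (\<lambda>e. ?y * ?t b e) = ?y * fps_nth (shift \<alpha> X) b"
    by (simp only: hsum_mult_left[OF hsummable_shift] shift_nth)
  also have "hsum (\<lambda>e. if b = 0 then 0 else ?t (b - 1) e) = fps_nth (fps_X * shift \<alpha> X) b"
    by (simp add: shift_nth hsum_finite[of "{}"])
  finally show "fps_nth (shift \<alpha> (fps_X * X)) b = fps_nth ((fps_X + fps_const ?y) * shift \<alpha> X) b"
    by (simp add: distrib_right del: fps_X_mult_nth)
qed

text \<open>The coefficients of the shifted series are infinite sums of multiples of the old ones,
  so the ideal has to be \<open>h\<close>-closed.\<close>

lemma shift_ideal:
  assumes I: "left_ideal I" "h_closed I" and X: "X \<in> coeff_ideal I"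
  shows "shift \<alpha> X \<in> coeff_ideal I"
proof (rule coeff_idealI)
  fix b
  show "fps_nth (shift \<alpha> X) b \<in> I"
    unfolding shift_nth
    by (rule hsum_in_closed[OF I hsummable_shift]) (intro left_ideal_mult I coeff_idealD X)
qed

definition L_minus_series :: "'n \<Rightarrow> 'n \<Rightarrow> 'n free_alg fps" where
  "L_minus_series i j = Abs_fps (\<lambda>e. L_minus (int e) i j)"

lemma L_minus_series_nth [simp]: "fps_nth (L_minus_series i j) e = L_minus (int e) i j"
  by (simp add: L_minus_series_def)

lemma L_minus_shift_eq: "L_minus_shift a i j = shift a (L_minus_series i j)"
  by (simp add: L_minus_shift_def shift_def)

lemma L_minus_series_X: "fps_nth (fps_X * L_minus_series i j) b = L_minus (int b - 1) i j"
  by (cases b) (simp_all add: L_minus_neg)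

abbreviation commutator :: "'a::ring \<Rightarrow> 'a \<Rightarrow> 'a" where
  "commutator x y \<equiv> x * y - y * x"

text \<open>\<open>mm_rel\<close> with fixed \<open>a\<close> is read as a series in
  \<open>v\<close>, and \<open>v\<close> is replaced by \<open>v + \<beta> h\<close>. The
  multiplication by \<open>v\<close> in it yields the extra term with
  \<open>of_nat \<beta> * hbar\<close>.\<close>

lemma rtt_half_shifted:
  fixes i j k l :: "'n::finite"
  shows "commutator (L_minus (a - 1) i j) (fps_nth (L_minus_shift \<beta> k l) b)
    - commutator (L_minus a i j) (fps_nth (fps_X * L_minus_shift \<beta> k l) b)
    - of_nat \<beta> * hbar * commutator (L_minus a i j) (fps_nth (L_minus_shift \<beta> k l) b)
    + hbar * (L_minus a k j * fps_nth (L_minus_shift \<beta> i l) b - fps_nth (L_minus_shift \<beta> k j) b * L_minus a i l)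
    \<in> yd_ideal"
proof -
  let ?Y = "L_minus_series :: 'n \<Rightarrow> 'n \<Rightarrow> 'n free_alg fps"
  let ?c = "\<lambda>a i j. fps_const (L_minus a i j :: 'n free_alg)"
  let ?Z = "commutator (?c (a - 1) i j) (?Y k l)
    - (?c a i j * (fps_X * ?Y k l) - fps_X * ?Y k l * ?c a i j)
    + fps_const hbar * (?c a k j * ?Y i l - ?Y k j * ?c a i l)"
  have "?Z \<in> coeff_ideal yd_ideal"
  proof (rule coeff_idealI)
    fix b
    have "fps_nth ?Z b = mm_rel i j k l a (int b)"
      by (simp add: mm_rel_def mm_comm_def mm_exch_def L_minus_series_X del: fps_X_mult_nth)
    then show "fps_nth ?Z b \<in> yd_ideal" by (simp only: mm_rel_ideal)
  qed
  then have "shift \<beta> ?Z \<in> coeff_ideal yd_ideal"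
    by (rule shift_ideal[OF left_ideal_yd_ideal h_closed_yd_ideal])
  then have "fps_nth (shift \<beta> ?Z) b \<in> yd_ideal" by (rule coeff_idealD)
  also have "fps_nth (shift \<beta> ?Z) b =
    commutator (L_minus (a - 1) i j) (fps_nth (L_minus_shift \<beta> k l) b)
    - (L_minus a i j * (fps_nth (fps_X * L_minus_shift \<beta> k l) b + of_nat \<beta> * hbar * fps_nth (L_minus_shift \<beta> k l) b)
       - (fps_nth (fps_X * L_minus_shift \<beta> k l) b + of_nat \<beta> * hbar * fps_nth (L_minus_shift \<beta> k l) b) * L_minus a i j)
    + hbar * (L_minus a k j * fps_nth (L_minus_shift \<beta> i l) b - fps_nth (L_minus_shift \<beta> k j) b * L_minus a i l)"
    by (simp only: shift_add shift_diff shift_const_left shift_const_right shift_X L_minus_shift_eq[symmetric]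
        fps_add_nth fps_sub_nth fps_mult_left_const_nth fps_mult_right_const_nth distrib_right)
  also have "\<dots> = commutator (L_minus (a - 1) i j) (fps_nth (L_minus_shift \<beta> k l) b)
    - commutator (L_minus a i j) (fps_nth (fps_X * L_minus_shift \<beta> k l) b)
    - of_nat \<beta> * hbar * commutator (L_minus a i j) (fps_nth (L_minus_shift \<beta> k l) b)
    + hbar * (L_minus a k j * fps_nth (L_minus_shift \<beta> i l) b - fps_nth (L_minus_shift \<beta> k j) b * L_minus a i l)"
  proof -
    have "A - (p + q - (r + s)) + B = A - (p - r) - (q - s) + B" for A B p q r s :: "'n free_alg" by simp
    moreover have "central (of_nat \<beta> * hbar :: 'n free_alg)" by (intro central_mult central_of_nat central_fps_X)
    note central_left_commute[OF this]
    ultimately show ?thesis by (simp only: distrib_left distrib_right right_diff_distrib mult.assoc)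
  qed
  finally show ?thesis .
qed

text \<open>The roles are exchanged: a coefficient of the series in \<open>v\<close>, already
  shifted, is held fixed, and \<open>u\<close> is shifted.\<close>

lemma rtt_shifted:
  fixes i j k l :: "'n::finite"
  shows "commutator (fps_nth (fps_X * L_minus_shift \<alpha> i j) a) (fps_nth (L_minus_shift \<beta> k l) b)
    - commutator (fps_nth (L_minus_shift \<alpha> i j) a) (fps_nth (fps_X * L_minus_shift \<beta> k l) b)
    + (of_nat \<alpha> - of_nat \<beta>) * hbar * commutator (fps_nth (L_minus_shift \<alpha> i j) a) (fps_nth (L_minus_shift \<beta> k l) b)
    + hbar * (fps_nth (L_minus_shift \<alpha> k j) a * fps_nth (L_minus_shift \<beta> i l) b
        - fps_nth (L_minus_shift \<beta> k j) b * fps_nth (L_minus_shift \<alpha> i l) a)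
    \<in> yd_ideal"
proof -
  let ?X = "L_minus_series :: 'n \<Rightarrow> 'n \<Rightarrow> 'n free_alg fps"
  let ?c = "\<lambda>k l. fps_const (fps_nth (L_minus_shift \<beta> k l) b :: 'n free_alg)"
  let ?d = "fps_const (fps_nth (fps_X * L_minus_shift \<beta> k l) b :: 'n free_alg)"
  let ?Z = "(fps_X * ?X i j * ?c k l - ?c k l * (fps_X * ?X i j))
    - commutator (?X i j) ?d
    - fps_const (of_nat \<beta> * hbar) * commutator (?X i j) (?c k l)
    + fps_const hbar * (?X k j * ?c i l - ?c k j * ?X i l)"
  have "?Z \<in> coeff_ideal yd_ideal"
  proof (rule coeff_idealI)
    fix a
    show "fps_nth ?Z a \<in> yd_ideal"
      using rtt_half_shifted[of "int a" i j \<beta> k l b]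
      by (simp only: fps_add_nth fps_sub_nth fps_mult_left_const_nth fps_mult_right_const_nth
          L_minus_series_X L_minus_series_nth)
  qed
  then have "shift \<alpha> ?Z \<in> coeff_ideal yd_ideal"
    by (rule shift_ideal[OF left_ideal_yd_ideal h_closed_yd_ideal])
  then have "fps_nth (shift \<alpha> ?Z) a \<in> yd_ideal" by (rule coeff_idealD)
  also have "fps_nth (shift \<alpha> ?Z) a =
    ((fps_nth (fps_X * L_minus_shift \<alpha> i j) a + of_nat \<alpha> * hbar * fps_nth (L_minus_shift \<alpha> i j) a) * fps_nth (L_minus_shift \<beta> k l) b
       - fps_nth (L_minus_shift \<beta> k l) b * (fps_nth (fps_X * L_minus_shift \<alpha> i j) a + of_nat \<alpha> * hbar * fps_nth (L_minus_shift \<alpha> i j) a))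
    - commutator (fps_nth (L_minus_shift \<alpha> i j) a) (fps_nth (fps_X * L_minus_shift \<beta> k l) b)
    - of_nat \<beta> * hbar * commutator (fps_nth (L_minus_shift \<alpha> i j) a) (fps_nth (L_minus_shift \<beta> k l) b)
    + hbar * (fps_nth (L_minus_shift \<alpha> k j) a * fps_nth (L_minus_shift \<beta> i l) b
        - fps_nth (L_minus_shift \<beta> k j) b * fps_nth (L_minus_shift \<alpha> i l) a)"
    by (simp only: shift_add shift_diff shift_const_left shift_const_right shift_X L_minus_shift_eq[symmetric]
        fps_add_nth fps_sub_nth fps_mult_left_const_nth fps_mult_right_const_nth distrib_right)
  also have "\<dots> = commutator (fps_nth (fps_X * L_minus_shift \<alpha> i j) a) (fps_nth (L_minus_shift \<beta> k l) b)
    - commutator (fps_nth (L_minus_shift \<alpha> i j) a) (fps_nth (fps_X * L_minus_shift \<beta> k l) b)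
    + (of_nat \<alpha> - of_nat \<beta>) * hbar * commutator (fps_nth (L_minus_shift \<alpha> i j) a) (fps_nth (L_minus_shift \<beta> k l) b)
    + hbar * (fps_nth (L_minus_shift \<alpha> k j) a * fps_nth (L_minus_shift \<beta> i l) b
        - fps_nth (L_minus_shift \<beta> k j) b * fps_nth (L_minus_shift \<alpha> i l) a)"
  proof -
    have eq: "(p + q - (r + s)) - A - (b - b') + C = (p - r) - A + (q - b - (s - b')) + C"
      for A C b b' p q r s :: "'n free_alg" by simp
    have "central (of_nat \<alpha> * hbar :: 'n free_alg)" by (intro central_mult central_of_nat central_fps_X)
    note central_left_commute[OF this]
    then show ?thesis
      by (simp only: distrib_left distrib_right left_diff_distrib right_diff_distrib mult.assoc) (rule eq)
  qed
  finally show ?thesis .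
qed

text \<open>\<open>outer x\<close> is \<open>x(u)\<close> and \<open>fps_const y\<close> is
  \<open>y(v)\<close> in the ring of series in \<open>u\<close> over series in \<open>v\<close>;
  both maps are ring homomorphisms.\<close>

definition outer :: "'a::ring_1 fps \<Rightarrow> 'a fps fps" where
  "outer x = Abs_fps (\<lambda>r. fps_const (fps_nth x r))"

lemma outer_nth [simp]: "fps_nth (outer x) r = fps_const (fps_nth x r)"
  by (simp add: outer_def)

lemma outer_add: "outer (x + y) = outer x + outer y"
  and outer_diff: "outer (x - y) = outer x - outer y"
  and outer_0 [simp]: "outer 0 = 0" and outer_1 [simp]: "outer 1 = 1"
  by (rule fps_ext, simp)+

lemma fps_const_sum': "fps_const (sum f A) = (\<Sum>x\<in>A. fps_const (f x))"
  by (induction A rule: infinite_finite_induct) (simp_all flip: fps_const_add)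

lemma outer_mult: "outer (x * y) = outer x * outer y"
  by (rule fps_ext) (simp add: fps_mult_nth fps_const_sum')

lemma outer_const: "outer (fps_const c) = fps_const (fps_const c)"
  by (rule fps_ext) simp

lemma outer_X: "outer fps_X = fps_X"
  by (rule fps_ext) (simp add: fps_X_def)

lemma outer_ideal: "left_ideal I \<Longrightarrow> x \<in> coeff_ideal I \<Longrightarrow> outer x \<in> coeff_ideal (coeff_ideal I)"
  by (auto simp: coeff_ideal_def left_ideal_0)

lemma fps_const_ideal: "left_ideal I \<Longrightarrow> x \<in> coeff_ideal I \<Longrightarrow> fps_const x \<in> coeff_ideal (coeff_ideal I)"
  for I :: "'a::ring_1 set"
  by (auto simp: coeff_ideal_def left_ideal_0)

lemma outer_const_nth: "fps_nth (fps_nth (outer x * fps_const y) a) b = fps_nth x a * fps_nth y b"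
  and const_outer_nth: "fps_nth (fps_nth (fps_const y * outer x) a) b = fps_nth y b * fps_nth x a"
  by simp_all

lemma rtt_two_variables:
  fixes i j k l :: "'n::finite"
  shows "(fps_X - fps_const fps_X + (of_nat \<alpha> - of_nat \<beta>) * fps_const (fps_const hbar))
        * commutator (outer (L_minus_shift \<alpha> i j)) (fps_const (L_minus_shift \<beta> k l))
     + fps_const (fps_const hbar) * (outer (L_minus_shift \<alpha> k j) * fps_const (L_minus_shift \<beta> i l)
        - fps_const (L_minus_shift \<beta> k j) * outer (L_minus_shift \<alpha> i l))
    \<in> coeff_ideal (coeff_ideal yd_ideal)" (is "?Z \<in> _")
proof (intro coeff_idealI)
  fix a b
  let ?U = "\<lambda>i j. L_minus_shift \<alpha> i j :: 'n free_alg fps"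
  let ?V = "\<lambda>i j. L_minus_shift \<beta> i j :: 'n free_alg fps"
  have X: "fps_X * commutator (outer x) (fps_const y) = commutator (outer (fps_X * x)) (fps_const y)" for x y :: "'n free_alg fps"
    by (simp only: outer_mult outer_X right_diff_distrib mult.assoc central_left_commute[OF central_fps_X])
  have Y: "fps_const fps_X * commutator (outer x) (fps_const y) = commutator (outer x) (fps_const (fps_X * y))" for x y :: "'n free_alg fps"
    by (simp only: fps_const_mult[symmetric] right_diff_distrib mult.assoc
        central_left_commute[OF central_fps_const[OF central_fps_X]])
  have c: "(of_nat \<alpha> - of_nat \<beta>) * fps_const (fps_const hbar)
      = (fps_const (fps_const ((of_nat \<alpha> - of_nat \<beta>) * hbar)) :: 'n free_alg fps fps)"
    by (simp add: fps_of_nat[symmetric] flip: fps_const_mult fps_const_sub)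
  have nth: "fps_nth (fps_nth (fps_const (fps_const z) * w) a) b = z * fps_nth (fps_nth w a) b" for z and w :: "'n free_alg fps fps"
    by simp
  show "fps_nth (fps_nth ?Z a) b \<in> yd_ideal"
    using rtt_shifted[of \<alpha> i j a \<beta> k l b]
    by (simp only: left_diff_distrib[of fps_X] distrib_right[of "fps_X - _"] X Y c fps_add_nth fps_sub_nth nth outer_const_nth const_outer_nth)
qed

text \<open>Setting \<open>v = u\<close>: the components of \<open>rtt_shifted\<close> with
  \<open>a + b = r\<close> are added up, and the two terms coming from \<open>u - v\<close> cancel.
  What survives is the relation at parameters differing by
  \<open>(\<alpha> - \<beta>) h\<close>.\<close>

lemma rtt_one_variable:
  fixes i j k l :: "'n::finite"
  shows "(of_nat \<alpha> - of_nat \<beta>) * fps_const hbar * commutator (L_minus_shift \<alpha> i j) (L_minus_shift \<beta> k l)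
     + fps_const hbar * (L_minus_shift \<alpha> k j * L_minus_shift \<beta> i l - L_minus_shift \<beta> k j * L_minus_shift \<alpha> i l)
    \<in> coeff_ideal yd_ideal" (is "?Z \<in> _")
proof (intro coeff_idealI)
  fix r
  let ?U = "\<lambda>i j. L_minus_shift \<alpha> i j :: 'n free_alg fps"
  let ?V = "\<lambda>i j. L_minus_shift \<beta> i j :: 'n free_alg fps"
  have rev: "fps_nth (x * y) r = (\<Sum>a=0..r. fps_nth x (r - a) * fps_nth y a)" for x y :: "'n free_alg fps"
    unfolding fps_mult_nth by (rule sum.reindex_bij_witness[of _ "\<lambda>a. r - a" "\<lambda>a. r - a"]) auto
  let ?t = "\<lambda>a. commutator (fps_nth (fps_X * ?U i j) a) (fps_nth (?V k l) (r - a))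
    - commutator (fps_nth (?U i j) a) (fps_nth (fps_X * ?V k l) (r - a))
    + (of_nat \<alpha> - of_nat \<beta>) * hbar * commutator (fps_nth (?U i j) a) (fps_nth (?V k l) (r - a))
    + hbar * (fps_nth (?U k j) a * fps_nth (?V i l) (r - a)
        - fps_nth (?V k j) (r - a) * fps_nth (?U i l) a)"
  have "(\<Sum>a=0..r. ?t a) \<in> yd_ideal"
    by (intro left_ideal_sum left_ideal_yd_ideal rtt_shifted)
  also have "(\<Sum>a=0..r. ?t a) = fps_nth (commutator (fps_X * ?U i j) (?V k l)) r
     - fps_nth (commutator (?U i j) (fps_X * ?V k l)) r
     + (of_nat \<alpha> - of_nat \<beta>) * hbar * fps_nth (commutator (?U i j) (?V k l)) r
     + hbar * fps_nth (?U k j * ?V i l - ?V k j * ?U i l) r"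
    unfolding fps_sub_nth fps_mult_nth[of "_ * ?U i j" "?V k l"] fps_mult_nth[of "?U i j" "_ * ?V k l"]
      fps_mult_nth[of "?U i j" "?V k l"] fps_mult_nth[of "?U k j" "?V i l"]
      rev[of "?V k l" "_ * ?U i j"] rev[of "_ * ?V k l" "?U i j"] rev[of "?V k l" "?U i j"] rev[of "?V k j" "?U i l"]
    by (simp only: sum_subtractf sum.distrib sum_distrib_left[symmetric])
  also have "commutator (fps_X * ?U i j) (?V k l) = commutator (?U i j) (fps_X * ?V k l)"
    by (simp only: mult.assoc central_left_commute[OF central_fps_X])
  finally have "(of_nat \<alpha> - of_nat \<beta>) * hbar * fps_nth (commutator (?U i j) (?V k l)) r
     + hbar * fps_nth (?U k j * ?V i l - ?V k j * ?U i l) r \<in> yd_ideal" by simp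
  moreover have "(of_nat \<alpha> - of_nat \<beta>) * fps_const hbar
      = (fps_const ((of_nat \<alpha> - of_nat \<beta>) * hbar) :: 'n free_alg fps)"
    by (simp add: fps_of_nat[symmetric] flip: fps_const_mult fps_const_sub)
  ultimately show "fps_nth ?Z r \<in> yd_ideal"
    by (simp only: fps_add_nth fps_mult_left_const_nth)
qed

section \<open>Operators on tensors\<close>

abbreviation swp :: "nat \<Rightarrow> nat \<Rightarrow> nat \<Rightarrow> nat" where
  "swp \<equiv> Transposition.transpose"

lemma sum_fun_apply: "(sum f A) x = (\<Sum>s\<in>A. f s x)"
  by (induction A rule: infinite_finite_induct) simp_all

declare plus_fun_apply [simp del] zero_fun_apply [simp del]

lemmas fun_apply = plus_fun_apply zero_fun_apply fun_diff_def fun_Compl_def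

definition smul :: "'s::times \<Rightarrow> ('n, 's) tmat \<Rightarrow> ('n, 's) tmat" where
  "smul c G = (\<lambda>I J. c * G I J)"

text \<open>Left multiplication by the operator of \<open>\<sigma>\<close> if \<open>s\<close>
  holds, otherwise right multiplication by the operator of its inverse. With the inverse both sides
  obey the same rule \<open>act_act\<close>, so one lemma covers both. Indices are functions on all
  natural numbers, which leaves room for a position \<open>0\<close> beside
  \<open>1..k\<close>.\<close>

definition act :: "bool \<Rightarrow> (nat \<Rightarrow> nat) \<Rightarrow> ('n, 's) tmat \<Rightarrow> ('n, 's) tmat" where
  "act s \<sigma> G = (\<lambda>I J. if s then G (I \<circ> \<sigma>) J else G I (J \<circ> \<sigma>))"

definition tensors :: "'s set \<Rightarrow> ('n, 's) tmat set" where
  "tensors \<I> = {G. \<forall>I J. G I J \<in> \<I>}"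

text \<open>Linearity is over central scalars only, since entries lie in a noncommutative ring. The
  last condition allows applying the operator to a congruence modulo any left ideal
  (\<open>linear_op_cong\<close>).\<close>

definition linear_op :: "(('n, 's::ring_1) tmat \<Rightarrow> ('n, 's) tmat) \<Rightarrow> bool" where
  "linear_op T \<longleftrightarrow> (\<forall>G H. T (G + H) = T G + T H) \<and> (\<forall>c G. central c \<longrightarrow> T (smul c G) = smul c (T G)) \<and>
     (\<forall>\<I> G. left_ideal \<I> \<longrightarrow> G \<in> tensors \<I> \<longrightarrow> T G \<in> tensors \<I>)"

lemma tensorsI: "(\<And>I J. G I J \<in> \<I>) \<Longrightarrow> G \<in> tensors \<I>"
  and tensorsD: "G \<in> tensors \<I> \<Longrightarrow> G I J \<in> \<I>"
  by (auto simp: tensors_def)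

lemma smul_add: "smul c (G + H) = smul c G + smul c (H :: ('n, 's::ring_1) tmat)"
  and smul_diff: "smul c (G - H) = smul c G - smul c H"
  and smul_minus: "smul c (- G) = - smul c G"
  and smul_uminus: "smul (- c) G = - smul c G"
  and smul_plus: "smul (c + d) G = smul c G + smul d G"
  and smul_smul: "smul c (smul d G) = smul (c * d) G"
  and smul_1 [simp]: "smul 1 G = G"
  and smul_0 [simp]: "smul 0 G = 0"
  by (auto simp: smul_def fun_eq_iff fun_apply algebra_simps)

lemma smul_sum: "smul c (sum f A) = (\<Sum>x\<in>A. smul c (f x :: ('n, 's::ring_1) tmat))"
  by (auto simp: smul_def fun_eq_iff sum_fun_apply sum_distrib_left)

lemma smul_commute: "central c \<Longrightarrow> smul c (smul d G) = smul d (smul c (G :: ('n, 's::ring_1) tmat))"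
  by (simp add: smul_smul centralD)

lemma tensors_add: "left_ideal \<I> \<Longrightarrow> G \<in> tensors \<I> \<Longrightarrow> H \<in> tensors \<I> \<Longrightarrow> G + H \<in> tensors \<I>"
  and tensors_diff: "left_ideal \<I> \<Longrightarrow> G \<in> tensors \<I> \<Longrightarrow> H \<in> tensors \<I> \<Longrightarrow> G - H \<in> tensors \<I>"
  and tensors_smul: "left_ideal \<I> \<Longrightarrow> G \<in> tensors \<I> \<Longrightarrow> smul c G \<in> tensors \<I>"
  and tensors_0: "left_ideal \<I> \<Longrightarrow> 0 \<in> tensors \<I>"
  for \<I> :: "'s::ring_1 set"
  by (auto simp: tensors_def fun_apply smul_def left_ideal_add left_ideal_diff left_ideal_mult left_ideal_0)

lemma tensors_minus: "left_ideal \<I> \<Longrightarrow> G \<in> tensors \<I> \<Longrightarrow> - G \<in> tensors \<I>"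
  for \<I> :: "'s::ring_1 set"
  by (auto simp: tensors_def fun_apply left_ideal_minus)

lemma tensors_sum: "left_ideal \<I> \<Longrightarrow> (\<And>x. x \<in> A \<Longrightarrow> f x \<in> tensors \<I>) \<Longrightarrow> sum f A \<in> tensors \<I>"
  for \<I> :: "'s::ring_1 set"
  by (auto simp: tensors_def sum_fun_apply left_ideal_sum)

lemma tensors_trans:
  "left_ideal \<I> \<Longrightarrow> G - H \<in> tensors \<I> \<Longrightarrow> H - K \<in> tensors \<I> \<Longrightarrow> G - K \<in> tensors \<I>"
  for \<I> :: "'s::ring_1 set"
  using tensors_add[of \<I> "G - H" "H - K"] by simp

lemma tensors_sym: "left_ideal \<I> \<Longrightarrow> G - H \<in> tensors \<I> \<Longrightarrow> H - G \<in> tensors \<I>"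
  for \<I> :: "'s::ring_1 set"
  using tensors_minus[of \<I> "G - H"] by simp

lemma left_ideal_singleton_0: "left_ideal {0 :: 's::ring_1}"
  by (auto simp: left_ideal_def)

lemma tensors_singleton_0: "G \<in> tensors {0 :: 's::ring_1} \<longleftrightarrow> G = 0"
  by (auto simp: tensors_def fun_eq_iff fun_apply)

lemma linear_opI:
  assumes "\<And>G H. T (G + H) = T G + T H" "\<And>c G. central c \<Longrightarrow> T (smul c G) = smul c (T G)"
    "\<And>\<I> G. left_ideal \<I> \<Longrightarrow> G \<in> tensors \<I> \<Longrightarrow> T G \<in> tensors \<I>"
  shows "linear_op T"
  using assms by (auto simp: linear_op_def)

lemma linear_op_add: "linear_op T \<Longrightarrow> T (G + H) = T G + T H"
  and linear_op_smul: "linear_op T \<Longrightarrow> central c \<Longrightarrow> T (smul c G) = smul c (T G)"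
  and linear_op_ideal: "linear_op T \<Longrightarrow> left_ideal \<I> \<Longrightarrow> G \<in> tensors \<I> \<Longrightarrow> T G \<in> tensors \<I>"
  by (auto simp: linear_op_def)

lemma linear_op_minus: "linear_op T \<Longrightarrow> T (- G) = - T G"
  using linear_op_smul[of T "- 1" G] by (simp add: smul_uminus central_minus)

lemma linear_op_diff: "linear_op T \<Longrightarrow> T (G - H) = T G - T H"
  using linear_op_add[of T G "- H"] linear_op_minus[of T H] by (simp only: diff_conv_add_uminus)

lemma linear_op_0: "linear_op T \<Longrightarrow> T 0 = 0"
  using linear_op_diff[of T 0 0] by simp

lemma linear_op_sum: "linear_op T \<Longrightarrow> T (sum f A) = (\<Sum>x\<in>A. T (f x))"
  by (induction A rule: infinite_finite_induct) (simp_all add: linear_op_0 linear_op_add)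

lemma linear_op_cong: "linear_op T \<Longrightarrow> left_ideal \<I> \<Longrightarrow> G - H \<in> tensors \<I> \<Longrightarrow> T G - T H \<in> tensors \<I>"
  by (simp add: linear_op_diff[symmetric] linear_op_ideal)

lemma linear_op_id: "linear_op (\<lambda>G. G)"
  by (rule linear_opI) auto

lemma linear_op_comp: "linear_op T \<Longrightarrow> linear_op U \<Longrightarrow> linear_op (\<lambda>G. T (U G))"
  by (rule linear_opI) (simp_all add: linear_op_add linear_op_smul linear_op_ideal)

lemma linear_op_plus: "linear_op T \<Longrightarrow> linear_op U \<Longrightarrow> linear_op (\<lambda>G. T G + U G)"
  by (rule linear_opI) (simp_all add: linear_op_add linear_op_smul linear_op_ideal smul_add tensors_add)

lemma linear_op_smul_comp: "central c \<Longrightarrow> linear_op T \<Longrightarrow> linear_op (\<lambda>G. smul c (T G))"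
  by (rule linear_opI) (simp_all add: linear_op_add linear_op_smul linear_op_ideal smul_add tensors_smul smul_commute)

lemma linear_op_sum_comp: "(\<And>x. x \<in> A \<Longrightarrow> linear_op (T x)) \<Longrightarrow> linear_op (\<lambda>G. \<Sum>x\<in>A. T x G)"
  by (rule linear_opI)
    (simp_all add: linear_op_add linear_op_smul linear_op_ideal sum.distrib smul_sum tensors_sum)

lemma linear_op_act: "linear_op (act s \<sigma>)"
  by (rule linear_opI) (auto simp: act_def smul_def fun_eq_iff tensors_def fun_apply)

lemma act_act: "act s \<sigma> (act s \<rho> G) = act s (\<sigma> \<circ> \<rho>) G"
  by (cases s) (simp_all add: act_def comp_assoc)

lemma act_commute_sides: "act True \<sigma> (act False \<rho> G) = act False \<rho> (act True \<sigma> G)"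
  by (simp add: act_def)

lemma act_id [simp]: "act s id G = G"
  by (cases s) (simp_all add: act_def)

lemma act_swp_swp [simp]: "act s (swp a b) (act s (swp a b) G) = G"
  by (simp add: act_act)


subsection \<open>Linear factors\<close>

text \<open>A factor \<open>d + t P\<close> of an \<open>R\<close>-matrix with its denominator
  cleared, applied on the side \<open>s\<close>; the pair \<open>f\<close> consists of
  \<open>d\<close> and the permutation.\<close>

definition fac :: "bool \<Rightarrow> 's::ring_1 \<Rightarrow> 's \<times> (nat \<Rightarrow> nat) \<Rightarrow> ('n, 's) tmat \<Rightarrow> ('n, 's) tmat" where
  "fac s t f G = smul (fst f) G + smul t (act s (snd f) G)"

primrec ops :: "bool \<Rightarrow> 's::ring_1 \<Rightarrow> ('s \<times> (nat \<Rightarrow> nat)) list \<Rightarrow> ('n, 's) tmat \<Rightarrow> ('n, 's) tmat" where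
  "ops s t [] G = G"
| "ops s t (f # fs) G = fac s t f (ops s t fs G)"

lemma ops_append: "ops s t (fs @ gs) G = ops s t fs (ops s t gs G)"
  by (induction fs) simp_all

definition cfacs :: "('s::ring_1 \<times> (nat \<Rightarrow> nat)) list \<Rightarrow> bool" where
  "cfacs fs \<longleftrightarrow> (\<forall>f\<in>set fs. central (fst f))"

lemma cfacs_Cons [simp]: "cfacs (f # fs) \<longleftrightarrow> central (fst f) \<and> cfacs fs"
  and cfacs_Nil [simp]: "cfacs []"
  and cfacs_append [simp]: "cfacs (fs @ gs) \<longleftrightarrow> cfacs fs \<and> cfacs gs"
  and cfacs_rev [simp]: "cfacs (rev fs) \<longleftrightarrow> cfacs fs"
  by (auto simp: cfacs_def)

lemma linear_op_fac: "central t \<Longrightarrow> central (fst f) \<Longrightarrow> linear_op (fac s t f)"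
  unfolding fac_def
  by (intro linear_op_plus linear_op_smul_comp linear_op_act linear_op_id)

lemma linear_op_ops:
  "central t \<Longrightarrow> cfacs fs \<Longrightarrow> linear_op (ops s t fs :: ('n, 's::ring_1) tmat \<Rightarrow> ('n, 's) tmat)"
proof (induction fs)
  case Nil
  have "ops s t [] = (\<lambda>G :: ('n, 's) tmat. G)" by (rule ext) simp
  then show ?case by (simp only: linear_op_id)
next
  case (Cons f fs)
  then have f: "central (fst f)" "cfacs fs" by simp_all
  have "linear_op (\<lambda>G :: ('n, 's) tmat. fac s t f (ops s t fs G))"
    by (rule linear_op_comp[OF linear_op_fac[OF Cons.prems(1) f(1)] Cons.IH[OF Cons.prems(1) f(2)]])
  moreover have "ops s t (f # fs) = (\<lambda>G :: ('n, 's) tmat. fac s t f (ops s t fs G))" by (rule ext) simp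
  ultimately show ?case by (simp only:)
qed

lemma linear_op_fac_commute:
  assumes T: "linear_op T" and t: "central t" and f: "central (fst f)"
    and comm: "\<And>G. T (act s (snd f) G) = act s (snd f) (T G)"
  shows "T (fac s t f G) = fac s t f (T G)"
  by (simp add: fac_def linear_op_add[OF T] linear_op_smul[OF T] t f comm)

lemma linear_op_ops_commute:
  assumes T: "linear_op T" and t: "central t" and fs: "cfacs fs"
    and comm: "\<And>G f. f \<in> set fs \<Longrightarrow> T (act s (snd f) G) = act s (snd f) (T G)"
  shows "T (ops s t fs G) = ops s t fs (T G)"
  using fs comm by (induction fs) (simp_all add: linear_op_fac_commute[OF T t])

lemma ops_sides_commute:
  assumes "central t" "cfacs fs" "central t'" "cfacs gs"
  shows "ops True t fs (ops False t' gs G) = ops False t' gs (ops True t fs G)"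
proof (rule linear_op_ops_commute[OF linear_op_ops[OF assms(1,2)] assms(3,4)])
  fix G and g :: "'a \<times> (nat \<Rightarrow> nat)"
  show "ops True t fs (act False (snd g) G) = act False (snd g) (ops True t fs G)"
    by (rule linear_op_ops_commute[OF linear_op_act assms(1,2), symmetric]) (simp add: act_commute_sides)
qed

lemma ops_swap:
  assumes t: "central t" and fs: "cfacs fs" and gs: "cfacs gs"
    and comm: "\<And>f g. f \<in> set fs \<Longrightarrow> g \<in> set gs \<Longrightarrow> snd f \<circ> snd g = snd g \<circ> snd f"
  shows "ops s t (fs @ gs) G = ops s t (gs @ fs) G"
proof -
  have "ops s t fs (ops s t gs G) = ops s t gs (ops s t fs G)"
  proof (rule linear_op_ops_commute[OF linear_op_ops[OF t fs] t gs])
    fix G g assume "g \<in> set gs"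
    then show "ops s t fs (act s (snd g) G) = act s (snd g) (ops s t fs G)"
      by (intro linear_op_ops_commute[OF linear_op_act t fs, symmetric]) (metis act_act comm)
  qed
  then show ?thesis by (simp add: ops_append)
qed

text \<open>Factors that share neither a row nor a column commute, so a product taken row by row can
  be rearranged column by column without changing the order inside any row or column.\<close>

lemma ops_grid:
  fixes f :: "'x \<Rightarrow> 'y \<Rightarrow> 's::ring_1 \<times> (nat \<Rightarrow> nat)" and G :: "('n, 's) tmat"
  assumes t: "central t" and c: "\<And>a b. central (fst (f a b))"
    and comm: "\<And>a a' b b'. a \<in> set as \<Longrightarrow> a' \<in> set as \<Longrightarrow> b \<in> set bs \<Longrightarrow> b' \<in> set bs \<Longrightarrow>
      a \<noteq> a' \<Longrightarrow> b \<noteq> b' \<Longrightarrow> snd (f a b) \<circ> snd (f a' b') = snd (f a' b') \<circ> snd (f a b)"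
    and d: "distinct as" "distinct bs"
  shows "ops s t (concat (map (\<lambda>a. map (f a) bs) as)) G = ops s t (concat (map (\<lambda>b. map (\<lambda>a. f a b) as) bs)) G"
  using d(1) comm
proof (induction as arbitrary: G)
  case Nil
  then show ?case by (induction bs) auto
next
  case (Cons a as)
  note comm' = Cons.prems(2) and IH = Cons.IH
  have c1: "cfacs (map (f a) bs)" for bs by (auto simp: cfacs_def c)
  have c2: "cfacs (map (\<lambda>a. f a b) as)" for b as by (auto simp: cfacs_def c)
  \<comment> \<open>The first row is merged into the columns of the other rows: its entries in later
    columns commute with the entries of column \<open>b\<close> in other rows.\<close>
  have *: "ops s t (map (f a) bs' @ concat (map (\<lambda>b. map (\<lambda>a. f a b) as) bs')) G
    = ops s t (concat (map (\<lambda>b. map (\<lambda>a. f a b) (a # as)) bs')) G"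
    if "distinct bs'" "set bs' \<subseteq> set bs" for bs' and G :: "('n, 's) tmat"
    using that
  proof (induction bs' arbitrary: G)
    case (Cons b bs')
    have sw: "ops s t (map (f a) bs' @ map (\<lambda>a. f a b) as) G = ops s t (map (\<lambda>a. f a b) as @ map (f a) bs') G" for G :: "('n, 's) tmat"
    proof (rule ops_swap[OF t c1 c2])
      fix g g' assume "g \<in> set (map (f a) bs')" "g' \<in> set (map (\<lambda>a. f a b) as)"
      then obtain b' a' where "b' \<in> set bs'" "a' \<in> set as" "g = f a b'" "g' = f a' b" by auto
      then show "snd g \<circ> snd g' = snd g' \<circ> snd g"
        using Cons.prems \<open>distinct (a # as)\<close> by (simp only:) (rule comm', auto)
    qed
    have "ops s t (map (f a) (b # bs') @ concat (map (\<lambda>b. map (\<lambda>a. f a b) as) (b # bs'))) G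
      = fac s t (f a b) (ops s t (map (f a) bs' @ map (\<lambda>a. f a b) as) (ops s t (concat (map (\<lambda>b. map (\<lambda>a. f a b) as) bs')) G))"
      by (simp add: ops_append)
    then have "ops s t (map (f a) (b # bs') @ concat (map (\<lambda>b. map (\<lambda>a. f a b) as) (b # bs'))) G
      = ops s t (map (\<lambda>a. f a b) (a # as)) (ops s t (map (f a) bs' @ concat (map (\<lambda>b. map (\<lambda>a. f a b) as) bs')) G)"
      unfolding sw by (simp add: ops_append)
    also have "ops s t (map (f a) bs' @ concat (map (\<lambda>b. map (\<lambda>a. f a b) as) bs')) G
      = ops s t (concat (map (\<lambda>b. map (\<lambda>a. f a b) (a # as)) bs')) G"
      by (rule Cons.IH) (use Cons.prems in auto)
    finally show ?case by (simp add: ops_append)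
  qed simp
  have "ops s t (concat (map (\<lambda>a. map (f a) bs) as)) G = ops s t (concat (map (\<lambda>b. map (\<lambda>a. f a b) as) bs)) G" for G :: "('n, 's) tmat"
  proof (rule IH)
    show "distinct as" using Cons.prems by simp
  qed (rule comm', auto)
  then show ?case using *[OF d(2) subset_refl] by (simp add: ops_append)
qed

text \<open>Unitarity: \<open>(d + t P) (d - t P) = d^2 - t^2\<close> for an involution
  \<open>P\<close>. The result is a central scalar, so the product collapses from the
  inside.\<close>

lemma ops_inverse:
  assumes t: "central t" and fs: "cfacs fs" and inv: "\<And>f. f \<in> set fs \<Longrightarrow> snd f \<circ> snd f = id"
  shows "ops s t fs (ops s (- t) (rev fs) G) = smul (prod_list (map (\<lambda>f. fst f ^ 2 - t ^ 2) fs)) G"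
  using fs inv
proof (induction fs arbitrary: G)
  case (Cons f fs)
  let ?p = "prod_list (map (\<lambda>f. fst f ^ 2 - t ^ 2) fs)"
  have cp: "central ?p" using Cons.prems t by (intro central_prod_list) (auto simp: cfacs_def)
  have cf: "central (fst f)" using Cons.prems by simp
  have ff: "fac s t f (fac s (- t) f G) = smul (fst f ^ 2 - t ^ 2) G"
  proof -
    have 1: "act s (snd f) (act s (snd f) G) = G" by (simp only: act_act Cons.prems(2)[OF list.set_intros(1)] act_id)
    have "fac s t f (fac s (- t) f G) = smul (fst f * fst f) G - smul (fst f * t) (act s (snd f) G)
      + (smul (t * fst f) (act s (snd f) G) - smul (t * t) G)"
      by (simp only: fac_def linear_op_add[OF linear_op_act] linear_op_smul[OF linear_op_act t]
          linear_op_smul[OF linear_op_act cf] linear_op_minus[OF linear_op_act]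
          1 smul_add smul_minus smul_smul smul_uminus diff_conv_add_uminus)
    also have "\<dots> = smul (fst f * fst f) G - smul (t * t) G"
      by (simp only: centralD[OF t, of "fst f"]) simp
    also have "\<dots> = smul (fst f ^ 2 - t ^ 2) G"
      by (simp only: smul_plus smul_uminus diff_conv_add_uminus power2_eq_square)
    finally show ?thesis .
  qed
  have "ops s t (f # fs) (ops s (- t) (rev (f # fs)) G) = fac s t f (smul ?p (fac s (- t) f G))"
    using Cons by (simp add: ops_append)
  then show ?case
    using cp by (simp add: linear_op_smul[OF linear_op_fac[OF t cf]] smul_smul ff
        centralD[OF cp, of "fst f ^ 2 - t ^ 2"])
qed simp

declare minus_apply [simp del] uminus_apply [simp del]

subsection \<open>Antisymmetrization\<close>

definition alt :: "bool \<Rightarrow> nat set \<Rightarrow> ('n, 's::ring_1) tmat \<Rightarrow> ('n, 's) tmat" where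
  "alt s A G = (\<Sum>\<sigma> | \<sigma> permutes A. smul (of_int (sign \<sigma>)) (act s \<sigma> G))"

abbreviation nperm :: "nat set \<Rightarrow> nat" where
  "nperm A \<equiv> card {\<sigma>. \<sigma> permutes A}"

lemma nperm_pos: "finite A \<Longrightarrow> nperm A > 0"
  by (simp add: card_permutations)

lemma linear_op_alt: "linear_op (alt s A :: ('n, 's::ring_1) tmat \<Rightarrow> _)"
proof -
  have "linear_op (\<lambda>G :: ('n, 's) tmat. \<Sum>\<sigma> | \<sigma> permutes A. smul (of_int (sign \<sigma>)) (act s \<sigma> G))"
    by (rule linear_op_sum_comp, rule linear_op_smul_comp[OF central_of_int linear_op_act])
  then show ?thesis by (simp only: alt_def[abs_def])
qed

lemma alt_act_commute:
  "(\<And>\<sigma>. \<sigma> permutes A \<Longrightarrow> \<sigma> \<circ> \<rho> = \<rho> \<circ> \<sigma>) \<Longrightarrow> alt s A (act s \<rho> G) = act s \<rho> (alt s A (G :: ('n, 's::ring_1) tmat))"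
  by (simp add: alt_def linear_op_sum[OF linear_op_act] linear_op_smul[OF linear_op_act] act_act)

lemma alt_act_other_side: "alt True A (act False \<rho> G) = act False \<rho> (alt True A (G :: ('n, 's::ring_1) tmat))"
  by (simp add: alt_def linear_op_sum[OF linear_op_act] linear_op_smul[OF linear_op_act] act_commute_sides)

lemma linear_op_alt_commute:
  fixes T :: "('n, 's::ring_1) tmat \<Rightarrow> ('n, 's) tmat"
  assumes T: "linear_op T" and "\<And>\<sigma> G. \<sigma> permutes A \<Longrightarrow> T (act s \<sigma> G) = act s \<sigma> (T G)"
  shows "T (alt s A G) = alt s A (T G)"
  by (simp add: alt_def linear_op_sum[OF T] linear_op_smul[OF T] assms(2))

lemma swp_permutes: "a \<in> A \<Longrightarrow> b \<in> A \<Longrightarrow> swp a b permutes A"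
  by (rule permutes_swap_id)

lemma permutes_finite_permutation: "finite A \<Longrightarrow> \<sigma> permutes A \<Longrightarrow> permutation \<sigma>"
  using permutation_permutes by blast

lemma alt_swp:
  fixes G :: "('n, 's::ring_1) tmat"
  assumes "a \<in> A" "b \<in> A" "a \<noteq> b" "finite A"
  shows "alt s A (act s (swp a b) G) = - alt s A G"
proof -
  have p: "swp a b permutes A" using assms by (simp add: swp_permutes)
  have "alt s A (act s (swp a b) G) = (\<Sum>\<sigma> | \<sigma> permutes A. smul (of_int (sign \<sigma>)) (act s (\<sigma> \<circ> swp a b) G))"
    by (simp only: alt_def act_act)
  also have "\<dots> = (\<Sum>\<sigma> | \<sigma> permutes A. smul (of_int (sign (\<sigma> \<circ> swp a b))) (act s \<sigma> G))"
  proof (rule sum.reindex_bij_witness[of _ "\<lambda>\<sigma>. \<sigma> \<circ> swp a b" "\<lambda>\<sigma>. \<sigma> \<circ> swp a b"])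
    fix \<sigma> assume "\<sigma> \<in> {\<sigma>. \<sigma> permutes A}"
    then show "\<sigma> \<circ> swp a b \<in> {\<sigma>. \<sigma> permutes A}" by (simp add: permutes_compose[OF p])
    show "\<sigma> \<circ> swp a b \<circ> swp a b = \<sigma>" by (simp add: comp_assoc)
    then show "smul (of_int (sign (\<sigma> \<circ> swp a b \<circ> swp a b))) (act s (\<sigma> \<circ> swp a b) G)
      = smul (of_int (sign \<sigma>)) (act s (\<sigma> \<circ> swp a b) G)" by (simp only:)
  qed (use p permutes_compose in \<open>auto simp: comp_assoc\<close>)
  also have "\<dots> = (\<Sum>\<sigma> | \<sigma> permutes A. - smul (of_int (sign \<sigma>)) (act s \<sigma> G))"
  proof (rule sum.cong[OF refl])
    fix \<sigma> assume "\<sigma> \<in> {\<sigma>. \<sigma> permutes A}"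
    then have "sign (\<sigma> \<circ> swp a b) = - sign \<sigma>"
      using assms by (simp add: sign_compose permutes_finite_permutation permutation_swap_id sign_swap_id)
    then show "smul (of_int (sign (\<sigma> \<circ> swp a b))) (act s \<sigma> G) = - smul (of_int (sign \<sigma>)) (act s \<sigma> G)"
      by (simp only: of_int_minus smul_uminus)
  qed
  finally show ?thesis by (simp only: sum_negf alt_def)
qed

text \<open>The relation with \<open>1 - P\<close> is available for neighbouring positions, whose
  parameters differ by \<open>h\<close>, so antisymmetry is established for adjacent transpositions.
  Any other transposition is a conjugate of an adjacent one by adjacent ones.\<close>

lemma adjacent_swp_induct [consumes 1, case_names id swp]:
  assumes \<sigma>: "\<sigma> permutes {lo..hi::nat}" and id: "P id"
    and step: "\<And>a \<sigma>. lo \<le> a \<Longrightarrow> a < hi \<Longrightarrow> P \<sigma> \<Longrightarrow> P (swp a (Suc a) \<circ> \<sigma>)"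
  shows "P \<sigma>"
proof -
  have *: "P (swp a b \<circ> \<sigma>)" if "lo \<le> a" "a < b" "b \<le> hi" "P \<sigma>" for a b \<sigma>
    using that
  proof (induction b arbitrary: \<sigma>)
    case (Suc b)
    show ?case
    proof (cases "a = b")
      case True
      have "P (swp a (Suc a) \<circ> \<sigma>)" by (rule step) (use Suc.prems in auto)
      then show ?thesis by (simp only: True)
    next
      case False
      then have "swp a (Suc b) = swp b (Suc b) \<circ> (swp a b \<circ> swp b (Suc b))"
        using Suc.prems by (auto simp: fun_eq_iff Transposition.transpose_def)
      then have "swp a (Suc b) \<circ> \<sigma> = swp b (Suc b) \<circ> (swp a b \<circ> (swp b (Suc b) \<circ> \<sigma>))"
        by (simp add: comp_assoc)
      moreover have "P (swp b (Suc b) \<circ> (swp a b \<circ> (swp b (Suc b) \<circ> \<sigma>)))"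
      proof (rule step)
        show "P (swp a b \<circ> (swp b (Suc b) \<circ> \<sigma>))"
        proof (rule Suc.IH)
          show "P (swp b (Suc b) \<circ> \<sigma>)" by (rule step) (use Suc.prems False in auto)
        qed (use Suc.prems False in auto)
      qed (use Suc.prems False in auto)
      ultimately show ?thesis by (simp only:)
    qed
  qed simp
  show ?thesis
    using \<sigma> finite_atLeastAtMost
  proof (induction rule: permutes_induct)
    case (swap a b p)
    then show ?case
      using *[of a b p] *[of b a p] transpose_commute[of a b]
      by (metis atLeastAtMost_iff linorder_neqE_nat)
  qed (rule id)
qed

lemma sign_swp_comp:
  assumes "permutation \<sigma>" "a \<noteq> b"
  shows "sign (swp a b \<circ> \<sigma>) = - sign \<sigma>"
  using assms by (simp add: sign_compose permutation_swap_id sign_swap_id)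

lemma sum_const_smul: "(\<Sum>x\<in>A. G) = smul (of_nat (card A)) (G :: ('n, 's::ring_1) tmat)"
  by (simp add: smul_def fun_eq_iff sum_fun_apply)

lemma smul_sign_sign: "smul (of_int (sign \<sigma>)) (smul (of_int (sign \<sigma>)) G) = (G :: ('n, 's::ring_1) tmat)"
  by (simp only: smul_smul of_int_mult[symmetric] sign_idempotent of_int_1 smul_1)

text \<open>If adjacent transpositions act as \<open>-1\<close> modulo the ideal, every permutation
  acts by its sign, and each summand of \<open>alt\<close> is congruent to \<open>G\<close>.\<close>

lemma alt_antisym:
  fixes G :: "('n, 's::ring_1) tmat"
  assumes I: "left_ideal \<I>"
    and G: "\<And>a. lo \<le> a \<Longrightarrow> a < hi \<Longrightarrow> act s (swp a (Suc a)) G + G \<in> tensors \<I>"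
  shows "alt s {lo..hi} G - smul (of_nat (nperm {lo..hi})) G \<in> tensors \<I>"
proof -
  have *: "permutation \<sigma> \<and> act s \<sigma> G - smul (of_int (sign \<sigma>)) G \<in> tensors \<I>" if "\<sigma> permutes {lo..hi}" for \<sigma>
    using that
  proof (induction rule: adjacent_swp_induct)
    case id
    have "act s id G - smul (of_int (sign id)) G = 0" by (simp only: act_id sign_id of_int_1 smul_1 diff_self)
    then show ?case using tensors_0[OF I] permutation_id by metis
  next
    case (swp a \<sigma>)
    let ?t = "swp a (Suc a)"
    have 1: "act s ?t (act s \<sigma> G) - act s ?t (smul (of_int (sign \<sigma>)) G) \<in> tensors \<I>"
      using swp by (intro linear_op_cong[OF linear_op_act I]) simp
    have 2: "smul (of_int (sign \<sigma>)) (act s ?t G + G) \<in> tensors \<I>"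
      using swp by (intro tensors_smul I G) auto
    have "act s (?t \<circ> \<sigma>) G - smul (of_int (sign (?t \<circ> \<sigma>))) G =
      (act s ?t (act s \<sigma> G) - act s ?t (smul (of_int (sign \<sigma>)) G)) + smul (of_int (sign \<sigma>)) (act s ?t G + G)"
      using swp by (simp add: sign_swp_comp act_act linear_op_smul[OF linear_op_act] smul_add smul_uminus)
    with tensors_add[OF I 1 2]
    have "act s (?t \<circ> \<sigma>) G - smul (of_int (sign (?t \<circ> \<sigma>))) G \<in> tensors \<I>" by (simp only:)
    moreover have "permutation (?t \<circ> \<sigma>)"
      using swp by (intro permutation_compose permutation_swap_id) simp
    ultimately show ?case by blast
  qed
  have "alt s {lo..hi} G - smul (of_nat (nperm {lo..hi})) G
    = (\<Sum>\<sigma> | \<sigma> permutes {lo..hi}. smul (of_int (sign \<sigma>)) (act s \<sigma> G) - G)"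
    by (simp only: alt_def sum_subtractf sum_const_smul)
  also have "\<dots> = (\<Sum>\<sigma> | \<sigma> permutes {lo..hi}. smul (of_int (sign \<sigma>)) (act s \<sigma> G - smul (of_int (sign \<sigma>)) G))"
    by (simp only: smul_diff smul_sign_sign)
  also have "\<dots> \<in> tensors \<I>"
    using * by (intro tensors_sum tensors_smul I) auto
  finally show ?thesis .
qed

lemma alt_antisym_op:
  fixes T :: "('n, 's::ring_1) tmat \<Rightarrow> ('n, 's) tmat"
  assumes T: "linear_op T" and anti: "\<And>a G. lo \<le> a \<Longrightarrow> a < hi \<Longrightarrow> T (act s (swp a (Suc a)) G) = - T G"
  shows "T (alt s {lo..hi} G) = smul (of_nat (nperm {lo..hi})) (T G)"
proof -
  have *: "permutation \<sigma> \<and> (\<forall>G. T (act s \<sigma> G) = smul (of_int (sign \<sigma>)) (T G))" if "\<sigma> permutes {lo..hi}" for \<sigma>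
    using that
  proof (induction rule: adjacent_swp_induct)
    case id
    show ?case by (simp only: act_id sign_id of_int_1 smul_1 permutation_id simp_thms)
  next
    case (swp a \<sigma>)
    have "T (act s (swp a (Suc a) \<circ> \<sigma>) G) = smul (of_int (sign (swp a (Suc a) \<circ> \<sigma>))) (T G)" for G
      using swp by (simp add: act_act[symmetric] anti sign_swp_comp smul_uminus)
    moreover have "permutation (swp a (Suc a) \<circ> \<sigma>)"
      using swp by (intro permutation_compose permutation_swap_id) simp
    ultimately show ?case by blast
  qed
  have "T (alt s {lo..hi} G) = (\<Sum>\<sigma> | \<sigma> permutes {lo..hi}. smul (of_int (sign \<sigma>)) (T (act s \<sigma> G)))"
    by (simp only: alt_def linear_op_sum[OF T] linear_op_smul[OF T] central_of_int)
  also have "\<dots> = (\<Sum>\<sigma> | \<sigma> permutes {lo..hi}. T G)"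
    using * by (intro sum.cong) (auto simp: smul_sign_sign)
  finally show ?thesis by (simp only: sum_const_smul)
qed

subsection \<open>Fusion\<close>

text \<open>\<open>1 - P\<close>, the value of \<open>R_bar\<close> at
  \<open>u = - h\<close>.\<close>

definition skew :: "bool \<Rightarrow> nat \<Rightarrow> nat \<Rightarrow> ('n, 's::ring_1) tmat \<Rightarrow> ('n, 's) tmat" where
  "skew s x y G = G - act s (swp x y) G"

lemma linear_op_skew: "linear_op (skew s x y :: ('n, 's::ring_1) tmat \<Rightarrow> _)"
  by (rule linear_opI)
    (simp_all add: skew_def linear_op_add[OF linear_op_act] linear_op_smul[OF linear_op_act] smul_diff
      linear_op_ideal[OF linear_op_act] tensors_diff)

lemma skew_act: "skew s x y (act s (swp x y) G) = - skew s x y G"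
  and act_skew: "act s (swp x y) (skew s x y G) = - skew s x y (G :: ('n, 's::ring_1) tmat)"
  by (simp_all add: skew_def linear_op_diff[OF linear_op_act])

lemma alt_skew: "a \<in> A \<Longrightarrow> b \<in> A \<Longrightarrow> a \<noteq> b \<Longrightarrow> finite A \<Longrightarrow>
    alt s A (skew s a b G) = alt s A G + alt s A (G :: ('n, 's::ring_1) tmat)"
  by (simp add: skew_def linear_op_diff[OF linear_op_alt] alt_swp)

text \<open>
  The Yang--Baxter equation for the factors \<open>d\<^sub>x + t P\<^sub>x\<^sub>p\<close>, \<open>d\<^sub>y + t P\<^sub>y\<^sub>p\<close> and \<open>1 - P\<^sub>x\<^sub>y\<close>.
\<close>

lemma fusion:
  fixes G :: "('n, 's::ring_1) tmat"
  assumes xyp: "x \<noteq> y" "x \<noteq> p" "y \<noteq> p" and t: "central t" and c: "central dx" "central dy" and d: "dx - dy = - t"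
  shows "skew s x y (fac s t (dx, swp x p) (fac s t (dy, swp y p) G))
    = fac s t (dy, swp y p) (fac s t (dx, swp x p) (skew s x y G))"
proof -
  let ?x = "swp x p" and ?y = "swp y p" and ?s = "swp x y"
  let ?E = "\<lambda>\<sigma>. act s \<sigma> G"
  have sx: "?s \<circ> ?x = ?x \<circ> ?y" and sy: "?s \<circ> ?y = ?y \<circ> ?x" and xs: "?x \<circ> ?s = ?y \<circ> ?x" and ys: "?y \<circ> ?s = ?x \<circ> ?y"
    and sxy: "?s \<circ> (?x \<circ> ?y) = ?x" and yxs: "?y \<circ> (?y \<circ> ?x) = ?x"
    using xyp by (auto simp: fun_eq_iff Transposition.transpose_def)
  have ff: "fac s t (d1, \<sigma>) (fac s t (d2, \<rho>) H) = smul (d1 * d2) H + smul (d1 * t) (act s \<rho> H)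
      + (smul (t * d2) (act s \<sigma> H) + smul (t * t) (act s (\<sigma> \<circ> \<rho>) H))"
    if "central d1" "central d2" for d1 d2 \<sigma> \<rho> and H :: "('n, 's) tmat"
    by (simp only: fac_def fst_conv snd_conv linear_op_add[OF linear_op_act]
        linear_op_smul[OF linear_op_act that(2)] linear_op_smul[OF linear_op_act t] smul_add smul_smul act_act)
  have dx: "dx = dy - t" using d by (simp add: algebra_simps)
  have dyt: "t * (dy * z) = dy * (t * z)" for z by (rule central_left_commute[OF c(2)])
  have lhs: "skew s x y (fac s t (dx, ?x) (fac s t (dy, ?y) G)) =
    (smul (dx * dy) G + smul (dx * t) (?E ?y) + (smul (t * dy) (?E ?x) + smul (t * t) (?E (?x \<circ> ?y))))
    - (smul (dx * dy) (?E ?s) + smul (dx * t) (?E (?y \<circ> ?x)) + (smul (t * dy) (?E (?x \<circ> ?y)) + smul (t * t) (?E ?x)))"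
    by (simp only: ff[OF c] skew_def linear_op_add[OF linear_op_act]
        linear_op_smul[OF linear_op_act central_mult[OF c(1) c(2)]]
        linear_op_smul[OF linear_op_act central_mult[OF c(1) t]]
        linear_op_smul[OF linear_op_act central_mult[OF t c(2)]]
        linear_op_smul[OF linear_op_act central_mult[OF t t]] act_act sx sy sxy)
  have rhs: "fac s t (dy, ?y) (fac s t (dx, ?x) (skew s x y G)) =
    (smul (dy * dx) (G - ?E ?s) + smul (dy * t) (?E ?x - ?E (?y \<circ> ?x)))
    + (smul (t * dx) (?E ?y - ?E (?x \<circ> ?y)) + smul (t * t) (?E (?y \<circ> ?x) - ?E ?x))"
    by (simp only: ff[OF c(2) c(1)] skew_def linear_op_diff[OF linear_op_act] act_act comp_assoc xs ys yxs)
  show ?thesis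
    unfolding lhs rhs unfolding dx
    by (simp add: fun_eq_iff smul_def fun_apply left_diff_distrib right_diff_distrib mult.assoc dyt centralD[OF t, of dy]
        distrib_left distrib_right)
qed

text \<open>\<open>1 - P\<close> standing outside the product \<open>fs\<close> can be moved inside
  it, at the price of other factors. Only the existence of the new product enters the absorption of
  antisymmetrizers.\<close>

definition passes :: "bool \<Rightarrow> nat \<Rightarrow> nat \<Rightarrow> 's::ring_1 \<Rightarrow> ('s \<times> (nat \<Rightarrow> nat)) list \<Rightarrow> 'n itself \<Rightarrow> bool" where
  "passes s x y t fs _ \<longleftrightarrow> (\<exists>fs'. \<forall>G :: ('n, 's) tmat. skew s x y (ops s t fs G) = ops s t fs' (skew s x y G))"

lemma passes_append: "passes s x y t fs N \<Longrightarrow> passes s x y t gs N \<Longrightarrow> passes s x y t (fs @ gs) N"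
  unfolding passes_def by (metis ops_append)

lemma passes_concat: "(\<And>fs. fs \<in> set fss \<Longrightarrow> passes s x y t fs N) \<Longrightarrow> passes s x y t (concat fss) N"
proof (induction fss)
  case Nil
  show ?case unfolding passes_def by (rule exI[of _ "[]"]) simp
next
  case (Cons fs fss)
  then show ?case by (simp add: passes_append)
qed

lemma skew_ops_commute:
  fixes G :: "('n, 's::ring_1) tmat"
  assumes t: "central t" and fs: "cfacs fs" and comm: "\<And>f. f \<in> set fs \<Longrightarrow> snd f \<circ> swp x y = swp x y \<circ> snd f"
  shows "skew s x y (ops s t fs G) = ops s t fs (skew s x y G)"
proof -
  have "act s (swp x y) (ops s t fs G) = ops s t fs (act s (swp x y) G)"
    by (rule linear_op_ops_commute[OF linear_op_act t fs]) (simp only: act_act comm)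
  then show ?thesis by (simp only: skew_def linear_op_diff[OF linear_op_ops[OF t fs]])
qed

lemma skew_ops_adjacent:
  fixes G :: "('n, 's::ring_1) tmat"
  assumes t: "central t" and fs: "cfacs fs" "cfacs gs" and xyp: "x \<noteq> y" "x \<noteq> p" "y \<noteq> p"
    and c: "central dx" "central dy" and d: "dx - dy = - t"
    and comm: "\<And>f. f \<in> set fs \<union> set gs \<Longrightarrow> snd f \<circ> swp x y = swp x y \<circ> snd f"
  shows "skew s x y (ops s t (fs @ (dx, swp x p) # (dy, swp y p) # gs) G)
    = ops s t (fs @ (dy, swp y p) # (dx, swp x p) # gs) (skew s x y G)"
proof -
  have 1: "skew s x y (ops s t fs H) = ops s t fs (skew s x y H)" for H :: "('n, 's) tmat"
    by (rule skew_ops_commute[OF t fs(1)]) (simp add: comm)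
  have 2: "skew s x y (ops s t gs H) = ops s t gs (skew s x y H)" for H :: "('n, 's) tmat"
    by (rule skew_ops_commute[OF t fs(2)]) (simp add: comm)
  show ?thesis
    by (simp only: ops_append ops.simps 1 fusion[OF xyp t c d] 2)
qed

lemma smul_double:
  assumes e: "e + e = (1 :: 's::ring_1)" and "X + X = Y + (Y :: ('n, 's) tmat)"
  shows "X = Y"
proof -
  have "smul e X + smul e X = smul e Y + smul e Y" using assms(2) by (simp only: smul_add[symmetric])
  then show ?thesis by (simp only: smul_plus[symmetric] e smul_1)
qed

text \<open>\<open>2 A = A (1 - P)\<close>: the factor \<open>1 - P\<close> is split off the
  antisymmetrizer and moved through \<open>fs\<close>, where it turns the transposition into a sign;
  then it is moved back. The factor \<open>2\<close> is divided out with \<open>e\<close>.\<close>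

lemma alt_ops_swp:
  fixes G :: "('n, 's::ring_1) tmat"
  assumes e: "e + e = (1 :: 's)" and A: "a \<in> A" "b \<in> A" "a \<noteq> b" "finite A" and t: "central t" and fs: "cfacs fs"
    and p: "passes s a b t fs TYPE('n)"
  shows "alt s A (ops s t fs (act s (swp a b) G)) = - alt s A (ops s t fs G)"
proof (rule smul_double[OF e])
  obtain fs' where p: "\<And>G :: ('n, 's) tmat. skew s a b (ops s t fs G) = ops s t fs' (skew s a b G)"
    using p unfolding passes_def by blast
  have "alt s A (ops s t fs (act s (swp a b) G)) + alt s A (ops s t fs (act s (swp a b) G))
    = alt s A (skew s a b (ops s t fs (act s (swp a b) G)))"
    by (simp only: alt_skew[OF A])
  also have "\<dots> = alt s A (ops s t fs' (skew s a b (act s (swp a b) G)))" by (simp only: p)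
  also have "\<dots> = alt s A (ops s t fs' (skew s a b (- G)))"
    by (simp only: skew_act linear_op_minus[OF linear_op_skew])
  also have "\<dots> = alt s A (skew s a b (ops s t fs (- G)))" by (simp only: p)
  also have "\<dots> = alt s A (ops s t fs (- G)) + alt s A (ops s t fs (- G))" by (simp only: alt_skew[OF A])
  also have "\<dots> = - alt s A (ops s t fs G) + - alt s A (ops s t fs G)"
    by (simp only: linear_op_minus[OF linear_op_ops[OF t fs]] linear_op_minus[OF linear_op_alt])
  finally show "alt s A (ops s t fs (act s (swp a b) G)) + alt s A (ops s t fs (act s (swp a b) G))
    = - alt s A (ops s t fs G) + - alt s A (ops s t fs G)" .
qed

lemma alt_ops_alt:
  fixes G :: "('n, 's::ring_1) tmat"
  assumes e: "e + e = (1 :: 's)" and t: "central t" and fs: "cfacs fs"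
    and p: "\<And>a. lo \<le> a \<Longrightarrow> a < hi \<Longrightarrow> passes s a (Suc a) t fs TYPE('n)"
  shows "alt s {lo..hi} (ops s t fs (alt s {lo..hi} G)) = smul (of_nat (nperm {lo..hi})) (alt s {lo..hi} (ops s t fs G))"
  by (rule alt_antisym_op[OF linear_op_comp[OF linear_op_alt linear_op_ops[OF t fs]]])
    (rule alt_ops_swp[OF e _ _ _ _ t fs p], auto)

text \<open>Mirror image of \<open>alt_ops_alt\<close>: \<open>1 - P\<close> is split off the inner
  antisymmetrizer and moved outwards, so that the outer antisymmetrizer is absorbed and the inner
  one stays. In \<open>crossed_trace\<close> an antisymmetrizer outside the
  \<open>R\<close>-matrices is removed in this way.\<close>

lemma alt_ops_alt':
  fixes G :: "('n, 's::ring_1) tmat"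
  assumes e: "e + e = (1 :: 's)" and t: "central t" and fs: "cfacs fs"
    and p: "\<And>a. lo \<le> a \<Longrightarrow> a < hi \<Longrightarrow> \<exists>fs'. \<forall>G :: ('n, 's) tmat. skew s a (Suc a) (ops s t fs' G) = ops s t fs (skew s a (Suc a) G)"
  shows "alt s {lo..hi} (ops s t fs (alt s {lo..hi} G)) = smul (of_nat (nperm {lo..hi})) (ops s t fs (alt s {lo..hi} G))"
proof -
  let ?H = "ops s t fs (alt s {lo..hi} G)"
  have "act s (swp a (Suc a)) ?H = - ?H" if a: "lo \<le> a" "a < hi" for a
  proof (rule smul_double[OF e])
    obtain fs' where p: "\<And>G :: ('n, 's) tmat. skew s a (Suc a) (ops s t fs' G) = ops s t fs (skew s a (Suc a) G)"
      using p[OF a] by blast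
    have aa: "act s (swp a (Suc a)) (alt s {lo..hi} G) = - alt s {lo..hi} G"
    proof -
      have sw: "swp a (Suc a) permutes {lo..hi}" using a by (intro swp_permutes) auto
      have "act s (swp a (Suc a)) (alt s {lo..hi} G)
        = (\<Sum>\<sigma> | \<sigma> permutes {lo..hi}. smul (of_int (sign \<sigma>)) (act s (swp a (Suc a) \<circ> \<sigma>) G))"
        by (simp only: alt_def linear_op_sum[OF linear_op_act] linear_op_smul[OF linear_op_act] central_of_int act_act)
      also have "\<dots> = (\<Sum>\<sigma> | \<sigma> permutes {lo..hi}. smul (of_int (sign (swp a (Suc a) \<circ> \<sigma>))) (act s \<sigma> G))"
      proof (rule sum.reindex_bij_witness[of _ "\<lambda>\<sigma>. swp a (Suc a) \<circ> \<sigma>" "\<lambda>\<sigma>. swp a (Suc a) \<circ> \<sigma>"])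
        fix \<sigma> assume "\<sigma> \<in> {\<sigma>. \<sigma> permutes {lo..hi}}"
        then show "swp a (Suc a) \<circ> \<sigma> \<in> {\<sigma>. \<sigma> permutes {lo..hi}}" by (simp add: permutes_compose[OF _ sw])
        show "swp a (Suc a) \<circ> (swp a (Suc a) \<circ> \<sigma>) = \<sigma>" by (simp add: comp_assoc[symmetric])
        then show "smul (of_int (sign (swp a (Suc a) \<circ> (swp a (Suc a) \<circ> \<sigma>)))) (act s (swp a (Suc a) \<circ> \<sigma>) G)
          = smul (of_int (sign \<sigma>)) (act s (swp a (Suc a) \<circ> \<sigma>) G)" by (simp only:)
      qed (use sw permutes_compose in \<open>auto simp: comp_assoc[symmetric]\<close>)
      also have "\<dots> = (\<Sum>\<sigma> | \<sigma> permutes {lo..hi}. - smul (of_int (sign \<sigma>)) (act s \<sigma> G))"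
        by (intro sum.cong) (auto simp: sign_swp_comp permutes_finite_permutation[OF finite_atLeastAtMost] smul_uminus)
      finally show ?thesis by (simp only: sum_negf alt_def)
    qed
    have "skew s a (Suc a) (alt s {lo..hi} G) = alt s {lo..hi} G + alt s {lo..hi} G"
      by (simp add: skew_def aa)
    then have H: "?H + ?H = skew s a (Suc a) (ops s t fs' (alt s {lo..hi} G))"
      by (simp only: p linear_op_add[OF linear_op_ops[OF t fs]])
    have "act s (swp a (Suc a)) ?H + act s (swp a (Suc a)) ?H = act s (swp a (Suc a)) (?H + ?H)"
      by (simp only: linear_op_add[OF linear_op_act])
    also have "\<dots> = - (?H + ?H)" by (simp only: H act_skew)
    finally show "act s (swp a (Suc a)) ?H + act s (swp a (Suc a)) ?H = - ?H + - ?H"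
      by (simp only: minus_add_distrib)
  qed
  \<comment> \<open>An equality is a congruence modulo the zero ideal, so \<open>alt_antisym\<close>
    applies.\<close>
  then have "alt s {lo..hi} ?H - smul (of_nat (nperm {lo..hi})) ?H \<in> tensors {0}"
    by (intro alt_antisym left_ideal_singleton_0) (simp add: tensors_singleton_0)
  then show ?thesis by (simp only: tensors_singleton_0 right_minus_eq)
qed

subsection \<open>Traces\<close>

text \<open>The partial trace over position \<open>a\<close>. The result is still indexed by all
  positions, but constant in position \<open>a\<close>.\<close>

definition pt :: "nat \<Rightarrow> ('n::finite, 's::ring_1) tmat \<Rightarrow> ('n, 's) tmat" where
  "pt a G = (\<lambda>I J. \<Sum>x\<in>UNIV. G (I(a := x)) (J(a := x)))"

primrec ptr :: "nat list \<Rightarrow> ('n::finite, 's::ring_1) tmat \<Rightarrow> ('n, 's) tmat" where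
  "ptr [] G = G"
| "ptr (a # as) G = pt a (ptr as G)"

lemma linear_op_pt: "linear_op (pt a :: ('n::finite, 's::ring_1) tmat \<Rightarrow> _)"
  by (rule linear_opI)
    (simp_all add: pt_def smul_def fun_eq_iff plus_fun_apply sum.distrib sum_distrib_left tensors_def left_ideal_sum)

lemma linear_op_ptr: "linear_op (ptr as :: ('n::finite, 's::ring_1) tmat \<Rightarrow> _)"
proof (induction as)
  case Nil
  have "ptr [] = (\<lambda>G :: ('n, 's) tmat. G)" by (rule ext) simp
  then show ?case by (simp only: linear_op_id)
next
  case (Cons a as)
  have "ptr (a # as) = (\<lambda>G :: ('n, 's) tmat. pt a (ptr as G))" by (rule ext) simp
  with linear_op_comp[OF linear_op_pt Cons] show ?case by (simp only:)
qed

lemma pt_pt: "pt a (pt b G) = pt b (pt a G)"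
proof (cases "a = b")
  case False
  then show ?thesis
    unfolding pt_def by (subst sum.swap) (simp add: fun_upd_twist[OF False])
qed simp

lemma ptr_append: "ptr (as @ bs) G = ptr as (ptr bs G)"
  by (induction as) simp_all

lemma ptr_remove1: "a \<in> set as \<Longrightarrow> ptr as G = pt a (ptr (remove1 a as) G)"
  by (induction as) (auto simp: pt_pt)

lemma pt_act_swp:
  assumes "c \<noteq> a" "c \<noteq> b"
  shows "pt c (act s (swp a b) G) = act s (swp a b) (pt c G)"
proof -
  have "I(c := x) \<circ> swp a b = (I \<circ> swp a b)(c := x)" for I :: "nat \<Rightarrow> 'a" and x
    using assms by (auto simp: fun_eq_iff Transposition.transpose_def)
  then show ?thesis by (cases s) (simp_all add: pt_def act_def)
qed

lemma ptr_act_swp: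
  assumes "a \<notin> set as" "b \<notin> set as"
  shows "ptr as (act s (swp a b) G) = act s (swp a b) (ptr as G)"
  using assms
proof (induction as)
  case (Cons c as)
  then have "c \<noteq> a" "c \<noteq> b" by auto
  with Cons show ?case by (simp add: pt_act_swp)
qed simp

text \<open>The entries of \<open>G\<close> need not commute, so cyclicity of the trace is used for
  operators with central entries only. For a transposition of two traced positions it is a renaming
  of the summation variables.\<close>

lemma pt_pt_cyclic:
  assumes "a \<noteq> b"
  shows "pt a (pt b (act True (swp a b) G)) = pt a (pt b (act False (swp a b) G))"
proof -
  have *: "I(a := x, b := y) \<circ> swp a b = I(a := y, b := x)" for I :: "nat \<Rightarrow> 'a" and x y
    using assms by (auto simp: fun_eq_iff Transposition.transpose_def)
  have "(\<Sum>x\<in>UNIV. \<Sum>y\<in>UNIV. G (I(a := x, b := y) \<circ> swp a b) (J(a := x, b := y)))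
    = (\<Sum>x\<in>UNIV. \<Sum>y\<in>UNIV. G (I(a := x, b := y)) (J(a := x, b := y) \<circ> swp a b))" for I J
    unfolding * by (rule sum.swap)
  then show ?thesis by (simp only: pt_def act_def if_True if_False)
qed

lemma ptr_cyclic_swp:
  assumes "distinct as" "a \<in> set as" "b \<in> set as" "a \<noteq> b"
  shows "ptr as (act True (swp a b) G) = ptr as (act False (swp a b) G)"
proof -
  have b: "b \<in> set (remove1 a as)" using assms by simp
  let ?r = "remove1 b (remove1 a as)"
  have r: "a \<notin> set ?r" "b \<notin> set ?r" using assms by auto
  show ?thesis
    by (simp only: ptr_remove1[OF assms(2)] ptr_remove1[OF b] ptr_act_swp[OF r] pt_pt_cyclic[OF assms(4)])
qed

text \<open>The inverse appears because \<open>act False\<close> multiplies by the inverse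
  permutation.\<close>

lemma ptr_cyclic_perm:
  assumes as: "distinct as" and "finite A" and A: "A \<subseteq> set as" and \<sigma>: "\<sigma> permutes A"
  shows "ptr as (act True \<sigma> G) = ptr as (act False (inv \<sigma>) G)"
  using \<sigma> \<open>finite A\<close>
proof (induction arbitrary: G rule: permutes_induct)
  case id
  show ?case by (simp only: act_id inv_id)
next
  case (swap a b p)
  have "ptr as (act True (swp a b \<circ> p) G) = ptr as (act True (swp a b) (act True p G))"
    by (simp only: act_act)
  also have "\<dots> = ptr as (act False (swp a b) (act True p G))"
    using swap A by (intro ptr_cyclic_swp as) auto
  also have "\<dots> = ptr as (act True p (act False (swp a b) G))"
    by (simp only: act_commute_sides)
  also have "\<dots> = ptr as (act False (inv p \<circ> swp a b) G)"
    by (simp only: swap.IH act_act)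
  also have "inv p \<circ> swp a b = inv (swp a b \<circ> p)"
    using swap by (simp add: o_inv_distrib permutes_bij)
  finally show ?case .
qed

lemma ptr_cyclic_alt:
  fixes G :: "('n::finite, 's::ring_1) tmat"
  assumes as: "distinct as" and fA: "finite A" and A: "A \<subseteq> set as"
  shows "ptr as (alt True A G) = ptr as (alt False A G)"
proof -
  have "ptr as (alt True A G) = (\<Sum>\<sigma> | \<sigma> permutes A. smul (of_int (sign \<sigma>)) (ptr as (act True \<sigma> G)))"
    by (simp only: alt_def linear_op_sum[OF linear_op_ptr] linear_op_smul[OF linear_op_ptr] central_of_int)
  also have "\<dots> = (\<Sum>\<sigma> | \<sigma> permutes A. smul (of_int (sign (inv \<sigma>))) (ptr as (act False (inv \<sigma>) G)))"
    by (intro sum.cong refl)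
      (simp add: ptr_cyclic_perm[OF as fA A] sign_inverse permutes_finite_permutation[OF fA])
  also have "\<dots> = (\<Sum>\<sigma> | \<sigma> permutes A. smul (of_int (sign \<sigma>)) (ptr as (act False \<sigma> G)))"
    by (rule sum.reindex_bij_witness[of _ inv inv]) (auto simp: permutes_inv permutes_inv_inv)
  also have "\<dots> = ptr as (alt False A G)"
    by (simp only: alt_def linear_op_sum[OF linear_op_ptr] linear_op_smul[OF linear_op_ptr] central_of_int)
  finally show ?thesis .
qed

lemma ptr_cyclic_fac:
  assumes "distinct as" "a \<in> set as" "b \<in> set as" "a \<noteq> b" "central t" "central d"
  shows "ptr as (fac True t (d, swp a b) G) = ptr as (fac False t (d, swp a b) G)"
  by (simp only: fac_def fst_conv snd_conv linear_op_add[OF linear_op_ptr]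
      linear_op_smul[OF linear_op_ptr assms(5)] ptr_cyclic_swp[OF assms(1-4)])

text \<open>Factors are taken around the trace one at a time, the outermost first; it ends up
  innermost on the other side, which reverses the order.\<close>

lemma ptr_cyclic_ops:
  assumes as: "distinct as" and t: "central t"
    and fs: "\<And>f. f \<in> set fs \<Longrightarrow> \<exists>a b. a \<in> set as \<and> b \<in> set as \<and> a \<noteq> b \<and> snd f = swp a b" and c: "cfacs fs"
  shows "ptr as (ops False t fs G) = ptr as (ops True t (rev fs) G)"
  using fs c
proof (induction fs arbitrary: G)
  case (Cons f fs)
  obtain a b where ab: "a \<in> set as" "b \<in> set as" "a \<noteq> b" "snd f = swp a b"
    using Cons.prems(1)[of f] by auto
  then have f: "f = (fst f, swp a b)" by (metis prod.collapse)
  have cf: "central (fst f)" "cfacs fs" using Cons.prems by auto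
  have "ptr as (ops False t (f # fs) G) = ptr as (fac True t f (ops False t fs G))"
    using ptr_cyclic_fac[OF as ab(1-3) t cf(1), of "ops False t fs G"] f by simp
  also have "\<dots> = ptr as (ops False t fs (fac True t f G))"
    using ops_sides_commute[of t "[f]" t fs G] t cf by simp
  also have "\<dots> = ptr as (ops True t (rev fs) (fac True t f G))"
    by (rule Cons.IH) (use Cons.prems in auto)
  finally show ?case by (simp add: ops_append)
qed simp

lemma pt_const:
  "(\<And>I J x y. G (I(a := x)) (J(a := y)) = G I J) \<Longrightarrow> pt a (\<lambda>I J. G I J * H I J) = (\<lambda>I J. G I J * pt a H I J)"
  by (simp add: pt_def fun_eq_iff sum_distrib_left)

lemma ptr_const:
  assumes "\<And>I J a x y. a \<in> set as \<Longrightarrow> G (I(a := x)) (J(a := y)) = G I J"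
  shows "ptr as (\<lambda>I J. G I J * H I J) = (\<lambda>I J. G I J * ptr as H I J)"
  using assms by (induction as) (simp_all add: pt_const)

lemma ptr_const_right:
  assumes "\<And>I J a x y. a \<in> set as \<Longrightarrow> G (I(a := x)) (J(a := y)) = G I J"
  shows "ptr as (\<lambda>I J. H I J * G I J) = (\<lambda>I J. ptr as H I J * G I J)"
  using assms by (induction as) (simp_all add: pt_def fun_eq_iff sum_distrib_right)

subsection \<open>Products of generating matrices\<close>

text \<open>For matrices placed at distinct positions, an entry of the product is a product of
  single entries. The list keeps the order of multiplication, which matters in a noncommutative
  ring.\<close>

definition word :: "(nat \<Rightarrow> 'n \<Rightarrow> 'n \<Rightarrow> 's) \<Rightarrow> nat list \<Rightarrow> ('n, 's::ring_1) tmat" where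
  "word L xs = (\<lambda>I J. prod_list (map (\<lambda>a. L a (I a) (J a)) xs))"

lemma word_append: "word L (xs @ ys) I J = word L xs I J * word L ys I J"
  and word_Cons: "word L (a # xs) I J = L a (I a) (J a) * word L xs I J"
  and word_Nil: "word L [] I J = 1"
  by (simp_all add: word_def)

lemma word_cong: "(\<And>a. a \<in> set xs \<Longrightarrow> I a = I' a) \<Longrightarrow> (\<And>a. a \<in> set xs \<Longrightarrow> J a = J' a) \<Longrightarrow> word L xs I J = word L xs I' J'"
  unfolding word_def by (intro arg_cong[where f = prod_list] map_cong) auto

text \<open>The entries of \<open>(d + t P) X_1 Y_2 = Y_2 X_1 (d + t P)\<close> modulo the
  ideal.\<close>

definition exchange :: "'s::ring_1 set \<Rightarrow> 's \<Rightarrow> 's \<Rightarrow> ('n \<Rightarrow> 'n \<Rightarrow> 's) \<Rightarrow> ('n \<Rightarrow> 'n \<Rightarrow> 's) \<Rightarrow> bool" where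
  "exchange \<I> d t X Y \<longleftrightarrow> (\<forall>i j k l.
     d * (X i j * Y k l - Y k l * X i j) + t * (X k j * Y i l - Y k j * X i l) \<in> \<I>)"

lemma word_exchange:
  assumes I: "two_sided_ideal \<I>" and d: "central d" and t: "central t"
    and ab: "a \<noteq> b" "a \<notin> set xs" "b \<notin> set xs" "a \<notin> set ys" "b \<notin> set ys"
    and rel: "exchange \<I> d t (L a) (L b)"
  shows "fac True t (d, swp a b) (word L (xs @ a # b # ys)) - fac False t (d, swp a b) (word L (xs @ b # a # ys)) \<in> tensors \<I>"
proof (rule tensorsI)
  fix I J
  let ?X = "word L xs I J" and ?Y = "word L ys I J"
  have w: "word L xs (I \<circ> swp a b) J = ?X" "word L xs I (J \<circ> swp a b) = ?X"
    "word L ys (I \<circ> swp a b) J = ?Y" "word L ys I (J \<circ> swp a b) = ?Y"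
    using ab by (auto intro!: word_cong simp: Transposition.transpose_def)
  have "(fac True t (d, swp a b) (word L (xs @ a # b # ys)) - fac False t (d, swp a b) (word L (xs @ b # a # ys))) I J
    = d * (?X * (L a (I a) (J a) * (L b (I b) (J b) * ?Y))) + t * (?X * (L a (I b) (J a) * (L b (I a) (J b) * ?Y)))
      - (d * (?X * (L b (I b) (J b) * (L a (I a) (J a) * ?Y))) + t * (?X * (L b (I b) (J a) * (L a (I a) (J b) * ?Y))))"
    by (simp add: minus_apply fac_def smul_def plus_fun_apply act_def word_append word_Cons w)
  also have "\<dots> = ?X * (d * (L a (I a) (J a) * L b (I b) (J b) - L b (I b) (J b) * L a (I a) (J a))
      + t * (L a (I b) (J a) * L b (I a) (J b) - L b (I b) (J a) * L a (I a) (J b))) * ?Y"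
    by (simp add: distrib_left distrib_right left_diff_distrib right_diff_distrib mult.assoc
        central_left_commute[OF d, of ?X] central_left_commute[OF t, of ?X])
  also have "\<dots> \<in> \<I>"
    using rel unfolding exchange_def by (intro two_sided_mult_right I left_ideal_mult two_sided_left) blast
  finally show "(fac True t (d, swp a b) (word L (xs @ a # b # ys)) - fac False t (d, swp a b) (word L (xs @ b # a # ys))) I J \<in> \<I>" .
qed

lemma fac_skew: "fac s (- 1) (1, swp a b) G = skew s a b (G :: ('n, 's::ring_1) tmat)"
  by (simp add: fac_def skew_def smul_uminus)

lemma tensors_half:
  fixes G :: "('n, 's::ring_1) tmat"
  assumes e: "e + e = (1 :: 's)" and I: "left_ideal \<I>" and G: "G + G \<in> tensors \<I>"
  shows "G \<in> tensors \<I>"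
proof -
  have "smul e (G + G) \<in> tensors \<I>" by (rule tensors_smul[OF I G])
  also have "smul e (G + G) = G" by (simp only: smul_add smul_plus[symmetric] e smul_1)
  finally show ?thesis .
qed

text \<open>The fusion procedure. Modulo the ideal \<open>(1 - P) w = w' (1 - P)\<close>, where
  \<open>w'\<close> has the letters \<open>a\<close> and \<open>Suc a\<close> interchanged.
  Multiplying by \<open>A\<close> on the left gives \<open>2 A w = A w' (1 - P)\<close>, so
  \<open>A w\<close> changes sign under right multiplication by \<open>P\<close>.\<close>

lemma word_antisym:
  fixes L :: "nat \<Rightarrow> 'n \<Rightarrow> 'n \<Rightarrow> 's::ring_1"
  assumes I: "two_sided_ideal \<I>" and e: "e + e = (1 :: 's)" and ws: "distinct ws"
    and adj: "\<And>a. lo \<le> a \<Longrightarrow> a < hi \<Longrightarrow> \<exists>xs ys. ws = xs @ a # Suc a # ys"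
    and rel: "\<And>a. lo \<le> a \<Longrightarrow> a < hi \<Longrightarrow> exchange \<I> 1 (- 1) (L a) (L (Suc a))"
  shows "alt False {lo..hi} (alt True {lo..hi} (word L ws))
    - smul (of_nat (nperm {lo..hi})) (alt True {lo..hi} (word L ws)) \<in> tensors \<I>"
proof (rule alt_antisym[OF two_sided_left[OF I]])
  fix a assume a: "lo \<le> a" "a < hi"
  note LI = two_sided_left[OF I]
  let ?A = "alt True {lo..hi} :: ('n, 's) tmat \<Rightarrow> _" and ?t = "swp a (Suc a)"
  obtain xs ys where w: "ws = xs @ a # Suc a # ys" using adj[OF a] by blast
  let ?w' = "word L (xs @ Suc a # a # ys)"
  have "skew True a (Suc a) (word L ws) - skew False a (Suc a) ?w' \<in> tensors \<I>"
    using word_exchange[OF I central_1 central_minus[OF central_1] _ _ _ _ _ rel[OF a], of xs ys] ws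
    by (simp add: w fac_skew)
  then have "?A (skew True a (Suc a) (word L ws)) - ?A (skew False a (Suc a) ?w') \<in> tensors \<I>"
    by (rule linear_op_cong[OF linear_op_alt LI])
  also have "?A (skew True a (Suc a) (word L ws)) = ?A (word L ws) + ?A (word L ws)"
    using a by (intro alt_skew) auto
  also have "?A (skew False a (Suc a) ?w') = skew False a (Suc a) (?A ?w')"
    by (simp only: skew_def linear_op_diff[OF linear_op_alt] alt_act_other_side)
  finally have *: "?A (word L ws) + ?A (word L ws) - skew False a (Suc a) (?A ?w') \<in> tensors \<I>" .
  have "act False ?t (?A (word L ws) + ?A (word L ws)) - act False ?t (skew False a (Suc a) (?A ?w')) \<in> tensors \<I>"
    by (rule linear_op_cong[OF linear_op_act LI *])
  from tensors_add[OF LI * this]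
  have "(act False ?t (?A (word L ws)) + ?A (word L ws)) + (act False ?t (?A (word L ws)) + ?A (word L ws)) \<in> tensors \<I>"
    by (simp add: act_skew linear_op_add[OF linear_op_act] algebra_simps)
  then show "act False ?t (?A (word L ws)) + ?A (word L ws) \<in> tensors \<I>"
    by (rule tensors_half[OF e LI])
qed

subsection \<open>Commuting traces\<close>

lemma swp_commute_disjoint: "{a, b} \<inter> {c, d} = {} \<Longrightarrow> swp a b \<circ> swp c d = swp c d \<circ> swp a b"
  by (auto simp: fun_eq_iff Transposition.transpose_def)

lemma permutes_commute_disjoint:
  assumes "\<sigma> permutes A" "\<rho> permutes B" "A \<inter> B = {}"
  shows "\<sigma> \<circ> \<rho> = \<rho> \<circ> \<sigma>"
proof
  fix x
  consider "x \<in> A" "x \<notin> B" | "x \<in> B" "x \<notin> A" | "x \<notin> A" "x \<notin> B" using assms by blast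
  then show "(\<sigma> \<circ> \<rho>) x = (\<rho> \<circ> \<sigma>) x"
  proof cases
    case 1
    then have "\<sigma> x \<in> A" using assms by (simp add: permutes_in_image)
    then have "\<sigma> x \<notin> B" using assms by blast
    with 1 show ?thesis using assms by (simp add: permutes_not_in)
  next
    case 2
    then have "\<rho> x \<in> B" using assms by (simp add: permutes_in_image)
    then have "\<rho> x \<notin> A" using assms by blast
    with 2 show ?thesis using assms by (simp add: permutes_not_in)
  next
    case 3
    with assms show ?thesis by (simp add: permutes_not_in)
  qed
qed

text \<open>Factors at positions other than \<open>x\<close> and \<open>y\<close> commute with the
  transposition of \<open>x\<close> and \<open>y\<close>, and the two neighbouring factors are
  exchanged by \<open>fusion\<close>.\<close>

lemma passes_adjacent:
  fixes c :: "nat \<Rightarrow> 's::ring_1"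
  assumes t: "central t" and c: "\<And>a. central (c a)" and ws: "distinct ws" "p \<notin> set ws" "ws = xs @ x # y # ys"
    and d: "c x - c y = - t"
  shows "passes s x y t (map (\<lambda>a. (c a, swp a p)) ws) TYPE('n)"
  unfolding passes_def
proof (intro exI allI)
  let ?m = "map (\<lambda>a. (c a, swp a p))"
  fix G :: "('n, 's) tmat"
  have cf: "cfacs (?m zs)" for zs by (auto simp: cfacs_def c)
  have xyp: "x \<noteq> y" "x \<noteq> p" "y \<noteq> p" using ws by auto
  have "snd f \<circ> swp x y = swp x y \<circ> snd f" if f: "f \<in> set (?m xs) \<union> set (?m ys)" for f
  proof -
    obtain a where "a \<in> set xs \<union> set ys" "f = (c a, swp a p)" using f by auto
    then show ?thesis using ws by (auto intro!: swp_commute_disjoint simp del: comp_apply)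
  qed
  from skew_ops_adjacent[OF t cf cf xyp c c d this, where s = s and G = G]
  show "skew s x y (ops s t (?m ws) G)
    = ops s t (?m xs @ (c y, swp y p) # (c x, swp x p) # ?m ys) (skew s x y G)"
    by (simp add: ws(3))
qed

lemma passes_sym: "passes s x y t fs N = passes s y x t fs N"
  by (simp add: passes_def skew_def transpose_commute)

lemma passes_cong:
  fixes fs gs :: "('s::ring_1 \<times> (nat \<Rightarrow> nat)) list"
  assumes "\<And>G :: ('n, 's) tmat. ops s t fs G = ops s t gs G" "passes s x y t gs TYPE('n)"
  shows "passes s x y t fs TYPE('n)"
  using assms unfolding passes_def by simp

text \<open>The factors \<open>d a b + t P_ab\<close> that arise when a block of positions
  \<open>as\<close> is interchanged with a block \<open>bs\<close>.\<close>

definition grid :: "(nat \<Rightarrow> nat \<Rightarrow> 's) \<Rightarrow> nat list \<Rightarrow> nat list \<Rightarrow> ('s \<times> (nat \<Rightarrow> nat)) list" where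
  "grid d as bs = concat (map (\<lambda>a. map (\<lambda>b. (d a b, swp a b)) bs) as)"

lemma rev_grid: "rev (grid d as bs) = grid d (rev as) (rev bs)"
  by (induction as) (simp_all add: grid_def rev_map)

lemma grid_Cons: "grid d (a # as) bs = map (\<lambda>b. (d a b, swp a b)) bs @ grid d as bs"
  by (simp add: grid_def)

lemma cfacs_grid: "(\<And>a b. central (d a b)) \<Longrightarrow> cfacs (grid d as bs)"
  by (auto simp: grid_def cfacs_def)

lemma grid_mem: "f \<in> set (grid d as bs) \<Longrightarrow> \<exists>a\<in>set as. \<exists>b\<in>set bs. f = (d a b, swp a b)"
  by (auto simp: grid_def)

lemma passes_grid_rows:
  fixes d :: "nat \<Rightarrow> nat \<Rightarrow> 's::ring_1"
  assumes t: "central t" and c: "\<And>a b. central (d a b)" and bs: "distinct bs" "set as \<inter> set bs = {}" "bs = xs @ x # y # ys"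
    and d: "\<And>a. a \<in> set as \<Longrightarrow> d a x - d a y = - t"
  shows "passes s x y t (grid d as bs) TYPE('n)"
  unfolding grid_def
proof (rule passes_concat)
  fix fs assume "fs \<in> set (map (\<lambda>a. map (\<lambda>b. (d a b, swp a b)) bs) as)"
  then obtain a where a: "a \<in> set as" "fs = map (\<lambda>b. (d a b, swp b a)) bs"
    by (auto simp: transpose_commute)
  have "passes s x y t (map (\<lambda>b. (d a b, swp b a)) bs) TYPE('n)"
    by (rule passes_adjacent[OF t c bs(1) _ bs(3) d[OF a(1)]]) (use bs a in auto)
  then show "passes s x y t fs TYPE('n)" by (simp only: a(2))
qed

text \<open>In row order the factors of \<open>x\<close> and \<open>y\<close> with the same
  \<open>b\<close> are not neighbours. \<open>ops_grid\<close> first brings the product into column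
  order, where \<open>fusion\<close> applies inside each column.\<close>

lemma passes_grid_columns:
  fixes d :: "nat \<Rightarrow> nat \<Rightarrow> 's::ring_1"
  assumes t: "central t" and c: "\<And>a b. central (d a b)" and as: "distinct as" "distinct bs" "set as \<inter> set bs = {}" "as = xs @ x # y # ys"
    and d: "\<And>b. b \<in> set bs \<Longrightarrow> d x b - d y b = - t"
  shows "passes s x y t (grid d as bs) TYPE('n)"
proof (rule passes_cong)
  show "passes s x y t (concat (map (\<lambda>b. map (\<lambda>a. (d a b, swp a b)) as) bs)) TYPE('n)"
  proof (rule passes_concat)
    fix fs assume "fs \<in> set (map (\<lambda>b. map (\<lambda>a. (d a b, swp a b)) as) bs)"
    then obtain b where b: "b \<in> set bs" "fs = map (\<lambda>a. (d a b, swp a b)) as" by auto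
    have "passes s x y t (map (\<lambda>a. (d a b, swp a b)) as) TYPE('n)"
      by (rule passes_adjacent[OF t c as(1) _ as(4) d[OF b(1)]]) (use as b in auto)
    then show "passes s x y t fs TYPE('n)" by (simp only: b(2))
  qed
  show "ops s t (grid d as bs) G = ops s t (concat (map (\<lambda>b. map (\<lambda>a. (d a b, swp a b)) as) bs)) G" for G :: "('n, 's) tmat"
    unfolding grid_def
    by (rule ops_grid[OF t _ _ as(1,2)]) (use as(3) in \<open>auto simp: c intro!: swp_commute_disjoint simp del: comp_apply\<close>)
qed

lemma prod_list_rev_central:
  "(\<And>x. x \<in> set xs \<Longrightarrow> central (f x)) \<Longrightarrow> prod_list (map f (rev xs)) = prod_list (map f xs :: 's::ring_1 list)"
proof (induction xs)
  case (Cons x xs)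
  then have "central (f x)" by simp
  with Cons show ?case by (simp add: centralD)
qed simp

text \<open>The letter \<open>a\<close> is carried to the right over \<open>bs\<close>, one letter
  at a time. The factor of the first letter met is innermost on the left side and outermost on the
  right side, whence \<open>rev bs\<close> on the left side only.\<close>

lemma word_row:
  fixes L :: "nat \<Rightarrow> 'n \<Rightarrow> 'n \<Rightarrow> 's::ring_1"
  assumes I: "two_sided_ideal \<I>" and d: "\<And>a b. central (d a b)" and t: "central t"
    and rel: "\<And>b. b \<in> set bs \<Longrightarrow> exchange \<I> (d a b) t (L a) (L b)"
    and dist: "distinct (xs @ a # bs @ ys)"
  shows "ops True t (map (\<lambda>b. (d a b, swp a b)) (rev bs)) (word L (xs @ a # bs @ ys))
    - ops False t (map (\<lambda>b. (d a b, swp a b)) bs) (word L (xs @ bs @ a # ys)) \<in> tensors \<I>"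
  using rel dist
proof (induction bs arbitrary: xs)
  case Nil
  then show ?case using tensors_0[OF two_sided_left[OF I]] by simp
next
  case (Cons b bs)
  note LI = two_sided_left[OF I]
  let ?P = "map (\<lambda>b. (d a b, swp a b))"
  have cf: "cfacs (?P bs)" for bs by (auto simp: cfacs_def d)
  have "fac True t (d a b, swp a b) (word L (xs @ a # b # (bs @ ys))) - fac False t (d a b, swp a b) (word L (xs @ b # a # (bs @ ys))) \<in> tensors \<I>"
    by (rule word_exchange[OF I d t]) (use Cons.prems in auto)
  from linear_op_cong[OF linear_op_ops[OF t cf] LI this, of True "rev bs"]
  have 1: "ops True t (?P (rev (b # bs))) (word L (xs @ a # (b # bs) @ ys))
      - ops True t (?P (rev bs)) (fac False t (d a b, swp a b) (word L (xs @ b # a # bs @ ys))) \<in> tensors \<I>"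
    by (simp add: ops_append)
  have "ops True t (?P (rev bs)) (word L ((xs @ [b]) @ a # bs @ ys)) - ops False t (?P bs) (word L ((xs @ [b]) @ bs @ a # ys)) \<in> tensors \<I>"
    by (rule Cons.IH) (use Cons.prems in auto)
  then have "fac False t (d a b, swp a b) (ops True t (?P (rev bs)) (word L (xs @ b # a # bs @ ys)))
      - fac False t (d a b, swp a b) (ops False t (?P bs) (word L (xs @ (b # bs) @ a # ys))) \<in> tensors \<I>"
    by (intro linear_op_cong[OF linear_op_fac[OF t] LI]) (simp_all add: d)
  moreover have "fac False t (d a b, swp a b) (ops True t (?P (rev bs)) H) = ops True t (?P (rev bs)) (fac False t (d a b, swp a b) H)" for H :: "('n, 's) tmat"
    using ops_sides_commute[OF t cf t, of "[(d a b, swp a b)]" "rev bs" H] by (simp add: d)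
  ultimately have 2: "ops True t (?P (rev bs)) (fac False t (d a b, swp a b) (word L (xs @ b # a # bs @ ys)))
      - ops False t (?P (b # bs)) (word L (xs @ (b # bs) @ a # ys)) \<in> tensors \<I>" by simp
  show ?case by (rule tensors_trans[OF LI 1 2])
qed

lemma word_block:
  fixes L :: "nat \<Rightarrow> 'n \<Rightarrow> 'n \<Rightarrow> 's::ring_1"
  assumes I: "two_sided_ideal \<I>" and d: "\<And>a b. central (d a b)" and t: "central t"
    and rel: "\<And>a b. a \<in> set as \<Longrightarrow> b \<in> set bs \<Longrightarrow> exchange \<I> (d a b) t (L a) (L b)"
    and dist: "distinct (xs @ as @ bs @ ys)"
  shows "ops True t (grid d as (rev bs)) (word L (xs @ as @ bs @ ys))
    - ops False t (rev (grid d as (rev bs))) (word L (xs @ bs @ as @ ys)) \<in> tensors \<I>"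
  using rel dist
proof (induction as arbitrary: xs)
  case Nil
  then show ?case using tensors_0[OF two_sided_left[OF I]] by (simp add: grid_def)
next
  case (Cons a as)
  note LI = two_sided_left[OF I]
  let ?P = "map (\<lambda>b. (d a b, swp a b))" and ?g = "grid d as (rev bs)"
  have cf: "cfacs (?P bs)" for bs by (auto simp: cfacs_def d)
  have cg: "cfacs ?g" by (rule cfacs_grid[OF d])
  have "ops True t ?g (word L ((xs @ [a]) @ as @ bs @ ys)) - ops False t (rev ?g) (word L ((xs @ [a]) @ bs @ as @ ys)) \<in> tensors \<I>"
    by (rule Cons.IH) (use Cons.prems in auto)
  from linear_op_cong[OF linear_op_ops[OF t cf] LI this, of True "rev bs"]
  have 1: "ops True t (grid d (a # as) (rev bs)) (word L (xs @ (a # as) @ bs @ ys))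
    - ops True t (?P (rev bs)) (ops False t (rev ?g) (word L (xs @ a # bs @ (as @ ys)))) \<in> tensors \<I>"
    by (simp add: grid_Cons ops_append)
  have "ops True t (?P (rev bs)) (word L (xs @ a # bs @ (as @ ys))) - ops False t (?P bs) (word L (xs @ bs @ a # (as @ ys))) \<in> tensors \<I>"
    by (rule word_row[OF I d t]) (use Cons.prems in auto)
  then have "ops False t (rev ?g) (ops True t (?P (rev bs)) (word L (xs @ a # bs @ (as @ ys))))
    - ops False t (rev ?g) (ops False t (?P bs) (word L (xs @ bs @ a # (as @ ys)))) \<in> tensors \<I>"
    by (intro linear_op_cong[OF linear_op_ops[OF t] LI]) (simp_all add: cg)
  moreover have "ops False t (rev ?g) (ops False t (?P bs) H) = ops False t (rev (grid d (a # as) (rev bs))) H" for H :: "('n, 's) tmat"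
    by (simp add: grid_Cons ops_append rev_map)
  moreover have "ops False t (rev ?g) (ops True t (?P (rev bs)) H) = ops True t (?P (rev bs)) (ops False t (rev ?g) H)" for H :: "('n, 's) tmat"
    by (rule ops_sides_commute[OF t cf t, symmetric]) (simp add: cg)
  ultimately have 2: "ops True t (?P (rev bs)) (ops False t (rev ?g) (word L (xs @ a # bs @ (as @ ys))))
    - ops False t (rev (grid d (a # as) (rev bs))) (word L (xs @ bs @ (a # as) @ ys)) \<in> tensors \<I>" by simp
  show ?case by (rule tensors_trans[OF LI 1 2])
qed

text \<open>
  With \<open>D W = W' D\<close>, \<open>E D = D E = s\<close> and \<open>A\<close> absorbing a second copy of itself across \<open>D\<close>, \<open>E\<close>
  and \<open>W'\<close>, cyclicity gives \<open>s tr (A W) = tr (A E W' D) = s tr (A W')\<close>.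
\<close>

lemma trace_conjugation:
  fixes AL AR DL DR EL TR :: "('n, 's::ring_1) tmat \<Rightarrow> ('n, 's) tmat"
  assumes I: "left_ideal \<I>" and c: "central c" and s: "central s"
    and lin: "linear_op AL" "linear_op AR" "linear_op DL" "linear_op DR" "linear_op EL" "linear_op TR"
    and ED: "\<And>G. EL (DL G) = smul s G" and DE: "\<And>G. DL (EL G) = smul s G"
    and AE: "\<And>G. AL (EL (AL G)) = smul c (AL (EL G))" and AD: "\<And>G. AL (DL (AL G)) = smul c (AL (DL G))"
    and AA: "\<And>G. AL (AL G) = smul c (AL G)"
    and cyc: "\<And>G. TR (DR G) = TR (DL G)" "\<And>G. TR (AR G) = TR (AL G)"
    and com: "\<And>G. AL (AR G) = AR (AL G)" "\<And>G. AL (DR G) = DR (AL G)" "\<And>G. EL (AR G) = AR (EL G)"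
      "\<And>G. EL (DR G) = DR (EL G)" "\<And>G. DL (AR G) = AR (DL G)"
    and W: "DL w - DR w' \<in> tensors \<I>" and A: "AR (AL w') - smul c (AL w') \<in> tensors \<I>"
  shows "smul (c * c * s) (TR (AL w) - TR (AL w')) \<in> tensors \<I>"
proof -
  have cong: "T G - T H \<in> tensors \<I>" if "linear_op T" "G - H \<in> tensors \<I>" for T :: "('n, 's) tmat \<Rightarrow> ('n, 's) tmat" and G H
    by (rule linear_op_cong[OF that(1) I that(2)])
  have sm: "T (smul r G) = smul r (T G)" if "linear_op T" "r = c \<or> r = s" for T :: "('n, 's) tmat \<Rightarrow> ('n, 's) tmat" and G r
    using that c s by (auto intro: linear_op_smul)
  have 1: "smul s (TR (AL w)) - TR (AL (EL (DR w'))) \<in> tensors \<I>"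
  proof -
    have "TR (AL (EL (DL w))) - TR (AL (EL (DR w'))) \<in> tensors \<I>"
      by (rule cong[OF lin(6) cong[OF lin(1) cong[OF lin(5) W]]])
    then show ?thesis by (simp only: ED sm[OF lin(1)] sm[OF lin(6)] simp_thms)
  qed
  let ?y = "AL w'"
  have "smul c (TR (AL (EL (DR w')))) = TR (AL (EL (DR ?y)))"
    by (simp only: AE[symmetric] sm[OF lin(6), symmetric] simp_thms com(2))
  then have 2: "smul (c * c) (TR (AL (EL (DR w')))) = TR (AL (EL (DR (smul c ?y))))"
    by (simp only: smul_smul[symmetric] sm[OF lin(4)] sm[OF lin(5)] sm[OF lin(1)] sm[OF lin(6)] simp_thms)
  have 3: "TR (AL (EL (DR (AR ?y)))) - TR (AL (EL (DR (smul c ?y)))) \<in> tensors \<I>"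
    by (rule cong[OF lin(6) cong[OF lin(1) cong[OF lin(5) cong[OF lin(4) A]]]])
  have "TR (AL (EL (DR (AR ?y)))) = TR (DR (AR (AL (EL ?y))))"
    by (simp only: com(4) com(3) com(2) com(1))
  also have "\<dots> = TR (AR (DL (AL (EL ?y))))" by (simp only: cyc(1) com(5))
  also have "\<dots> = TR (smul c (AL (DL (EL ?y))))" by (simp only: cyc(2) AD)
  also have "\<dots> = smul (c * c * s) (TR ?y)"
    by (simp only: DE AA sm[OF lin(1)] sm[OF lin(6)] simp_thms)
      (simp only: smul_smul centralD[OF s, of c] mult.assoc)
  finally have 4: "TR (AL (EL (DR (AR ?y)))) = smul (c * c * s) (TR ?y)" .
  have "smul (c * c) (smul s (TR (AL w)) - TR (AL (EL (DR w')))) \<in> tensors \<I>"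
    by (rule tensors_smul[OF I 1])
  then have 5: "smul (c * c * s) (TR (AL w)) - TR (AL (EL (DR (smul c ?y)))) \<in> tensors \<I>"
    by (simp only: smul_diff smul_smul 2)
  have "smul (c * c * s) (TR (AL w)) - smul (c * c * s) (TR ?y) \<in> tensors \<I>"
    by (rule tensors_trans[OF I 5 tensors_sym[OF I 3[unfolded 4]]])
  then show ?thesis by (simp only: smul_diff)
qed

lemma ops_alt_sides:
  assumes "central t" "cfacs fs"
  shows "ops True t fs (alt False A G) = alt False A (ops True t fs (G :: ('n, 's::ring_1) tmat))"
    and "alt True A (ops False t fs G) = ops False t fs (alt True A G)"
proof -
  show "ops True t fs (alt False A G) = alt False A (ops True t fs G)"
  proof (rule linear_op_alt_commute[OF linear_op_ops[OF assms]])
    show "ops True t fs (act False \<sigma> G) = act False \<sigma> (ops True t fs G)" for \<sigma> and G :: "('n, 's) tmat"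
      by (rule linear_op_ops_commute[OF linear_op_act assms, symmetric]) (rule act_commute_sides[symmetric])
  qed
  show "alt True A (ops False t fs G) = ops False t fs (alt True A G)"
    by (rule linear_op_ops_commute[OF linear_op_alt assms]) (rule alt_act_other_side)
qed

lemma alt_alt_sides:
  "alt True A (alt False B G) = alt False B (alt True A (G :: ('n, 's::ring_1) tmat))"
  by (rule linear_op_alt_commute[OF linear_op_alt]) (rule alt_act_other_side)

lemma alt_alt_disjoint:
  fixes G :: "('n, 's::ring_1) tmat"
  assumes "A \<inter> B = {}"
  shows "alt s A (alt s B G) = alt s B (alt s A G)"
  by (rule linear_op_alt_commute[OF linear_op_alt], rule alt_act_commute)
    (rule permutes_commute_disjoint[OF _ _ assms])

lemma upt_split: "lo \<le> a \<Longrightarrow> a < hi \<Longrightarrow> [lo..<Suc hi] = [lo..<a] @ a # Suc a # [Suc (Suc a)..<Suc hi]"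
proof -
  assume a: "lo \<le> a" "a < hi"
  then have "[lo..<Suc hi] = [lo..<a] @ [a..<Suc hi]"
    using upt_add_eq_append[of lo a "Suc hi - a"] by simp
  also have "[a..<Suc hi] = a # Suc a # [Suc (Suc a)..<Suc hi]"
    using a by (simp add: upt_conv_Cons)
  finally show ?thesis .
qed

lemma upt_split_rev:
  assumes "lo \<le> a" "a < hi"
  obtains xs ys where "rev [lo..<Suc hi] = xs @ Suc a # a # ys"
  using that[of "rev [Suc (Suc a)..<Suc hi]" "rev [lo..<a]"] by (simp add: upt_split[OF assms] del: upt_Suc)

text \<open>An instance of \<open>trace_conjugation\<close>: \<open>D\<close> is the grid that
  interchanges the two blocks, \<open>E\<close> is its reverse with \<open>- t\<close>, inverse to
  it up to the scalar \<open>s\<close> by \<open>ops_inverse\<close>, and \<open>A\<close>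
  antisymmetrizes each block. The steps of \<open>d\<close> reflect the parameters
  \<open>u_i = u + (i - 1) h\<close> and let every adjacent pair pass the grid.\<close>

lemma fused_traces:
  fixes L :: "nat \<Rightarrow> 'n::finite \<Rightarrow> 'n \<Rightarrow> 's::ring_1" and d :: "nat \<Rightarrow> nat \<Rightarrow> 's"
  assumes I: "two_sided_ideal \<I>" and e: "e + e = (1 :: 's)" and d: "\<And>a b. central (d a b)" and t: "central t"
    and rel: "\<And>a b. 1 \<le> a \<Longrightarrow> a \<le> k \<Longrightarrow> Suc k \<le> b \<Longrightarrow> b \<le> k + m \<Longrightarrow> exchange \<I> (d a b) t (L a) (L b)"
    and d1: "\<And>a b. d a b - d (Suc a) b = - t" and d2: "\<And>a b. d a (Suc b) - d a b = - t"
    and adj: "\<And>a. 1 \<le> a \<Longrightarrow> a < k \<Longrightarrow> exchange \<I> 1 (- 1) (L a) (L (Suc a))"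
      "\<And>a. Suc k \<le> a \<Longrightarrow> a < k + m \<Longrightarrow> exchange \<I> 1 (- 1) (L a) (L (Suc a))"
  defines "as \<equiv> [1..<Suc k]" and "bs \<equiv> [Suc k..<Suc (k + m)]"
  defines "A \<equiv> (\<lambda>G. alt True {1..k} (alt True {Suc k..k + m} G)) :: ('n, 's) tmat \<Rightarrow> ('n, 's) tmat"
  defines "c \<equiv> of_nat (nperm {1..k} * nperm {Suc k..k + m}) :: 's"
  defines "s \<equiv> prod_list (map (\<lambda>f. fst f ^ 2 - t ^ 2) (grid d as (rev bs)))"
  shows "smul (c * c * s) (ptr (as @ bs) (A (word L (as @ bs))) - ptr (as @ bs) (A (word L (bs @ as)))) \<in> tensors \<I>"
proof -
  note LI = two_sided_left[OF I]
  let ?R = "grid d as (rev bs)"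
  let ?nA = "of_nat (nperm {1..k}) :: 's" and ?nB = "of_nat (nperm {Suc k..k + m}) :: 's"
  define B where "B = (\<lambda>G. alt False {1..k} (alt False {Suc k..k + m} G) :: ('n, 's) tmat)"
  have dist: "distinct (as @ bs)" "distinct (bs @ as)" by (auto simp: as_def bs_def)
  have disj: "set as \<inter> set (rev bs) = {}" "{1..k} \<inter> {Suc k..k + m} = {}" by (auto simp: as_def bs_def)
  have cR: "cfacs ?R" by (rule cfacs_grid[OF d])
  have mt: "central (- t)" using t by simp
  have c_eq: "c = ?nA * ?nB" by (simp add: c_def)
  have lin_nat: "T (smul (of_nat q) G) = smul (of_nat q) (T G)" if "linear_op T" for T :: "('n, 's) tmat \<Rightarrow> ('n, 's) tmat" and q G
    using that by (simp add: linear_op_smul)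
  have swap: "alt b {1..k} (alt b {Suc k..k + m} G) = alt b {Suc k..k + m} (alt b {1..k} G)" for b and G :: "('n, 's) tmat"
    by (rule alt_alt_disjoint[OF disj(2)])
  have absorb: "A (ops True r fs (A G)) = smul c (A (ops True r fs G))"
    if r: "central r" and fs: "cfacs fs"
      and p1: "\<And>a. 1 \<le> a \<Longrightarrow> a < k \<Longrightarrow> passes True a (Suc a) r fs TYPE('n)"
      and p2: "\<And>a. Suc k \<le> a \<Longrightarrow> a < k + m \<Longrightarrow> passes True a (Suc a) r fs TYPE('n)" for r fs G
  proof -
    have a1: "alt True {1..k} (ops True r fs (alt True {1..k} G)) = smul ?nA (alt True {1..k} (ops True r fs G))" for G :: "('n, 's) tmat"
      by (rule alt_ops_alt[OF e r fs p1])
    have a2: "alt True {Suc k..k + m} (ops True r fs (alt True {Suc k..k + m} G)) = smul ?nB (alt True {Suc k..k + m} (ops True r fs G))" for G :: "('n, 's) tmat"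
      by (rule alt_ops_alt[OF e r fs p2])
    have "A (ops True r fs (A G)) = alt True {Suc k..k + m} (smul ?nA (alt True {1..k} (ops True r fs (alt True {Suc k..k + m} G))))"
      by (simp only: A_def a1 swap[of True "ops True r fs _"])
    also have "\<dots> = smul ?nA (alt True {1..k} (smul ?nB (alt True {Suc k..k + m} (ops True r fs G))))"
      by (simp only: lin_nat[OF linear_op_alt] swap[symmetric] a2)
    also have "\<dots> = smul c (A (ops True r fs G))"
      by (simp only: lin_nat[OF linear_op_alt] smul_smul A_def c_eq)
    finally show ?thesis .
  qed
  have linA: "linear_op A" and linB: "linear_op B"
    unfolding A_def B_def by (rule linear_op_comp[OF linear_op_alt linear_op_alt])+
  have mem: "\<exists>a b. a \<in> set (as @ bs) \<and> b \<in> set (as @ bs) \<and> a \<noteq> b \<and> snd f = swp a b" if f: "f \<in> set (rev ?R)" for f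
  proof -
    obtain a b where ab: "a \<in> set as" "b \<in> set (rev bs)" "f = (d a b, swp a b)" using grid_mem f by fastforce
    then show ?thesis using disj(1) by (intro exI[of _ a] exI[of _ b]) auto
  qed
  have invol: "snd f \<circ> snd f = id" if f: "f \<in> set ?R" for f using grid_mem[OF f] by auto
  \<comment> \<open>The factors \<open>d^2 - t^2\<close> are central, so \<open>E D\<close> and
    \<open>D E\<close> give the same scalar.\<close>
  have s_rev: "prod_list (map (\<lambda>f. fst f ^ 2 - t ^ 2) (rev ?R)) = s"
    unfolding s_def by (subst prod_list_rev_central) (use cR t in \<open>auto simp: cfacs_def\<close>)
  have cs: "central s"
    unfolding s_def by (rule central_prod_list) (use cR t in \<open>auto simp: cfacs_def\<close>)
  show ?thesis
  proof (rule trace_conjugation[OF LI _ cs linA linB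
        linear_op_ops[OF t cR] linear_op_ops[OF t, of "rev ?R" False] linear_op_ops[OF mt, of "rev ?R" True] linear_op_ptr])
    show "central c" by (simp add: c_def)
    show "cfacs (rev ?R)" "cfacs (rev ?R)" using cR by simp_all
    show "ops True (- t) (rev ?R) (ops True t ?R G) = smul s G" for G :: "('n, 's) tmat"
      using ops_inverse[OF mt, of "rev ?R" True G] cR invol by (simp add: s_rev)
    show "ops True t ?R (ops True (- t) (rev ?R) G) = smul s G" for G :: "('n, 's) tmat"
      using ops_inverse[OF t cR, of True G] invol by (simp add: s_def)
    show "A (ops True (- t) (rev ?R) (A G)) = smul c (A (ops True (- t) (rev ?R) G))" for G
    proof (rule absorb[OF mt])
      show "cfacs (rev ?R)" using cR by simp
      fix a assume a: "1 \<le> a" "a < k"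
      \<comment> \<open>With \<open>- t\<close> in place of \<open>t\<close> the difference required
        by \<open>fusion\<close> changes sign. It holds for the pair \<open>Suc a\<close>,
        \<open>a\<close>, and \<open>E\<close> indeed lists the positions of \<open>as\<close>
        backwards.\<close>
      obtain xs ys where xy: "rev as = xs @ Suc a # a # ys" using upt_split_rev[OF a] unfolding as_def by blast
      have "passes True (Suc a) a (- t) (grid d (rev as) bs) TYPE('n)"
        by (rule passes_grid_columns[OF mt d _ _ _ xy]) (use d1 dist disj in \<open>auto simp: algebra_simps\<close>)
      then show "passes True a (Suc a) (- t) (rev ?R) TYPE('n)" by (simp add: rev_grid passes_sym)
    next
      fix a assume a: "Suc k \<le> a" "a < k + m"
      have "passes True a (Suc a) (- t) (grid d (rev as) bs) TYPE('n)"
        by (rule passes_grid_rows[OF mt d _ _ upt_split[OF a, folded bs_def]]) (use d2 dist disj in \<open>auto simp: algebra_simps\<close>)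
      then show "passes True a (Suc a) (- t) (rev ?R) TYPE('n)" by (simp add: rev_grid)
    qed
    show "A (ops True t ?R (A G)) = smul c (A (ops True t ?R G))" for G
    proof (rule absorb[OF t cR])
      fix a assume a: "1 \<le> a" "a < k"
      show "passes True a (Suc a) t ?R TYPE('n)"
        by (rule passes_grid_columns[OF t d _ _ _ upt_split[OF a, folded as_def]]) (use d1 dist disj in auto)
    next
      fix a assume a: "Suc k \<le> a" "a < k + m"
      obtain xs ys where xy: "rev bs = xs @ Suc a # a # ys" using upt_split_rev[OF a] unfolding bs_def by blast
      have "passes True (Suc a) a t ?R TYPE('n)"
        by (rule passes_grid_rows[OF t d _ _ xy]) (use d2 dist disj in auto)
      then show "passes True a (Suc a) t ?R TYPE('n)" by (simp add: passes_sym)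
    qed
    show "A (A G) = smul c (A G)" for G
    proof -
      have p: "passes s x y 1 [] TYPE('n)" for s x y
        unfolding passes_def by (rule exI[of _ "[]"]) simp
      have "A (ops True 1 [] (A G)) = smul c (A (ops True 1 [] G))"
        by (rule absorb[OF central_1 cfacs_Nil p p])
      then show ?thesis by simp
    qed
    show "ptr (as @ bs) (ops False t (rev ?R) G) = ptr (as @ bs) (ops True t ?R G)" for G
      using ptr_cyclic_ops[OF dist(1) t mem, of "rev ?R"] cR by simp
    show "ptr (as @ bs) (B G) = ptr (as @ bs) (A G)" for G
    proof -
      have "ptr (as @ bs) (B G) = ptr (as @ bs) (alt True {1..k} (alt False {Suc k..k + m} G))"
        unfolding B_def by (rule ptr_cyclic_alt[OF dist(1), symmetric]) (auto simp: as_def bs_def)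
      also have "\<dots> = ptr (as @ bs) (alt False {Suc k..k + m} (alt True {1..k} G))"
        by (simp only: alt_alt_sides)
      also have "\<dots> = ptr (as @ bs) (alt True {Suc k..k + m} (alt True {1..k} G))"
        by (rule ptr_cyclic_alt[OF dist(1), symmetric]) (auto simp: as_def bs_def)
      finally show ?thesis by (simp only: A_def swap)
    qed
    show "A (B G) = B (A G)" for G
      by (simp only: A_def B_def alt_alt_sides)
    show "A (ops False t (rev ?R) G) = ops False t (rev ?R) (A G)" for G
      using cR by (simp only: A_def ops_alt_sides[OF t] cfacs_rev)
    show "ops True (- t) (rev ?R) (B G) = B (ops True (- t) (rev ?R) G)" for G
      using cR by (simp only: B_def ops_alt_sides[OF mt] cfacs_rev)
    show "ops True (- t) (rev ?R) (ops False t (rev ?R) G) = ops False t (rev ?R) (ops True (- t) (rev ?R) G)" for G :: "('n, 's) tmat"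
      using cR by (intro ops_sides_commute mt t) simp_all
    show "ops True t ?R (B G) = B (ops True t ?R G)" for G
      using cR by (simp only: B_def ops_alt_sides[OF t])
    have "ops True t ?R (word L ([] @ as @ bs @ [])) - ops False t (rev ?R) (word L ([] @ bs @ as @ [])) \<in> tensors \<I>"
      by (rule word_block[OF I d t]) (use dist rel in \<open>auto simp: as_def bs_def\<close>)
    then show "ops True t ?R (word L (as @ bs)) - ops False t (rev ?R) (word L (bs @ as)) \<in> tensors \<I>" by simp
    show "B (A (word L (bs @ as))) - smul c (A (word L (bs @ as))) \<in> tensors \<I>"
    proof -
      let ?w = "word L (bs @ as)"
      have 1: "alt False {1..k} (alt True {1..k} ?w) - smul ?nA (alt True {1..k} ?w) \<in> tensors \<I>"
      proof (rule word_antisym[OF I e dist(2)])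
        fix a assume "1 \<le> a" "a < k"
        then have "bs @ as = (bs @ [1..<a]) @ a # Suc a # [Suc (Suc a)..<Suc k]"
          by (simp add: as_def upt_split del: upt_Suc)
        then show "\<exists>xs ys. bs @ as = xs @ a # Suc a # ys" by blast
      qed (rule adj(1))
      have 2: "alt False {Suc k..k + m} (alt True {Suc k..k + m} ?w) - smul ?nB (alt True {Suc k..k + m} ?w) \<in> tensors \<I>"
      proof (rule word_antisym[OF I e dist(2)])
        fix a assume "Suc k \<le> a" "a < k + m"
        then have "bs @ as = [Suc k..<a] @ a # Suc a # ([Suc (Suc a)..<Suc (k + m)] @ as)"
          by (simp add: bs_def upt_split del: upt_Suc)
        then show "\<exists>xs ys. bs @ as = xs @ a # Suc a # ys" by blast
      qed (rule adj(2))
      have "alt False {1..k} (alt True {1..k} (alt False {Suc k..k + m} (alt True {Suc k..k + m} ?w)))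
        - alt False {1..k} (alt True {1..k} (smul ?nB (alt True {Suc k..k + m} ?w))) \<in> tensors \<I>"
        by (rule linear_op_cong[OF linear_op_alt LI linear_op_cong[OF linear_op_alt LI 2]])
      then have 3: "B (A ?w) - smul ?nB (alt True {Suc k..k + m} (alt False {1..k} (alt True {1..k} ?w))) \<in> tensors \<I>"
        by (simp only: A_def B_def alt_alt_sides lin_nat[OF linear_op_alt] swap)
      have "smul ?nB (alt True {Suc k..k + m} (alt False {1..k} (alt True {1..k} ?w)))
        - smul ?nB (alt True {Suc k..k + m} (smul ?nA (alt True {1..k} ?w))) \<in> tensors \<I>"
        unfolding smul_diff[symmetric] by (rule tensors_smul[OF LI linear_op_cong[OF linear_op_alt LI 1]])
      also have "smul ?nB (alt True {Suc k..k + m} (smul ?nA (alt True {1..k} ?w))) = smul c (A ?w)"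
        by (simp only: lin_nat[OF linear_op_alt] smul_smul c_eq A_def swap mult_of_nat_commute[of "nperm {Suc k..k + m}"])
      finally show ?thesis by (rule tensors_trans[OF LI 3])
    qed
  qed
qed

subsection \<open>Locality and relabelling of positions\<close>

definition supported :: "nat set \<Rightarrow> ('n, 's) tmat \<Rightarrow> bool" where
  "supported S G \<longleftrightarrow> (\<forall>I I' J J'. (\<forall>a\<in>S. I a = I' a \<and> J a = J' a) \<longrightarrow> G I J = G I' J')"

lemma supportedD:
  "supported S G \<Longrightarrow> (\<And>a. a \<in> S \<Longrightarrow> I a = I' a) \<Longrightarrow> (\<And>a. a \<in> S \<Longrightarrow> J a = J' a) \<Longrightarrow> G I J = G I' J'"
  by (simp add: supported_def)

lemma supported_word: "supported (set xs) (word L xs)"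
  unfolding supported_def by (auto intro: word_cong)

lemma supported_act: "supported S G \<Longrightarrow> \<sigma> permutes S \<Longrightarrow> supported S (act s \<sigma> G)"
  unfolding supported_def act_def by (cases s) (auto simp: permutes_in_image)

lemma supported_alt: "supported S G \<Longrightarrow> supported S (alt s S (G :: ('n, 's::ring_1) tmat))"
  unfolding supported_def[of S "alt s S G"]
proof (intro allI impI)
  fix I I' J J' :: "nat \<Rightarrow> 'n"
  assume G: "supported S G" and *: "\<forall>a\<in>S. I a = I' a \<and> J a = J' a"
  have "act s \<sigma> G I J = act s \<sigma> G I' J'" if "\<sigma> permutes S" for \<sigma>
    by (rule supportedD[OF supported_act[OF G that]]) (use * in auto)
  then show "alt s S G I J = alt s S G I' J'"
    unfolding alt_def sum_fun_apply smul_def by (intro sum.cong refl) simp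
qed

lemma supported_pt:
  assumes G: "supported S G"
  shows "supported S (pt a G)"
proof -
  have "pt a G I J = pt a G I' J'" if *: "\<And>a. a \<in> S \<Longrightarrow> I a = I' a" "\<And>a. a \<in> S \<Longrightarrow> J a = J' a" for I I' J J'
    unfolding pt_def by (rule sum.cong[OF refl], rule supportedD[OF G]) (use * in auto)
  then show ?thesis unfolding supported_def by blast
qed

lemma supported_ptr: "supported S G \<Longrightarrow> supported S (ptr as G)"
  by (induction as) (simp_all add: supported_pt)

lemma supported_perm:
  assumes "supported S G" "\<sigma> permutes A" "S \<inter> A = {}"
  shows "act s \<sigma> G = G"
proof -
  have "\<sigma> a = a" if "a \<in> S" for a using assms(2,3) that permutes_not_in[of \<sigma> A a] by blast
  then show ?thesis using assms(1) unfolding supported_def act_def by (cases s) (auto simp: fun_eq_iff)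
qed

lemma supported_upd: "supported S G \<Longrightarrow> a \<notin> S \<Longrightarrow> G (I(a := x)) (J(a := y)) = G I J"
  by (erule supportedD) auto

text \<open>For matrices supported on disjoint sets of positions this entrywise product is the
  tensor product: a word carries no delta factors at positions outside its list.\<close>

definition tprod :: "('n, 's) tmat \<Rightarrow> ('n, 's) tmat \<Rightarrow> ('n, 's::times) tmat" where
  "tprod G H = (\<lambda>I J. G I J * H I J)"

lemma act_tprod: "act s \<sigma> (tprod G H) = tprod (act s \<sigma> G) (act s \<sigma> H)"
  by (simp add: act_def tprod_def fun_eq_iff)

lemma alt_tprod:
  fixes G H :: "('n, 's::ring_1) tmat"
  assumes "supported S G" "S \<inter> A = {}"
  shows "alt s A (tprod G H) = tprod G (alt s A H)" and "alt s A (tprod H G) = tprod (alt s A H) G"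
proof -
  have "act s \<sigma> G = G" if "\<sigma> permutes A" for \<sigma> by (rule supported_perm[OF assms(1) that assms(2)])
  then have 1: "smul (of_int z) (act s \<sigma> (tprod G H)) = tprod G (smul (of_int z) (act s \<sigma> H))"
    and 2: "smul (of_int z) (act s \<sigma> (tprod H G)) = tprod (smul (of_int z) (act s \<sigma> H)) G"
    if "\<sigma> permutes A" for \<sigma> z
    using that unfolding act_tprod
    by (simp_all add: fun_eq_iff tprod_def smul_def mult.assoc central_left_commute[OF central_of_int])
  have "alt s A (tprod G H) = (\<Sum>\<sigma> | \<sigma> permutes A. tprod G (smul (of_int (sign \<sigma>)) (act s \<sigma> H)))"
    unfolding alt_def by (intro sum.cong refl) (simp only: mem_Collect_eq 1)
  then show "alt s A (tprod G H) = tprod G (alt s A H)"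
    by (simp add: alt_def fun_eq_iff sum_fun_apply tprod_def sum_distrib_left)
  have "alt s A (tprod H G) = (\<Sum>\<sigma> | \<sigma> permutes A. tprod (smul (of_int (sign \<sigma>)) (act s \<sigma> H)) G)"
    unfolding alt_def by (intro sum.cong refl) (simp only: mem_Collect_eq 2)
  then show "alt s A (tprod H G) = tprod (alt s A H) G"
    by (simp add: alt_def fun_eq_iff sum_fun_apply tprod_def sum_distrib_right)
qed

lemma ptr_tprod:
  assumes "supported S G" "S \<inter> set as = {}"
  shows "ptr as (tprod G H) = tprod G (ptr as H)" and "ptr as (tprod H G) = tprod (ptr as H) G"
proof -
  have "G (I(a := x)) (J(a := y)) = G I J" if "a \<in> set as" for I J a x y
    by (rule supported_upd[OF assms(1)]) (use that assms(2) in auto)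
  then show "ptr as (tprod G H) = tprod G (ptr as H)" "ptr as (tprod H G) = tprod (ptr as H) G"
    unfolding tprod_def by (intro ptr_const ptr_const_right; blast)+
qed

text \<open>All positions of the support are traced over, so this matrix is constant. For the list
  \<open>1..k\<close> and the shifted \<open>L_minus\<close> its value is \<open>k!\<close> times
  \<open>ell_bar k\<close>.\<close>

definition fused_trace :: "(nat \<Rightarrow> 'n::finite \<Rightarrow> 'n \<Rightarrow> 's::ring_1) \<Rightarrow> nat list \<Rightarrow> ('n, 's) tmat" where
  "fused_trace L as = ptr as (alt True (set as) (word L as))"

lemma supported_ptr_complement: "supported S G \<Longrightarrow> supported (S - set as) (ptr as G)"
proof (induction as)
  case (Cons a as)
  then have s: "supported (S - set as) (ptr as G)" by simp
  show ?case
    unfolding supported_def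
  proof (intro allI impI)
    fix I I' J J' :: "nat \<Rightarrow> 'a" assume *: "\<forall>b\<in>S - set (a # as). I b = I' b \<and> J b = J' b"
    have "ptr as G (I(a := x)) (J(a := x)) = ptr as G (I'(a := x)) (J'(a := x))" for x
      by (rule supportedD[OF s]) (use * in auto)
    then show "ptr (a # as) G I J = ptr (a # as) G I' J'" by (simp add: pt_def)
  qed
qed simp

lemma fused_trace_const: "fused_trace L as I J = fused_trace L as I' J'"
proof -
  have "supported (set as - set as) (fused_trace L as)"
    unfolding fused_trace_def by (intro supported_ptr_complement supported_alt supported_word)
  then show ?thesis by (rule supportedD) auto
qed

lemma fused_trace_product:
  assumes "set as \<inter> set bs = {}"
  shows "ptr (as @ bs) (alt True (set as) (alt True (set bs) (word L (as @ bs)))) = tprod (fused_trace L as) (fused_trace L bs)"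
    and "ptr (as @ bs) (alt True (set as) (alt True (set bs) (word L (bs @ as)))) = tprod (fused_trace L bs) (fused_trace L as)"
proof -
  have d: "set as \<inter> set bs = {}" "set bs \<inter> set as = {}" using assms by auto
  have w: "word L (as @ bs) = tprod (word L as) (word L bs)" "word L (bs @ as) = tprod (word L bs) (word L as)"
    by (simp_all add: fun_eq_iff word_append tprod_def)
  note s = supported_word supported_alt[OF supported_word]
  show "ptr (as @ bs) (alt True (set as) (alt True (set bs) (word L (as @ bs)))) = tprod (fused_trace L as) (fused_trace L bs)"
    by (simp only: w fused_trace_def ptr_append alt_tprod(1)[OF s(1) d(1)] alt_tprod(2)[OF s(2) d(2)]
        ptr_tprod(1)[OF s(2) d(1)] ptr_tprod(2)[OF supported_ptr[OF s(2)] d(2)])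
  show "ptr (as @ bs) (alt True (set as) (alt True (set bs) (word L (bs @ as)))) = tprod (fused_trace L bs) (fused_trace L as)"
    by (simp only: w fused_trace_def ptr_append alt_tprod(2)[OF s(1) d(1)] alt_tprod(1)[OF s(2) d(2)]
        ptr_tprod(2)[OF s(2) d(1)] ptr_tprod(1)[OF supported_ptr[OF s(2)] d(2)])
qed

text \<open>Renaming of positions, by which the block \<open>k + 1..k + m\<close> is identified with
  \<open>1..m\<close>.\<close>

definition pull :: "(nat \<Rightarrow> nat) \<Rightarrow> ('n, 's) tmat \<Rightarrow> ('n, 's) tmat" where
  "pull g G = (\<lambda>I J. G (I \<circ> g) (J \<circ> g))"

lemma pull_act:
  assumes "bij g"
  shows "act s (g \<circ> \<sigma> \<circ> inv g) (pull g G) = pull g (act s \<sigma> G)"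
proof -
  have "I \<circ> (g \<circ> \<sigma> \<circ> inv g) \<circ> g = I \<circ> g \<circ> \<sigma>" for I :: "nat \<Rightarrow> 'a"
    using bij_is_inj[OF assms] by (simp add: fun_eq_iff)
  then show ?thesis by (simp only: pull_def act_def)
qed

lemma pull_pt: "inj g \<Longrightarrow> pt (g a) (pull g G) = pull g (pt a G)"
proof -
  assume "inj g"
  then have "I(g a := x) \<circ> g = (I \<circ> g)(a := x)" for I :: "nat \<Rightarrow> 'a" and x
    by (auto simp: fun_eq_iff inj_eq)
  then show ?thesis by (simp add: pt_def pull_def)
qed

lemma pull_ptr: "inj g \<Longrightarrow> ptr (map g as) (pull g G) = pull g (ptr as G)"
  by (induction as) (simp_all add: pull_pt)

lemma permutesI: "bij p \<Longrightarrow> (\<And>x. x \<notin> S \<Longrightarrow> p x = x) \<Longrightarrow> p permutes S"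
  by (simp add: permutes_def bij_iff)

lemma pull_alt:
  fixes G :: "('n, 's::ring_1) tmat"
  assumes g: "g permutes B" "finite B" and A: "finite A"
  shows "alt s (g ` A) (pull g G) = pull g (alt s A G)"
proof -
  have pg: "permutation g" "permutation (inv g)" and bij: "bij g"
    using permutes_finite_permutation[OF g(2,1)] permutes_bij[OF g(1)] by (auto intro: permutation_inverse)
  have conj: "g \<circ> \<sigma> \<circ> inv g permutes g ` A \<longleftrightarrow> \<sigma> permutes A" for \<sigma>
  proof -
    have *: "g \<circ> \<sigma> \<circ> inv g permutes g ` A" if "bij g" "\<sigma> permutes A" for g \<sigma> :: "nat \<Rightarrow> nat" and A
    proof (rule permutesI)
      show "bij (g \<circ> \<sigma> \<circ> inv g)" by (intro bij_comp bij_imp_bij_inv permutes_bij[OF that(2)] that(1))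
      show "(g \<circ> \<sigma> \<circ> inv g) x = x" if "x \<notin> g ` A" for x
      proof -
        have "inv g x \<notin> A" using that by (metis \<open>bij g\<close> bij_inv_eq_iff imageI)
        then have "\<sigma> (inv g x) = inv g x" using \<open>\<sigma> permutes A\<close> by (simp add: permutes_not_in)
        then show ?thesis using \<open>bij g\<close> by (simp add: bij_is_surj surj_f_inv_f)
      qed
    qed
    have "\<sigma> permutes A" if "g \<circ> \<sigma> \<circ> inv g permutes g ` A"
    proof -
      have "inv g \<circ> (g \<circ> \<sigma> \<circ> inv g) \<circ> inv (inv g) permutes inv g ` (g ` A)"
        by (rule *[OF bij_imp_bij_inv[OF bij] that])
      moreover have "inv g \<circ> (g \<circ> \<sigma> \<circ> inv g) \<circ> inv (inv g) = \<sigma>"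
        using bij by (simp add: fun_eq_iff inv_inv_eq bij_is_inj)
      moreover have "inv g ` (g ` A) = A" using bij by (simp add: image_inv_f_f bij_is_inj)
      ultimately show ?thesis by (simp only:)
    qed
    then show ?thesis using *[OF bij] by blast
  qed
  have inv1: "g \<circ> (inv g \<circ> \<rho> \<circ> g) \<circ> inv g = \<rho>" and inv2: "inv g \<circ> (g \<circ> \<rho> \<circ> inv g) \<circ> g = \<rho>" for \<rho> :: "nat \<Rightarrow> nat"
    using bij by (simp_all add: fun_eq_iff bij_is_inj bij_is_surj surj_f_inv_f)
  have sg: "sign (g \<circ> \<sigma> \<circ> inv g) = sign \<sigma>" if "\<sigma> permutes A" for \<sigma>
  proof -
    have "permutation \<sigma>" by (rule permutes_finite_permutation[OF A that])
    moreover have "sign g * sign \<sigma> * sign g = sign \<sigma>" by (simp add: mult.commute mult.left_commute)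
    ultimately show ?thesis
      using pg by (simp add: sign_compose permutation_compose sign_inverse del: comp_apply)
  qed
  have "alt s (g ` A) (pull g G) = (\<Sum>\<rho> | \<rho> permutes g ` A. smul (of_int (sign \<rho>)) (act s \<rho> (pull g G)))"
    by (rule alt_def)
  also have "\<dots> = (\<Sum>\<sigma> | \<sigma> permutes A. smul (of_int (sign (g \<circ> \<sigma> \<circ> inv g))) (act s (g \<circ> \<sigma> \<circ> inv g) (pull g G)))"
    by (rule sum.reindex_bij_witness[of _ "\<lambda>\<sigma>. g \<circ> \<sigma> \<circ> inv g" "\<lambda>\<rho>. inv g \<circ> \<rho> \<circ> g"])
      (use conj inv1 inv2 in \<open>auto simp del: comp_apply\<close>, metis conj inv1)
  also have "\<dots> = (\<Sum>\<sigma> | \<sigma> permutes A. smul (of_int (sign \<sigma>)) (pull g (act s \<sigma> G)))"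
    by (intro sum.cong refl) (simp add: sg pull_act[OF bij])
  also have "\<dots> = pull g (alt s A G)"
    by (simp add: alt_def pull_def fun_eq_iff sum_fun_apply smul_def)
  finally show ?thesis .
qed

lemma fused_trace_relabel:
  assumes g: "g permutes B" "finite B"
  shows "fused_trace L (map g as) I J = fused_trace (L \<circ> g) as I J"
proof -
  have "word L (map g as) = pull g (word (L \<circ> g) as)"
    by (simp add: word_def pull_def comp_def)
  then have "fused_trace L (map g as) = pull g (fused_trace (L \<circ> g) as)"
    unfolding fused_trace_def
    by (simp add: pull_alt[OF g] pull_ptr[OF permutes_inj[OF g(1)]])
  then show ?thesis
    using fused_trace_const[of "L \<circ> g" as] by (simp only: pull_def)
qed

lemma fused_trace_shift:
  "fused_trace L [Suc k..<Suc (k + m)] I J = fused_trace (\<lambda>a. L (a + k)) [1..<Suc m] I J"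
proof -
  \<comment> \<open>The renaming must be a permutation: \<open>1..m\<close> moves up by
    \<open>k\<close>, and the positions from \<open>m + 1\<close> to \<open>k + m\<close> move down
    by \<open>m\<close> and fill \<open>1..k\<close>.\<close>
  define g where "g = (\<lambda>a::nat. if 1 \<le> a \<and> a \<le> m then a + k else if m < a \<and> a \<le> k + m then a - m else a)"
  define g' where "g' = (\<lambda>a::nat. if 1 \<le> a \<and> a \<le> k then a + m else if k < a \<and> a \<le> k + m then a - k else a)"
  have "bij g"
    by (rule o_bij[of g']) (auto simp: fun_eq_iff g_def g'_def)
  then have g: "g permutes {1..k + m}"
    by (rule permutesI) (auto simp: g_def)
  have map: "map g [1..<Suc m] = [Suc k..<Suc (k + m)]"
    by (rule nth_equalityI) (auto simp: g_def simp del: upt_Suc)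
  have "fused_trace L [Suc k..<Suc (k + m)] I J = fused_trace (L \<circ> g) [1..<Suc m] I J"
    unfolding map[symmetric] by (rule fused_trace_relabel[OF g]) simp
  also have "fused_trace (L \<circ> g) [1..<Suc m] = fused_trace (\<lambda>a. L (a + k)) [1..<Suc m]"
  proof -
    have "word (L \<circ> g) [1..<Suc m] = word (\<lambda>a. L (a + k)) [1..<Suc m]"
      unfolding word_def by (intro ext arg_cong[where f = prod_list] map_cong) (auto simp: g_def)
    then show ?thesis by (simp only: fused_trace_def)
  qed
  finally show ?thesis .
qed

text \<open>Applied to \<open>outer\<close> and \<open>fps_const\<close>, which turn a fused trace
  into a series in \<open>u\<close> or in \<open>v\<close>.\<close>

lemma fused_trace_hom:
  fixes \<psi> :: "'a::ring_1 \<Rightarrow> 'b::ring_1" and L :: "nat \<Rightarrow> 'c::finite \<Rightarrow> 'c \<Rightarrow> 'a"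
  assumes add: "\<And>x y. \<psi> (x + y) = \<psi> x + \<psi> y" and mult: "\<And>x y. \<psi> (x * y) = \<psi> x * \<psi> y" and one: "\<psi> 1 = 1"
  shows "fused_trace (\<lambda>a i j. \<psi> (L a i j)) as I J = \<psi> (fused_trace L as I J)"
proof -
  have zero: "\<psi> 0 = 0" using add[of 0 0] by simp
  have neg: "\<psi> (- x) = - \<psi> x" for x using add[of x "- x"] by (simp add: zero eq_neg_iff_add_eq_0 add.commute)
  have diff: "\<psi> (x - y) = \<psi> x - \<psi> y" for x y using add[of x "- y"] by (simp add: neg)
  have sm: "\<psi> (sum f A) = (\<Sum>x\<in>A. \<psi> (f x))" for f and A :: "'c set"
    by (induction A rule: infinite_finite_induct) (simp_all add: zero add)
  have sm': "\<psi> (sum f A) = (\<Sum>x\<in>A. \<psi> (f x))" for f and A :: "(nat \<Rightarrow> nat) set"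
    by (induction A rule: infinite_finite_induct) (simp_all add: zero add)
  have nat: "\<psi> (of_nat n) = of_nat n" for n by (induction n) (simp_all add: zero one add)
  have int: "\<psi> (of_int i) = of_int i" for i by (cases i) (simp_all add: nat neg diff one)
  have word: "word (\<lambda>a i j. \<psi> (L a i j)) as I J = \<psi> (word L as I J)" for I J
    by (induction as) (simp_all add: word_def one mult)
  have alt: "alt True A (\<lambda>I J. \<psi> (G I J)) I J = \<psi> (alt True A G I J)" for A and G :: "('c, 'a) tmat" and I J
    by (simp add: alt_def sum_fun_apply smul_def act_def sm' mult int)
  have ptr: "ptr as (\<lambda>I J. \<psi> (G I J)) = (\<lambda>I J. \<psi> (ptr as G I J))" for as and G :: "('c, 'a) tmat"
    by (induction as) (simp_all add: pt_def sm)
  have "word (\<lambda>a i j. \<psi> (L a i j)) as = (\<lambda>I J. \<psi> (word L as I J))" by (intro ext word)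
  moreover have "alt True (set as) (\<lambda>I J. \<psi> (word L as I J)) = (\<lambda>I J. \<psi> (alt True (set as) (word L as) I J))"
    by (intro ext alt)
  ultimately show ?thesis
    unfolding fused_trace_def by (simp only: ptr)
qed

subsection \<open>The series \<open>\<ell>\<^sub>k\<close> as fused traces\<close>

text \<open>Positions outside the list carry identities, whose delta factors form the condition; for
  the list of all positions the condition is empty.\<close>

lemma foldr_place:
  fixes M :: "nat \<Rightarrow> 'n::finite \<Rightarrow> 'n \<Rightarrow> 's::ring_1"
  assumes "distinct as" "set as \<subseteq> {1..k}" "I \<in> midx k" "J \<in> midx k"
  shows "foldr (tmul k) (map (\<lambda>a. place k a (M a)) as) tid I J
    = (if \<forall>b\<in>{1..k} - set as. I b = J b then word M as I J else 0)"
  using assms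
proof (induction as arbitrary: I)
  case Nil
  then have "(\<forall>b\<in>{1..k}. I b = J b) \<longleftrightarrow> I = J" using midx_eqI by blast
  then show ?case by (simp add: tid_def word_Nil)
next
  case (Cons a as)
  let ?C = "\<forall>b\<in>{1..k} - set (a # as). I b = J b"
  have a: "a \<in> {1..k}" "a \<notin> set as" using Cons.prems by auto
  have "foldr (tmul k) (map (\<lambda>a. place k a (M a)) (a # as)) tid I J
    = (\<Sum>x\<in>UNIV. M a (I a) x * foldr (tmul k) (map (\<lambda>a. place k a (M a)) as) tid (I(a := x)) J)"
    using tmul_place[OF Cons.prems(3) a(1)] by simp
  also have "\<dots> = (\<Sum>x\<in>UNIV. if x = J a then (if ?C then M a (I a) x * word M as I J else 0) else 0)"
  proof (rule sum.cong[OF refl])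
    fix x
    have 1: "foldr (tmul k) (map (\<lambda>a. place k a (M a)) as) tid (I(a := x)) J
      = (if \<forall>b\<in>{1..k} - set as. (I(a := x)) b = J b then word M as (I(a := x)) J else 0)"
      by (rule Cons.IH[OF _ _ midx_fun_upd[OF Cons.prems(3) a(1)] Cons.prems(4)]) (use Cons.prems in auto)
    have 2: "(\<forall>b\<in>{1..k} - set as. (I(a := x)) b = J b) \<longleftrightarrow> x = J a \<and> ?C"
      using a by auto
    have 3: "word M as (I(a := x)) J = word M as I J"
      by (rule word_cong) (use a in auto)
    show "M a (I a) x * foldr (tmul k) (map (\<lambda>a. place k a (M a)) as) tid (I(a := x)) J
      = (if x = J a then (if ?C then M a (I a) x * word M as I J else 0) else 0)"
      unfolding 1 2 3 by simp
  qed
  also have "\<dots> = (if ?C then word M (a # as) I J else 0)" by (simp add: word_Cons)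
  finally show ?case .
qed

lemma L_minus_prod_eq:
  assumes "I \<in> midx k" "J \<in> midx k"
  shows "L_minus_prod k I J = word (\<lambda>a. L_minus_shift (a - 1)) [1..<Suc k] (I :: nat \<Rightarrow> 'n::finite) J"
  unfolding L_minus_prod_def
  by (subst foldr_place[OF _ _ assms]) (auto simp del: upt_Suc)

lemma ptr_PiE:
  fixes G :: "('n::finite, 's::ring_1) tmat"
  assumes "distinct as"
  shows "ptr as G I J = (\<Sum>K\<in>PiE (set as) (\<lambda>_. UNIV). G (override_on I K (set as)) (override_on J K (set as)))"
  using assms
proof (induction as arbitrary: I J)
  case Nil
  then show ?case by simp
next
  case (Cons a as)
  then have a: "a \<notin> set as" "distinct as" by auto
  have "ptr (a # as) G I J = (\<Sum>x\<in>UNIV. \<Sum>K\<in>PiE (set as) (\<lambda>_. UNIV).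
    G (override_on (I(a := x)) K (set as)) (override_on (J(a := x)) K (set as)))"
    by (simp add: pt_def Cons.IH[OF a(2)] del: fun_upd_apply)
  also have "\<dots> = (\<Sum>(x, K)\<in>UNIV \<times> PiE (set as) (\<lambda>_. UNIV).
    G (override_on (I(a := x)) K (set as)) (override_on (J(a := x)) K (set as)))"
    by (rule sum.cartesian_product)
  also have "\<dots> = (\<Sum>(x, K)\<in>UNIV \<times> PiE (set as) (\<lambda>_. UNIV).
    G (override_on I (K(a := x)) (set (a # as))) (override_on J (K(a := x)) (set (a # as))))"
  proof (rule sum.cong[OF refl])
    fix s :: "'n \<times> (nat \<Rightarrow> 'n)"
    have "override_on (I(a := x)) K (set as) = override_on I (K(a := x)) (set (a # as))" for I K :: "nat \<Rightarrow> 'n" and x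
      using a by (auto simp: fun_eq_iff override_on_def)
    then show "(case s of (x, K) \<Rightarrow> G (override_on (I(a := x)) K (set as)) (override_on (J(a := x)) K (set as)))
      = (case s of (x, K) \<Rightarrow> G (override_on I (K(a := x)) (set (a # as))) (override_on J (K(a := x)) (set (a # as))))"
      by (simp only:)
  qed
  also have "\<dots> = (\<Sum>K\<in>(\<lambda>(x, K). K(a := x)) ` (UNIV \<times> PiE (set as) (\<lambda>_. UNIV)).
    G (override_on I K (set (a # as))) (override_on J K (set (a # as))))"
  proof (subst sum.reindex)
    show "inj_on (\<lambda>(x, K). K(a := x)) (UNIV \<times> PiE (set as) (\<lambda>_. UNIV :: 'n set))"
      using inj_combinator[OF a(1), of "\<lambda>_. UNIV :: 'n set"] by simp
  qed (simp add: case_prod_unfold)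
  also have "(\<lambda>(x, K). K(a := x)) ` (UNIV \<times> PiE (set as) (\<lambda>_. UNIV :: 'n set)) = PiE (set (a # as)) (\<lambda>_. UNIV)"
    by (simp add: PiE_insert_eq)
  finally show ?case .
qed

text \<open>Elements of \<open>midx k\<close> are \<open>undefined\<close> outside
  \<open>{1..k}\<close>, so the iterated trace evaluated at the constant function
  \<open>undefined\<close> runs exactly over them.\<close>

lemma ptr_midx:
  "ptr [1..<Suc k] G (\<lambda>_. undefined) (\<lambda>_. undefined) = (\<Sum>I\<in>midx k. G I (I :: nat \<Rightarrow> 'n::finite))"
proof -
  have s: "set [1..<Suc k] = {1..k}" by auto
  have "ptr [1..<Suc k] G (\<lambda>_. undefined) (\<lambda>_. undefined)
    = (\<Sum>I\<in>midx k. G (override_on (\<lambda>_. undefined) I {1..k}) (override_on (\<lambda>_. undefined) I {1..k}))"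
    by (subst ptr_PiE) (simp_all only: distinct_upt s midx_def)
  also have "\<dots> = (\<Sum>I\<in>midx k. G I I)"
  proof (rule sum.cong[OF refl])
    fix I :: "nat \<Rightarrow> 'n" assume "I \<in> midx k"
    then have "override_on (\<lambda>_. undefined) I {1..k} = I"
      by (auto simp: fun_eq_iff override_on_def midx_def PiE_def extensional_def)
    then show "G (override_on (\<lambda>_. undefined) I {1..k}) (override_on (\<lambda>_. undefined) I {1..k}) = G I I"
      by (simp only:)
  qed
  finally show ?thesis .
qed

lemma fps_const_of_int: "fps_const (of_int i) = (of_int i :: 'a::ring_1 fps)"
  by (cases i) (simp_all add: fps_of_nat flip: fps_const_sub fps_const_neg)

text \<open>Left multiplication by the antisymmetrizer is \<open>alt True\<close> divided by
  \<open>k!\<close>. The indices \<open>I\<close> and \<open>J\<close> are arbitrary because a fused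
  trace is constant.\<close>

lemma ell_bar_eq:
  fixes L :: "nat \<Rightarrow> 'n::finite \<Rightarrow> 'n \<Rightarrow> 'n free_alg fps"
  defines "L \<equiv> \<lambda>a. L_minus_shift (a - 1)"
  shows "ell_bar k = fps_const (scal (fps_const (1 / fact k))) * fused_trace L [1..<Suc k] I J"
proof -
  let ?\<theta> = "\<lambda>z. fps_const (scal (fps_const z)) :: 'n free_alg fps"
  let ?W = "word L [1..<Suc k]"
  have \<theta>_mult: "?\<theta> (x * y) = ?\<theta> x * ?\<theta> y" for x y
    by (simp add: scal_mult[symmetric])
  have \<theta>_sum: "?\<theta> (sum f A) = (\<Sum>x\<in>A. ?\<theta> (f x))" for f and A :: "(nat \<Rightarrow> nat) set"
    by (simp add: fps_const_sum' scal_sum)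
  have \<theta>_int: "?\<theta> (of_int i) = of_int i" for i
    by (simp add: fps_const_of_int scal_of_int)
  have \<theta>_perm: "?\<theta> (perm_op \<sigma> I K) = perm_op \<sigma> I K" for \<sigma> and I K :: "nat \<Rightarrow> 'n"
    by (simp add: perm_op_def)
  have s: "set [1..<Suc k] = {1..k}" by auto
  have entry: "tmul k (\<lambda>I J. ?\<theta> (antisymmetrizer k I J)) (L_minus_prod k) I I
    = ?\<theta> (1 / fact k) * alt True {1..k} ?W I I" if I: "I \<in> midx k" for I
  proof -
    have "?\<theta> (antisymmetrizer k I K) = ?\<theta> (1 / fact k) * (\<Sum>\<sigma> | \<sigma> permutes {1..k}. of_int (sign \<sigma>) * perm_op \<sigma> I K)" for K
    proof -
      have "antisymmetrizer k I K = 1 / fact k * (\<Sum>\<sigma> | \<sigma> permutes {1..k}. of_int (sign \<sigma>) * perm_op \<sigma> I K)"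
        by (simp add: antisymmetrizer_def)
      then show ?thesis by (simp only: \<theta>_mult \<theta>_sum \<theta>_int \<theta>_perm)
    qed
    then have "tmul k (\<lambda>I J. ?\<theta> (antisymmetrizer k I J)) (L_minus_prod k) I I
      = (\<Sum>K\<in>midx k. ?\<theta> (1 / fact k) * (\<Sum>\<sigma> | \<sigma> permutes {1..k}. of_int (sign \<sigma>) * perm_op \<sigma> I K) * L_minus_prod k K I)"
      by (simp only: tmul_def)
    also have "\<dots> = ?\<theta> (1 / fact k) * (\<Sum>\<sigma> | \<sigma> permutes {1..k}. of_int (sign \<sigma>) * (\<Sum>K\<in>midx k. perm_op \<sigma> I K * ?W K I))"
      by (subst sum_distrib_left, subst sum.swap)
        (simp add: sum_distrib_left sum_distrib_right mult.assoc L_minus_prod_eq[OF _ I, folded L_def] del: upt_Suc)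
    also have "(\<Sum>\<sigma> | \<sigma> permutes {1..k}. of_int (sign \<sigma>) * (\<Sum>K\<in>midx k. perm_op \<sigma> I K * ?W K I))
      = (\<Sum>\<sigma> | \<sigma> permutes {1..k}. of_int (sign \<sigma>) * ?W (I \<circ> \<sigma>) I)"
    proof (rule sum.cong[OF refl])
      fix \<sigma> assume "\<sigma> \<in> {\<sigma>. \<sigma> permutes {1..k}}"
      then have \<sigma>: "\<sigma> permutes {1..k}" by simp
      have "(\<Sum>K\<in>midx k. perm_op \<sigma> I K * ?W K I) = (\<Sum>K\<in>midx k. if K = I \<circ> \<sigma> then ?W (I \<circ> \<sigma>) I else 0)"
        by (rule sum.cong) (auto simp: perm_op_def perm_op_iff[OF \<sigma>] simp del: upt_Suc)
      also have "\<dots> = ?W (I \<circ> \<sigma>) I" using midx_comp[OF I \<sigma>] by simp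
      finally show "of_int (sign \<sigma>) * (\<Sum>K\<in>midx k. perm_op \<sigma> I K * ?W K I) = of_int (sign \<sigma>) * ?W (I \<circ> \<sigma>) I" by simp
    qed
    finally show ?thesis by (simp only: alt_def sum_fun_apply smul_def act_def if_True)
  qed
  have "ell_bar k = (\<Sum>I\<in>midx k. ?\<theta> (1 / fact k) * alt True {1..k} ?W I I)"
    unfolding ell_bar_def ttrace_def by (rule sum.cong[OF refl entry])
  also have "\<dots> = ?\<theta> (1 / fact k) * ptr [1..<Suc k] (alt True {1..k} ?W) (\<lambda>_. undefined) (\<lambda>_. undefined)"
    by (simp only: ptr_midx sum_distrib_left)
  also have "ptr [1..<Suc k] (alt True {1..k} ?W) (\<lambda>_. undefined) (\<lambda>_. undefined) = fused_trace L [1..<Suc k] I J"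
    unfolding fused_trace_const[of _ _ I J "\<lambda>_. undefined" "\<lambda>_. undefined"] by (simp only: fused_trace_def s)
  finally show ?thesis .
qed


subsection \<open>Commutativity\<close>

abbreviation hh :: "'n free_alg fps fps" where
  "hh \<equiv> fps_const (fps_const hbar)"

abbreviation yd_series2 :: "'n::finite free_alg fps fps set" where
  "yd_series2 \<equiv> coeff_ideal (coeff_ideal yd_ideal)"

lemma two_sided_yd_series: "two_sided_ideal (coeff_ideal yd_ideal)"
  and two_sided_yd_series2: "two_sided_ideal yd_series2"
  by (intro two_sided_coeff two_sided_ideal_yd_ideal)+

lemma half_exists: "\<exists>e :: 'n free_alg fps fps. e + e = 1"
proof -
  have "fps_const (fps_const x) + fps_const (fps_const x) = fps_const (fps_const (x + x))" for x :: "'n free_alg"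
    by simp
  then show ?thesis using scal_half by (metis fps_const_1_eq_1)
qed

lemma yd_ideal_divide_h: "hbar * x \<in> yd_ideal \<Longrightarrow> x \<in> yd_ideal"
  using yd_ideal_divide_h_power[of 1 x] by simp

text \<open>For parameters differing by \<open>h\<close>, \<open>rtt_one_variable\<close> is up to
  sign \<open>h\<close> times the relation with \<open>1 - P\<close>, and saturation removes the
  \<open>h\<close>.\<close>

lemma exchange_minus_one:
  assumes "b = Suc a"
  shows "exchange (coeff_ideal yd_ideal) 1 (- 1) (L_minus_shift a) (L_minus_shift b :: 'n::finite \<Rightarrow> _)"
  unfolding exchange_def
proof (intro allI, rule coeff_idealI, rule yd_ideal_divide_h)
  fix i j k l :: 'n and r
  let ?X = "L_minus_shift a :: 'n \<Rightarrow> 'n \<Rightarrow> _" and ?Y = "L_minus_shift b :: 'n \<Rightarrow> 'n \<Rightarrow> _"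
  have "fps_nth (- ((of_nat a - of_nat b) * fps_const hbar * commutator (?X i j) (?Y k l)
     + fps_const hbar * (?X k j * ?Y i l - ?Y k j * ?X i l))) r \<in> yd_ideal"
    by (rule coeff_idealD, rule left_ideal_minus[OF two_sided_left[OF two_sided_yd_series]], rule rtt_one_variable)
  also have "- ((of_nat a - of_nat b) * fps_const hbar * commutator (?X i j) (?Y k l)
     + fps_const hbar * (?X k j * ?Y i l - ?Y k j * ?X i l))
    = fps_const hbar * (1 * (?X i j * ?Y k l - ?Y k l * ?X i j) + - 1 * (?X k j * ?Y i l - ?Y k j * ?X i l))"
  proof -
    have "of_nat a - of_nat b = (- 1 :: 'n free_alg fps)" by (simp add: assms)
    moreover have "- (- 1 * H * C + H * E) = H * (1 * C + - 1 * E)" for H C E :: "'n free_alg fps"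
      by (simp add: right_diff_distrib)
    ultimately show ?thesis by (simp only:)
  qed
  finally show "hbar * fps_nth (1 * (?X i j * ?Y k l - ?Y k l * ?X i j) + - 1 * (?X k j * ?Y i l - ?Y k j * ?X i l)) r \<in> yd_ideal"
    by (simp only: fps_mult_left_const_nth)
qed

lemma exchange_hom:
  assumes ex: "exchange \<I> 1 (- 1) X Y" and add: "\<And>x y. \<psi> (x + y) = \<psi> x + \<psi> y" and mult: "\<And>x y. \<psi> (x * y) = \<psi> x * \<psi> y"
    and I: "\<And>x. x \<in> \<I> \<Longrightarrow> \<psi> x \<in> \<J>"
  shows "exchange \<J> 1 (- 1) (\<lambda>i j. \<psi> (X i j)) (\<lambda>i j. \<psi> (Y i j))"
  unfolding exchange_def
proof (intro allI)
  fix i j k l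
  have zero: "\<psi> 0 = 0" using add[of 0 0] by simp
  have neg: "\<psi> (- x) = - \<psi> x" for x using add[of x "- x"] by (simp add: zero eq_neg_iff_add_eq_0 add.commute)
  have diff: "\<psi> (x - y) = \<psi> x - \<psi> y" for x y using add[of x "- y"] by (simp add: neg)
  have "\<psi> (1 * (X i j * Y k l - Y k l * X i j) + - 1 * (X k j * Y i l - Y k j * X i l)) \<in> \<J>"
    using ex unfolding exchange_def by (intro I) blast
  then show "1 * (\<psi> (X i j) * \<psi> (Y k l) - \<psi> (Y k l) * \<psi> (X i j)) + - 1 * (\<psi> (X k j) * \<psi> (Y i l) - \<psi> (Y k j) * \<psi> (X i l)) \<in> \<J>"
    by (simp add: diff add neg mult)
qed

lemma yd_of_int_cancel: "r \<noteq> 0 \<Longrightarrow> of_int r * hbar * x \<in> yd_ideal \<Longrightarrow> x \<in> yd_ideal"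
proof -
  assume r: "r \<noteq> 0" and x: "of_int r * hbar * x \<in> yd_ideal"
  have "scal (fps_const (inverse (of_int r))) * (of_int r * hbar * x) \<in> yd_ideal"
    by (rule left_ideal_mult[OF left_ideal_yd_ideal x])
  moreover have "scal (fps_const (inverse (of_int r))) * (of_int r * (hbar * x)) = hbar * x"
    using scal_inverse[of "of_int r" "hbar * x"] r by (simp only: fps_const_of_int scal_of_int) simp
  ultimately show ?thesis using yd_ideal_divide_h by (simp only: mult.assoc)
qed

text \<open>For \<open>r = 0\<close> the coefficient of \<open>u^(i+1) v^j\<close> is
  \<open>x_(i,j) - x_(i+1,j-1)\<close>, which permits induction on \<open>j\<close>. For other
  \<open>r\<close> the factor has the constant term \<open>r h\<close>, which can be cancelled
  modulo the ideal, so induction on the total degree works.\<close>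

lemma cancel_linear:
  fixes x :: "'n::finite free_alg fps fps"
  assumes x: "(fps_X - fps_const fps_X + of_int r * hh) * x \<in> yd_series2"
  shows "x \<in> yd_series2"
proof -
  note LI = left_ideal_yd_ideal
  let ?x = "\<lambda>i j. fps_nth (fps_nth x i) j"
  let ?p = "\<lambda>i j. if i = 0 then 0 else ?x (i - 1) j" and ?q = "\<lambda>i j. if j = 0 then 0 else ?x i (j - 1)"
  have rh: "of_int r * hh = fps_const (fps_const (of_int r * hbar) :: 'n free_alg fps)"
    by (simp add: fps_const_of_int[symmetric])
  have nth: "?p i j - ?q i j + of_int r * hbar * ?x i j \<in> yd_ideal" for i j
  proof -
    have "fps_nth (fps_nth ((fps_X - fps_const fps_X + of_int r * hh) * x) i) j \<in> yd_ideal"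
      by (intro coeff_idealD x)
    also have "fps_nth (fps_nth ((fps_X - fps_const fps_X + of_int r * hh) * x) i) j = ?p i j - ?q i j + of_int r * hbar * ?x i j"
      unfolding rh by (simp add: distrib_right left_diff_distrib)
    finally show ?thesis .
  qed
  have "?x i j \<in> yd_ideal" for i j
  proof (cases "r = 0")
    case True
    show ?thesis
    proof (induction j arbitrary: i)
      case 0
      show ?case using nth[of "Suc i" 0] True by simp
    next
      case (Suc j)
      have "?x i (Suc j) - ?x (Suc i) j \<in> yd_ideal" using nth[of "Suc i" "Suc j"] True by simp
      from left_ideal_add[OF LI this Suc.IH[of "Suc i"]] show ?case by simp
    qed
  next
    case False
    show ?thesis
    proof (induction "i + j" arbitrary: i j rule: less_induct)
      case less
      have "?p i j \<in> yd_ideal" "?q i j \<in> yd_ideal" by (auto intro: less left_ideal_0[OF LI])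
      then have "(?p i j - ?q i j + of_int r * hbar * ?x i j) - (?p i j - ?q i j) \<in> yd_ideal"
        by (intro left_ideal_diff[OF LI] nth)
      then have "of_int r * hbar * ?x i j \<in> yd_ideal" by (simp only: add_diff_cancel_left')
      then show ?case by (rule yd_of_int_cancel[OF False])
    qed
  qed
  then show ?thesis by (intro coeff_idealI)
qed

lemma cancel_prod_list:
  assumes "\<And>f x. f \<in> set fs \<Longrightarrow> g f * x \<in> \<I> \<Longrightarrow> x \<in> \<I>" "prod_list (map g fs) * x \<in> \<I>"
  shows "x \<in> (\<I> :: 's::ring_1 set)"
  using assms
proof (induction fs arbitrary: x)
  case (Cons f fs)
  have "g f * (prod_list (map g fs) * x) \<in> \<I>" using Cons.prems(2) by (simp add: mult.assoc)
  then have "prod_list (map g fs) * x \<in> \<I>" using Cons.prems(1)[of f] by simp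
  then show ?case using Cons.IH Cons.prems(1) by (metis list.set_intros(2))
qed simp

theorem ell_bar_commute:
  "fps_nth (ell_bar k) r * fps_nth (ell_bar m) s - fps_nth (ell_bar m) s * fps_nth (ell_bar k) r
    \<in> (yd_ideal :: 'n::finite free_alg set)"
proof -
  let ?I = "yd_series2 :: 'n free_alg fps fps set"
  note I = two_sided_yd_series2 and LI = two_sided_left[OF two_sided_yd_series2]
  obtain e :: "'n free_alg fps fps" where e: "e + e = 1" using half_exists by blast
  \<comment> \<open>Positions \<open>1..k\<close> carry the parameter \<open>u\<close>, the others
    \<open>v\<close>. Their shifts \<open>a - 1\<close> and \<open>b - k - 1\<close> differ by
    \<open>a - b + k\<close>, the integer that enters \<open>d\<close>.\<close>
  define L :: "nat \<Rightarrow> 'n \<Rightarrow> 'n \<Rightarrow> 'n free_alg fps fps" where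
    "L = (\<lambda>a i j. if a \<le> k then outer (L_minus_shift (a - 1) i j) else fps_const (L_minus_shift (a - k - 1) i j))"
  define M :: "nat \<Rightarrow> 'n \<Rightarrow> 'n \<Rightarrow> 'n free_alg fps" where "M = (\<lambda>a. L_minus_shift (a - 1))"
  define d :: "nat \<Rightarrow> nat \<Rightarrow> 'n free_alg fps fps" where
    "d = (\<lambda>a b. fps_X - fps_const fps_X + (of_nat a - of_nat b + of_nat k) * hh)"
  let ?as = "[1..<Suc k]" and ?bs = "[Suc k..<Suc (k + m)]"
  have sets: "set ?as = {1..k}" "set ?bs = {Suc k..k + m}" by auto
  let ?A = "\<lambda>G :: ('n, 'n free_alg fps fps) tmat. alt True {1..k} (alt True {Suc k..k + m} G)"
  let ?c = "of_nat (nperm {1..k} * nperm {Suc k..k + m}) :: 'n free_alg fps fps"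
  let ?s = "prod_list (map (\<lambda>f. fst f ^ 2 - hh ^ 2) (grid d ?as (rev ?bs)))"
  have chh: "central (hh :: 'n free_alg fps fps)" by (intro central_fps_const central_fps_X)
  have cd: "central (d a b)" for a b
    unfolding d_def by (intro central_add central_diff central_mult chh central_of_nat central_fps_X central_fps_const)
  have hom1: "outer (x + y) = outer x + outer y" "outer (x * y) = outer x * outer y" for x y :: "'n free_alg fps"
    by (simp_all add: outer_add outer_mult)
  have hom2: "fps_const (x + y) = fps_const x + fps_const y" "fps_const (x * y) = fps_const x * fps_const y" for x y :: "'n free_alg fps"
    by simp_all
  have "smul (?c * ?c * ?s) (ptr (?as @ ?bs) (?A (word L (?as @ ?bs))) - ptr (?as @ ?bs) (?A (word L (?bs @ ?as)))) \<in> tensors ?I"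
  proof (rule fused_traces[OF I e cd chh])
    show "exchange ?I (d a b) hh (L a) (L b)" if ab: "1 \<le> a" "a \<le> k" "Suc k \<le> b" "b \<le> k + m" for a b
    proof -
      have "(of_nat (a - 1) - of_nat (b - k - 1) :: 'n free_alg fps fps) = of_nat a - of_nat b + of_nat k"
        using ab by (simp add: of_nat_diff algebra_simps)
      moreover have "L a = (\<lambda>i j. outer (L_minus_shift (a - 1) i j))" "L b = (\<lambda>i j. fps_const (L_minus_shift (b - k - 1) i j))"
        using ab by (auto simp: L_def)
      moreover have "exchange ?I (fps_X - fps_const fps_X + (of_nat (a - 1) - of_nat (b - k - 1)) * hh) hh
          (\<lambda>i j. outer (L_minus_shift (a - 1) i j)) (\<lambda>i j. fps_const (L_minus_shift (b - k - 1) i j))"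
        unfolding exchange_def by (intro allI rtt_two_variables)
      ultimately show ?thesis by (simp only: d_def)
    qed
    show "d a b - d (Suc a) b = - hh" "d a (Suc b) - d a b = - hh" for a b
      by (simp_all add: d_def algebra_simps)
    show "exchange ?I 1 (- 1) (L a) (L (Suc a))" if a: "1 \<le> a" "a < k" for a
    proof -
      have "exchange ?I 1 (- 1) (\<lambda>i j. outer (L_minus_shift (a - 1) i j)) (\<lambda>i j. outer (L_minus_shift a i j :: 'n free_alg fps))"
        by (rule exchange_hom[OF exchange_minus_one hom1 outer_ideal[OF left_ideal_yd_ideal]]) (use a in auto)
      then show ?thesis using a by (simp add: L_def)
    qed
    show "exchange ?I 1 (- 1) (L a) (L (Suc a))" if a: "Suc k \<le> a" "a < k + m" for a
    proof -
      have "exchange ?I 1 (- 1) (\<lambda>i j. fps_const (L_minus_shift (a - k - 1) i j)) (\<lambda>i j. fps_const (L_minus_shift (a - k) i j :: 'n free_alg fps))"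
        by (rule exchange_hom[OF exchange_minus_one hom2 fps_const_ideal[OF left_ideal_yd_ideal]]) (use a in auto)
      then show ?thesis using a by (simp add: L_def Suc_diff_le)
    qed
  qed
  then have 1: "?c * ?c * ?s * (fused_trace L ?as I J * fused_trace L ?bs I J - fused_trace L ?bs I J * fused_trace L ?as I J) \<in> ?I" for I J
    using fused_trace_product[of ?as ?bs L] unfolding sets
    by (auto simp: tensors_def smul_def minus_apply tprod_def simp del: upt_Suc of_nat_mult)
  have T1: "fused_trace L ?as I J = outer (fused_trace M ?as I J)" for I J
  proof -
    have "word L ?as = word (\<lambda>a i j. outer (M a i j)) ?as"
      unfolding word_def by (intro ext arg_cong[where f = prod_list] map_cong) (auto simp: L_def M_def)
    then have "fused_trace L ?as I J = fused_trace (\<lambda>a i j. outer (M a i j)) ?as I J" by (simp only: fused_trace_def)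
    also have "\<dots> = outer (fused_trace M ?as I J)" by (rule fused_trace_hom[OF hom1 outer_1])
    finally show ?thesis .
  qed
  have T2: "fused_trace L ?bs I J = fps_const (fused_trace M [1..<Suc m] I J)" for I J
  proof -
    have "word (\<lambda>a. L (a + k)) [1..<Suc m] = word (\<lambda>a i j. fps_const (M a i j)) [1..<Suc m]"
      unfolding word_def by (intro ext arg_cong[where f = prod_list] map_cong) (auto simp: L_def M_def)
    then have "fused_trace L ?bs I J = fused_trace (\<lambda>a i j. fps_const (M a i j)) [1..<Suc m] I J"
      by (simp only: fused_trace_shift) (simp only: fused_trace_def)
    also have "\<dots> = fps_const (fused_trace M [1..<Suc m] I J)" by (rule fused_trace_hom[OF hom2]) simp
    finally show ?thesis .
  qed
  fix I J :: "nat \<Rightarrow> 'n"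
  let ?x = "fused_trace M ?as I J" and ?y = "fused_trace M [1..<Suc m] I J"
  have nat_cancel: "z \<in> ?I" if "of_nat q * z \<in> ?I" "q > 0" for q z
  proof (rule coeff_idealI, rule coeff_idealI, rule left_ideal_of_nat_cancel[OF left_ideal_yd_ideal _ that(2)])
    fix i j
    have "fps_nth (fps_nth (of_nat q * z) i) j \<in> yd_ideal" by (intro coeff_idealD that(1))
    then show "of_nat q * fps_nth (fps_nth z i) j \<in> yd_ideal" by (simp add: fps_of_nat[symmetric])
  qed
  have pos: "nperm {1..k} * nperm {Suc k..k + m} > 0" by (simp add: nperm_pos)
  have 3: "?s * (outer ?x * fps_const ?y - fps_const ?y * outer ?x) \<in> ?I"
    using 1[of I J] nat_cancel pos unfolding T1 T2 mult.assoc by blast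
  have "outer ?x * fps_const ?y - fps_const ?y * outer ?x \<in> ?I"
  proof (rule cancel_prod_list[where g = "\<lambda>f. fst f ^ 2 - hh ^ 2" and fs = "grid d ?as (rev ?bs)", OF _ 3])
    fix f z assume fg: "f \<in> set (grid d ?as (rev ?bs))" and z: "(fst f ^ 2 - hh ^ 2) * z \<in> ?I"
    obtain a b where "f = (d a b, swp a b)" using grid_mem[OF fg] by blast
    then have f: "fst f = d a b" by simp
    let ?r = "int a - int b + int k"
    \<comment> \<open>Each factor of the scalar splits into two linear ones, to which
      \<open>cancel_linear\<close> applies.\<close>
    have "fst f ^ 2 - hh ^ 2 = (d a b - hh) * (d a b + hh)"
      by (simp add: f power2_eq_square algebra_simps centralD[OF chh, of "d a b"])
    also have "d a b - hh = fps_X - fps_const fps_X + of_int (?r - 1) * hh"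
      by (simp add: d_def algebra_simps)
    also have "d a b + hh = fps_X - fps_const fps_X + of_int (?r + 1) * hh"
      by (simp add: d_def algebra_simps)
    finally show "z \<in> ?I" using z by (simp only: mult.assoc) (blast intro: cancel_linear)
  qed
  then have 2: "fps_nth ?x r * fps_nth ?y s - fps_nth ?y s * fps_nth ?x r \<in> yd_ideal"
    using outer_const_nth[of ?x ?y r s] const_outer_nth[of ?y ?x r s] unfolding coeff_ideal_def
    by (auto dest!: spec[of _ r] spec[of _ s])
  let ?a = "scal (fps_const (1 / fact k)) :: 'n free_alg" and ?b = "scal (fps_const (1 / fact m)) :: 'n free_alg"
  have "fps_nth (ell_bar k) r = ?a * fps_nth ?x r" "fps_nth (ell_bar m) s = ?b * fps_nth ?y s"
    by (simp_all add: ell_bar_eq[of _ I J] M_def del: upt_Suc)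
  then have "fps_nth (ell_bar k) r * fps_nth (ell_bar m) s - fps_nth (ell_bar m) s * fps_nth (ell_bar k) r
    = ?a * ?b * (fps_nth ?x r * fps_nth ?y s - fps_nth ?y s * fps_nth ?x r)"
    by (simp only: mult.assoc right_diff_distrib central_left_commute[OF central_scal, of "fps_nth _ _"]
        central_left_commute[OF central_scal, of ?a])
  then show ?thesis using left_ideal_mult[OF left_ideal_yd_ideal 2] by simp
qed

section \<open>The critical level\<close>

lemma crit_add: "crit (x + y) = crit x + crit y"
  and crit_diff: "crit (x - y) = crit x - crit y"
  and crit_mult: "crit (x * y) = crit x * crit y"
  and crit_0: "crit 0 = 0" and crit_1: "crit 1 = 1"
  by (simp_all add: crit_def plus_yangian_double.abs_eq plus_yd_crit.abs_eq minus_yangian_double.abs_eq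
      minus_yd_crit.abs_eq times_yangian_double.abs_eq
      times_yd_crit.abs_eq zero_yangian_double_def zero_yd_crit_def one_yangian_double_def one_yd_crit_def)

lemma crit_power: "crit (x ^ k) = crit x ^ k"
  by (induction k) (simp_all add: crit_1 crit_mult)

lemma crit_surj: obtains x where "a = crit x"
proof -
  have "\<exists>x. abs_yd_crit y = crit x" for y :: "'a yangian_double"
    by (induct y rule: yangian_double.abs_induct) (auto simp: crit_def)
  then have "\<exists>x. a = crit x" by (induct a rule: yd_crit.abs_induct) simp
  with that show ?thesis by blast
qed

lemma crit_yd_ideal: "x \<in> yd_ideal \<Longrightarrow> crit x = 0"
proof -
  assume "x \<in> yd_ideal"
  then have "yd x = yd 0" by (simp add: yangian_double.abs_eq_iff)
  then show "crit x = 0" using crit_0 by (simp add: crit_def)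
qed

definition crit_kernel :: "'n::finite free_alg set" where
  "crit_kernel = {x. crit x = 0}"

lemma two_sided_crit_kernel: "two_sided_ideal crit_kernel"
  by (auto simp: two_sided_ideal_def crit_kernel_def crit_diff crit_mult crit_0)

lemma yd_ideal_subset_kernel: "yd_ideal \<subseteq> crit_kernel"
  by (auto simp: crit_kernel_def crit_yd_ideal)

lemma c_free_crit: "c_free - scal (fps_const (- of_nat CARD('n))) \<in> (crit_kernel :: 'n::finite free_alg set)"
proof -
  have "yd (c_free + of_nat CARD('n) :: 'n free_alg) - 0 \<in> two_sided_ideal_gen {yd (c_free + of_nat CARD('n))}"
    by (auto simp: two_sided_ideal_gen_def)
  then have "crit (c_free + of_nat CARD('n) :: 'n free_alg) = abs_yd_crit 0"
    unfolding crit_def by (simp add: yd_crit.abs_eq_iff)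
  then have "crit (c_free + of_nat CARD('n) :: 'n free_alg) = 0"
    by (simp add: zero_yd_crit_def)
  moreover have "c_free - scal (fps_const (- of_nat CARD('n))) = (c_free + of_nat CARD('n) :: 'n free_alg)"
    using scal_fps_const_of_nat[of "CARD('n)", where ?'a = 'n] by (simp add: scal_minus flip: fps_const_neg)
  ultimately show ?thesis by (simp only: crit_kernel_def mem_Collect_eq)
qed

lemma crit_hbar_power_commute: "x * (crit hbar ^ m * y) = crit hbar ^ m * (x * y)"
proof -
  obtain z where "x = crit z" by (rule crit_surj)
  then have "x * crit hbar ^ m = crit hbar ^ m * x"
    by (simp only: crit_power[symmetric] crit_mult[symmetric] centralD[OF central_hbar_power, of z])
  then show ?thesis by (simp add: mult.assoc[symmetric])
qed

lemma J_ideal_left: "left_ideal (J_ideal p)"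
  unfolding J_ideal_def by (rule left_ideal_gen)

lemma J_ideal_0: "0 \<in> J_ideal p"
  and J_ideal_mult: "a \<in> J_ideal p \<Longrightarrow> r * a \<in> J_ideal p"
  using J_ideal_left unfolding left_ideal_def by blast+

lemma J_h_mult: "x \<in> J_h p m \<Longrightarrow> r * x \<in> J_h p m"
proof -
  assume "x \<in> J_h p m"
  then obtain a b where "a \<in> J_ideal p" "x = a + crit hbar ^ m * b"
    unfolding J_h_def by (auto elim!: set_plus_elim)
  then have "r * x = r * a + crit hbar ^ m * (r * b)" "r * a \<in> J_ideal p"
    by (simp_all add: distrib_left crit_hbar_power_commute J_ideal_mult)
  then show ?thesis unfolding J_h_def by (metis rangeI set_plus_intro)
qed

text \<open>The preimage of \<open>J_h p m\<close> in the free algebra, where the estimates are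
  carried out.\<close>

definition Jf :: "nat \<Rightarrow> nat \<Rightarrow> 'n::finite free_alg set" where
  "Jf p m = {x. crit x \<in> J_h p m}"

lemma left_ideal_Jf: "left_ideal (Jf p m)"
  unfolding left_ideal_def Jf_def
  by (auto simp: crit_0 crit_diff crit_mult J_h_zero J_h_diff J_h_mult)

lemma Jf_power: "m \<le> k \<Longrightarrow> hbar ^ k * x \<in> Jf p m"
proof -
  assume "m \<le> k"
  then have "crit (hbar ^ k * x) = 0 + crit hbar ^ m * crit (hbar ^ (k - m) * x)"
    by (simp add: crit_mult[symmetric] crit_power[symmetric] mult.assoc[symmetric] power_add[symmetric])
  moreover note J_ideal_0[of p]
  ultimately show ?thesis unfolding Jf_def J_h_def by (simp only: mem_Collect_eq) (intro set_plus_intro rangeI)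
qed

lemma Jf_h: "x \<in> Jf p m \<Longrightarrow> hbar * x \<in> Jf p (Suc m)"
proof -
  assume "x \<in> Jf p m"
  then obtain a b where ab: "a \<in> J_ideal p" "crit x = a + crit hbar ^ m * b"
    unfolding Jf_def J_h_def by (auto elim!: set_plus_elim)
  have "crit (hbar * x) = crit hbar * a + crit hbar ^ Suc m * b"
    by (simp only: crit_mult ab(2) distrib_left power_Suc mult.assoc)
  moreover note J_ideal_mult[OF ab(1), of "crit hbar"]
  ultimately show ?thesis unfolding Jf_def J_h_def by (simp only: mem_Collect_eq) (intro set_plus_intro rangeI)
qed

lemma Jf_gen: "int p \<le> r \<Longrightarrow> l_free i j r \<in> Jf p m"
proof -
  assume "int p \<le> r"
  then have "crit (l_free i j r) \<in> J_ideal p" unfolding J_ideal_def left_ideal_gen_def by auto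
  then have "crit (l_free i j r) + crit hbar ^ m * 0 \<in> J_h p m"
    unfolding J_h_def by (intro set_plus_intro rangeI)
  then show ?thesis by (simp add: Jf_def)
qed

lemma Jf_kernel: "x \<in> crit_kernel \<Longrightarrow> x \<in> Jf p m"
  by (simp add: crit_kernel_def Jf_def J_h_zero)

lemma Jf_0: "x \<in> Jf p 0"
  using Jf_power[of 0 0 x p] by simp

section \<open>Products of generators with a large upper index on the left\<close>

lemma ideal_power_cong:
  assumes I: "two_sided_ideal I" and x: "x - y \<in> I"
  shows "x ^ k - y ^ k \<in> (I :: 'a::ring_1 set)"
  by (induction k) (simp_all add: left_ideal_0[OF two_sided_left[OF I]] two_sided_ideal_times[OF I x])

lemma tcoeff_cong:
  assumes I: "two_sided_ideal I" and x: "x - y \<in> I"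
  shows "tcoeff \<gamma> x P Q - tcoeff \<gamma> y P Q \<in> I"
proof -
  note LI = two_sided_left[OF I]
  have "tcoeff \<gamma> x P Q - tcoeff \<gamma> y P Q = (\<Sum>i\<le>P. scal (fps_const (\<gamma> i)) *
    (of_nat (invc i P * ((P - i) choose Q)) * (x ^ (P - i - Q) - y ^ (P - i - Q))))"
    by (simp add: tcoeff_def sum_subtractf right_diff_distrib del: of_nat_mult)
  also have "\<dots> \<in> I"
    by (rule left_ideal_sum[OF LI], rule left_ideal_mult[OF LI], rule left_ideal_mult[OF LI], rule ideal_power_cong[OF I x])
  finally show ?thesis .
qed

lemma tcoeff_central: "central b \<Longrightarrow> central (tcoeff \<gamma> b P Q)"
proof -
  assume b: "central b"
  have "central (\<Sum>i\<in>A. scal (fps_const (\<gamma> i)) * (of_nat (invc i P * ((P - i) choose Q)) * b ^ (P - i - Q)))" for A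
    by (induction A rule: infinite_finite_induct) (use b in \<open>auto simp del: of_nat_mult\<close>)
  then show ?thesis by (simp only: tcoeff_def)
qed

text \<open>
  The central element acts by a scalar, so right multiplication by its polynomials is harmless.
\<close>

definition scalar_like :: "'n::finite free_alg \<Rightarrow> bool" where
  "scalar_like b \<longleftrightarrow> (\<exists>z. b - scal z \<in> crit_kernel)"

lemma Jf_tcoeff_right:
  assumes "x \<in> Jf p m" "scalar_like b"
  shows "x * tcoeff \<gamma> b P Q \<in> Jf p m"
proof -
  obtain z where z: "b - scal z \<in> crit_kernel" using assms(2) by (auto simp: scalar_like_def)
  have "x * (tcoeff \<gamma> b P Q - tcoeff \<gamma> (scal z) P Q) \<in> Jf p m"
    by (rule Jf_kernel, rule left_ideal_mult[OF two_sided_left[OF two_sided_crit_kernel]],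
        rule tcoeff_cong[OF two_sided_crit_kernel z])
  moreover have "x * tcoeff \<gamma> (scal z) P Q \<in> Jf p m"
    unfolding centralD[OF tcoeff_central[OF central_scal]] by (rule left_ideal_mult[OF left_ideal_Jf assms(1)])
  ultimately have "x * (tcoeff \<gamma> b P Q - tcoeff \<gamma> (scal z) P Q) + x * tcoeff \<gamma> (scal z) P Q \<in> Jf p m"
    by (rule left_ideal_add[OF left_ideal_Jf])
  then show ?thesis by (simp add: right_diff_distrib)
qed

text \<open>The common shape of the coefficients of \<open>L_plus\<close> and
  \<open>L_minus\<close>: a constant, nonzero only at exponent \<open>0\<close>, plus
  \<open>h\<close> times a generator up to sign. The estimates below thus cover the relation of
  \<open>L_plus\<close> with itself and the mixed one.\<close>

definition level_like :: "(int \<Rightarrow> 'n::finite \<Rightarrow> 'n \<Rightarrow> 'n free_alg) \<Rightarrow> bool" where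
  "level_like Y \<longleftrightarrow> (\<forall>e i j. \<exists>E g. (E = 0 \<or> E = 1 \<and> e = 0) \<and>
     (g = 0 \<or> g = l_free i j (- e - 1) \<or> g = - l_free i j (- e - 1)) \<and> Y e i j = E + hbar * g)"

lemma level_like_L_plus: "level_like L_plus"
  unfolding level_like_def
proof (intro allI)
  fix e and i j :: 'n
  show "\<exists>E g. (E = 0 \<or> E = 1 \<and> e = 0) \<and> (g = 0 \<or> g = l_free i j (- e - 1) \<or> g = - l_free i j (- e - 1)) \<and>
      L_plus e i j = E + hbar * g"
    by (rule exI[of _ "if e = 0 \<and> i = j then 1 else 0"], rule exI[of _ "if e < 0 then - l_free i j (- e - 1) else 0"])
      (simp add: L_plus_def)
qed

lemma level_like_L_minus: "level_like L_minus"
  unfolding level_like_def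
proof (intro allI)
  fix e and i j :: 'n
  show "\<exists>E g. (E = 0 \<or> E = 1 \<and> e = 0) \<and> (g = 0 \<or> g = l_free i j (- e - 1) \<or> g = - l_free i j (- e - 1)) \<and>
      L_minus e i j = E + hbar * g"
    by (rule exI[of _ "if e = 0 \<and> i = j then 1 else 0"], rule exI[of _ "if e \<ge> 0 then l_free i j (- e - 1) else 0"])
      (simp add: L_minus_def)
qed

text \<open>The relations give commutation relations for generators after division by
  \<open>h^2\<close>. An error term must therefore be \<open>h^2\<close> times an element of
  \<open>N\<close>, which is stronger than being in \<open>N\<close> and divisible by
  \<open>h^2\<close>.\<close>

definition h2 :: "'n::finite free_alg set \<Rightarrow> 'n free_alg set" where
  "h2 N = {hbar ^ 2 * z | z. z \<in> N}"

lemma left_ideal_h2: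
  assumes N: "left_ideal N"
  shows "left_ideal (h2 N)"
  unfolding left_ideal_def h2_def
proof (intro conjI ballI allI)
  show "0 \<in> {hbar ^ 2 * z |z. z \<in> N}" using left_ideal_0[OF N] by force
  show "x - y \<in> {hbar ^ 2 * z |z. z \<in> N}" if "x \<in> {hbar ^ 2 * z |z. z \<in> N}" "y \<in> {hbar ^ 2 * z |z. z \<in> N}" for x y
    using that left_ideal_diff[OF N] by (auto simp: right_diff_distrib[symmetric])
  show "r * x \<in> {hbar ^ 2 * z |z. z \<in> N}" if "x \<in> {hbar ^ 2 * z |z. z \<in> N}" for x r
    using that left_ideal_mult[OF N] by (auto simp: central_left_commute[OF central_hbar_power])
qed

lemma h2I: "x = hbar ^ 2 * z \<Longrightarrow> z \<in> N \<Longrightarrow> x \<in> h2 N"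
  by (auto simp: h2_def)

lemma L_plus_pos: "e > 0 \<Longrightarrow> L_plus e i j = 0"
  by (simp add: L_plus_def)

text \<open>The induction step for \<open>generators_nearly_commute\<close>, from precision
  \<open>m'\<close> to \<open>Suc m'\<close>. The number \<open>s\<close> is the upper index of the
  right-hand generator and \<open>r\<close> that of the left-hand one; the bound on \<open>r\<close>
  dominates all other indices.\<close>

context
  fixes p m' r :: nat and s b :: int and r0 :: nat
  assumes s: "s = - b - 1"
    and IH1: "\<And>s' r (i::'n::finite) j k l. s \<le> s' \<Longrightarrow> s' < int p \<Longrightarrow> int r0 \<le> r \<Longrightarrow> l_free i j r * l_free k l s' \<in> Jf p m'"
    and IH2: "\<And>s' r (i::'n::finite) j k l. 0 \<le> s' \<Longrightarrow> s' < int p \<Longrightarrow> int r0 \<le> r \<Longrightarrow> l_free i j r * l_free k l s' \<in> Jf p m'"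
    and r: "int r \<ge> int p + int m' + \<bar>b\<bar> + int r0 + 3 + \<bar>s\<bar>"
begin

private abbreviation "N \<equiv> Jf p (Suc m') :: 'n free_alg set"

private lemma NL: "left_ideal N" by (rule left_ideal_Jf)

private lemma gen_ideal:
  assumes "g = 0 \<or> g = x \<or> g = - x" "left_ideal M" "x \<in> (M :: 'n free_alg set)"
  shows "g \<in> M"
  using assms by (auto simp: left_ideal_0 left_ideal_minus)

text \<open>The term \<open>(P, Q)\<close> carries \<open>h^(P - Q)\<close> and generators with
  upper indices \<open>r - P\<close> and \<open>s + Q\<close>, whose sum is
  \<open>r + s - (P - Q)\<close>. If \<open>P - Q\<close> is large, the power of \<open>h\<close>
  suffices. Otherwise either \<open>s + Q >= p\<close> and the right-hand generator lies in the
  ideal, or \<open>r - P\<close> is large and the induction hypothesis applies, the missing power of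
  \<open>h\<close> being at hand.\<close>

lemma rel_term_left:
  fixes i j k l :: 'n
  assumes Y: "level_like Y" and g: "homogeneous \<gamma> f" and PQ: "(P, Q) \<noteq> (0, 0)"
  shows "rcoeff (hbar * y) (- int P) (int Q) f * (L_plus (- int (Suc r) + int P) i j * Y (b - int Q) k l) \<in> h2 N"
proof (cases "Q < P \<and> P \<le> Suc r")
  case False
  then have "rcoeff (hbar * y) (- int P) (int Q) f = 0 \<or> L_plus (- int (Suc r) + int P) i j = (0 :: 'n free_alg)"
    using rcoeff_homogeneous_0[OF g _ PQ] by (cases "P \<le> Q") (auto simp: L_plus_pos)
  then show ?thesis using left_ideal_0[OF left_ideal_h2[OF NL]] by auto
next
  case True
  define D where "D = P - Suc Q"
  have P: "P = Suc (Q + D)" using True by (simp add: D_def)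
  let ?T = "tcoeff \<gamma> y P Q"
  have rc: "rcoeff (hbar * y) (- int P) (int Q) f = hbar ^ Suc D * ?T"
    using rcoeff_homogeneous[OF g, of y P Q] P by (simp del: power_Suc)
  obtain E G where EG: "E = 0 \<or> E = 1 \<and> b - int Q = 0" "G = 0 \<or> G = l_free k l (s + int Q) \<or> G = - l_free k l (s + int Q)"
    "Y (b - int Q) k l = E + hbar * G"
    using Y s unfolding level_like_def by (smt (verit, del_insts))
  show ?thesis
  proof (cases "P = Suc r")
    case True
    \<comment> \<open>Here \<open>L_plus\<close> contributes its constant term and no factor
      \<open>h\<close>; as \<open>P\<close> is maximal, either \<open>P - Q\<close> is large or
      \<open>s + Q >= p\<close>.\<close>
    define \<delta> :: "'n free_alg" where "\<delta> = (if i = j then 1 else 0)"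
    have L: "L_plus (- int (Suc r) + int P) i j = \<delta>" by (simp add: True L_plus_def \<delta>_def)
    have c\<delta>: "central \<delta>" by (simp add: \<delta>_def)
    have e1: "hbar ^ Suc D * ?T * (\<delta> * E) \<in> h2 N"
    proof (cases "E = 0")
      case False
      then have "b = int Q" using EG(1) by auto
      with True P r have D: "D \<ge> Suc (Suc m')" by linarith
      then obtain d where d: "D = Suc d" "d \<ge> Suc m'" by (cases D) auto
      show ?thesis
      proof (rule h2I)
        show "hbar ^ Suc D * ?T * (\<delta> * E) = hbar ^ 2 * (hbar ^ d * (?T * (\<delta> * E)))"
          by (simp only: d(1) power_Suc power2_eq_square mult.assoc)
      qed (rule Jf_power[OF d(2)])
    qed (use left_ideal_0[OF left_ideal_h2[OF NL]] in simp)
    have e2: "hbar ^ Suc D * ?T * (\<delta> * (hbar * G)) \<in> h2 N"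
    proof (rule h2I)
      show "hbar ^ Suc D * ?T * (\<delta> * (hbar * G)) = hbar ^ 2 * (hbar ^ D * (?T * (\<delta> * G)))"
        by (simp add: \<delta>_def power2_eq_square mult.assoc central_left_commute[OF central_fps_X, of ?T]
            central_left_commute[OF central_fps_X, of "hbar ^ D"] del: fps_X_mult_nth)
      show "hbar ^ D * (?T * (\<delta> * G)) \<in> N"
      proof (cases "Suc m' \<le> D")
        case False
        with True P r s have "int p \<le> s + int Q" by linarith
        then have "G \<in> N" by (intro gen_ideal[OF EG(2) NL] Jf_gen)
        then show ?thesis by (intro left_ideal_mult[OF NL])
      qed (rule Jf_power)
    qed
    show ?thesis
      unfolding rc L EG(3) distrib_left by (rule left_ideal_add[OF left_ideal_h2[OF NL] e1 e2])
  next
    case False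
    define r' where "r' = int r - int P"
    have r'0: "r' \<ge> 0" using False \<open>Q < P \<and> P \<le> Suc r\<close> by (simp add: r'_def)
    have e: "- int (Suc r) + int P = - r' - 1" by (simp add: r'_def)
    have L: "L_plus (- int (Suc r) + int P) i j = - (hbar * l_free i j r')"
      unfolding e using r'0 by (simp add: L_plus_def)
    have e1: "hbar ^ Suc D * ?T * (- (hbar * l_free i j r') * E) \<in> h2 N"
    proof (cases "E = 0")
      case False
      then have E: "E = 1" "b = int Q" using EG(1) by auto
      show ?thesis
      proof (rule h2I)
        show "hbar ^ Suc D * ?T * (- (hbar * l_free i j r') * E) = hbar ^ 2 * (hbar ^ D * (- ?T * l_free i j r'))"
          unfolding E(1) by (simp add: power2_eq_square mult.assoc central_left_commute[OF central_fps_X, of ?T]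
              central_left_commute[OF central_fps_X, of "hbar ^ D"] del: fps_X_mult_nth)
        show "hbar ^ D * (- ?T * l_free i j r') \<in> N"
        proof (cases "Suc m' \<le> D")
          case False
          with E P r have "int p \<le> r'" by (simp add: r'_def)
          then show ?thesis by (intro left_ideal_mult[OF NL] Jf_gen)
        qed (rule Jf_power)
      qed
    qed (use left_ideal_0[OF left_ideal_h2[OF NL]] in simp)
    have e2: "hbar ^ Suc D * ?T * (- (hbar * l_free i j r') * (hbar * G)) \<in> h2 N"
    proof (rule h2I)
      show "hbar ^ Suc D * ?T * (- (hbar * l_free i j r') * (hbar * G)) = hbar ^ 2 * (hbar ^ Suc D * (- ?T * (l_free i j r' * G)))"
        by (simp add: power2_eq_square mult.assoc central_left_commute[OF central_fps_X, of ?T]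
            central_left_commute[OF central_fps_X, of "hbar ^ D"] central_left_commute[OF central_fps_X, of "l_free i j r'"]
            del: fps_X_mult_nth)
      show "hbar ^ Suc D * (- ?T * (l_free i j r' * G)) \<in> N"
      proof (cases "Suc m' \<le> Suc D")
        case False
        show ?thesis
        proof (cases "int p \<le> s + int Q")
          case True
          then have "G \<in> N" by (intro gen_ideal[OF EG(2) NL] Jf_gen)
          then show ?thesis by (intro left_ideal_mult[OF NL])
        next
          case F2: False
          have "int r0 \<le> r'" using False F2 P r by (simp add: r'_def)
          then have x: "l_free i j r' * l_free k l (s + int Q) \<in> Jf p m'" using F2 by (intro IH1) auto
          have "l_free i j r' * G = 0 \<or> l_free i j r' * G = l_free i j r' * l_free k l (s + int Q)
            \<or> l_free i j r' * G = - (l_free i j r' * l_free k l (s + int Q))" using EG(2) by auto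
          from gen_ideal[OF this left_ideal_Jf x] have "l_free i j r' * G \<in> Jf p m'" .
          then have "hbar * (- ?T * (l_free i j r' * G)) \<in> N"
            by (rule Jf_h[OF left_ideal_mult[OF left_ideal_Jf]])
          then have "hbar ^ D * (hbar * (- ?T * (l_free i j r' * G))) \<in> N" by (rule left_ideal_mult[OF NL])
          then show ?thesis by (simp only: power_Suc2 mult.assoc)
        qed
      qed (rule Jf_power)
    qed
    show ?thesis
      unfolding rc L EG(3) distrib_left by (rule left_ideal_add[OF left_ideal_h2[OF NL] e1 e2])
  qed
qed

text \<open>In this order the generator with index \<open>r - P\<close> stands on the right. It lies
  in the ideal if \<open>r - P >= p\<close>; otherwise, unless the power of \<open>h\<close>
  suffices, \<open>s + Q\<close> is large and the second induction hypothesis applies. The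
  coefficient of \<open>R\<close> at the right end is admissible because \<open>y\<close> is
  \<open>scalar_like\<close>.\<close>

lemma rel_term_right:
  fixes i j k l :: 'n
  assumes Y: "level_like Y" and g: "homogeneous \<gamma> f" and PQ: "(P, Q) \<noteq> (0, 0)" and y: "scalar_like y"
  shows "Y (b - int Q) k l * L_plus (- int (Suc r) + int P) i j * rcoeff (hbar * y) (- int P) (int Q) f \<in> h2 N"
proof (cases "Q < P \<and> P \<le> Suc r")
  case False
  then have "rcoeff (hbar * y) (- int P) (int Q) f = 0 \<or> L_plus (- int (Suc r) + int P) i j = (0 :: 'n free_alg)"
    using rcoeff_homogeneous_0[OF g _ PQ] by (cases "P \<le> Q") (auto simp: L_plus_pos)
  then show ?thesis using left_ideal_0[OF left_ideal_h2[OF NL]] by auto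
next
  case True
  define D where "D = P - Suc Q"
  have P: "P = Suc (Q + D)" using True by (simp add: D_def)
  let ?T = "tcoeff \<gamma> y P Q"
  note TR = Jf_tcoeff_right[OF _ y, of _ p "Suc m'" \<gamma> P Q]
  have rc: "rcoeff (hbar * y) (- int P) (int Q) f = hbar ^ Suc D * ?T"
    using rcoeff_homogeneous[OF g, of y P Q] P by (simp del: power_Suc)
  have hout: "x * (hbar ^ q * t) = hbar ^ q * (x * t)" for x t :: "'n free_alg" and q
    by (rule central_left_commute[OF central_hbar_power])
  obtain E G where EG: "E = 0 \<or> E = 1 \<and> b - int Q = 0" "G = 0 \<or> G = l_free k l (s + int Q) \<or> G = - l_free k l (s + int Q)"
    "Y (b - int Q) k l = E + hbar * G"
    using Y s unfolding level_like_def by (smt (verit, del_insts))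
  show ?thesis
  proof (cases "P = Suc r")
    case True
    define \<delta> :: "'n free_alg" where "\<delta> = (if i = j then 1 else 0)"
    have L: "L_plus (- int (Suc r) + int P) i j = \<delta>" by (simp add: True L_plus_def \<delta>_def)
    have c\<delta>: "central \<delta>" by (simp add: \<delta>_def)
    have e1: "E * \<delta> * (hbar ^ Suc D * ?T) \<in> h2 N"
    proof (cases "E = 0")
      case False
      then have "b = int Q" using EG(1) by auto
      with True P r have D: "D \<ge> Suc (Suc m')" by linarith
      then obtain d where d: "D = Suc d" "d \<ge> Suc m'" by (cases D) auto
      show ?thesis
      proof (rule h2I)
        show "E * \<delta> * (hbar ^ Suc D * ?T) = hbar ^ 2 * (hbar ^ d * (E * \<delta> * ?T))"
          by (subst hout[where x = "E * \<delta>"]) (simp only: d(1) power_Suc power2_eq_square mult.assoc)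
      qed (rule Jf_power[OF d(2)])
    qed (use left_ideal_0[OF left_ideal_h2[OF NL]] in simp)
    have e2: "hbar * G * \<delta> * (hbar ^ Suc D * ?T) \<in> h2 N"
    proof (rule h2I)
      show "hbar * G * \<delta> * (hbar ^ Suc D * ?T) = hbar ^ 2 * (hbar ^ D * (\<delta> * G * ?T))"
        by (subst hout[where x = "hbar * G * \<delta>"]) (simp add: \<delta>_def power2_eq_square mult.assoc
            central_left_commute[OF central_fps_X, of "hbar ^ D"] del: fps_X_mult_nth)
      show "hbar ^ D * (\<delta> * G * ?T) \<in> N"
      proof (cases "Suc m' \<le> D")
        case False
        with True P r s have "int p \<le> s + int Q" by linarith
        then have "G \<in> N" by (intro gen_ideal[OF EG(2) NL] Jf_gen)
        then have "\<delta> * G * ?T \<in> N" by (rule TR[OF left_ideal_mult[OF NL]])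
        then show ?thesis by (rule left_ideal_mult[OF NL])
      qed (rule Jf_power)
    qed
    show ?thesis
      unfolding rc L EG(3) distrib_right by (rule left_ideal_add[OF left_ideal_h2[OF NL] e1 e2])
  next
    case False
    define r' where "r' = int r - int P"
    have r'0: "r' \<ge> 0" using False \<open>Q < P \<and> P \<le> Suc r\<close> by (simp add: r'_def)
    have e: "- int (Suc r) + int P = - r' - 1" by (simp add: r'_def)
    have L: "L_plus (- int (Suc r) + int P) i j = - (hbar * l_free i j r')"
      unfolding e using r'0 by (simp add: L_plus_def)
    have e1: "E * - (hbar * l_free i j r') * (hbar ^ Suc D * ?T) \<in> h2 N"
    proof (cases "E = 0")
      case False
      then have E: "E = 1" "b = int Q" using EG(1) by auto
      show ?thesis
      proof (rule h2I)
        show "E * - (hbar * l_free i j r') * (hbar ^ Suc D * ?T) = hbar ^ 2 * (hbar ^ D * (- l_free i j r' * ?T))"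
          unfolding E(1) by (subst hout[where x = "1 * - (hbar * l_free i j r')"])
            (simp add: power2_eq_square mult.assoc central_left_commute[OF central_fps_X, of "hbar ^ D"] del: fps_X_mult_nth)
        show "hbar ^ D * (- l_free i j r' * ?T) \<in> N"
        proof (cases "Suc m' \<le> D")
          case False
          with E P r have "int p \<le> r'" by (simp add: r'_def)
          then have "- l_free i j r' * ?T \<in> N" by (rule TR[OF left_ideal_minus[OF NL Jf_gen]])
          then show ?thesis by (rule left_ideal_mult[OF NL])
        qed (rule Jf_power)
      qed
    qed (use left_ideal_0[OF left_ideal_h2[OF NL]] in simp)
    have e2: "hbar * G * - (hbar * l_free i j r') * (hbar ^ Suc D * ?T) \<in> h2 N"
    proof (rule h2I)
      show "hbar * G * - (hbar * l_free i j r') * (hbar ^ Suc D * ?T) = hbar ^ 2 * (hbar ^ Suc D * (- (G * l_free i j r') * ?T))"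
        by (subst hout[where x = "hbar * G * - (hbar * l_free i j r')"]) (simp add: power2_eq_square mult.assoc central_left_commute[OF central_fps_X, of G]
            central_left_commute[OF central_fps_X, of "hbar ^ D"] del: fps_X_mult_nth)
      show "hbar ^ Suc D * (- (G * l_free i j r') * ?T) \<in> N"
      proof (cases "Suc m' \<le> Suc D")
        case False
        show ?thesis
        proof (cases "int p \<le> r'")
          case True
          then have "- (G * l_free i j r') * ?T \<in> N"
            by (rule TR[OF left_ideal_minus[OF NL left_ideal_mult[OF NL Jf_gen]]])
          then show ?thesis by (rule left_ideal_mult[OF NL])
        next
          case F2: False
          have "int r0 \<le> s + int Q" using False F2 P r s by (simp add: r'_def)
          then have x: "l_free k l (s + int Q) * l_free i j r' \<in> Jf p m'" using F2 r'0 by (intro IH2) auto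
          have "G * l_free i j r' = 0 \<or> G * l_free i j r' = l_free k l (s + int Q) * l_free i j r'
            \<or> G * l_free i j r' = - (l_free k l (s + int Q) * l_free i j r')" using EG(2) by auto
          from gen_ideal[OF this left_ideal_Jf x] have "G * l_free i j r' \<in> Jf p m'" .
          then have "- (G * l_free i j r') * ?T \<in> Jf p m'"
            by (rule Jf_tcoeff_right[OF left_ideal_minus[OF left_ideal_Jf] y])
          then have "hbar * (- (G * l_free i j r') * ?T) \<in> N" by (rule Jf_h)
          then have "hbar ^ D * (hbar * (- (G * l_free i j r') * ?T)) \<in> N" by (rule left_ideal_mult[OF NL])
          then show ?thesis by (simp only: power_Suc2 mult.assoc)
        qed
      qed (rule Jf_power)
    qed
    show ?thesis
      unfolding rc L EG(3) distrib_right by (rule left_ideal_add[OF left_ideal_h2[OF NL] e1 e2])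
  qed
qed

text \<open>In the application \<open>L_plus\<close> vanishes for \<open>P > r + 1\<close> and the
  coefficients of \<open>R\<close> for \<open>Q >= P\<close>, so the sum is finite and its leading
  term can be split off.\<close>

lemma hsum_rel_mod_h2:
  fixes R :: "int \<times> int \<Rightarrow> 'n free_alg"
  assumes 0: "\<And>P q. \<not> (P \<le> 0 \<and> q \<ge> 0) \<Longrightarrow> R (P, q) = 0"
    and big: "\<And>P Q. P > Suc r \<or> Q \<ge> P \<Longrightarrow> (P, Q) \<noteq> (0, 0) \<Longrightarrow> R (- int P, int Q) = 0"
    and small: "\<And>P Q. (P, Q) \<noteq> (0, 0) \<Longrightarrow> R (- int P, int Q) \<in> h2 N"
  shows "hsum R - R (0, 0) \<in> h2 N"
proof -
  let ?A = "(\<lambda>(P, Q). (- int P, int Q)) ` ({..Suc r} \<times> {..Suc r})"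
  have "R x = 0" if "x \<notin> ?A" for x
  proof -
    obtain p' q' where x: "x = (p', q')" by (cases x)
    show ?thesis
    proof (cases rule: exponent_cases[of p' q'])
      case 1
      then show ?thesis using 0 x by blast
    next
      case (2 P Q)
      have "\<not> (P \<le> Suc r \<and> Q \<le> Suc r)"
      proof
        assume "P \<le> Suc r \<and> Q \<le> Suc r"
        then have "(P, Q) \<in> {..Suc r} \<times> {..Suc r}" by simp
        then have "(\<lambda>(P, Q). (- int P, int Q)) (P, Q) \<in> ?A" by (rule imageI)
        with that x 2 show False by simp
      qed
      then show ?thesis unfolding x 2 by (intro big) auto
    qed
  qed
  then have "hsum R = sum R ?A" by (intro hsum_finite) auto
  moreover have "(0, 0) \<in> ?A" by (rule image_eqI[of _ _ "(0, 0)"]) auto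
  ultimately have "hsum R - R (0, 0) = sum R (?A - {(0, 0)})"
    by (simp add: sum.remove[of ?A "(0, 0)"])
  also have "\<dots> \<in> h2 N"
  proof (rule left_ideal_sum[OF left_ideal_h2[OF NL]])
    fix x assume "x \<in> ?A - {(0, 0)}"
    then have nz: "x \<noteq> (0, 0)" and "x \<in> ?A" by blast+
    from \<open>x \<in> ?A\<close> obtain y where "x = (\<lambda>(P, Q). (- int P, int Q)) y" by blast
    then obtain P Q where x: "x = (- int P, int Q)" by (cases y) simp
    with nz have "(P, Q) \<noteq> (0, 0)" by auto
    then show "R x \<in> h2 N" unfolding x(1) by (rule small)
  qed
  finally show ?thesis .
qed

text \<open>The terms at \<open>(0, 0)\<close> give \<open>h^2\<close> times the commutator of
  \<open>l_ij^(r)\<close> with \<open>g\<close>, and all others lie in \<open>h2 N\<close>.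
  Saturation divides by \<open>h^2\<close>, and \<open>g l_ij^(r)\<close> lies in \<open>N\<close>
  because \<open>r >= p\<close>.\<close>

lemma rel_commutator:
  fixes i j k l :: 'n
  assumes Y: "level_like Y" and \<beta>: "scalar_like \<beta>'"
    and rel: "hsum (rel_left (hbar * \<beta>) L_plus Y (- int (Suc r)) b i j k l)
      - hsum (rel_right (hbar * \<beta>') L_plus Y (- int (Suc r)) b i j k l) \<in> yd_ideal"
    and Yb: "Y b k l = E + hbar * g" "central E"
  shows "l_free i j (int r) * g \<in> N"
proof -
  let ?n = "CARD('n)"
  let ?L = "rel_left (hbar * \<beta>) L_plus Y (- int (Suc r)) b i j k l"
    and ?R = "rel_right (hbar * \<beta>') L_plus Y (- int (Suc r)) b i j k l"
  have homF: "homogeneous (phi_coeff ?n) (f_series ?n)" by (rule homogeneous_f_series) simp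
  have homG: "homogeneous (\<lambda>i. if i = 0 then 0 else phi_coeff ?n (i - 1)) (f_hP ?n)" by (rule homogeneous_f_hP) simp
  note H = left_ideal_h2[OF NL]
  have rc0: "rcoeff y (- int P) (int Q) (f_series ?n) = 0 \<and> rcoeff y (- int P) (int Q) (f_hP ?n) = 0"
    if "P \<le> Q" "(P, Q) \<noteq> (0, 0)" for y :: "'n free_alg" and P Q
    by (simp only: rcoeff_homogeneous_0[OF homF that] rcoeff_homogeneous_0[OF homG that] simp_thms)
  have lp: "L_plus (- int (Suc r) + int P) i j = (0 :: 'n free_alg)" if "P > Suc r" for P and i j :: 'n
    using that by (intro L_plus_pos) simp
  have 1: "hsum ?L - ?L (0, 0) \<in> h2 N"
  proof (rule hsum_rel_mod_h2)
    show "?L (P, q) = 0" if "\<not> (P \<le> 0 \<and> q \<ge> 0)" for P q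
      by (simp add: rel_left_def rcoeff_eq_0[OF that])
    show "?L (- int P, int Q) = 0" if "P > Suc r \<or> Q \<ge> P" "(P, Q) \<noteq> (0, 0)" for P Q
      using that(1)
    proof
      assume "P > Suc r"
      then show ?thesis
        by (simp only: rel_left_def prod.case diff_minus_eq_add lp mult_zero_left mult_zero_right add_0_left)
    next
      assume "Q \<ge> P"
      then show ?thesis by (simp only: rel_left_def prod.case rc0[OF _ that(2)] mult_zero_left add_0_left)
    qed
    show "?L (- int P, int Q) \<in> h2 N" if "(P, Q) \<noteq> (0, 0)" for P Q
      unfolding rel_left_def prod.case diff_minus_eq_add
      by (rule left_ideal_add[OF H rel_term_left[OF Y homF that] rel_term_left[OF Y homG that]])
  qed
  have 2: "hsum ?R - ?R (0, 0) \<in> h2 N"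
  proof (rule hsum_rel_mod_h2)
    show "?R (P, q) = 0" if "\<not> (P \<le> 0 \<and> q \<ge> 0)" for P q
      by (simp add: rel_right_def rcoeff_eq_0[OF that])
    show "?R (- int P, int Q) = 0" if "P > Suc r \<or> Q \<ge> P" "(P, Q) \<noteq> (0, 0)" for P Q
      using that(1)
    proof
      assume "P > Suc r"
      then show ?thesis
        by (simp only: rel_right_def prod.case diff_minus_eq_add lp mult_zero_left mult_zero_right add_0_left)
    next
      assume "Q \<ge> P"
      then show ?thesis by (simp only: rel_right_def prod.case rc0[OF _ that(2)] mult_zero_right add_0_left)
    qed
    show "?R (- int P, int Q) \<in> h2 N" if "(P, Q) \<noteq> (0, 0)" for P Q
      unfolding rel_right_def prod.case diff_minus_eq_add
      by (rule left_ideal_add[OF H rel_term_right[OF Y homF that \<beta>] rel_term_right[OF Y homG that \<beta>]])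
  qed
  have f0: "fps_nth (f_series ?n) 0 = 1" by (rule f_series_nth_0) simp
  let ?l = "l_free i j (int r)"
  have L0: "L_plus (- int (Suc r)) i j = - (hbar * ?l)" by (simp add: L_plus_def)
  have L: "?L (0, 0) = - (hbar * ?l) * (E + hbar * g)"
    by (simp add: rel_left_def rcoeff_0_0 f0 mult.assoc L0 Yb(1) del: of_nat_Suc)
  have R: "?R (0, 0) = (E + hbar * g) * - (hbar * ?l)"
    by (simp add: rel_right_def rcoeff_0_0 f0 mult.assoc L0 Yb(1) del: of_nat_Suc)
  obtain z where z: "z \<in> N" "(hsum ?L - ?L (0, 0)) - (hsum ?R - ?R (0, 0)) = hbar ^ 2 * z"
    using left_ideal_diff[OF H 1 2] by (auto simp: h2_def)
  have LR: "?L (0, 0) - ?R (0, 0) = hbar ^ 2 * (g * ?l - ?l * g)"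
    unfolding L R
    by (simp add: distrib_left distrib_right right_diff_distrib mult.assoc power2_eq_square
        central_left_commute[OF central_fps_X, of ?l] central_left_commute[OF central_fps_X, of g]
        central_left_commute[OF Yb(2), of ?l] central_left_commute[OF Yb(2), of hbar] centralD[OF Yb(2), of ?l] centralD[OF Yb(2), of "hbar * ?l"]
        del: fps_X_mult_nth)
  have "hsum ?L - hsum ?R = ((hsum ?L - ?L (0, 0)) - (hsum ?R - ?R (0, 0))) + (?L (0, 0) - ?R (0, 0))"
    by simp
  also have "\<dots> = hbar ^ 2 * (z + (g * ?l - ?l * g))"
    by (simp only: z(2) LR distrib_left)
  finally have "hsum ?L - hsum ?R = hbar ^ 2 * (z + (g * ?l - ?l * g))" .
  with rel have "z + (g * ?l - ?l * g) \<in> yd_ideal"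
    using yd_ideal_divide_h_power by metis
  then have 3: "z + (g * ?l - ?l * g) \<in> N"
    using yd_ideal_subset_kernel Jf_kernel by blast
  have "int r \<ge> int p" using r by linarith
  then have 4: "z + g * ?l \<in> N"
    by (intro left_ideal_add[OF NL z(1)] left_ideal_mult[OF NL] Jf_gen)
  have "(z + g * ?l) - (z + (g * ?l - ?l * g)) \<in> N" by (rule left_ideal_diff[OF NL 4 3])
  then show ?thesis by simp
qed

end

lemma scalar_like_0: "scalar_like 0"
  unfolding scalar_like_def by (rule exI[of _ 0]) (simp add: crit_kernel_def crit_0)

lemma half_c_scalar:
  "- (scal (fps_const (1 / 2)) * c_free) - scal (fps_const (of_nat CARD('n) / 2)) \<in> (crit_kernel :: 'n::finite free_alg set)"
  "scal (fps_const (1 / 2)) * c_free - scal (- fps_const (of_nat CARD('n) / 2)) \<in> (crit_kernel :: 'n free_alg set)"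
proof -
  have "scal (fps_const (1 / 2)) * (c_free - scal (fps_const (- of_nat CARD('n)))) \<in> (crit_kernel :: 'n free_alg set)"
    by (rule left_ideal_mult[OF two_sided_left[OF two_sided_crit_kernel] c_free_crit])
  then show 2: "scal (fps_const (1 / 2)) * c_free - scal (- fps_const (of_nat CARD('n) / 2)) \<in> (crit_kernel :: 'n free_alg set)"
    by (simp add: right_diff_distrib flip: scal_mult)
  show "- (scal (fps_const (1 / 2)) * c_free) - scal (fps_const (of_nat CARD('n) / 2)) \<in> (crit_kernel :: 'n free_alg set)"
    using left_ideal_minus[OF two_sided_left[OF two_sided_crit_kernel] 2] by (simp add: scal_minus del: fps_const_neg)
qed

lemma half_hc_eq: "half_hc = hbar * (scal (fps_const (1 / 2)) * c_free)"
  and minus_half_hc_eq: "- half_hc = hbar * - (scal (fps_const (1 / 2)) * c_free)"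
  by (simp_all add: half_hc_def mult.assoc central_left_commute[OF central_fps_X, of "scal _"] del: fps_X_mult_nth)

text \<open>The defining relation exchanges the two generators up to terms of higher order in
  \<open>h\<close>. In those terms the induction hypothesis is applied to finitely many indices
  \<open>s'\<close> below \<open>p\<close>, so a common bound exists.\<close>

lemma generators_nearly_commute:
  "\<exists>q::nat. \<forall>r\<ge>int q. \<forall>i j k l. l_free i j r * l_free k l s \<in> (Jf p m :: 'n::finite free_alg set)"
proof (induction m arbitrary: p s)
  case 0
  then show ?case by (simp add: Jf_0)
next
  case (Suc m)
  obtain qf :: "int \<Rightarrow> nat" where qf: "\<And>s' r (i::'n) j k l. r \<ge> int (qf s') \<Longrightarrow> l_free i j r * l_free k l s' \<in> Jf p m"
    using Suc.IH[of _ p] by metis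
  \<comment> \<open>The sum dominates each of the finitely many bounds \<open>qf s'\<close>.\<close>
  define r0 where "r0 = (\<Sum>s'\<in>{min s 0..<int p}. qf s')"
  have le: "qf s' \<le> r0" if "min s 0 \<le> s'" "s' < int p" for s'
    unfolding r0_def using that by (intro member_le_sum) auto
  have IH: "l_free i j r * l_free k l s' \<in> Jf p m" if "min s 0 \<le> s'" "s' < int p" "int r0 \<le> r" for s' r and i j k l :: 'n
    by (rule qf) (use le[OF that(1,2)] that(3) in linarith)
  define b where "b = - s - 1"
  define q where "q = p + m + nat \<bar>b\<bar> + r0 + 3 + nat \<bar>s\<bar>"
  have "l_free i j r * l_free k l s \<in> Jf p (Suc m)" if r: "r \<ge> int q" for r and i j k l :: 'n
  proof -
    obtain r' where r': "r = int r'" using r by (metis nat_int nonneg_int_cases of_nat_0_le_iff order_trans)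
    have s: "s = - b - 1" by (simp add: b_def)
    have I1: "\<And>s' r (i::'n) j k l. s \<le> s' \<Longrightarrow> s' < int p \<Longrightarrow> int r0 \<le> r \<Longrightarrow> l_free i j r * l_free k l s' \<in> Jf p m"
      and I2: "\<And>s' r (i::'n) j k l. 0 \<le> s' \<Longrightarrow> s' < int p \<Longrightarrow> int r0 \<le> r \<Longrightarrow> l_free i j r * l_free k l s' \<in> Jf p m"
      by (rule IH; simp)+
    have R: "int r' \<ge> int p + int m + \<bar>b\<bar> + int r0 + 3 + \<bar>s\<bar>" using r by (simp add: r' q_def)
    \<comment> \<open>A generator with \<open>s >= 0\<close> is a coefficient of
      \<open>L_plus\<close>, one with \<open>s < 0\<close> a coefficient of \<open>L_minus\<close>;
      in both cases it occurs at exponent \<open>b\<close>.\<close>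
    show ?thesis
    proof (cases "s \<ge> 0")
      case True
      have rel: "hsum (rel_left (hbar * 0) L_plus L_plus (- int (Suc r')) b i j k l)
        - hsum (rel_right (hbar * 0) L_plus L_plus (- int (Suc r')) b i j k l) \<in> yd_ideal"
        using plus_plus_ideal by simp
      have Yb: "L_plus b k l = 0 + hbar * - l_free k l s"
        using True by (simp add: L_plus_def b_def)
      have "l_free i j (int r') * - l_free k l s \<in> Jf p (Suc m)"
        by (rule rel_commutator[OF s I1 I2 R level_like_L_plus scalar_like_0 rel Yb central_0])
      from left_ideal_minus[OF left_ideal_Jf this] show ?thesis by (simp add: r')
    next
      case False
      have rel: "hsum (rel_left (hbar * (scal (fps_const (1 / 2)) * c_free)) L_plus L_minus (- int (Suc r')) b i j k l)
        - hsum (rel_right (hbar * - (scal (fps_const (1 / 2)) * c_free)) L_plus L_minus (- int (Suc r')) b i j k l) \<in> yd_ideal"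
        using plus_minus_ideal unfolding minus_half_hc_eq[symmetric] half_hc_eq[symmetric] .
      have sc: "scalar_like (- (scal (fps_const (1 / 2)) * c_free) :: 'n free_alg)"
        unfolding scalar_like_def using half_c_scalar by blast
      have Yb: "L_minus b k l = (if b = 0 \<and> k = l then 1 else 0) + hbar * l_free k l s"
        using False by (simp add: L_minus_def b_def)
      have "l_free i j (int r') * l_free k l s \<in> Jf p (Suc m)"
        by (rule rel_commutator[OF s I1 I2 R level_like_L_minus sc rel Yb]) auto
      then show ?thesis by (simp add: r')
    qed
  qed
  then show ?case by blast
qed

section \<open>Multiplication in the completed algebra\<close>

text \<open>\<open>l_ij^(r) x\<close> tends to \<open>0\<close> modulo \<open>J_p\<close> as
  \<open>r\<close> grows, to the precision \<open>h^m\<close>.\<close>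

definition absorbed :: "nat \<Rightarrow> nat \<Rightarrow> 'n::finite free_alg \<Rightarrow> bool" where
  "absorbed p m x \<longleftrightarrow> (\<exists>q::nat. \<forall>r\<ge>int q. \<forall>i j. l_free i j r * x \<in> Jf p m)"

lemma absorbed_add: "absorbed p m x \<Longrightarrow> absorbed p m y \<Longrightarrow> absorbed p m (x + y)"
proof -
  assume "absorbed p m x" "absorbed p m y"
  then obtain q q' where q: "\<And>r i j. r \<ge> int q \<Longrightarrow> l_free i j r * x \<in> Jf p m" "\<And>r i j. r \<ge> int q' \<Longrightarrow> l_free i j r * y \<in> Jf p m"
    unfolding absorbed_def by blast
  show ?thesis unfolding absorbed_def
  proof (intro exI[of _ "max q q'"] allI impI)
    fix r i j assume "r \<ge> int (max q q')"
    then have "l_free i j r * x \<in> Jf p m" "l_free i j r * y \<in> Jf p m" by (intro q; simp)+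
    then show "l_free i j r * (x + y) \<in> Jf p m"
      by (simp add: distrib_left left_ideal_add[OF left_ideal_Jf])
  qed
qed

lemma absorbed_central: "central c \<Longrightarrow> absorbed p m x \<Longrightarrow> absorbed p m (c * x)"
  unfolding absorbed_def by (metis central_left_commute left_ideal_mult left_ideal_Jf)

lemma absorbed_0: "absorbed p m 0"
  unfolding absorbed_def by (simp add: left_ideal_0[OF left_ideal_Jf])

lemma absorbed_sum: "(\<And>s. s \<in> A \<Longrightarrow> absorbed p m (f s)) \<Longrightarrow> absorbed p m (sum f A)"
  by (induction A rule: infinite_finite_induct) (simp_all add: absorbed_0 absorbed_add)

lemma absorbed_power: "absorbed p m (hbar ^ m * z)"
  unfolding absorbed_def by (simp add: central_left_commute[OF central_hbar_power] Jf_power)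

text \<open>The elements \<open>a\<close> with \<open>a y\<close> in \<open>J_h p m\<close> form a
  left ideal. It contains the generators of \<open>J_q\<close>, hence all of
  \<open>J_q\<close>.\<close>

lemma Jf_mult_right:
  assumes q: "\<And>r i j. r \<ge> int q \<Longrightarrow> l_free i j r * y \<in> Jf p m" and x: "x \<in> Jf q m"
  shows "x * y \<in> Jf p m"
proof -
  let ?M = "{a. a * crit y \<in> J_h p m}"
  have "left_ideal ?M"
    unfolding left_ideal_def
    by (auto simp: J_h_zero left_diff_distrib J_h_diff mult.assoc J_h_mult)
  moreover have "{crit (l_free i j r) |i j r. r \<ge> int q} \<subseteq> ?M"
    using q by (auto simp: Jf_def crit_mult)
  ultimately have J: "J_ideal q \<subseteq> ?M" unfolding J_ideal_def left_ideal_gen_def by blast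
  obtain a b where ab: "a \<in> J_ideal q" "crit x = a + crit hbar ^ m * b"
    using x unfolding Jf_def J_h_def by (auto elim!: set_plus_elim)
  obtain b' where b': "b = crit b'" by (rule crit_surj)
  have "crit hbar ^ m * b * crit y \<in> J_h p m"
    using Jf_power[of m m "b' * y" p] unfolding Jf_def by (simp add: crit_mult crit_power b' mult.assoc)
  moreover have "a * crit y \<in> J_h p m" using ab(1) J by blast
  ultimately have "a * crit y + crit hbar ^ m * b * crit y \<in> J_h p m" by (intro J_h_add)
  then show ?thesis by (simp add: Jf_def crit_mult ab(2) distrib_right)
qed

text \<open>First \<open>q\<close> is chosen for \<open>y\<close>, then \<open>r\<close> so large
  that \<open>l_ij^(r) g\<close> lies in \<open>J_q\<close>; multiplication by \<open>y\<close>
  leads from there into \<open>J_p\<close>. The central generator is simply moved to the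
  left.\<close>

lemma absorbed_gen_mult: "(\<And>p m. absorbed p m y) \<Longrightarrow> absorbed p m (gen g * y)"
proof -
  assume y: "\<And>p m. absorbed p m y"
  obtain q where q: "\<And>r i j. r \<ge> int q \<Longrightarrow> l_free i j r * y \<in> Jf p m"
    using y[of p m] unfolding absorbed_def by blast
  show ?thesis
  proof (cases g)
    case (L_gen k l s)
    obtain q' :: nat where q': "\<And>r i j. r \<ge> int q' \<Longrightarrow> l_free i j r * l_free k l s \<in> Jf q m"
      using generators_nearly_commute[of s q m] by blast
    have "l_free i j r * gen g * y \<in> Jf p m" if "r \<ge> int q'" for r i j
      unfolding L_gen by (rule Jf_mult_right[OF q q'[OF that]])
    then show ?thesis unfolding absorbed_def mult.assoc by blast
  next
    case C_gen
    have "l_free i j r * (c_free * y) \<in> Jf p m" if r: "r \<ge> int q" for r i j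
    proof -
      have "(l_free i j r * c_free - c_free * l_free i j r) * y \<in> yd_ideal"
        by (rule two_sided_mult_right[OF two_sided_ideal_yd_ideal c_free_comm])
      then have "(l_free i j r * c_free - c_free * l_free i j r) * y \<in> Jf p m"
        using yd_ideal_subset_kernel Jf_kernel by blast
      moreover have "c_free * (l_free i j r * y) \<in> Jf p m"
        by (rule left_ideal_mult[OF left_ideal_Jf q[OF r]])
      ultimately have "(l_free i j r * c_free - c_free * l_free i j r) * y + c_free * (l_free i j r * y) \<in> Jf p m"
        by (rule left_ideal_add[OF left_ideal_Jf])
      then show ?thesis by (simp add: left_diff_distrib mult.assoc)
    qed
    then show ?thesis unfolding absorbed_def C_gen by blast
  qed
qed

lemma absorbed_word: "absorbed p m (fps_const (Poly_Mapping.single (Word gs) 1))"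
proof (induction gs arbitrary: p m)
  case Nil
  have "l_free i j r * fps_const (Poly_Mapping.single (Word []) 1) = l_free i j r" for r and i j :: 'a
    using single_one[where ?'a = "'a gen_word" and ?'b = complex] by (simp add: zero_gen_word_def)
  then have "\<forall>r\<ge>int p. \<forall>i j :: 'a. l_free i j r * fps_const (Poly_Mapping.single (Word []) 1) \<in> Jf p m"
    by (simp add: Jf_gen)
  then show ?case unfolding absorbed_def by blast
next
  case (Cons g gs)
  have "fps_const (Poly_Mapping.single (Word (g # gs)) 1) = gen g * fps_const (Poly_Mapping.single (Word gs) (1 :: complex))"
    by (simp add: gen_def mult_single)
  then show ?case using absorbed_gen_mult[OF Cons.IH] by simp
qed

text \<open>Words are treated by induction on their length, polynomials by linearity, and of a
  series in \<open>h\<close> only the finitely many coefficients below \<open>h^m\<close>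
  matter.\<close>

lemma absorbed_all: "absorbed p m x"
proof -
  have 1: "absorbed p m (fps_const y)" for y :: "'a gen_word \<Rightarrow>\<^sub>0 complex"
  proof -
    have y: "y = (\<Sum>k\<in>Poly_Mapping.keys y. Poly_Mapping.single k (Poly_Mapping.lookup y k))"
      by (rule poly_mapping_eqI) (simp add: lookup_sum lookup_single when_def in_keys_iff)
    have "absorbed p m (fps_const (Poly_Mapping.single k v))" for k :: "'a gen_word" and v
    proof -
      obtain gs where k: "k = Word gs" by (cases k)
      have "fps_const (Poly_Mapping.single k v) = scal (fps_const v) * fps_const (Poly_Mapping.single (Word gs) 1)"
        by (rule fps_ext) (simp add: mult_single k)
      then show ?thesis using absorbed_central[OF central_scal absorbed_word] by metis
    qed
    then show ?thesis by (subst y) (simp add: fps_const_sum' absorbed_sum)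
  qed
  let ?s = "\<Sum>i<m. hbar ^ i * fps_const (fps_nth x i)"
  have "fps_nth (x - ?s) j = 0" if "j < m" for j
  proof -
    have "fps_nth ?s j = (\<Sum>i<m. if i = j then fps_nth x i else 0)"
      unfolding fps_sum_nth by (intro sum.cong) (auto simp: fps_X_power_mult_nth)
    then show ?thesis using that by simp
  qed
  then obtain z where "x - ?s = hbar ^ m * z" using fps_low_coeffs_zero by blast
  then have x: "x = ?s + hbar ^ m * z" by (simp add: algebra_simps)
  have "absorbed p m ?s"
    by (rule absorbed_sum) (rule absorbed_central[OF central_hbar_power 1])
  from absorbed_add[OF this absorbed_power] show ?thesis
    by (rule iffD2[OF arg_cong[OF x, of "absorbed p m"]])
qed

text \<open>Continuity of right multiplication by a fixed element, which the left ideals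
  \<open>J_p\<close> alone do not guarantee.\<close>

lemma J_h_mult_right: "\<exists>q. \<forall>r\<ge>q. \<forall>x\<in>J_h r r. x * y \<in> J_h p m"
proof -
  obtain y' where y': "y = crit y'" by (rule crit_surj)
  obtain q where q: "\<And>r i j. r \<ge> int q \<Longrightarrow> l_free i j r * y' \<in> Jf p m"
    using absorbed_all[of p m y'] unfolding absorbed_def by blast
  have "x * y \<in> J_h p m" if "r \<ge> max q m" "x \<in> J_h r r" for r x
  proof -
    obtain x' where x': "x = crit x'" by (rule crit_surj)
    have "x \<in> J_h q m" using that J_h_antimono[of q r m r] by auto
    then have "x' \<in> Jf q m" by (simp add: Jf_def x')
    from Jf_mult_right[OF q this] show ?thesis by (simp add: Jf_def x' y' crit_mult)
  qed
  then show ?thesis by blast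
qed

section \<open>The product of the completion\<close>

lemma component_iff:
  assumes "w \<in> component z p m"
  shows "v \<in> component z p m \<longleftrightarrow> v - w \<in> J_h p m"
proof -
  obtain a where a: "component z p m = a +o J_h p m" by (rule component_coset)
  have mem: "x \<in> component z p m \<longleftrightarrow> x - a \<in> J_h p m" for x
  proof
    assume "x \<in> component z p m"
    then show "x - a \<in> J_h p m" by (auto simp: a elt_set_plus_def)
  next
    assume "x - a \<in> J_h p m"
    moreover have "x = a + (x - a)" by simp
    ultimately show "x \<in> component z p m" unfolding a elt_set_plus_def by blast
  qed
  have "v - w = (v - a) - (w - a)" "v - a = (v - w) + (w - a)" by simp_all
  then show ?thesis using assms mem J_h_diff J_h_add by metis
qed

lemma component_nonempty: obtains a where "a \<in> component z p m"
proof -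
  obtain a where "component z p m = a +o J_h p m" by (rule component_coset)
  moreover have "a + 0 \<in> a +o J_h p m" by (rule set_plus_intro2) (rule J_h_zero)
  ultimately show ?thesis using that by simp
qed

lemma component_mono: "p \<le> p' \<Longrightarrow> m \<le> m' \<Longrightarrow> a \<in> component z p' m' \<Longrightarrow> a \<in> component z p m"
  using coset_familyD(2)[OF coset_family_component] by blast

lemma yd_cr_eqI: "(\<And>p m. \<exists>a. a \<in> component x p m \<and> a \<in> component y p m) \<Longrightarrow> x = y"
proof -
  assume *: "\<And>p m. \<exists>a. a \<in> component x p m \<and> a \<in> component y p m"
  have "component x p m = component y p m" for p m
  proof -
    obtain a where a: "a \<in> component x p m" "a \<in> component y p m" using * by blast
    show ?thesis by (rule set_eqI) (simp add: component_iff[OF a(1)] component_iff[OF a(2)])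
  qed
  then show "x = y" by (meson component_inject ext)
qed

definition is_product :: "'n::finite yd_cr \<Rightarrow> 'n yd_cr \<Rightarrow> 'n yd_cr \<Rightarrow> bool" where
  "is_product x y z \<longleftrightarrow> (\<forall>p m. \<exists>q. \<forall>r\<ge>q. \<forall>a\<in>component x r r. \<forall>b\<in>component y r r. a * b \<in> component z p m)"

lemma is_product_unique:
  assumes "is_product x y z" "is_product x y z'"
  shows "z = z'"
proof (rule yd_cr_eqI)
  fix p m
  obtain q q' where q: "\<And>r a b. r \<ge> q \<Longrightarrow> a \<in> component x r r \<Longrightarrow> b \<in> component y r r \<Longrightarrow> a * b \<in> component z p m"
    "\<And>r a b. r \<ge> q' \<Longrightarrow> a \<in> component x r r \<Longrightarrow> b \<in> component y r r \<Longrightarrow> a * b \<in> component z' p m"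
    using assms unfolding is_product_def by meson
  let ?r = "max q q'"
  obtain a where a: "a \<in> component x ?r ?r" by (rule component_nonempty)
  obtain b where b: "b \<in> component y ?r ?r" by (rule component_nonempty)
  show "\<exists>a. a \<in> component z p m \<and> a \<in> component z' p m"
    using q(1)[OF _ a b] q(2)[OF _ a b] by auto
qed

text \<open>In \<open>a b - a0 b0 = a (b - b0) + (a - a0) b0\<close> the first term is small for
  every \<open>a\<close> because \<open>J_h\<close> is a left ideal, and the second by continuity of
  right multiplication by the fixed \<open>b0\<close>. So the products of deep representatives form
  a single class.\<close>

lemma is_product_exists: "\<exists>z. is_product x y z"
proof -
  have ex: "\<exists>c q. \<forall>r\<ge>q. \<forall>a\<in>component x r r. \<forall>b\<in>component y r r. a * b - c \<in> J_h p m" for p m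
  proof -
    let ?N = "max p m"
    obtain b0 where b0: "b0 \<in> component y ?N ?N" by (rule component_nonempty)
    obtain q0 where q0: "\<And>r j. r \<ge> q0 \<Longrightarrow> j \<in> J_h r r \<Longrightarrow> j * b0 \<in> J_h p m"
      using J_h_mult_right[of b0 p m] by blast
    let ?q = "max ?N q0"
    obtain a0 where a0: "a0 \<in> component x ?q ?q" by (rule component_nonempty)
    have "a * b - a0 * b0 \<in> J_h p m" if r: "r \<ge> ?q" and ab: "a \<in> component x r r" "b \<in> component y r r" for r a b
    proof -
      have "a \<in> component x ?q ?q" by (rule component_mono[OF r r ab(1)])
      then have "a - a0 \<in> J_h ?q ?q" using component_iff[OF a0] by blast
      then have 1: "(a - a0) * b0 \<in> J_h p m" by (rule q0[rotated]) simp
      have N: "?N \<le> r" using r by simp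
      have "b \<in> component y ?N ?N" by (rule component_mono[OF N N ab(2)])
      then have "b - b0 \<in> J_h ?N ?N" using component_iff[OF b0] by blast
      moreover have "J_h ?N ?N \<subseteq> (J_h p m :: 'a yd_crit set)" by (rule J_h_antimono) simp_all
      ultimately have 2: "a * (b - b0) \<in> J_h p m" by (intro J_h_mult) blast
      have "a * b - a0 * b0 = a * (b - b0) + (a - a0) * b0" by (simp add: right_diff_distrib left_diff_distrib)
      then show ?thesis using J_h_add[OF 2 1] by simp
    qed
    then show ?thesis by blast
  qed
  define Q where "Q p m c \<longleftrightarrow> (\<exists>q. \<forall>r\<ge>q. \<forall>a\<in>component x r r. \<forall>b\<in>component y r r. a * b - c \<in> J_h p m)" for p m c
  define c where "c p m = (SOME c. Q p m c)" for p m
  have "Q p m (c p m)" for p m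
    unfolding c_def by (rule someI_ex) (use ex[of p m] in \<open>simp add: Q_def\<close>)
  then have "\<exists>q. \<forall>r\<ge>q. \<forall>a\<in>component x r r. \<forall>b\<in>component y r r. a * b - c p m \<in> J_h p m" for p m
    unfolding Q_def by blast
  then obtain q where q: "\<forall>r\<ge>q p m. \<forall>a\<in>component x r r. \<forall>b\<in>component y r r. a * b - c p m \<in> J_h p m" for p m
    by metis
  have cq: "a * b - c p m \<in> J_h p m"
    if "r \<ge> q p m" "a \<in> component x r r" "b \<in> component y r r" for p m r a b
    using q that by blast
  define Z where "Z = (\<lambda>p m. c p m +o J_h p m)"
  have memZ: "w \<in> Z p m \<longleftrightarrow> w - c p m \<in> J_h p m" for w p m
  proof
    assume "w \<in> Z p m"
    then show "w - c p m \<in> J_h p m" by (auto simp: Z_def elt_set_plus_def)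
  next
    assume "w - c p m \<in> J_h p m"
    moreover have "w = c p m + (w - c p m)" by simp
    ultimately show "w \<in> Z p m" unfolding Z_def elt_set_plus_def by blast
  qed
  have "coset_family Z"
    unfolding coset_family_def
  proof (intro conjI allI impI subsetI)
    show "\<exists>a. Z p m = a +o J_h p m" for p m by (auto simp: Z_def)
    fix p p' m m' :: nat and w assume le: "p \<le> p'" "m \<le> m'" and w: "w \<in> Z p' m'"
    \<comment> \<open>Both classes are compared with the product of one pair of representatives that
      is deep enough for each of them.\<close>
    let ?r = "max (q p m) (q p' m')"
    obtain a where a: "a \<in> component x ?r ?r" by (rule component_nonempty)
    obtain b where b: "b \<in> component y ?r ?r" by (rule component_nonempty)
    have 1: "a * b - c p m \<in> J_h p m" by (rule cq[OF _ a b]) simp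
    have 2: "a * b - c p' m' \<in> J_h p' m'" by (rule cq[OF _ a b]) simp
    have "(w - c p' m') - (a * b - c p' m') \<in> J_h p' m'" using w 2 unfolding memZ by (rule J_h_diff)
    then have "w - a * b \<in> J_h p m" using J_h_antimono[OF le] by auto
    from J_h_add[OF this 1] show "w \<in> Z p m" by (simp add: memZ)
  qed
  then have "component (Abs_yd_cr Z) = Z" by (simp add: Abs_yd_cr_inverse)
  then have "is_product x y (Abs_yd_cr Z)" unfolding is_product_def by (simp only: memZ) (intro allI exI ballI impI cq)
  then show ?thesis ..
qed

lemma is_product_times: "is_product x y (x * y)"
proof -
  have "x * y = (THE z. is_product x y z)" unfolding times_yd_cr_def is_product_def ..
  moreover have "\<exists>!z. is_product x y z" using is_product_exists is_product_unique by blast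
  ultimately show ?thesis by (simp only: theI')
qed

lemma times_yd_cr_eqI: "is_product x y z \<Longrightarrow> x * y = z"
  using is_product_times is_product_unique by blast

lemma yd_cr_distrib_left: "x * (y + z) = x * y + x * (z :: 'n::finite yd_cr)"
proof (rule times_yd_cr_eqI)
  show "is_product x (y + z) (x * y + x * z)"
    unfolding is_product_def
  proof (intro allI)
    fix p m
    obtain q where q: "\<forall>r\<ge>q. \<forall>a\<in>component x r r. \<forall>b\<in>component y r r. a * b \<in> component (x * y) p m"
      using is_product_times[of x y] unfolding is_product_def by blast
    obtain q' where q': "\<forall>r\<ge>q'. \<forall>a\<in>component x r r. \<forall>b\<in>component z r r. a * b \<in> component (x * z) p m"
      using is_product_times[of x z] unfolding is_product_def by blast
    show "\<exists>q. \<forall>r\<ge>q. \<forall>a\<in>component x r r. \<forall>b\<in>component (y + z) r r. a * b \<in> component (x * y + x * z) p m"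
    proof (intro exI[of _ "max q q'"] allI impI ballI)
      fix r a d assume r: "max q q' \<le> r" and a: "a \<in> component x r r" and d: "d \<in> component (y + z) r r"
      obtain b c where bc: "b \<in> component y r r" "c \<in> component z r r" "d = b + c"
        using d unfolding component_add by (elim set_plus_elim)
      have "a * b \<in> component (x * y) p m" "a * c \<in> component (x * z) p m"
        using q q' a bc r by (simp_all only: max.bounded_iff) blast+
      then show "a * d \<in> component (x * y + x * z) p m"
        unfolding component_add bc(3) distrib_left by (rule set_plus_intro)
    qed
  qed
qed

lemma component_yd_cr: "component (yd_cr x) p m = crit x +o J_h p m"
  unfolding yd_cr_def yd_cr_of_crit_def by (simp add: Abs_yd_cr_inverse coset_family_const)

lemma crit_in_component: "crit x \<in> component (yd_cr x) p m"
  using set_plus_intro2[OF J_h_zero, of "crit x" p m] by (simp add: component_yd_cr)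

lemma yd_cr_mult: "yd_cr x * yd_cr y = yd_cr (x * y)"
proof (rule times_yd_cr_eqI)
  show "is_product (yd_cr x) (yd_cr y) (yd_cr (x * y))"
    unfolding is_product_def
  proof (intro allI)
    fix p m
    obtain q where q: "\<And>r j. r \<ge> q \<Longrightarrow> j \<in> J_h r r \<Longrightarrow> j * crit y \<in> J_h p m"
      using J_h_mult_right[of "crit y" p m] by blast
    show "\<exists>q. \<forall>r\<ge>q. \<forall>a\<in>component (yd_cr x) r r. \<forall>b\<in>component (yd_cr y) r r. a * b \<in> component (yd_cr (x * y)) p m"
    proof (intro exI[of _ "max q (max p m)"] allI impI ballI)
      fix r a b assume r: "max q (max p m) \<le> r" and ab: "a \<in> component (yd_cr x) r r" "b \<in> component (yd_cr y) r r"
      have a: "a - crit x \<in> J_h r r" and b: "b - crit y \<in> J_h r r"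
        using ab component_iff[OF crit_in_component] by blast+
      have "b - crit y \<in> J_h p m" using b r J_h_antimono[of p r m r] by auto
      then have 1: "a * (b - crit y) \<in> J_h p m" by (rule J_h_mult)
      have 2: "(a - crit x) * crit y \<in> J_h p m" using q[OF _ a] r by simp
      have "a * b - crit (x * y) = a * (b - crit y) + (a - crit x) * crit y"
        by (simp add: crit_mult right_diff_distrib left_diff_distrib)
      then have "a * b - crit (x * y) \<in> J_h p m" using J_h_add[OF 1 2] by simp
      then show "a * b \<in> component (yd_cr (x * y)) p m" using component_iff[OF crit_in_component] by blast
    qed
  qed
qed

lemma yd_cr_add: "yd_cr (x + y) = yd_cr x + yd_cr y"
proof (rule yd_cr_eqI, intro exI conjI)
  fix p m
  show "crit (x + y) \<in> component (yd_cr (x + y)) p m" by (rule crit_in_component)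
  show "crit (x + y) \<in> component (yd_cr x + yd_cr y) p m"
    unfolding component_add crit_add by (intro set_plus_intro crit_in_component)
qed

lemma yd_cr_eq_0: "(\<And>p m. x \<in> Jf p m) \<Longrightarrow> yd_cr x = 0"
proof (rule yd_cr_eqI, intro exI conjI)
  fix p m assume "\<And>p m. x \<in> Jf p m"
  then show "crit x \<in> component 0 p m" unfolding component_zero Jf_def by blast
qed (rule crit_in_component)

lemma yd_cr_0: "yd_cr 0 = 0"
  by (rule yd_cr_eq_0) (rule left_ideal_0[OF left_ideal_Jf])

lemma yd_cr_diff: "yd_cr (x - y) = yd_cr x - yd_cr y"
  using yd_cr_add[of "x - y" y] by (simp add: algebra_simps)

lemma yd_cr_yd_ideal: "x \<in> yd_ideal \<Longrightarrow> yd_cr x = 0"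
  using yd_ideal_subset_kernel Jf_kernel by (intro yd_cr_eq_0) blast

theorem ell_coeff_commute: "ell_coeff k r * ell_coeff m s = ell_coeff m s * (ell_coeff k r :: 'n::finite yd_cr)"
  using yd_cr_yd_ideal[OF ell_bar_commute[of k r m s]] by (simp add: ell_coeff_def yd_cr_mult yd_cr_diff)


section \<open>Reduction of invariance to the free algebra\<close>

lemma vacuum_ideal_left: "left_ideal vacuum_ideal"
  unfolding vacuum_ideal_def by (rule left_ideal_gen)

lemma vacuum_ideal_facts:
  "0 \<in> vacuum_ideal" "x \<in> vacuum_ideal \<Longrightarrow> y \<in> vacuum_ideal \<Longrightarrow> x - y \<in> vacuum_ideal" "x \<in> vacuum_ideal \<Longrightarrow> a * x \<in> vacuum_ideal"
  using vacuum_ideal_left unfolding left_ideal_def by blast+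

text \<open>The elements of the free algebra that annihilate the vacuum. They form a left ideal, so
  \<open>L_plus\<close> may be replaced by the identity at the right end of a product.\<close>

definition vac_kernel :: "'n::finite free_alg set" where
  "vac_kernel = {x. yd_cr x \<in> vacuum_ideal}"

lemma left_ideal_vac_kernel: "left_ideal vac_kernel"
  unfolding left_ideal_def vac_kernel_def
  by (auto simp: yd_cr_0 yd_cr_diff yd_cr_mult[symmetric] vacuum_ideal_facts)

lemma vac_kernel_gen: "r \<ge> 0 \<Longrightarrow> l_free i j r \<in> vac_kernel"
  unfolding vac_kernel_def vacuum_ideal_def left_ideal_gen_def by auto

lemma rep_vacuum_module_abs: "rep_vacuum_module (abs_vacuum_module x) - x \<in> vacuum_ideal"
proof -
  have "abs_vacuum_module (rep_vacuum_module (abs_vacuum_module x)) = abs_vacuum_module x"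
    by (rule Quotient_abs_rep[OF Quotient_vacuum_module])
  then show ?thesis by (simp add: vacuum_module.abs_eq_iff)
qed

lemma vac_act_abs: "x \<bullet> abs_vacuum_module y = abs_vacuum_module (x * y)"
proof -
  let ?r = "rep_vacuum_module (abs_vacuum_module y)"
  have "x * ?r = x * (y + (?r - y))" by simp
  also have "\<dots> = x * y + x * (?r - y)" by (rule yd_cr_distrib_left)
  finally have "x * ?r - x * y = x * (?r - y)" by simp
  then have "x * ?r - x * y \<in> vacuum_ideal"
    using vacuum_ideal_facts(3)[OF rep_vacuum_module_abs] by simp
  then show ?thesis by (simp add: vac_act_def vacuum_module.abs_eq_iff)
qed

lemma invariantsI:
  assumes "\<And>i j e. L_plus e i j * x - (if e = 0 \<and> i = j then x else 0) \<in> vac_kernel"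
  shows "yd_cr x \<bullet> vacuum \<in> invariants"
proof -
  have v: "yd_cr x \<bullet> vacuum = abs_vacuum_module (yd_cr x)"
    unfolding vacuum_def vac_act_abs one_yd_cr_def yd_cr_of_crit_def[symmetric]
    by (simp add: yd_cr_mult)
  have "yd_cr (L_plus e i j) \<bullet> abs_vacuum_module (yd_cr x)
    = (if e = 0 \<and> i = j then abs_vacuum_module (yd_cr x) else 0)" for i j e
  proof -
    have "yd_cr (L_plus e i j * x) - yd_cr (if e = 0 \<and> i = j then x else 0) \<in> vacuum_ideal"
      using assms[of e i j] by (simp only: vac_kernel_def mem_Collect_eq yd_cr_diff)
    then have "abs_vacuum_module (yd_cr (L_plus e i j * x)) = abs_vacuum_module (yd_cr (if e = 0 \<and> i = j then x else 0))"
      by (simp only: vacuum_module.abs_eq_iff)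
    then show ?thesis
      by (simp add: vac_act_abs yd_cr_mult yd_cr_0 zero_vacuum_module_def)
  qed
  then show ?thesis unfolding v invariants_def by blast
qed

section \<open>The mixed relation at the critical level\<close>

lemma outer_power: "outer (x ^ k) = outer x ^ k"
  by (induction k) (simp_all add: outer_mult)

lemma outer_compose: "outer (a oo b) = outer a oo outer (b :: 'a::comm_ring_1 fps)"
  by (rule fps_ext) (simp add: fps_compose_nth fps_const_sum' outer_power[symmetric])

lemma outer_inv_lin: "outer (inv_lin y) = inv_lin (fps_const y)"
  by (rule fps_ext) (simp add: fps_const_power)

lemma inv_lin_mult: "(1 - fps_const y * fps_X) * inv_lin y = (fps_X :: 'a::comm_ring_1 fps)"
proof (rule fps_ext)
  fix k
  have eq: "(1 - fps_const y * fps_X) * inv_lin y = inv_lin y - fps_const y * (fps_X * inv_lin y)"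
    by (simp only: left_diff_distrib mult_1_left mult.assoc)
  have X: "fps_nth (fps_X :: 'a fps) k = (if k = 1 then 1 else 0)" by (simp add: fps_X_def)
  show "fps_nth ((1 - fps_const y * fps_X) * inv_lin y) k = fps_nth fps_X k"
    unfolding eq X by (cases k; cases "k - 1") auto
qed

text \<open>\<open>(u - w) - a = u - (w + a)\<close>: both sides become \<open>u^(-1)\<close> after
  multiplication by \<open>1 - (w + a) u^(-1)\<close>, which is nonzero in a domain.\<close>

lemma inv_lin_compose: "inv_lin a oo inv_lin w = inv_lin (w + a :: 'a::idom)"
proof -
  let ?c = "inv_lin a oo inv_lin w"
  have 0: "fps_nth (inv_lin w) 0 = 0" by simp
  have "((1 - fps_const a * fps_X) * inv_lin a) oo inv_lin w = fps_X oo inv_lin w"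
    by (simp only: inv_lin_mult)
  then have 1: "(1 - fps_const a * inv_lin w) * ?c = inv_lin w"
    by (simp add: fps_compose_mult_distrib[OF 0] fps_compose_sub_distrib)
  have 2: "(1 - fps_const w * fps_X) * inv_lin w = fps_X" by (rule inv_lin_mult)
  have "(1 - fps_const (w + a) * fps_X) * ?c = ((1 - fps_const w * fps_X) - fps_const a * fps_X) * ?c"
    by (simp only: fps_const_add[symmetric] distrib_right diff_diff_eq)
  also have "\<dots> = ((1 - fps_const w * fps_X) - fps_const a * ((1 - fps_const w * fps_X) * inv_lin w)) * ?c"
    by (simp only: 2)
  also have "\<dots> = (1 - fps_const w * fps_X) * ((1 - fps_const a * inv_lin w) * ?c)"
    by (simp only: left_diff_distrib right_diff_distrib mult_1_left mult_1_right mult_ac)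
  also have "\<dots> = (1 - fps_const (w + a) * fps_X) * inv_lin (w + a)"
    by (simp only: 1 2 inv_lin_mult)
  finally have eq: "(1 - fps_const (w + a) * fps_X) * ?c = (1 - fps_const (w + a) * fps_X) * inv_lin (w + a)" .
  have "fps_nth (1 - fps_const (w + a) * fps_X) 0 \<noteq> 0" by simp
  then have "1 - fps_const (w + a) * fps_X \<noteq> 0" by (metis fps_zero_nth)
  with eq show ?thesis using mult_left_cancel by blast
qed

abbreviation omega :: "complex fps \<Rightarrow> complex fps fps fps" where
  "omega z \<equiv> inv_lin (fps_X + fps_const z)"

text \<open>The defining equation of \<open>f\<close> at the argument \<open>u - v - z\<close>; the
  shift by \<open>n h\<close> and the substitution of \<open>omega z\<close> combine by
  \<open>inv_lin_compose\<close>.\<close>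

lemma f_series_crossing:
  assumes "n > 0"
  shows "outer (f_series n) oo omega (z + of_nat n * hbar)
    = (1 - fps_const (fps_const hbar) ^ 2 * omega z ^ 2) * (outer (f_series n) oo omega z)"
proof -
  have 0: "fps_nth (omega z) 0 = 0" "fps_nth (inv_lin (fps_const (of_nat n * hbar))) 0 = (0 :: complex fps fps)" by simp_all
  have "normalizing n (f_series n)" using normalizing_phi[OF assms] f_series_eq[OF assms] by simp
  then have "f_series n oo inv_lin (of_nat n * hbar) = (1 - fps_const (hbar ^ 2) * fps_X ^ 2) * f_series n"
    by (simp add: normalizing_def)
  from arg_cong[OF this, of outer]
  have "outer (f_series n) oo inv_lin (fps_const (of_nat n * hbar))
    = (1 - fps_const (fps_const hbar) ^ 2 * fps_X ^ 2) * outer (f_series n)"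
    by (simp only: outer_compose outer_inv_lin outer_mult outer_diff outer_1 outer_const outer_power outer_X
        fps_const_power[symmetric])
  from arg_cong[OF this, of "\<lambda>x. x oo omega z"]
  have "outer (f_series n) oo inv_lin (fps_const (of_nat n * hbar)) oo omega z
    = (1 - fps_const (fps_const hbar) ^ 2 * omega z ^ 2) * (outer (f_series n) oo omega z)"
    by (simp only: fps_compose_mult_distrib[OF 0(1)] fps_compose_sub_distrib fps_compose_1
        fps_compose_power[OF 0(1), symmetric] fps_const_power fps_const_compose fps_X_fps_compose_startby0[OF 0(1)])
  then show ?thesis
    by (simp only: fps_compose_assoc[OF 0, symmetric] inv_lin_compose add.assoc fps_const_add)
qed

lemma f_hP_compose: "outer (f_hP n) oo omega z = fps_const (fps_const hbar) * omega z * (outer (f_series n) oo omega z)"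
proof -
  have 0: "fps_nth (omega z) 0 = 0" by simp
  show ?thesis
    by (simp only: outer_mult outer_const outer_X fps_compose_mult_distrib[OF 0] fps_const_compose
        fps_X_fps_compose_startby0[OF 0])
qed

text \<open>Identities between scalar series are proved in a commutative ring and transported by
  this embedding, whose image is central.\<close>

definition scal2 :: "complex fps fps fps \<Rightarrow> 'n free_alg fps fps" where
  "scal2 x = Abs_fps (\<lambda>a. Abs_fps (\<lambda>b. scal (fps_nth (fps_nth x a) b)))"

lemma scal2_nth [simp]: "fps_nth (fps_nth (scal2 x) a) b = scal (fps_nth (fps_nth x a) b)"
  by (simp add: scal2_def)

lemma fps_ext2: "(\<And>a b. fps_nth (fps_nth x a) b = fps_nth (fps_nth y a) b) \<Longrightarrow> x = y"
  by (simp add: fps_eq_iff)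

lemma scal2_add: "scal2 (x + y) = scal2 x + scal2 y"
  and scal2_diff: "scal2 (x - y) = scal2 x - scal2 y"
  by (rule fps_ext2, simp add: scal_add scal_diff)+

lemma scal2_mult: "scal2 (x * y) = scal2 x * scal2 y"
  by (rule fps_ext2) (simp add: fps_mult_nth fps_sum_nth scal_sum scal_mult)

lemma scal2_1: "scal2 1 = 1"
  by (rule fps_ext2) simp

lemma scal2_X: "scal2 fps_X = fps_X"
  by (rule fps_ext2) (simp add: fps_X_def)

lemma scal2_const_X: "scal2 (fps_const fps_X) = fps_const fps_X"
  by (rule fps_ext2) (simp add: fps_X_def)

lemma scal2_const: "scal2 (fps_const (fps_const c)) = fps_const (fps_const (scal c))"
  by (rule fps_ext2) simp

lemma central_scal2 [simp]: "central (scal2 x)"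
  by (rule central_fpsI, rule central_fpsI) simp

lemma scal2_compose:
  "scal2 (outer g oo omega z)
    = Abs_fps (\<lambda>k. fps_const (scal (fps_nth g k))) oo inv_lin (fps_X + fps_const (scal z))"
proof (rule fps_ext2)
  fix a b
  have "outer g = Abs_fps (\<lambda>k. fps_const (fps_nth g k))" by (simp add: outer_def)
  then show "fps_nth (fps_nth (scal2 (outer g oo omega z)) a) b = fps_nth (fps_nth
     (Abs_fps (\<lambda>k. fps_const (scal (fps_nth g k))) oo inv_lin (fps_X + fps_const (scal z))) a) b"
    by (simp only: scal2_nth lift_compose_inv_lin_nth scal_sum scal_mult scal_of_nat scal_power)
qed

lemma rcoeff_scal2: "rcoeff (scal z) (- int P) (int Q) g = fps_nth (fps_nth (scal2 (outer g oo omega z)) P) Q"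
  by (simp add: rcoeff_def scal2_compose)

lemma rcoeff_cong:
  assumes I: "two_sided_ideal I" and x: "x - y \<in> I"
  shows "rcoeff x p q g - rcoeff y p q g \<in> I"
proof (cases rule: exponent_cases[of p q])
  case 1
  then show ?thesis by (simp add: rcoeff_eq_0 left_ideal_0[OF two_sided_left[OF I]])
next
  case (2 P Q)
  note LI = two_sided_left[OF I]
  have "rcoeff x p q g - rcoeff y p q g = (\<Sum>i\<le>P. scal (fps_nth g i) *
    (of_nat (invc i P * ((P - i) choose Q)) * (x ^ (P - i - Q) - y ^ (P - i - Q))))"
    by (simp add: 2 rcoeff_nat sum_subtractf right_diff_distrib del: of_nat_mult)
  also have "\<dots> \<in> I"
    by (rule left_ideal_sum[OF LI], rule left_ideal_mult[OF LI], rule left_ideal_mult[OF LI], rule ideal_power_cong[OF I x])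
  finally show ?thesis .
qed

text \<open>\<open>L_plus\<close> has no positive powers of \<open>u\<close> and
  \<open>L_minus\<close> no negative powers of \<open>v\<close>. In a mixed relation at
  \<open>u^(-A) v^B\<close> only \<open>P <= A\<close> and \<open>Q <= B\<close> survive, and the
  two sides are products of power series in \<open>u^(-1)\<close> and \<open>v\<close>.\<close>

lemma hsum_rectangle:
  assumes "\<And>p q. \<not> (p \<le> 0 \<and> q \<ge> 0) \<Longrightarrow> T (p, q) = 0"
    and "\<And>p q. p < - int A \<Longrightarrow> T (p, q) = 0" and "\<And>p q. q > int B \<Longrightarrow> T (p, q) = 0"
  shows "hsum T = (\<Sum>(P, Q)\<in>{..A} \<times> {..B}. T (- int P, int Q))"
proof -
  let ?g = "\<lambda>(P, Q). (- int P, int Q)"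
  have "hsum T = sum T (?g ` ({..A} \<times> {..B}))"
  proof (rule hsum_finite)
    fix s assume s: "s \<notin> ?g ` ({..A} \<times> {..B})"
    obtain p q where pq: "s = (p, q)" by (cases s)
    show "T s = 0"
    proof (rule ccontr)
      assume "T s \<noteq> 0"
      then have T: "T (p, q) \<noteq> 0" by (simp add: pq)
      have "p \<le> 0 \<and> q \<ge> 0" "\<not> p < - int A" "\<not> q > int B"
        using T assms by blast+
      then have "s = ?g (nat (- p), nat q)" "(nat (- p), nat q) \<in> {..A} \<times> {..B}" by (auto simp: pq)
      with s show False by blast
    qed
  qed simp
  also have "\<dots> = sum (T \<circ> ?g) ({..A} \<times> {..B})"
    by (rule sum.reindex) (auto simp: inj_on_def)
  also have "\<dots> = (\<Sum>(P, Q)\<in>{..A} \<times> {..B}. T (- int P, int Q))"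
    by (rule sum.cong) auto
  finally show ?thesis .
qed

lemma fps_mult_nth_rectangle:
  assumes "\<And>a b. fps_nth (fps_nth M a) b = N (- int a) (int b)"
  shows "fps_nth (fps_nth (R * M) A) B
    = (\<Sum>(P, Q)\<in>{..A} \<times> {..B}. fps_nth (fps_nth R P) Q * N (- int A + int P) (int B - int Q))"
proof -
  have "fps_nth (fps_nth (R * M) A) B = (\<Sum>P\<le>A. \<Sum>Q\<le>B. fps_nth (fps_nth R P) Q * fps_nth (fps_nth M (A - P)) (B - Q))"
    by (simp add: fps_mult_nth fps_sum_nth atLeast0AtMost)
  also have "\<dots> = (\<Sum>P\<le>A. \<Sum>Q\<le>B. fps_nth (fps_nth R P) Q * N (- int A + int P) (int B - int Q))"
    by (intro sum.cong refl) (simp add: assms of_nat_diff)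
  finally show ?thesis by (simp add: sum.cartesian_product)
qed

text \<open>Here the outer variable is \<open>u^(-1)\<close> and the inner one \<open>v\<close>,
  whereas the outer variable was \<open>u\<close> in the relations between two
  \<open>L_minus\<close>.\<close>

definition L_plus_series :: "'n \<Rightarrow> 'n \<Rightarrow> 'n free_alg fps fps" where
  "L_plus_series i j = Abs_fps (\<lambda>e. fps_const (L_plus (- int e) i j))"

lemma L_plus_series_nth [simp]: "fps_nth (L_plus_series i j) e = fps_const (L_plus (- int e) i j)"
  by (simp add: L_plus_series_def)

text \<open>The values at \<open>c = - n\<close> of \<open>h c / 2\<close>, subtracted in the
  argument of \<open>R\<close> on the left of the mixed relation, and of \<open>- h c / 2\<close> on
  the right.\<close>

abbreviation (input) "left_shift n \<equiv> - fps_const (of_nat n / 2) * (hbar :: complex fps)"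
abbreviation (input) "right_shift n \<equiv> fps_const (of_nat n / 2) * (hbar :: complex fps)"

lemma half_hc_crit:
  "half_hc - scal (left_shift CARD('n)) \<in> (crit_kernel :: 'n::finite free_alg set)"
  "- half_hc - scal (right_shift CARD('n)) \<in> (crit_kernel :: 'n free_alg set)"
proof -
  note LI = two_sided_left[OF two_sided_crit_kernel]
  have sc: "scal (z * hbar) = (hbar * scal z :: 'n free_alg)" for z
    by (simp only: scal_mult scal_hbar centralD[OF central_fps_X])
  show "half_hc - scal (left_shift CARD('n)) \<in> (crit_kernel :: 'n::finite free_alg set)"
    using left_ideal_mult[OF LI half_c_scalar(2)[where 'n = 'n], of hbar]
    by (simp only: half_hc_eq sc right_diff_distrib)
  show "- half_hc - scal (right_shift CARD('n)) \<in> (crit_kernel :: 'n free_alg set)"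
    using left_ideal_mult[OF LI half_c_scalar(1)[where 'n = 'n], of hbar]
    by (simp only: minus_half_hc_eq sc right_diff_distrib)
qed

context
  fixes i j k l :: "'n::finite"
begin

private abbreviation "X \<equiv> L_plus_series :: 'n \<Rightarrow> 'n \<Rightarrow> 'n free_alg fps fps"
private abbreviation "Y \<equiv> \<lambda>i j. fps_const (L_minus_series i j) :: 'n free_alg fps fps"
private abbreviation "\<Phi> \<equiv> \<lambda>g z. scal2 (outer g oo omega z) :: 'n free_alg fps fps"

text \<open>Modulo \<open>crit_kernel\<close> the shifts \<open>half_hc\<close> become scalars. All
  coefficients of \<open>R\<close> are then central, and the relation can be stated with products of
  series.\<close>

lemma mixed_series_relation:
  "\<Phi> (f_series CARD('n)) (left_shift CARD('n)) * (X i j * Y k l) + \<Phi> (f_hP CARD('n)) (left_shift CARD('n)) * (X k j * Y i l)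
    - \<Phi> (f_series CARD('n)) (right_shift CARD('n)) * (Y k l * X i j) - \<Phi> (f_hP CARD('n)) (right_shift CARD('n)) * (Y k j * X i l)
    \<in> coeff_ideal (coeff_ideal crit_kernel)" (is "?D \<in> _")
proof (intro coeff_idealI)
  fix A B :: nat
  note LI = two_sided_left[OF two_sided_crit_kernel]
  let ?S = "{..A} \<times> {..B}"
  let ?l = "\<lambda>y (P, Q). rel_left y L_plus L_minus (- int A) (int B) i j k l (- int P, int Q) :: 'n free_alg"
  let ?r = "\<lambda>y (P, Q). rel_right y L_plus L_minus (- int A) (int B) i j k l (- int P, int Q) :: 'n free_alg"
  have hl: "hsum (rel_left y L_plus L_minus (- int A) (int B) i j k l) = sum (?l y) ?S" for y
    by (subst hsum_rectangle[where A = A and B = B]) (auto simp: rel_left_def rcoeff_eq_0 L_plus_pos L_minus_neg case_prod_unfold)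
  have hr: "hsum (rel_right y L_plus L_minus (- int A) (int B) i j k l) = sum (?r y) ?S" for y
    by (subst hsum_rectangle[where A = A and B = B]) (auto simp: rel_right_def rcoeff_eq_0 L_plus_pos L_minus_neg case_prod_unfold)
  have 1: "sum (?l half_hc) ?S - sum (?r (- half_hc)) ?S \<in> crit_kernel"
    using plus_minus_ideal[of "- int A" "int B" i j k l] yd_ideal_subset_kernel unfolding hl hr by blast
  have 2: "sum (?l half_hc) ?S - sum (?l (scal (left_shift CARD('n)))) ?S \<in> crit_kernel"
    unfolding sum_subtractf[symmetric]
  proof (rule left_ideal_sum[OF LI])
    fix s assume "s \<in> ?S"
    obtain P Q where s: "s = (P, Q)" by (cases s)
    note c = two_sided_mult_right[OF two_sided_crit_kernel rcoeff_cong[OF two_sided_crit_kernel half_hc_crit(1)]]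
    show "?l half_hc s - ?l (scal (left_shift CARD('n))) s \<in> crit_kernel"
      unfolding s rel_left_def prod.case add_diff_add left_diff_distrib[symmetric]
      by (rule left_ideal_add[OF LI c c])
  qed
  have 3: "sum (?r (- half_hc)) ?S - sum (?r (scal (right_shift CARD('n)))) ?S \<in> crit_kernel"
    unfolding sum_subtractf[symmetric]
  proof (rule left_ideal_sum[OF LI])
    fix s assume "s \<in> ?S"
    obtain P Q where s: "s = (P, Q)" by (cases s)
    note c = left_ideal_mult[OF LI rcoeff_cong[OF two_sided_crit_kernel half_hc_crit(2)]]
    show "?r (- half_hc) s - ?r (scal (right_shift CARD('n))) s \<in> crit_kernel"
      unfolding s rel_right_def prod.case add_diff_add right_diff_distrib[symmetric]
      by (rule left_ideal_add[OF LI c c])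
  qed
  have "sum (?l (scal (left_shift CARD('n)))) ?S - sum (?r (scal (right_shift CARD('n)))) ?S \<in> crit_kernel"
    using left_ideal_add[OF LI left_ideal_diff[OF LI 1 2] 3] by simp
  moreover have "sum (?l (scal z)) ?S
      = fps_nth (fps_nth (\<Phi> (f_series CARD('n)) z * (X i j * Y k l)) A) B + fps_nth (fps_nth (\<Phi> (f_hP CARD('n)) z * (X k j * Y i l)) A) B" for z
    by (simp add: fps_mult_nth_rectangle[where M = "X i j * Y k l" and N = "\<lambda>a b. L_plus a i j * L_minus b k l"]
        fps_mult_nth_rectangle[where M = "X k j * Y i l" and N = "\<lambda>a b. L_plus a k j * L_minus b i l"]
        rel_left_def rcoeff_scal2 sum.distrib case_prod_unfold del: scal2_nth)
  moreover have "sum (?r (scal z)) ?S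
      = fps_nth (fps_nth (\<Phi> (f_series CARD('n)) z * (Y k l * X i j)) A) B + fps_nth (fps_nth (\<Phi> (f_hP CARD('n)) z * (Y k j * X i l)) A) B" for z
    by (simp add: fps_mult_nth_rectangle[where M = "Y k l * X i j" and N = "\<lambda>a b. L_minus b k l * L_plus a i j"]
        fps_mult_nth_rectangle[where M = "Y k j * X i l" and N = "\<lambda>a b. L_minus b k j * L_plus a i l"]
        rel_right_def centralD[OF rcoeff_central[OF central_scal]] rcoeff_scal2 sum.distrib case_prod_unfold del: scal2_nth)
  ultimately show "fps_nth (fps_nth ?D A) B \<in> crit_kernel"
    by (simp only: fps_add_nth fps_sub_nth diff_diff_eq)
qed

end

text \<open>In the application \<open>\<omega>\<close> and \<open>\<omega>'\<close> are
  \<open>(u - v + n h / 2)^(-1)\<close> and \<open>(u - v - n h / 2)^(-1)\<close>,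
  \<open>\<zeta>\<close> is \<open>u^(-1)\<close>, and \<open>\<phi>\<close> is \<open>f\<close> at
  the first argument. The factor \<open>\<xi> * \<xi> * \<eta>\<close> clears all denominators and
  leaves \<open>\<phi>\<close> as a common factor.\<close>

lemma crossing_scalars:
  fixes \<xi> \<eta> \<omega> \<omega>' \<zeta> h \<phi> :: "'a::comm_ring_1"
  assumes 1: "\<xi> * \<omega> = \<zeta>" and 2: "\<eta> * \<omega>' = \<zeta>"
  shows "\<xi> * \<xi> * \<eta> * (h * \<omega> * \<phi>) = \<phi> * (h * \<zeta> * \<xi> * \<eta>)" (is ?A)
    and "\<xi> * \<xi> * \<eta> * ((1 - h ^ 2 * \<omega> ^ 2) * \<phi>) = \<phi> * ((\<xi> * \<xi> - h * \<zeta> * (h * \<zeta>)) * \<eta>)" (is ?B)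
    and "\<xi> * \<xi> * \<eta> * (h * \<omega>' * ((1 - h ^ 2 * \<omega> ^ 2) * \<phi>)) = \<phi> * (h * \<zeta> * (\<xi> * \<xi> - h * \<zeta> * (h * \<zeta>)))" (is ?C)
proof -
  have "\<xi> * \<xi> * \<eta> * (h * \<omega> * \<phi>) = \<phi> * (h * (\<xi> * \<omega>) * \<xi> * \<eta>)"
    "\<xi> * \<xi> * \<eta> * ((1 - h ^ 2 * \<omega> ^ 2) * \<phi>) = \<phi> * ((\<xi> * \<xi> - h * (\<xi> * \<omega>) * (h * (\<xi> * \<omega>))) * \<eta>)"
    "\<xi> * \<xi> * \<eta> * (h * \<omega>' * ((1 - h ^ 2 * \<omega> ^ 2) * \<phi>))
      = \<phi> * (h * (\<eta> * \<omega>') * (\<xi> * \<xi> - h * (\<xi> * \<omega>) * (h * (\<xi> * \<omega>))))"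
    by (simp_all add: algebra_simps power2_eq_square)
  then show ?A ?B ?C by (simp_all only: 1 2)
qed

text \<open>The relation now reads
  \<open>\<xi> \<eta> (\<xi> + t P) X Y = d Y X (\<eta> + t P)\<close>. Left multiplication by
  \<open>\<xi> - t P\<close> turns \<open>\<xi> + t P\<close> into \<open>d\<close>, which thereby
  becomes a factor of both sides.\<close>

lemma crossing_inversion:
  fixes \<xi> \<eta> t :: "complex fps fps fps" and M1 M2 M3 M4 M5 M6 :: "'n free_alg fps fps"
  defines "d \<equiv> \<xi> * \<xi> - t * t"
  shows "scal2 \<xi> * (scal2 (\<xi> * \<xi> * \<eta>) * M1 + scal2 (t * \<xi> * \<eta>) * M2 - scal2 (d * \<eta>) * M3 - scal2 (t * d) * M4)
      - scal2 t * (scal2 (\<xi> * \<xi> * \<eta>) * M2 + scal2 (t * \<xi> * \<eta>) * M1 - scal2 (d * \<eta>) * M5 - scal2 (t * d) * M6)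
    = scal2 d * (scal2 (\<xi> * \<eta>) * M1 - (scal2 (\<xi> * \<eta>) * M3 + scal2 (\<xi> * t) * M4 - scal2 (t * \<eta>) * M5 - scal2 (t * t) * M6))"
proof -
  have e: "\<xi> * (\<xi> * \<xi> * \<eta>) = t * (t * \<xi> * \<eta>) + d * (\<xi> * \<eta>)" "t * (\<xi> * \<xi> * \<eta>) = \<xi> * (t * \<xi> * \<eta>)"
    "\<xi> * (d * \<eta>) = d * (\<xi> * \<eta>)" "\<xi> * (t * d) = d * (\<xi> * t)" "t * (d * \<eta>) = d * (t * \<eta>)" "t * (t * d) = d * (t * t)"
    by (simp_all add: d_def algebra_simps)
  have push: "scal2 a * (scal2 b * x) = scal2 (a * b) * (x :: 'n free_alg fps fps)" for a b x
    by (simp only: scal2_mult mult.assoc)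
  show ?thesis
    by (simp only: right_diff_distrib distrib_left push e scal2_add distrib_right) simp
qed

text \<open>\<open>(u - v - y) u^(-1)\<close>, normalized to constant term \<open>1\<close> in
  \<open>u^(-1)\<close> so that it can be cancelled.\<close>

definition xi :: "'n free_alg \<Rightarrow> 'n free_alg fps fps" where
  "xi y = 1 - fps_X * fps_const (fps_X + fps_const y)"

definition zh :: "'n free_alg fps fps" where
  "zh = fps_const (fps_const hbar) * fps_X"

lemma central_zh [simp]: "central zh"
  unfolding zh_def by (intro central_mult central_fps_const central_fps_X)

lemma xi_scal2: "xi (scal z) = scal2 (1 - fps_X * fps_const (fps_X + fps_const z))"
  by (simp only: xi_def scal2_diff scal2_1 scal2_mult scal2_X fps_const_add[symmetric] scal2_add scal2_const_X scal2_const)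

lemma zh_scal2: "zh = scal2 (fps_const (fps_const hbar) * fps_X)"
  by (simp only: zh_def scal2_mult scal2_const scal2_X scal_hbar)

text \<open>
  With \<open>t = h u\<^sup>-\<^sup>1\<close>, the four terms in parentheses are the components of
  \<open>(\<xi> - t P) Y X (\<eta> + t P)\<close>, where \<open>\<xi> = (u - v + nh/2) u\<^sup>-\<^sup>1\<close> and \<open>\<eta> = (u - v - nh/2) u\<^sup>-\<^sup>1\<close>.
\<close>

definition crossing_defect :: "'a::ring_1 \<Rightarrow> 'a \<Rightarrow> 'a \<Rightarrow> ('n \<Rightarrow> 'n \<Rightarrow> 'a) \<Rightarrow> ('n \<Rightarrow> 'n \<Rightarrow> 'a) \<Rightarrow> 'n \<Rightarrow> 'n \<Rightarrow> 'n \<Rightarrow> 'n \<Rightarrow> 'a" where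
  "crossing_defect \<xi> \<eta> t X Y i j k l = \<xi> * \<eta> * (X i j * Y k l) - (\<xi> * \<eta> * (Y k l * X i j)
     + \<xi> * t * (Y k j * X i l) - t * \<eta> * (Y i l * X k j) - t * t * (Y i j * X k l))"

lemma omega_mult: "(1 - fps_X * fps_const (fps_X + fps_const z)) * omega z = fps_X"
  using inv_lin_mult[of "fps_X + fps_const z"] by (simp only: mult.commute)

lemma mixed_relation:
  fixes i j k l :: "'n::finite"
  shows "crossing_defect (xi (scal (left_shift CARD('n)))) (xi (scal (right_shift CARD('n)))) zh
      L_plus_series (\<lambda>i j. fps_const (L_minus_series i j)) i j k l \<in> coeff_ideal (coeff_ideal crit_kernel)"
proof -
  let ?K = "coeff_ideal (coeff_ideal crit_kernel) :: 'n free_alg fps fps set"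
  let ?X = "L_plus_series :: 'n \<Rightarrow> 'n \<Rightarrow> 'n free_alg fps fps"
  let ?Y = "\<lambda>i j. fps_const (L_minus_series i j) :: 'n free_alg fps fps"
  define \<xi> \<eta> \<omega> \<omega>' \<phi> h where "\<xi> = (1 - fps_X * fps_const (fps_X + fps_const (left_shift CARD('n))) :: complex fps fps fps)"
    and "\<eta> = (1 - fps_X * fps_const (fps_X + fps_const (right_shift CARD('n))) :: complex fps fps fps)"
    and "\<omega> = omega (left_shift CARD('n))" and "\<omega>' = omega (right_shift CARD('n))"
    and "\<phi> = (outer (f_series CARD('n)) oo omega (left_shift CARD('n)))" and "h = (fps_const (fps_const hbar) :: complex fps fps fps)"
  note defs = \<xi>_def \<eta>_def \<omega>_def \<omega>'_def \<phi>_def h_def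
  define d where "d = \<xi> * \<xi> - h * fps_X * (h * fps_X)"
  note scalars = crossing_scalars[of \<xi> \<omega> fps_X \<eta> \<omega>', OF omega_mult[of "left_shift CARD('n)", folded defs] omega_mult[of "right_shift CARD('n)", folded defs], of h \<phi>, folded d_def]
  have LI1: "left_ideal (coeff_ideal crit_kernel :: 'n free_alg fps set)" and LI: "left_ideal ?K"
    by (intro left_ideal_coeff two_sided_left two_sided_crit_kernel)+
  have rs: "right_shift CARD('n) = left_shift CARD('n) + of_nat CARD('n) * hbar"
  proof -
    have "of_nat CARD('n) = (fps_const (of_nat CARD('n) / 2) + fps_const (of_nat CARD('n) / 2) :: complex fps)"
      by (simp add: fps_of_nat)
    then show ?thesis by (simp only: distrib_right mult_minus_left) simp
  qed
  have f: "outer (f_series CARD('n)) oo \<omega>' = (1 - h ^ 2 * \<omega> ^ 2) * \<phi>"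
    unfolding defs rs by (rule f_series_crossing) simp
  have \<phi>_eq: "outer (f_series CARD('n)) oo \<omega> = \<phi>" by (simp only: defs)
  have P0: "outer (f_hP CARD('n)) oo \<omega> = h * \<omega> * \<phi>" "outer (f_hP CARD('n)) oo \<omega>' = h * \<omega>' * (outer (f_series CARD('n)) oo \<omega>')"
    unfolding defs by (rule f_hP_compose)+
  have \<phi>0: "fps_nth (scal2 \<phi> :: 'n free_alg fps fps) 0 = 1"
  proof (rule fps_ext)
    fix b
    have "fps_nth \<phi> 0 = 1" by (simp add: \<phi>_def f_series_nth_0)
    then show "fps_nth (fps_nth (scal2 \<phi> :: 'n free_alg fps fps) 0) b = fps_nth 1 b"
      by (simp add: scal2_def)
  qed
  have d0: "fps_nth (scal2 d :: 'n free_alg fps fps) 0 = 1"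
  proof (rule fps_ext)
    fix b
    have "fps_nth d 0 = 1" by (simp add: d_def \<xi>_def)
    then show "fps_nth (fps_nth (scal2 d :: 'n free_alg fps fps) 0) b = fps_nth 1 b"
      by (simp add: scal2_def)
  qed
  have push: "scal2 a * (scal2 b * x) = scal2 (a * b) * (x :: 'n free_alg fps fps)" for a b x
    by (simp only: scal2_mult mult.assoc)
  let ?t = "h * fps_X"
  have rel: "scal2 (\<xi> * \<xi> * \<eta>) * (?X i j * ?Y k l) + scal2 (?t * \<xi> * \<eta>) * (?X k j * ?Y i l)
    - scal2 (d * \<eta>) * (?Y k l * ?X i j) - scal2 (?t * d) * (?Y k j * ?X i l) \<in> ?K" (is "?R \<in> _") for i j k l :: 'n
  proof -
    have "scal2 (\<xi> * \<xi> * \<eta>) * (scal2 \<phi> * (?X i j * ?Y k l) + scal2 (h * \<omega> * \<phi>) * (?X k j * ?Y i l)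
      - scal2 ((1 - h ^ 2 * \<omega> ^ 2) * \<phi>) * (?Y k l * ?X i j)
      - scal2 (h * \<omega>' * ((1 - h ^ 2 * \<omega> ^ 2) * \<phi>)) * (?Y k j * ?X i l)) \<in> ?K"
      using left_ideal_mult[OF LI mixed_series_relation[of i j k l], of "scal2 (\<xi> * \<xi> * \<eta>)"]
      unfolding \<omega>_def[symmetric] \<omega>'_def[symmetric] P0 f \<phi>_eq .
    then have "scal2 \<phi> * ?R \<in> ?K"
      unfolding right_diff_distrib distrib_left push scalars by (simp only: mult.commute[of _ \<phi>])
    then show ?thesis by (rule coeff_ideal_cancel_unit[OF LI1 \<phi>0])
  qed
  \<comment> \<open>In the second instance \<open>i\<close> and \<open>k\<close> are exchanged,
    because left multiplication by \<open>P\<close> permutes the row indices.\<close>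
  have "scal2 d * crossing_defect (scal2 \<xi>) (scal2 \<eta>) (scal2 ?t) ?X ?Y i j k l \<in> ?K"
    using left_ideal_diff[OF LI left_ideal_mult[OF LI rel[of i j k l], of "scal2 \<xi>"] left_ideal_mult[OF LI rel[of k j i l], of "scal2 ?t"]]
    unfolding d_def crossing_inversion crossing_defect_def scal2_mult[symmetric] .
  then have "crossing_defect (scal2 \<xi>) (scal2 \<eta>) (scal2 ?t) ?X ?Y i j k l \<in> ?K"
    by (rule coeff_ideal_cancel_unit[OF LI1 d0])
  then show ?thesis by (simp only: xi_scal2 zh_scal2 defs)
qed

section \<open>Shifting the second parameter of the mixed relation\<close>

definition shift_inner :: "nat \<Rightarrow> 'a::ring_1 fps fps fps \<Rightarrow> 'a fps fps fps" where
  "shift_inner \<alpha> x = Abs_fps (\<lambda>a. shift \<alpha> (fps_nth x a))"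

lemma shift_inner_nth [simp]: "fps_nth (shift_inner \<alpha> x) a = shift \<alpha> (fps_nth x a)"
  by (simp add: shift_inner_def)

lemma shift_0 [simp]: "shift \<alpha> 0 = 0"
  using shift_diff[of \<alpha> 0 0] by simp

lemma shift_inner_add: "shift_inner \<alpha> (x + y) = shift_inner \<alpha> x + shift_inner \<alpha> y"
  and shift_inner_diff: "shift_inner \<alpha> (x - y) = shift_inner \<alpha> x - shift_inner \<alpha> y"
  by (rule fps_ext, simp add: shift_add shift_diff)+

lemma shift_inner_X: "shift_inner \<alpha> (fps_X * x) = fps_X * shift_inner \<alpha> x"
  by (rule fps_ext) simp

lemma shift_inner_const: "shift_inner \<alpha> (fps_const (fps_const c) * x) = fps_const (fps_const c) * shift_inner \<alpha> x"
  by (rule fps_ext) (simp add: shift_const_left)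

lemma shift_inner_xi: "shift_inner \<alpha> (xi y * x) = xi (of_nat \<alpha> * hbar + y) * shift_inner \<alpha> x"
proof -
  have "shift \<alpha> ((fps_X + fps_const y) * z) = (fps_X + fps_const (of_nat \<alpha> * hbar + y)) * shift \<alpha> z" for z
    by (simp only: distrib_right shift_add shift_X shift_const_left fps_const_add[symmetric] add.assoc)
  then have "shift_inner \<alpha> (fps_const (fps_X + fps_const y) * x)
    = fps_const (fps_X + fps_const (of_nat \<alpha> * hbar + y)) * shift_inner \<alpha> x"
    by (intro fps_ext) (simp only: shift_inner_nth fps_mult_left_const_nth)
  then show ?thesis
    by (simp only: xi_def left_diff_distrib mult_1_left mult.assoc shift_inner_diff shift_inner_X)
qed

lemma shift_inner_zh: "shift_inner \<alpha> (zh * x) = zh * shift_inner \<alpha> x"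
  by (simp only: zh_def mult.assoc shift_inner_X shift_inner_const)

lemma shift_inner_ideal:
  "left_ideal I \<Longrightarrow> h_closed I \<Longrightarrow> x \<in> coeff_ideal (coeff_ideal I) \<Longrightarrow> shift_inner \<alpha> x \<in> coeff_ideal (coeff_ideal I)"
  by (rule coeff_idealI) (simp add: shift_ideal coeff_idealD)

lemma shift_inner_L:
  "shift_inner \<alpha> (L_plus_series i j * fps_const y) = L_plus_series i j * fps_const (shift \<alpha> y)"
  "shift_inner \<alpha> (fps_const y * L_plus_series i j) = fps_const (shift \<alpha> y) * L_plus_series i j"
  by (rule fps_ext, simp add: shift_const_left shift_const_right)+

text \<open>The elements that vanish in the completion. Shifts are infinite sums and need an
  \<open>h\<close>-closed ideal, words need a two-sided one, and the vacuum requires one inside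
  \<open>vac_kernel\<close>; this ideal meets all three demands and contains
  \<open>crit_kernel\<close>.\<close>

definition limit_kernel :: "'n::finite free_alg set" where
  "limit_kernel = {x. \<forall>p m. x \<in> Jf p m}"

text \<open>The \<open>Jf p m\<close> are built from left ideals; right multiplication is settled by
  \<open>absorbed_all\<close>.\<close>

lemma two_sided_limit_kernel: "two_sided_ideal limit_kernel"
proof (rule two_sidedI)
  show "left_ideal limit_kernel"
    unfolding left_ideal_def limit_kernel_def
    by (auto intro: left_ideal_0[OF left_ideal_Jf] left_ideal_diff[OF left_ideal_Jf] left_ideal_mult[OF left_ideal_Jf])
  fix x y :: "'n::finite free_alg" assume x: "x \<in> limit_kernel"
  have "x * y \<in> Jf p m" for p m
  proof -
    obtain q where "\<And>r i j. r \<ge> int q \<Longrightarrow> l_free i j r * y \<in> Jf p m"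
      using absorbed_all[of p m y] unfolding absorbed_def by blast
    from Jf_mult_right[OF this] x show ?thesis by (simp add: limit_kernel_def)
  qed
  then show "x * y \<in> limit_kernel" by (simp add: limit_kernel_def)
qed

lemma h_closed_limit_kernel: "h_closed limit_kernel"
  unfolding h_closed_def
proof (intro allI impI)
  fix x :: "'n::finite free_alg" assume x: "\<forall>m. \<exists>y\<in>limit_kernel. \<exists>z. x = y + hbar ^ m * z"
  have "x \<in> Jf p m" for p m
  proof -
    obtain y z where "y \<in> limit_kernel" "x = y + hbar ^ m * z" using x by blast
    then show ?thesis
      using left_ideal_add[OF left_ideal_Jf, of y p m "hbar ^ m * z"] Jf_power[of m m z p]
      by (simp add: limit_kernel_def)
  qed
  then show "x \<in> limit_kernel" by (simp add: limit_kernel_def)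
qed

lemma crit_kernel_subset: "crit_kernel \<subseteq> limit_kernel"
  by (auto simp: limit_kernel_def Jf_kernel)

lemma limit_kernel_subset: "limit_kernel \<subseteq> vac_kernel"
proof
  fix x :: "'n::finite free_alg" assume "x \<in> limit_kernel"
  then have "yd_cr x = 0" by (intro yd_cr_eq_0) (simp add: limit_kernel_def)
  then show "x \<in> vac_kernel" by (simp add: vac_kernel_def vacuum_ideal_facts(1))
qed

lemma coeff_ideal_mono: "I \<subseteq> J \<Longrightarrow> coeff_ideal I \<subseteq> coeff_ideal J"
  by (auto simp: coeff_ideal_def)

text \<open>\<open>(u - v - \<alpha> h + n h / 2) u^(-1)\<close>, the scalar for the parameter
  \<open>v + \<alpha> h\<close>; \<open>xi_right\<close> has \<open>- n h / 2\<close>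
  instead.\<close>

definition xi_left :: "nat \<Rightarrow> 'n::finite free_alg fps fps" where
  "xi_left \<alpha> = xi (of_nat \<alpha> * hbar + scal (left_shift CARD('n)))"

definition xi_right :: "nat \<Rightarrow> 'n::finite free_alg fps fps" where
  "xi_right \<alpha> = xi (of_nat \<alpha> * hbar + scal (right_shift CARD('n)))"

lemma mixed_relation_shifted:
  fixes i j k l :: "'n::finite"
  shows "crossing_defect (xi_left \<alpha>) (xi_right \<alpha>) zh L_plus_series (\<lambda>i j. fps_const (L_minus_shift \<alpha> i j)) i j k l
    \<in> coeff_ideal (coeff_ideal limit_kernel)"
proof -
  have "crossing_defect (xi (scal (left_shift CARD('n)))) (xi (scal (right_shift CARD('n)))) zh
      L_plus_series (\<lambda>i j. fps_const (L_minus_series i j)) i j k l \<in> coeff_ideal (coeff_ideal limit_kernel)"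
    using mixed_relation coeff_ideal_mono[OF coeff_ideal_mono[OF crit_kernel_subset]] by blast
  from shift_inner_ideal[OF two_sided_left[OF two_sided_limit_kernel] h_closed_limit_kernel this, of \<alpha>]
  show ?thesis
    by (simp only: crossing_defect_def mult.assoc shift_inner_diff shift_inner_add shift_inner_xi shift_inner_zh
        shift_inner_L L_minus_shift_eq xi_left_def xi_right_def)
qed

section \<open>Moving \<open>L\<^sup>+\<close> through the fused product\<close>

text \<open>The letters of \<open>xs\<close> and \<open>ys\<close> do not involve the positions
  \<open>a\<close> and \<open>p\<close>, so the difference is \<open>crossing_defect\<close> of the
  two middle letters, multiplied by words on both sides.\<close>

lemma word_crossing:
  assumes I: "two_sided_ideal \<I>" and c: "central \<xi>" "central \<eta>" "central t"
    and ap: "a \<noteq> p" "a \<notin> set xs" "p \<notin> set xs" "a \<notin> set ys" "p \<notin> set ys"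
    and rel: "\<And>i j k l. crossing_defect \<xi> \<eta> t (L p) (L a) i j k l \<in> \<I>"
  shows "smul (\<xi> * \<eta>) (word L (xs @ p # a # ys))
    - fac True (- t) (\<xi>, swp a p) (fac False t (\<eta>, swp a p) (word L (xs @ a # p # ys))) \<in> tensors (\<I> :: 's::ring_1 set)"
proof (rule tensorsI)
  fix I J
  let ?X = "word L xs I J" and ?Y = "word L ys I J"
  have w: "word L xs (I \<circ> swp a p) J = ?X" "word L xs I (J \<circ> swp a p) = ?X" "word L xs (I \<circ> swp a p) (J \<circ> swp a p) = ?X"
    "word L ys (I \<circ> swp a p) J = ?Y" "word L ys I (J \<circ> swp a p) = ?Y" "word L ys (I \<circ> swp a p) (J \<circ> swp a p) = ?Y"
    using ap by (auto intro!: word_cong simp: Transposition.transpose_def)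
  have v: "(K \<circ> swp a p) a = K p" "(K \<circ> swp a p) p = K a" for K :: "nat \<Rightarrow> 'b" by simp_all
  note l = central_left_commute[OF c(1), of ?X] central_left_commute[OF c(2), of ?X] central_left_commute[OF c(3), of ?X]
  have "(smul (\<xi> * \<eta>) (word L (xs @ p # a # ys))
    - fac True (- t) (\<xi>, swp a p) (fac False t (\<eta>, swp a p) (word L (xs @ a # p # ys)))) I J
    = ?X * (crossing_defect \<xi> \<eta> t (L p) (L a) (I p) (J p) (I a) (J a) * ?Y)"
    by (simp only: fun_apply fac_def fst_conv snd_conv smul_def act_def if_True if_False word_append word_Cons w v
        crossing_defect_def distrib_left distrib_right left_diff_distrib right_diff_distrib mult.assoc l
        mult_minus_left mult_minus_right diff_conv_add_uminus minus_add_distrib minus_minus add.assoc)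
  then show "(smul (\<xi> * \<eta>) (word L (xs @ p # a # ys))
    - fac True (- t) (\<xi>, swp a p) (fac False t (\<eta>, swp a p) (word L (xs @ a # p # ys)))) I J \<in> \<I>"
    by (simp only: left_ideal_mult[OF two_sided_left[OF I]] two_sided_mult_right[OF I] rel)
qed

lemma word_crossing_row:
  fixes L :: "nat \<Rightarrow> 'n \<Rightarrow> 'n \<Rightarrow> 's::ring_1"
  assumes I: "two_sided_ideal \<I>" and \<xi>: "\<And>a. central (\<xi> a)" and \<eta>: "\<And>a. central (\<eta> a)" and t: "central t"
    and "distinct (xs @ p # ws)"
    and "\<And>a i j k l. a \<in> set ws \<Longrightarrow> crossing_defect (\<xi> a) (\<eta> a) t (L p) (L a) i j k l \<in> \<I>"
  shows "smul (prod_list (map (\<lambda>a. \<xi> a * \<eta> a) ws)) (word L (xs @ p # ws))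
    - ops True (- t) (map (\<lambda>a. (\<xi> a, swp a p)) ws) (ops False t (map (\<lambda>a. (\<eta> a, swp a p)) ws) (word L (xs @ ws @ [p])))
    \<in> tensors \<I>"
  using assms(5,6)
proof (induction ws arbitrary: xs)
  case Nil
  show ?case by (simp add: tensors_0[OF two_sided_left[OF I]])
next
  case (Cons a ws)
  note LI = two_sided_left[OF I]
  let ?s = "prod_list (map (\<lambda>a. \<xi> a * \<eta> a) ws)"
  let ?fT = "fac True (- t) (\<xi> a, swp a p) :: ('n, 's) tmat \<Rightarrow> _" and ?fF = "fac False t (\<eta> a, swp a p) :: ('n, 's) tmat \<Rightarrow> _"
  let ?T = "map (\<lambda>a. (\<xi> a, swp a p)) ws" and ?F = "map (\<lambda>a. (\<eta> a, swp a p)) ws"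
  have mt: "central (- t)" using t by simp
  have cs: "central ?s" by (rule central_prod_list) (simp add: \<xi> \<eta>)
  have cT: "cfacs ?T" and cF: "cfacs ?F" by (simp_all add: cfacs_def \<xi> \<eta>)
  have lT: "linear_op ?fT" and lF: "linear_op ?fF" by (rule linear_op_fac, simp_all add: t \<xi> \<eta>)+
  have lin: "linear_op (\<lambda>G. ?fT (?fF G))" by (rule linear_op_comp[OF lT lF])
  have "smul (\<xi> a * \<eta> a) (word L (xs @ p # a # ws)) - ?fT (?fF (word L (xs @ a # p # ws))) \<in> tensors \<I>"
    by (rule word_crossing[OF I \<xi> \<eta> t]) (use Cons.prems in auto)
  from tensors_smul[OF LI this, of ?s]
  have 1: "smul (\<xi> a * \<eta> a * ?s) (word L (xs @ p # a # ws)) - ?fT (?fF (smul ?s (word L (xs @ a # p # ws)))) \<in> tensors \<I>"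
    by (simp only: smul_diff smul_smul linear_op_smul[OF lT cs] linear_op_smul[OF lF cs] centralD[OF cs])
  have "smul ?s (word L ((xs @ [a]) @ p # ws)) - ops True (- t) ?T (ops False t ?F (word L ((xs @ [a]) @ ws @ [p]))) \<in> tensors \<I>"
    by (rule Cons.IH) (use Cons.prems in auto)
  from linear_op_cong[OF lin LI this]
  have 2: "?fT (?fF (smul ?s (word L (xs @ a # p # ws)))) - ?fT (?fF (ops True (- t) ?T (ops False t ?F (word L (xs @ a # ws @ [p]))))) \<in> tensors \<I>"
    by simp
  have "?fF (ops True (- t) ?T G) = ops True (- t) ?T (?fF G)" for G
    using ops_sides_commute[OF mt cT t, of "[(\<eta> a, swp a p)]" G] \<eta> by simp
  with tensors_trans[OF LI 1 2] show ?case by simp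
qed

text \<open>The identity at position \<open>p\<close>, which replaces \<open>L_plus\<close> next to
  the vacuum.\<close>

definition tdelta :: "nat \<Rightarrow> ('n, 's::zero_neq_one) tmat" where
  "tdelta p I J = (if I p = J p then 1 else 0)"

text \<open>The trace over \<open>a\<close> of \<open>(\<xi> - t P) H_a (\<eta> + t P)\<close> has
  four terms. Besides \<open>\<xi> \<eta> tr H\<close> they are \<open>\<xi> t H_p\<close>,
  \<open>- t \<eta> H_p\<close> and \<open>- n t^2 H_p\<close>, the last because
  \<open>P H_a P = H_p\<close> leaves the trace of the identity over \<open>a\<close>. These three
  add up to \<open>(\<xi> - \<eta> - n t) t H_p = 0\<close>.\<close>

lemma pt_crossing:
  fixes H :: "('n::finite, 's::ring_1) tmat"
  assumes H: "supported S H" and p: "p \<notin> S" "a \<noteq> p" and t: "central t" and d: "\<xi> - \<eta> = of_nat CARD('n) * t"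
  shows "pt a (fac True (- t) (\<xi>, swp a p) (fac False t (\<eta>, swp a p) (tprod H (tdelta p)))) = smul (\<xi> * \<eta>) (tprod (pt a H) (tdelta p))"
proof (intro ext)
  fix I J :: "nat \<Rightarrow> 'n"
  let ?h = "H (I(a := I p)) (J(a := J p))" and ?\<delta> = "tdelta p I J :: 's"
  let ?G = "fac True (- t) (\<xi>, swp a p) (fac False t (\<eta>, swp a p) (tprod H (tdelta p)))"
  have u: "H (K(a := x) \<circ> swp a p) M = H (K(a := K p)) M" "H M (K(a := x) \<circ> swp a p) = H M (K(a := K p))" for K M :: "nat \<Rightarrow> 'n" and x
    by (rule supportedD[OF H]; use p in \<open>auto simp: Transposition.transpose_def\<close>)+
  have dl: "tdelta p (I(a := x)) (J(a := x)) = ?\<delta>" "tdelta p (I(a := x)) (J(a := x) \<circ> swp a p) = (if x = I p then 1 else 0 :: 's)"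
    "tdelta p (I(a := x) \<circ> swp a p) (J(a := x)) = (if x = J p then 1 else 0 :: 's)"
    "tdelta p (I(a := x) \<circ> swp a p) (J(a := x) \<circ> swp a p) = (1 :: 's)" for x
    using p by (auto simp: tdelta_def)
  have G: "?G (I(a := x)) (J(a := x)) = \<xi> * \<eta> * (H (I(a := x)) (J(a := x)) * ?\<delta>)
      + (if x = I p then \<xi> * (t * ?h) else 0) - (if x = J p then t * (\<eta> * ?h) else 0) - t * (t * ?h)" for x
  proof -
    have "?G (I(a := x)) (J(a := x)) = \<xi> * (\<eta> * (H (I(a := x)) (J(a := x)) * ?\<delta>) + t * (H (I(a := x)) (J(a := J p)) * (if x = I p then 1 else 0)))
      + - t * (\<eta> * (H (I(a := I p)) (J(a := x)) * (if x = J p then 1 else 0)) + t * (?h * 1))"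
      by (simp only: fun_apply fac_def fst_conv snd_conv smul_def act_def if_True if_False tprod_def u dl)
    then show ?thesis by (cases "x = I p"; cases "x = J p") (simp_all add: distrib_left mult.assoc)
  qed
  have "pt a ?G I J = \<xi> * \<eta> * (pt a H I J * ?\<delta>) + \<xi> * (t * ?h) - t * (\<eta> * ?h) - of_nat CARD('n) * (t * (t * ?h))"
    by (simp only: pt_def G sum.distrib sum_subtractf sum_distrib_left[symmetric] sum_distrib_right[symmetric])
      (simp add: pt_def central_left_commute[OF central_of_nat, of t])
  also have "\<dots> = \<xi> * \<eta> * (pt a H I J * ?\<delta>) + ((\<xi> - \<eta>) * (t * ?h) - of_nat CARD('n) * (t * (t * ?h)))"
    by (simp only: left_diff_distrib centralD[OF t, of \<eta>] mult.assoc[symmetric] add_diff_eq diff_diff_eq)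
  also have "\<dots> = \<xi> * \<eta> * (pt a H I J * ?\<delta>)"
    by (simp only: d mult.assoc diff_self add_0_right)
  finally show "pt a ?G I J = smul (\<xi> * \<eta>) (tprod (pt a H) (tdelta p)) I J"
    by (simp only: smul_def tprod_def)
qed

text \<open>The factors of the first position in the list do not involve the later positions. Those
  are traced out first, which removes their factors and leaves \<open>pt_crossing\<close> for the
  remaining one.\<close>

lemma ptr_crossing:
  fixes H :: "('n::finite, 's::ring_1) tmat"
  assumes H: "supported S H" and p: "p \<notin> S" and \<xi>: "\<And>a. central (\<xi> a)" and \<eta>: "\<And>a. central (\<eta> a)" and t: "central t"
    and "distinct (p # ws)" "\<And>a. a \<in> set ws \<Longrightarrow> \<xi> a - \<eta> a = of_nat CARD('n) * t"
  shows "ptr ws (ops True (- t) (map (\<lambda>a. (\<xi> a, swp a p)) ws) (ops False t (map (\<lambda>a. (\<eta> a, swp a p)) ws) (tprod H (tdelta p))))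
    = smul (prod_list (map (\<lambda>a. \<xi> a * \<eta> a) ws)) (tprod (ptr ws H) (tdelta p))"
  using assms(6,7)
proof (induction ws)
  case (Cons a ws)
  let ?s = "prod_list (map (\<lambda>a. \<xi> a * \<eta> a) ws)"
  let ?fT = "fac True (- t) (\<xi> a, swp a p) :: ('n, 's) tmat \<Rightarrow> _" and ?fF = "fac False t (\<eta> a, swp a p) :: ('n, 's) tmat \<Rightarrow> _"
  let ?T = "map (\<lambda>a. (\<xi> a, swp a p)) ws" and ?F = "map (\<lambda>a. (\<eta> a, swp a p)) ws"
  let ?G = "tprod H (tdelta p)"
  have mt: "central (- t)" using t by simp
  have cs: "central ?s" by (rule central_prod_list) (simp add: \<xi> \<eta>)
  have cT: "cfacs ?T" by (simp add: cfacs_def \<xi>)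
  have lT: "linear_op ?fT" and lF: "linear_op ?fF" by (rule linear_op_fac, simp_all add: t \<xi> \<eta>)+
  have aw: "a \<notin> set ws" "p \<notin> set ws" "a \<noteq> p" using Cons.prems by auto
  have pf: "ptr ws (fac s r (c, swp a p) G) = fac s r (c, swp a p) (ptr ws G)" if "central r" "central c" for s r c and G :: "('n, 's) tmat"
    by (rule linear_op_fac_commute[OF linear_op_ptr]) (simp_all add: that ptr_act_swp aw)
  have "ptr (a # ws) (ops True (- t) ((\<xi> a, swp a p) # ?T) (ops False t ((\<eta> a, swp a p) # ?F) ?G))
    = pt a (ptr ws (?fT (ops True (- t) ?T (?fF (ops False t ?F ?G)))))" by simp
  also have "ops True (- t) ?T (?fF (ops False t ?F ?G)) = ?fF (ops True (- t) ?T (ops False t ?F ?G))"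
    using ops_sides_commute[OF mt cT t, of "[(\<eta> a, swp a p)]"] \<eta> by simp
  also have "ptr ws (?fT (?fF (ops True (- t) ?T (ops False t ?F ?G)))) = ?fT (?fF (ptr ws (ops True (- t) ?T (ops False t ?F ?G))))"
    by (simp only: pf[OF mt \<xi>] pf[OF t \<eta>])
  also have "ptr ws (ops True (- t) ?T (ops False t ?F ?G)) = smul ?s (tprod (ptr ws H) (tdelta p))"
    by (rule Cons.IH) (use Cons.prems in auto)
  also have "pt a (?fT (?fF (smul ?s (tprod (ptr ws H) (tdelta p))))) = smul ?s (pt a (?fT (?fF (tprod (ptr ws H) (tdelta p)))))"
    by (simp only: linear_op_smul[OF lT cs] linear_op_smul[OF lF cs] linear_op_smul[OF linear_op_pt cs])
  also have "pt a (?fT (?fF (tprod (ptr ws H) (tdelta p)))) = smul (\<xi> a * \<eta> a) (tprod (pt a (ptr ws H)) (tdelta p))"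
    by (rule pt_crossing[OF supported_ptr[OF H] p aw(3) t]) (use Cons.prems in simp)
  finally show ?case by (simp add: smul_smul centralD[OF cs] mult.assoc)
qed simp

text \<open>\<open>ptr_crossing\<close> needs the \<open>R\<close>-matrices \<open>X\<close> and
  \<open>Y\<close> outermost, but the trace starts as \<open>tr A X w Y\<close> with the
  antisymmetrizer \<open>A\<close> outside. By fusion a copy of \<open>A\<close> is created to the
  left of \<open>w\<close> (\<open>AXA\<close>), and since \<open>A w\<close> is antisymmetric also
  one to its right. The outer \<open>A\<close> is taken around the trace to the right of
  \<open>Y\<close>, where the latter copy absorbs it (\<open>AYA\<close>), so that
  \<open>A w\<close> is left between \<open>X\<close> and \<open>Y\<close>.\<close>

lemma crossed_trace:
  fixes L :: "nat \<Rightarrow> 'n::finite \<Rightarrow> 'n \<Rightarrow> 's::ring_1"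
  assumes I: "two_sided_ideal \<I>" and V: "left_ideal \<V>" and IV: "\<I> \<subseteq> \<V>" and e: "e + e = (1 :: 's)"
    and \<xi>: "\<And>a. central (\<xi> a)" and \<eta>: "\<And>a. central (\<eta> a)" and t: "central t"
    and rel: "\<And>a i j k' l. 1 \<le> a \<Longrightarrow> a \<le> k \<Longrightarrow> crossing_defect (\<xi> a) (\<eta> a) t (L 0) (L a) i j k' l \<in> \<I>"
    and adj: "\<And>a. 1 \<le> a \<Longrightarrow> a < k \<Longrightarrow> exchange \<I> 1 (- 1) (L a) (L (Suc a))"
    and step: "\<And>a. 1 \<le> a \<Longrightarrow> \<xi> a - \<xi> (Suc a) = t" "\<And>a. 1 \<le> a \<Longrightarrow> \<eta> a - \<eta> (Suc a) = t"
    and diff: "\<And>a. \<xi> a - \<eta> a = of_nat CARD('n) * t"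
    and vac: "\<And>i j. L 0 i j - (if i = j then 1 else 0) \<in> \<V>"
  defines "ws \<equiv> [1..<Suc k]" and "c \<equiv> of_nat (nperm {1..k}) :: 's"
  shows "c * c * prod_list (map (\<lambda>a. \<xi> a * \<eta> a) ws) *
    (L 0 i j * fused_trace L ws I J - (if i = j then fused_trace L ws I J else 0)) \<in> \<V>"
proof -
  note LI = two_sided_left[OF I]
  have tIV: "G \<in> tensors \<V>" if "G \<in> tensors \<I>" for G :: "('n, 's) tmat" using that IV by (auto simp: tensors_def)
  let ?s = "prod_list (map (\<lambda>a. \<xi> a * \<eta> a) ws)"
  have mt: "central (- t)" using t by simp
  have cs: "central ?s" by (rule central_prod_list) (simp add: \<xi> \<eta>)
  have cc: "central c" by (simp add: c_def)
  have set_ws: "set ws = {1..k}" and dist: "distinct (0 # ws)" "distinct ws" by (auto simp: ws_def)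
  define AL AR where "AL = (alt True {1..k} :: ('n, 's) tmat \<Rightarrow> _)" and "AR = (alt False {1..k} :: ('n, 's) tmat \<Rightarrow> _)"
  define XL YR where "XL = (ops True (- t) (map (\<lambda>a. (\<xi> a, swp a 0)) ws) :: ('n, 's) tmat \<Rightarrow> _)"
    and "YR = (ops False t (map (\<lambda>a. (\<eta> a, swp a 0)) ws) :: ('n, 's) tmat \<Rightarrow> _)"
  define TR where "TR = (ptr ws :: ('n, 's) tmat \<Rightarrow> _)"
  define M1 where "M1 = (tprod (word L ws) (tdelta 0) :: ('n, 's) tmat)"
  have cX: "cfacs (map (\<lambda>a. (\<xi> a, swp a 0)) ws)" and cY: "cfacs (map (\<lambda>a. (\<eta> a, swp a 0)) ws)"
    by (simp_all add: cfacs_def \<xi> \<eta>)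
  have lin: "linear_op AL" "linear_op AR" "linear_op XL" "linear_op YR" "linear_op TR"
    unfolding AL_def AR_def XL_def YR_def TR_def
    by (rule linear_op_alt linear_op_ptr linear_op_ops[OF mt cX] linear_op_ops[OF t cY])+
  have sc: "T (smul c G) = smul c (T G)" if "linear_op T" for T :: "('n, 's) tmat \<Rightarrow> ('n, 's) tmat" and G
    by (rule linear_op_smul[OF that cc])
  have AXA: "AL (XL (AL G)) = smul c (AL (XL G))" for G
    unfolding AL_def XL_def c_def
  proof (rule alt_ops_alt[OF e mt cX])
    fix a assume a: "1 \<le> a" "a < k"
    show "passes True a (Suc a) (- t) (map (\<lambda>a. (\<xi> a, swp a 0)) ws) TYPE('n)"
      by (rule passes_adjacent[OF mt \<xi> _ _ upt_split[OF a, folded ws_def]]) (use dist step(1)[OF a(1)] in auto)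
  qed
  have AYA: "AR (YR (AR G)) = smul c (YR (AR G))" for G
    unfolding AR_def YR_def c_def
  proof (rule alt_ops_alt'[OF e t cY])
    fix a assume a: "1 \<le> a" "a < k"
    let ?m = "map (\<lambda>a. (\<eta> a, swp a 0))"
    let ?xs = "[1..<a]" and ?ys = "[Suc (Suc a)..<Suc k]"
    have split: "ws = ?xs @ a # Suc a # ?ys" using upt_split[OF a] by (simp only: ws_def)
    \<comment> \<open>The given product has to come out on the right-hand side of
      \<open>fusion\<close>. This happens for \<open>x = Suc a\<close> and \<open>y = a\<close>,
      where the difference of the \<open>\<eta>\<close> also has the required sign.\<close>
    have "skew False (Suc a) a (ops False t (?m ?xs @ (\<eta> (Suc a), swp (Suc a) 0) # (\<eta> a, swp a 0) # ?m ?ys) G)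
      = ops False t (?m ?xs @ (\<eta> a, swp a 0) # (\<eta> (Suc a), swp (Suc a) 0) # ?m ?ys) (skew False (Suc a) a G)" for G :: "('n, 's) tmat"
    proof (rule skew_ops_adjacent[OF t])
      show "\<eta> (Suc a) - \<eta> a = - t" using arg_cong[OF step(2)[OF a(1)], of uminus] by simp
      fix f assume f: "f \<in> set (?m ?xs) \<union> set (?m ?ys)"
      then have "f \<in> (\<lambda>b. (\<eta> b, swp b 0)) ` (set ?xs \<union> set ?ys)" by (simp only: set_map image_Un)
      then obtain b where "f = (\<eta> b, swp b 0)" "b \<in> set ?xs \<union> set ?ys" by (rule imageE)
      then show "snd f \<circ> swp (Suc a) a = swp (Suc a) a \<circ> snd f"
        using a by (auto intro!: swp_commute_disjoint simp del: comp_apply)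
    qed (use a in \<open>auto simp: cfacs_def \<eta>\<close>)
    moreover have "skew False (Suc a) a = (skew False a (Suc a) :: ('n, 's) tmat \<Rightarrow> _)"
      by (simp only: skew_def[abs_def] transpose_commute[of "Suc a"])
    moreover have "?m ?xs @ (\<eta> a, swp a 0) # (\<eta> (Suc a), swp (Suc a) 0) # ?m ?ys = ?m ws"
      by (simp only: split map_append list.map)
    ultimately have "skew False a (Suc a) (ops False t (?m ?xs @ (\<eta> (Suc a), swp (Suc a) 0) # (\<eta> a, swp a 0) # ?m ?ys) G)
      = ops False t (?m ws) (skew False a (Suc a) G)" for G :: "('n, 's) tmat"
      by (simp only:)
    then show "\<exists>fs'. \<forall>G :: ('n, 's) tmat. skew False a (Suc a) (ops False t fs' G) = ops False t (?m ws) (skew False a (Suc a) G)"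
      by (intro exI allI)
  qed
  have cyc: "TR (AL G) = TR (AR G)" for G
    unfolding TR_def AL_def AR_def by (rule ptr_cyclic_alt) (simp_all add: dist set_ws)
  have com: "AL (YR G) = YR (AL G)" "XL (AR G) = AR (XL G)" for G
    unfolding AL_def YR_def AR_def XL_def by (rule ops_alt_sides[OF t cY] ops_alt_sides[OF mt cX])+
  have sup_w: "supported {1..k} (word L ws)" using supported_word[of ws L] by (simp only: set_ws)
  have sup_d: "supported {0} (tdelta 0 :: ('n, 's) tmat)" by (simp add: supported_def tdelta_def)
  have AM: "AL M1 = tprod (AL (word L ws)) (tdelta 0)"
    unfolding AL_def M1_def by (rule alt_tprod(2)[OF sup_d]) simp
  have ARAL: "AR (AL M1) - smul c (AL M1) \<in> tensors \<V>"
  proof -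
    have 1: "AR (AL (word L ws)) - smul c (AL (word L ws)) \<in> tensors \<I>"
      unfolding AR_def AL_def c_def
    proof (rule word_antisym[OF I e dist(2)])
      fix a assume "1 \<le> a" "a < k"
      then show "\<exists>xs ys. ws = xs @ a # Suc a # ys" using upt_split[of 1 a k] unfolding ws_def by blast
    qed (rule adj)
    have "AR (AL M1) = tprod (AR (AL (word L ws))) (tdelta 0)"
      unfolding AM unfolding AR_def by (rule alt_tprod(2)[OF sup_d]) simp
    then have "AR (AL M1) - smul c (AL M1) = tprod (AR (AL (word L ws)) - smul c (AL (word L ws))) (tdelta 0)"
      by (simp add: AM tprod_def smul_def fun_eq_iff fun_apply left_diff_distrib mult.assoc)
    also have "\<dots> \<in> tensors \<I>"
      using 1 by (simp add: tensors_def tprod_def two_sided_mult_right[OF I])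
    finally show ?thesis by (rule tIV)
  qed
  note cong = linear_op_cong[OF _ V]
  have w0: "smul ?s (word L (0 # ws)) - XL (YR M1) \<in> tensors \<V>"
  proof -
    have "smul ?s (word L ([] @ 0 # ws)) - XL (YR (word L ([] @ ws @ [0]))) \<in> tensors \<I>"
      unfolding XL_def YR_def
      by (rule word_crossing_row[OF I \<xi> \<eta> t]) (use dist rel set_ws in auto)
    then have 1: "smul ?s (word L (0 # ws)) - XL (YR (word L (ws @ [0]))) \<in> tensors \<V>" using tIV by simp
    \<comment> \<open>Here the vacuum enters: \<open>L 0\<close> stands at the right end of the word
      and differs from the identity by an element of the left ideal \<open>\<V>\<close>.\<close>
    have "word L (ws @ [0]) - M1 \<in> tensors \<V>"
    proof (rule tensorsI)
      fix I J
      have "(word L (ws @ [0]) - M1) I J = word L ws I J * (L 0 (I 0) (J 0) - (if I 0 = J 0 then 1 else 0))"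
        by (simp only: fun_apply M1_def tprod_def tdelta_def word_append word_Cons word_Nil mult_1_right right_diff_distrib)
      then show "(word L (ws @ [0]) - M1) I J \<in> \<V>" by (simp only: left_ideal_mult[OF V vac])
    qed
    from tensors_trans[OF V 1 cong[OF lin(3) cong[OF lin(4) this]]] show ?thesis .
  qed
  have "TR (AL (smul ?s (word L (0 # ws)))) - TR (AL (XL (YR M1))) \<in> tensors \<V>"
    by (rule cong[OF lin(5) cong[OF lin(1) w0]])
  then have 1: "smul (c * c) (TR (AL (smul ?s (word L (0 # ws))))) - smul (c * c) (TR (AL (XL (YR M1)))) \<in> tensors \<V>"
    unfolding smul_diff[symmetric] by (rule tensors_smul[OF V])
  have "smul c (AL (XL (YR M1))) = AL (XL (YR (AL M1)))" by (simp only: AXA[symmetric] com)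
  then have "smul (c * c) (TR (AL (XL (YR M1)))) = TR (AL (XL (YR (smul c (AL M1)))))"
    by (simp only: smul_smul[symmetric] sc[OF lin(5), symmetric] sc[OF lin(4)] sc[OF lin(3)] sc[OF lin(1)])
  with 1 have 2: "smul (c * c) (TR (AL (smul ?s (word L (0 # ws))))) - TR (AL (XL (YR (smul c (AL M1))))) \<in> tensors \<V>"
    by (simp only:)
  have 3: "TR (AL (XL (YR (AR (AL M1))))) - TR (AL (XL (YR (smul c (AL M1))))) \<in> tensors \<V>"
    by (rule cong[OF lin(5) cong[OF lin(1) cong[OF lin(3) cong[OF lin(4) ARAL]]]])
  have 4: "TR (AL (XL (YR (AR (AL M1))))) = smul c (TR (XL (YR (AR (AL M1)))))"
    by (simp only: cyc com(2)[symmetric] AYA sc[OF lin(5)] sc[OF lin(3)])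
  have 5: "smul c (TR (XL (YR (AR (AL M1))))) - smul c (TR (XL (YR (smul c (AL M1))))) \<in> tensors \<V>"
    unfolding smul_diff[symmetric] by (rule tensors_smul[OF V cong[OF lin(5) cong[OF lin(3) cong[OF lin(4) ARAL]]]])
  have 6: "TR (XL (YR (smul c (AL M1)))) = smul c (TR (XL (YR (AL M1))))"
    by (simp only: sc[OF lin(5)] sc[OF lin(3)] sc[OF lin(4)])
  have 7: "TR (XL (YR (AL M1))) = smul ?s (tprod (TR (AL (word L ws))) (tdelta 0))"
    unfolding AM TR_def XL_def YR_def
    by (rule ptr_crossing[OF _ _ \<xi> \<eta> t dist(1) diff, of "{1..k}"], unfold AL_def, rule supported_alt[OF sup_w], simp)
  have F: "TR (AL (word L ws)) = fused_trace L ws" by (simp only: TR_def AL_def fused_trace_def set_ws)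
  have sup0: "supported {0} (word L [0])" using supported_word[of "[0]" L] by simp
  have d0: "{0} \<inter> {1..k} = {}" "{0} \<inter> set ws = {}" by (auto simp: set_ws)
  have "word L (0 # ws) = tprod (word L [0]) (word L ws)"
    by (simp add: fun_eq_iff tprod_def word_def)
  then have "TR (AL (word L (0 # ws))) = tprod (word L [0]) (fused_trace L ws)"
    unfolding F[symmetric] TR_def AL_def
    by (simp only: alt_tprod(1)[OF sup0 d0(1)] ptr_tprod(1)[OF sup0 d0(2)])
  then have 8: "TR (AL (smul ?s (word L (0 # ws)))) = smul ?s (tprod (word L [0]) (fused_trace L ws))"
    by (simp only: linear_op_smul[OF lin(5) cs] linear_op_smul[OF lin(1) cs])
  have "smul (c * c) (smul ?s (tprod (word L [0]) (fused_trace L ws)))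
    - smul (c * c) (smul ?s (tprod (fused_trace L ws) (tdelta 0))) \<in> tensors \<V>"
    using tensors_trans[OF V tensors_trans[OF V 2 tensors_sym[OF V 3]] 5[folded 4]]
    by (simp only: 4 6 7 8 F smul_smul mult.assoc)
  from tensorsD[OF this, of "(\<lambda>_. undefined)(0 := i)" "(\<lambda>_. undefined)(0 := j)"]
  have "c * c * (?s * (L 0 i j * fused_trace L ws I J)) - c * c * (?s * (fused_trace L ws I J * (if i = j then 1 else 0))) \<in> \<V>"
    unfolding fun_apply smul_def tprod_def tdelta_def word_Cons word_Nil fun_upd_same mult_1_right
      fused_trace_const[of L ws "(\<lambda>_. undefined)(0 := i)" "(\<lambda>_. undefined)(0 := j)" I J] .
  moreover have "fused_trace L ws I J * (if i = j then 1 else 0) = (if i = j then fused_trace L ws I J else 0)" by simp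
  ultimately have "c * c * (?s * (L 0 i j * fused_trace L ws I J)) - c * c * (?s * (if i = j then fused_trace L ws I J else 0)) \<in> \<V>"
    by (simp only:)
  then show ?thesis by (simp only: right_diff_distrib mult.assoc)
qed


section \<open>Invariance\<close>

lemma xi_diff: "xi y - xi z = fps_X * fps_const (fps_const (z - y))"
  by (simp only: xi_def fps_const_sub[symmetric] fps_const_add[symmetric] distrib_left right_diff_distrib) simp

lemma zh_eq: "fps_X * fps_const (fps_const hbar) = zh"
  unfolding zh_def by (rule centralD[OF central_fps_const[OF central_fps_const[OF central_fps_X]]])

lemma xi_step:
  "xi_left \<alpha> - xi_left (Suc \<alpha>) = (zh :: 'n::finite free_alg fps fps)"
  "xi_right \<alpha> - xi_right (Suc \<alpha>) = (zh :: 'n free_alg fps fps)"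
proof -
  have "of_nat (Suc \<alpha>) * hbar + y - (of_nat \<alpha> * hbar + y) = hbar" for y :: "'n free_alg"
    by (simp only: of_nat_Suc distrib_right mult_1_left) simp
  then show "xi_left \<alpha> - xi_left (Suc \<alpha>) = (zh :: 'n free_alg fps fps)" "xi_right \<alpha> - xi_right (Suc \<alpha>) = (zh :: 'n free_alg fps fps)"
    by (simp_all only: xi_left_def xi_right_def xi_diff zh_eq)
qed

text \<open>The gap \<open>n h\<close> between the two arguments at the critical level is what
  \<open>pt_crossing\<close> demands for the cancellation.\<close>

lemma xi_left_right: "xi_left \<alpha> - xi_right \<alpha> = of_nat CARD('n) * (zh :: 'n::finite free_alg fps fps)"
proof -
  have "of_nat \<alpha> * hbar + scal (right_shift CARD('n)) - (of_nat \<alpha> * hbar + scal (left_shift CARD('n)))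
    = (scal (right_shift CARD('n) - left_shift CARD('n)) :: 'n free_alg)"
    by (simp only: scal_diff add_diff_add diff_self add_0_left)
  also have "right_shift CARD('n) - left_shift CARD('n) = (fps_const (of_nat CARD('n) / 2) + fps_const (of_nat CARD('n) / 2)) * hbar"
    by (simp only: mult_minus_left diff_minus_eq_add distrib_right)
  also have "fps_const (of_nat CARD('n) / 2) + fps_const (of_nat CARD('n) / 2) = (of_nat CARD('n) :: complex fps)"
    by (simp add: fps_of_nat)
  also have "scal (of_nat CARD('n) * hbar) = of_nat CARD('n) * hbar" by (simp only: scal_mult scal_of_nat scal_hbar)
  finally have "xi_left \<alpha> - xi_right \<alpha> = fps_X * fps_const (fps_const (of_nat CARD('n) * (hbar :: 'n free_alg)))"
    by (simp only: xi_left_def xi_right_def xi_diff)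
  also have "\<dots> = fps_X * (of_nat CARD('n) * fps_const (fps_const hbar))"
    by (simp only: fps_const_mult[symmetric] fps_of_nat)
  also have "\<dots> = of_nat CARD('n) * zh"
    by (simp only: central_left_commute[OF central_of_nat, of fps_X] zh_eq)
  finally show ?thesis .
qed

lemma central_xi: "central (xi_left \<alpha>)" "central (xi_right \<alpha>)"
proof -
  have "central (xi (of_nat \<alpha> * hbar + scal z))" for z
    unfolding xi_def
    by (intro central_diff central_1 central_mult central_fps_X central_fps_const central_add central_of_nat central_scal)
  then show "central (xi_left \<alpha>)" "central (xi_right \<alpha>)" by (simp_all only: xi_left_def xi_right_def)
qed

lemma xi_prod_nth_0: "fps_nth (prod_list (map (\<lambda>a. xi_left (g a) * xi_right (g a)) as)) 0 = 1"
  by (induction as) (simp_all add: xi_left_def xi_right_def xi_def)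

lemma coeff_of_nat_cancel:
  fixes I :: "'n free_alg set"
  assumes "left_ideal I" "k > 0" "of_nat k * x \<in> coeff_ideal (coeff_ideal I)"
  shows "x \<in> coeff_ideal (coeff_ideal I)"
proof (intro coeff_idealI)
  fix a b
  have eq: "fps_nth (fps_nth (of_nat k * x) a) b = of_nat k * fps_nth (fps_nth x a) b"
    by (simp add: fps_of_nat[symmetric])
  have "fps_nth (fps_nth (of_nat k * x) a) b \<in> I"
    by (rule coeff_idealD, rule coeff_idealD, rule assms(3))
  then have "of_nat k * fps_nth (fps_nth x a) b \<in> I" by (simp only: eq)
  then show "fps_nth (fps_nth x a) b \<in> I" by (rule left_ideal_of_nat_cancel[OF assms(1) _ assms(2)])
qed

lemma L_plus_vac: "L_plus_series i j - (if i = j then 1 else 0) \<in> coeff_ideal (coeff_ideal vac_kernel)"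
proof (intro coeff_idealI)
  fix a b
  have "fps_nth (fps_nth (L_plus_series i j - (if i = j then 1 else 0)) a) b
    = (if a > 0 \<and> b = 0 then - hbar * l_free i j (int a - 1) else 0)"
    by (simp add: L_plus_def)
  also have "\<dots> \<in> vac_kernel"
  proof (cases "a > 0 \<and> b = 0")
    case True
    then have "- hbar * l_free i j (int a - 1) \<in> vac_kernel"
      by (intro left_ideal_mult[OF left_ideal_vac_kernel vac_kernel_gen]) simp
    then show ?thesis unfolding if_P[OF True] .
  next
    case False
    show ?thesis unfolding if_not_P[OF False] by (rule left_ideal_0[OF left_ideal_vac_kernel])
  qed
  finally show "fps_nth (fps_nth (L_plus_series i j - (if i = j then 1 else 0)) a) b \<in> vac_kernel" .
qed

text \<open>Position \<open>0\<close> carries \<open>L_plus\<close> in \<open>u\<close>, and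
  position \<open>a\<close> carries \<open>L_minus\<close> at \<open>v + (a - 1) h\<close>.
  \<open>crossed_trace\<close> gives the claim multiplied by integers and by a scalar series with
  constant term \<open>1\<close>, which cancel modulo \<open>vac_kernel\<close>.\<close>

lemma ell_bar_vac:
  fixes i j :: "'n::finite"
  shows "L_plus e i j * fps_nth (ell_bar k) r - (if e = 0 \<and> i = j then fps_nth (ell_bar k) r else 0) \<in> vac_kernel"
proof (cases "e > 0")
  case True
  then show ?thesis by (simp add: L_plus_pos left_ideal_0[OF left_ideal_vac_kernel])
next
  case False
  let ?I = "coeff_ideal (coeff_ideal limit_kernel) :: 'n free_alg fps fps set"
  let ?V = "coeff_ideal (coeff_ideal vac_kernel) :: 'n free_alg fps fps set"
  note V1 = left_ideal_coeff[OF left_ideal_vac_kernel]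
  obtain h :: "'n free_alg fps fps" where h: "h + h = 1" using half_exists by blast
  define M where "M = (\<lambda>a. L_minus_shift (a - 1) :: 'n \<Rightarrow> 'n \<Rightarrow> 'n free_alg fps)"
  define L where "L = (\<lambda>a::nat. if a = 0 then L_plus_series else (\<lambda>i j. fps_const (M a i j)))"
  let ?ws = "[1..<Suc k]" and ?o = "\<lambda>_::nat. undefined :: 'n"
  let ?p = "prod_list (map (\<lambda>a. xi_left (a - 1) * xi_right (a - 1)) ?ws) :: 'n free_alg fps fps"
  let ?c = "of_nat (nperm {1..k}) :: 'n free_alg fps fps"
  define F where "F = fused_trace M ?ws ?o ?o"
  have "word L ?ws = word (\<lambda>a i j. fps_const (M a i j)) ?ws"
    unfolding word_def by (intro ext arg_cong[where f = prod_list] map_cong refl) (auto simp: L_def)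
  then have "fused_trace L ?ws ?o ?o = fused_trace (\<lambda>a i j. fps_const (M a i j)) ?ws ?o ?o"
    by (simp only: fused_trace_def)
  also have "\<dots> = fps_const F"
    unfolding F_def by (rule fused_trace_hom) simp_all
  finally have F: "fused_trace L ?ws ?o ?o = fps_const F" .
  have "?c * ?c * ?p * (L 0 i j * fused_trace L ?ws ?o ?o - (if i = j then fused_trace L ?ws ?o ?o else 0)) \<in> ?V"
  proof (rule crossed_trace[where \<I> = ?I and t = zh and e = h])
    show "two_sided_ideal ?I" by (intro two_sided_coeff two_sided_limit_kernel)
    show "left_ideal ?V" by (rule left_ideal_coeff[OF V1])
    show "?I \<subseteq> ?V" by (intro coeff_ideal_mono limit_kernel_subset)
    show "h + h = 1" by (rule h)
    show "central (xi_left (a - 1) :: 'n free_alg fps fps)" "central (xi_right (a - 1) :: 'n free_alg fps fps)" for a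
      by (rule central_xi)+
    show "central (zh :: 'n free_alg fps fps)" by simp
    show "crossing_defect (xi_left (a - 1)) (xi_right (a - 1)) zh (L 0) (L a) i j k' l \<in> ?I" if "1 \<le> a" for a i j k' l
      using mixed_relation_shifted[of "a - 1" i j k' l] that by (simp add: L_def M_def)
    show "exchange ?I 1 (- 1) (L a) (L (Suc a))" if "1 \<le> a" for a
    proof -
      have "exchange (coeff_ideal yd_ideal) 1 (- 1) (M a) (M (Suc a))"
        unfolding M_def by (rule exchange_minus_one) (use that in simp)
      then have "exchange ?I 1 (- 1) (\<lambda>i j. fps_const (M a i j)) (\<lambda>i j. fps_const (M (Suc a) i j))"
      proof (rule exchange_hom)
        fix x :: "'n free_alg fps" assume "x \<in> coeff_ideal yd_ideal"
        then have "x \<in> coeff_ideal limit_kernel"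
          using coeff_ideal_mono[OF subset_trans[OF yd_ideal_subset_kernel crit_kernel_subset]] by blast
        then show "fps_const x \<in> ?I" by (rule fps_const_ideal[OF two_sided_left[OF two_sided_limit_kernel]])
      qed simp_all
      then show ?thesis using that by (simp add: L_def)
    qed
    show "xi_left (a - 1) - xi_left (Suc a - 1) = (zh :: 'n free_alg fps fps)"
      "xi_right (a - 1) - xi_right (Suc a - 1) = (zh :: 'n free_alg fps fps)" if "1 \<le> a" for a
      using xi_step[of "a - 1"] that by simp_all
    show "xi_left (a - 1) - xi_right (a - 1) = of_nat CARD('n) * (zh :: 'n free_alg fps fps)" for a
      by (rule xi_left_right)
    show "L 0 i j - (if i = j then 1 else 0) \<in> ?V" for i j
      using L_plus_vac[of i j] by (simp add: L_def)
  qed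
  then have 0: "?c * (?c * (?p * (L_plus_series i j * fps_const F - (if i = j then fps_const F else 0)))) \<in> ?V"
    by (simp only: F mult.assoc) (simp add: L_def)
  have np: "nperm {1..k} > 0" by (rule nperm_pos) simp
  have "?p * (L_plus_series i j * fps_const F - (if i = j then fps_const F else 0)) \<in> ?V"
    by (rule coeff_of_nat_cancel[OF left_ideal_vac_kernel np coeff_of_nat_cancel[OF left_ideal_vac_kernel np 0]])
  then have "L_plus_series i j * fps_const F - (if i = j then fps_const F else 0) \<in> ?V"
    by (rule coeff_ideal_cancel_unit[OF V1 xi_prod_nth_0])
  \<comment> \<open>The outer variable is \<open>u^(-1)\<close>, so the exponent \<open>e\<close> is
    read off at \<open>nat (- e)\<close>.\<close>
  from coeff_idealD[OF coeff_idealD[OF this, of "nat (- e)"], of r]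
  have 1: "L_plus e i j * fps_nth F r - (if e = 0 \<and> i = j then fps_nth F r else 0) \<in> vac_kernel"
    using False by (cases "i = j"; cases "e = 0") simp_all
  let ?z = "scal (fps_const (1 / fact k)) :: 'n free_alg"
  have "ell_bar k = fps_const ?z * F" unfolding F_def M_def by (rule ell_bar_eq)
  then have "fps_nth (ell_bar k) r = ?z * fps_nth F r" by simp
  then have "L_plus e i j * fps_nth (ell_bar k) r - (if e = 0 \<and> i = j then fps_nth (ell_bar k) r else 0)
    = ?z * (L_plus e i j * fps_nth F r - (if e = 0 \<and> i = j then fps_nth F r else 0))"
    by (simp add: right_diff_distrib central_left_commute[OF central_scal, of "L_plus e i j"])
  also have "\<dots> \<in> vac_kernel" by (rule left_ideal_mult[OF left_ideal_vac_kernel 1])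
  finally show ?thesis .
qed

theorem corollary4p7:
  assumes "CARD('n::finite) \<ge> 2"
  shows "(\<forall>k\<in>{1..CARD('n)}. \<forall>r. (ell_coeff k r :: 'n yd_cr) \<bullet> vacuum \<in> invariants) \<and>
    (\<forall>k\<in>{1..CARD('n)}. \<forall>m\<in>{1..CARD('n)}. \<forall>r s.
      (ell_coeff k r :: 'n yd_cr) * ell_coeff m s = ell_coeff m s * ell_coeff k r)"
proof -
  have "(ell_coeff k r :: 'n yd_cr) \<bullet> vacuum \<in> invariants" for k r
    unfolding ell_coeff_def by (rule invariantsI) (rule ell_bar_vac)
  then show ?thesis using ell_coeff_commute by blast
qed

end
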